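(* Let $\mathcal M$ be an o-minimal expansion of an ordered group, with universe $M$ and language $\mathcal L$, and let $\mathcal N=\langle\mathcal M,P\rangle$ be the expansion of $\mathcal M$ by a unary predicate for a dense $\mathrm{dcl}$-independent set $P\subseteq M$. Then every group definable in $\mathcal N$ is definably isomorphic (in $\mathcal N$) to a group definable in $\mathcal M$.
   Context: $\mathrm{dcl}$ denotes definable closure in $\mathcal M$; $P$ being $\mathrm{dcl}$-independent means no $p\in P$ lies in $\mathrm{dcl}(P\setminus\{p\})$ (over the empty set). Definability is with parameters. A group definable in $\mathcal N$ is one whose universe and operation are definable in $\mathcal N$; a definable isomorphism is a group isomorphism whose graph is definable in $\mathcal N$. *)

theory Defs
  imports "HOL-Algebra.Group"
begin

definition tuples :: "nat \<Rightarrow> 'a list set" where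
  "tuples n = {xs. length xs = n}"

text \<open>A structure on the universe in the sense of van den Dries (Tame Topology and
  o-minimal Structures, 1.2.1): a sequence of Boolean algebras S n of subsets of M^n,
  closed under products with M, containing the diagonals, closed under projection.\<close>
definition is_structure :: "(nat \<Rightarrow> 'a list set set) \<Rightarrow> bool" where
  "is_structure S \<longleftrightarrow>
     (\<forall>n. S n \<subseteq> Pow (tuples n)) \<and>
     (\<forall>n. {} \<in> S n) \<and>
     (\<forall>n A B. A \<in> S n \<longrightarrow> B \<in> S n \<longrightarrow> A \<union> B \<in> S n) \<and>
     (\<forall>n A. A \<in> S n \<longrightarrow> tuples n - A \<in> S n) \<and>
     (\<forall>n A. A \<in> S n \<longrightarrow> {x # xs | x xs. xs \<in> A} \<in> S (Suc n)) \<and>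
     (\<forall>n A. A \<in> S n \<longrightarrow> {xs @ [x] | x xs. xs \<in> A} \<in> S (Suc n)) \<and>
     (\<forall>n\<ge>1. {xs \<in> tuples n. xs ! 0 = xs ! (n - 1)} \<in> S n) \<and>
     (\<forall>n A. A \<in> S (Suc n) \<longrightarrow> butlast ` A \<in> S n)"

definition gen_structure :: "(nat \<Rightarrow> 'a list set set) \<Rightarrow> nat \<Rightarrow> 'a list set set" where
  "gen_structure G n = \<Inter>{S n | S. is_structure S \<and> (\<forall>m. G m \<subseteq> S m)}"

text \<open>Sets definable with parameters in the structure whose 0-definable sets are S0.\<close>
definition definable_sets :: "(nat \<Rightarrow> 'a list set set) \<Rightarrow> nat \<Rightarrow> 'a list set set" where
  "definable_sets S0 = gen_structure (\<lambda>n. S0 n \<union> (if n = 1 then {{[a]} | a. True} else {}))"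

definition expand_pred :: "(nat \<Rightarrow> 'a list set set) \<Rightarrow> 'a set \<Rightarrow> nat \<Rightarrow> 'a list set set" where
  "expand_pred D P = gen_structure (\<lambda>n. D n \<union> (if n = 1 then {{[p] | p. p \<in> P}} else {}))"

definition interval_or_point :: "'a::linorder set \<Rightarrow> bool" where
  "interval_or_point I \<longleftrightarrow> (\<exists>a. I = {a}) \<or> (\<exists>a b. I = {x. a < x \<and> x < b}) \<or>
     (\<exists>a. I = {x. a < x}) \<or> (\<exists>b. I = {x. x < b}) \<or> I = UNIV"

definition o_minimal :: "(nat \<Rightarrow> 'a::linorder list set set) \<Rightarrow> bool" where
  "o_minimal S0 \<longleftrightarrow> (\<forall>X \<in> definable_sets S0 1. \<exists>F. finite F \<and>
      (\<forall>I \<in> F. interval_or_point I) \<and> X = {[x] | x. x \<in> \<Union>F})"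

definition dcl :: "(nat \<Rightarrow> 'a list set set) \<Rightarrow> 'a set \<Rightarrow> 'a set" where
  "dcl S0 A = {b. \<exists>n X as. X \<in> S0 (Suc n) \<and> length as = n \<and> set as \<subseteq> A \<and>
                       {y. as @ [y] \<in> X} = {b}}"

definition dcl_independent :: "(nat \<Rightarrow> 'a list set set) \<Rightarrow> 'a set \<Rightarrow> bool" where
  "dcl_independent S0 P \<longleftrightarrow> (\<forall>p \<in> P. p \<notin> dcl S0 (P - {p}))"

definition grp :: "'a list set \<Rightarrow> ('a list \<Rightarrow> 'a list \<Rightarrow> 'a list) \<Rightarrow> 'a list \<Rightarrow> 'a list monoid" where
  "grp G m e = \<lparr>carrier = G, monoid.mult = m, one = e\<rparr>"

definition definable_group :: "(nat \<Rightarrow> 'a list set set) \<Rightarrow> nat \<Rightarrow> 'a list set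
    \<Rightarrow> ('a list \<Rightarrow> 'a list \<Rightarrow> 'a list) \<Rightarrow> 'a list \<Rightarrow> bool" where
  "definable_group D n G m e \<longleftrightarrow> G \<in> D n \<and>
     {xs @ ys @ m xs ys | xs ys. xs \<in> G \<and> ys \<in> G} \<in> D (3 * n) \<and>
     group (grp G m e)"

end

theory Submission
  imports Defs "HOL-Library.Countable_Set"
begin

text \<open>
  Finitely many sets and parameters define the group, so \<open>M\<close> may be replaced by a countable reduct over
  which all but finitely many elements of \<open>P\<close> are still independent, and then by a countably saturated
  ultrapower of the pair. Algebraic closure (finite fibres) is a pregeometry by o-minimality. A
  back-and-forth argument shows that the type of a tuple in the pair is determined by its type in \<open>M\<close> once
  the tuple is enlarged by the finitely many elements of \<open>P\<close> on which it depends (its support).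

  Let \<open>d\<close> be the largest rank over \<open>P\<close> of an element of the group. For two elements that are generic and
  independent over \<open>P\<close> the support of the product contains the supports of both factors, which are
  disjoint; as supports have bounded size, generic elements have empty support. Hence on generics the group
  and its multiplication agree with sets definable in \<open>M\<close>. This is a group chunk in the sense of Weil:
  every tuple \<open>a\<close> of the definable set that acts like a generic on generics codes a group element by its
  germ, and every group element is \<open>s * a\<close> with \<open>s\<close> from a fixed list of \<open>2 * d + 1\<close> independent generics
  and \<open>a\<close> such a code. Choosing the first \<open>s\<close> that works represents the group by pairs \<open>(s, a)\<close>, and the
  set of these pairs and their multiplication are definable in \<open>M\<close>.
\<close>

section \<open>Definability calculus\<close>

text \<open>Finiteness of fibres is lost in an ultrapower, so only the axioms of
  \<open>finfam\<close>, which speak of a family of sets, are transferred. Genericity over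
  \<open>P\<close> is an infinite conjunction, but whether a fibre has a generic point is
  expressible in \<open>L\<close>: it does when the fibre is infinite at almost every index. Hence
  statements about all generics stay definable in \<open>M\<close>. Parameters can destroy the
  independence of \<open>P\<close>; exchange confines the damage to finitely many points, which
  become constants as well. Distinct tuples may have the same germ, and no quotient is formed: only
  tuples that are the sole code of their germ are used. They suffice because a generic is the sole
  code of itself. The number \<open>2 * d + 1\<close> is a count: a tuple of rank at most
  \<open>d\<close> over \<open>P\<close> spoils the genericity of at most \<open>d\<close> members
  of an independent list. So over any group element some member is generic, and the corresponding
  quotient is generic too; and any \<open>d + 1\<close> members include one generic over a given
  code, so that agreement at \<open>d + 1\<close> members identifies the germ. The latter makes the
  isomorphism definable in the pair.\<close>

lemma tuples_iff [simp]: "xs \<in> tuples n \<longleftrightarrow> length xs = n"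
  by (simp add: tuples_def)

section \<open>Generated structures as least structures\<close>

lemma gen_structure_least:
  assumes "is_structure S" "\<And>m. G m \<subseteq> S m"
  shows "gen_structure G n \<subseteq> S n"
  using assms unfolding gen_structure_def by blast

lemma gen_structure_incl: "G n \<subseteq> gen_structure G n"
  unfolding gen_structure_def by blast

lemma is_structure_full: "is_structure (\<lambda>n. Pow (tuples n))"
  unfolding is_structure_def by (auto simp: tuples_def)

lemma is_structure_INT:
  assumes "\<And>S. S \<in> C \<Longrightarrow> is_structure S" "C \<noteq> {}"
  shows "is_structure (\<lambda>n. \<Inter>{S n | S. S \<in> C})"
proof -
  have *: "X \<in> \<Inter>{S n | S. S \<in> C} \<longleftrightarrow> (\<forall>S\<in>C. X \<in> S n)" for X n by blast
  have sub: "\<Inter>{S n | S. S \<in> C} \<subseteq> Pow (tuples n)" for n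
  proof -
    obtain S where "S \<in> C" using assms(2) by blast
    moreover from this have "S n \<subseteq> Pow (tuples n)" using assms(1)[of S] by (simp add: is_structure_def)
    ultimately show ?thesis by blast
  qed
  show ?thesis
    unfolding is_structure_def *
    using sub assms(1) by (simp add: is_structure_def)
qed

lemma is_structure_gen:
  assumes "\<And>n. G n \<subseteq> Pow (tuples n)"
  shows "is_structure (gen_structure G)"
proof -
  have "gen_structure G = (\<lambda>n. \<Inter>{S n | S. S \<in> {S. is_structure S \<and> (\<forall>m. G m \<subseteq> S m)}})"
    unfolding gen_structure_def by simp
  moreover have "(\<lambda>n. Pow (tuples n)) \<in> {S. is_structure S \<and> (\<forall>m. G m \<subseteq> S m)}"
    using assms is_structure_full by blast
  ultimately show ?thesis using is_structure_INT[of "{S. is_structure S \<and> (\<forall>m. G m \<subseteq> S m)}"]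
    by (metis (no_types, lifting) empty_iff mem_Collect_eq)
qed

lemma gen_structure_mono:
  assumes "\<And>n. G n \<subseteq> G' n"
  shows "gen_structure G n \<subseteq> gen_structure G' n"
  using assms unfolding gen_structure_def by blast

text \<open>Formulas are predicates on assignments \<open>nat \<Rightarrow> 'a\<close> that depend on finitely many variables.\<close>
definition dfn :: "(nat \<Rightarrow> 'a list set set) \<Rightarrow> ((nat \<Rightarrow> 'a) \<Rightarrow> bool) \<Rightarrow> bool" where
  "dfn S \<phi> \<longleftrightarrow> (\<exists>m. (\<forall>e e'. (\<forall>i<m. e i = e' i) \<longrightarrow> \<phi> e = \<phi> e') \<and> {xs \<in> tuples m. \<phi> ((!) xs)} \<in> S m)"

text \<open>Overwrites the block of variables from \<open>l\<close> on by a list; the counterpart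
  for tuples of updating one variable, so that a whole tuple can be quantified at once.\<close>

definition upds :: "(nat \<Rightarrow> 'b) \<Rightarrow> nat \<Rightarrow> 'b list \<Rightarrow> nat \<Rightarrow> 'b" where
  "upds e l ys = (\<lambda>i. if l \<le> i \<and> i < l + length ys then ys ! (i - l) else e i)"

lemma upds_simps:
  "n \<le> l \<Longrightarrow> map (upds e l ys) [0..<n] = map e [0..<n]"
  "length ys = k \<Longrightarrow> map (upds e l ys) [l..<l + k] = ys"
  "i < l \<Longrightarrow> upds e l ys i = e i"
  "i < length ys \<Longrightarrow> upds e l ys (l + i) = ys ! i"
proof -
  show "n \<le> l \<Longrightarrow> map (upds e l ys) [0..<n] = map e [0..<n]"
    by (auto simp: upds_def)
  show "length ys = k \<Longrightarrow> map (upds e l ys) [l..<l + k] = ys"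
    by (intro nth_equalityI) (auto simp: upds_def)
qed (auto simp: upds_def)

section \<open>Closure of a structure under substitution and first-order operations\<close>

locale struct =
  fixes S :: "nat \<Rightarrow> 'a list set set"
  assumes is_structure: "is_structure S"
begin

lemma
  shows length_mem: "\<And>A xs n. A \<in> S n \<Longrightarrow> xs \<in> A \<Longrightarrow> length xs = n"
    and empty_mem: "\<And>n. {} \<in> S n"
    and Un_mem: "\<And>A B n. A \<in> S n \<Longrightarrow> B \<in> S n \<Longrightarrow> A \<union> B \<in> S n"
    and compl_mem: "\<And>A n. A \<in> S n \<Longrightarrow> tuples n - A \<in> S n"
    and cons_mem: "\<And>A n. A \<in> S n \<Longrightarrow> {x # xs | x xs. xs \<in> A} \<in> S (Suc n)"
    and snoc_mem: "\<And>A n. A \<in> S n \<Longrightarrow> {xs @ [x] | x xs. xs \<in> A} \<in> S (Suc n)"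
    and diag_mem: "\<And>n. n \<ge> 1 \<Longrightarrow> {xs \<in> tuples n. xs ! 0 = xs ! (n - 1)} \<in> S n"
    and proj_mem: "\<And>A n. A \<in> S (Suc n) \<Longrightarrow> butlast ` A \<in> S n"
  using is_structure unfolding is_structure_def
  by (auto simp only: tuples_iff subset_iff Pow_iff)

lemma full_mem: "tuples n \<in> S n"
  using compl_mem[OF empty_mem, of n] by simp

lemma Int_mem: assumes "A \<in> S n" "B \<in> S n" shows "A \<inter> B \<in> S n"
proof -
  have "A \<inter> B = tuples n - ((tuples n - A) \<union> (tuples n - B))"
    using assms by (auto dest: length_mem)
  then show ?thesis using assms by (simp add: Un_mem compl_mem)
qed

lemma Diff_mem: assumes "A \<in> S n" "B \<in> S n" shows "A - B \<in> S n"
proof -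
  have "A - B = A \<inter> (tuples n - B)"
    using assms by (auto dest: length_mem)
  then show ?thesis using assms by (simp add: Int_mem compl_mem)
qed

lemma padL_mem: "A \<in> S n \<Longrightarrow> {ys @ xs | ys xs. length ys = k \<and> xs \<in> A} \<in> S (k + n)"
proof (induction k)
  case (Suc k)
  have "{ys @ xs | ys xs. length ys = Suc k \<and> xs \<in> A}
      = {x # zs | x zs. zs \<in> {ys @ xs | ys xs. length ys = k \<and> xs \<in> A}}" (is "?l = ?r")
  proof
    show "?l \<subseteq> ?r" by (clarsimp simp: length_Suc_conv) blast
    show "?r \<subseteq> ?l" by clarsimp (metis append_Cons length_Cons)
  qed
  then show ?case using cons_mem[OF Suc.IH[OF Suc.prems]] by simp
qed simp

lemma padR_mem: "A \<in> S n \<Longrightarrow> {xs @ ys | xs ys. length ys = k \<and> xs \<in> A} \<in> S (n + k)"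
proof (induction k)
  case (Suc k)
  have "{xs @ ys | xs ys. length ys = Suc k \<and> xs \<in> A}
      = {zs @ [x] | x zs. zs \<in> {xs @ ys | xs ys. length ys = k \<and> xs \<in> A}}" (is "?l = ?r")
  proof
    show "?l \<subseteq> ?r"
    proof clarify
      fix xs ys assume "length (ys::'a list) = Suc k" "xs \<in> A"
      then obtain zs z where "ys = zs @ [z]" "length zs = k"
        by (metis length_Suc_conv_rev)
      with \<open>xs \<in> A\<close> show "\<exists>x zs. xs @ ys = zs @ [x] \<and> zs \<in> {xs @ ys |xs ys. length ys = k \<and> xs \<in> A}"
        by (intro exI[of _ z] exI[of _ "xs @ zs"]) auto
    qed
    show "?r \<subseteq> ?l" by clarsimp (metis length_append_singleton)
  qed
  then show ?case using snoc_mem[OF Suc.IH[OF Suc.prems]] by simp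
qed simp

lemma take_image_mem: "A \<in> S (n + k) \<Longrightarrow> take n ` A \<in> S n"
proof (induction k arbitrary: A)
  case 0
  then have "\<And>xs. xs \<in> A \<Longrightarrow> take n xs = xs" using length_mem[OF 0] by simp
  then have "take n ` A = A" by simp
  with 0 show ?case by simp
next
  case (Suc k)
  have "take n ` A = take n ` butlast ` A"
    unfolding image_image
    by (rule image_cong[OF refl]) (use length_mem[OF Suc.prems] in \<open>simp add: take_butlast\<close>)
  then show ?case using Suc.IH[of "butlast ` A"] proj_mem[of A "n+k"] Suc.prems by simp
qed

text \<open>Only the diagonal equating first and last coordinate is given by the axioms. The one of
  length \<open>j - i + 1\<close> is padded by \<open>i\<close> coordinates on the left and
  \<open>n - j - 1\<close> on the right.\<close>

lemma eq_mem_less: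
  assumes "i < j" "j < n" shows "{xs \<in> tuples n. xs ! i = xs ! j} \<in> S n"
proof -
  define D :: "'a list set" where "D = {xs \<in> tuples (Suc (j - i)). xs ! 0 = xs ! (Suc (j - i) - 1)}"
  have D: "D \<in> S (Suc (j - i))" unfolding D_def by (rule diag_mem) simp
  define E :: "'a list set" where "E = {ys @ xs | ys xs. length ys = i \<and> xs \<in> D}"
  have E: "E \<in> S (i + Suc (j - i))" unfolding E_def by (rule padL_mem[OF D])
  define F :: "'a list set" where "F = {xs @ ys | xs ys. length ys = n - Suc j \<and> xs \<in> E}"
  have F: "F \<in> S (i + Suc (j - i) + (n - Suc j))" unfolding F_def by (rule padR_mem[OF E])
  have EI: "ys @ xs \<in> E" if "length ys = i" "xs \<in> D" for ys xs
    unfolding E_def using that by blast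
  have FI: "xs @ ys \<in> F" if "length ys = n - Suc j" "xs \<in> E" for ys xs
    unfolding F_def using that by blast
  have len: "i + Suc (j - i) + (n - Suc j) = n" using assms by simp
  have "F = {xs \<in> tuples n. xs ! i = xs ! j}"
  proof
    show "F \<subseteq> {xs \<in> tuples n. xs ! i = xs ! j}"
      unfolding F_def E_def D_def using assms by (auto simp: nth_append)
    show "{xs \<in> tuples n. xs ! i = xs ! j} \<subseteq> F"
    proof clarify
      fix xs :: "'a list" assume xs: "xs \<in> tuples n" "xs ! i = xs ! j"
      have "drop i (take (Suc j) xs) \<in> D"
        unfolding D_def using xs assms by (simp add: Suc_diff_le)
      then have "take i xs @ drop i (take (Suc j) xs) \<in> E"
        using xs assms by (intro EI) auto
      then have "(take i xs @ drop i (take (Suc j) xs)) @ drop (Suc j) xs \<in> F"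
        using xs assms by (intro FI) auto
      moreover have "(take i xs @ drop i (take (Suc j) xs)) @ drop (Suc j) xs = xs"
        using assms
        by (metis append_take_drop_id less_or_eq_imp_le min.absorb1 take_take Suc_leI less_SucI)
      ultimately show "xs \<in> F" by simp
    qed
  qed
  with F len show ?thesis by simp
qed

lemma eq_mem: assumes "i < n" "j < n" shows "{xs \<in> tuples n. xs ! i = xs ! j} \<in> S n"
proof -
  consider "i < j" | "j < i" | "i = j" by linarith
  then show ?thesis
  proof cases
    case 1 then show ?thesis using eq_mem_less assms by blast
  next
    case 2
    have "{xs \<in> tuples n. xs ! i = xs ! j} = {xs \<in> tuples n. xs ! j = (xs ! i :: 'a)}" by auto
    then show ?thesis using eq_mem_less[OF 2 assms(1)] by (simp only:)
  next
    case 3 then show ?thesis using full_mem[of n] by (simp add: tuples_def)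
  qed
qed

lemma finite_Int_mem:
  assumes "finite I" "\<And>i. i \<in> I \<Longrightarrow> {xs \<in> tuples n. Q i xs} \<in> S n"
  shows "{xs \<in> tuples n. \<forall>i\<in>I. Q i xs} \<in> S n"
  using assms
proof (induction I)
  case empty show ?case using full_mem[of n] by (simp add: tuples_def)
next
  case (insert i I)
  have "{xs \<in> tuples n. \<forall>i\<in>insert i I. Q i xs} = {xs \<in> tuples n. Q i xs} \<inter> {xs \<in> tuples n. \<forall>i\<in>I. Q i xs}"
    by auto
  then show ?case using insert Int_mem by simp
qed

text \<open>Substitution of variables, with repetitions and omissions allowed. A copy of
  \<open>X\<close> is put on \<open>r\<close> extra coordinates, these are equated with the
  coordinates listed in \<open>js\<close>, and then projected away.\<close>

lemma reindex_mem:
  assumes X: "X \<in> S r" and js: "length js = r" "\<forall>j\<in>set js. j < m"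
  shows "{xs \<in> tuples m. map ((!) xs) js \<in> X} \<in> S m"
proof -
  define A where "A = {ys @ xs | ys xs. length ys = m \<and> xs \<in> X}"
  have A: "A \<in> S (m + r)" unfolding A_def by (rule padL_mem[OF X])
  define B :: "'a list set" where "B = {xs \<in> tuples (m + r). \<forall>k\<in>{..<r}. xs ! (js ! k) = xs ! (m + k)}"
  have B: "B \<in> S (m + r)" unfolding B_def
  proof (rule finite_Int_mem)
    fix k assume "k \<in> {..<r}"
    then show "{xs \<in> tuples (m + r). xs ! (js ! k) = xs ! (m + k)} \<in> S (m + r)"
      using js by (intro eq_mem) (auto simp: trans_less_add1)
  qed simp
  have "take m ` (A \<inter> B) = {xs \<in> tuples m. map ((!) xs) js \<in> X}"
  proof
    show "take m ` (A \<inter> B) \<subseteq> {xs \<in> tuples m. map ((!) xs) js \<in> X}"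
    proof clarify
      fix zs assume "zs \<in> A" "zs \<in> B"
      then obtain ys xs where z: "zs = ys @ xs" "length ys = m" "xs \<in> X" unfolding A_def by blast
      have lx: "length xs = r" using length_mem[OF X z(3)] .
      have "map ((!) ys) js = xs"
      proof (rule nth_equalityI)
        show "length (map ((!) ys) js) = length xs" using lx js by simp
        fix k assume "k < length (map ((!) ys) js)"
        then have k: "k < r" using js by simp
        then have "zs ! (js ! k) = zs ! (m + k)" using \<open>zs \<in> B\<close> unfolding B_def by simp
        then show "map ((!) ys) js ! k = xs ! k" using z k js by (simp add: nth_append)
      qed
      then show "take m zs \<in> tuples m \<and> map ((!) (take m zs)) js \<in> X" using z by simp
    qed
    show "{xs \<in> tuples m. map ((!) xs) js \<in> X} \<subseteq> take m ` (A \<inter> B)"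
    proof clarify
      fix xs :: "'a list" assume xs: "xs \<in> tuples m" "map ((!) xs) js \<in> X"
      let ?z = "xs @ map ((!) xs) js"
      have "?z \<in> A" unfolding A_def using xs by force
      moreover have "?z \<in> B" unfolding B_def using xs js by (auto simp: nth_append)
      moreover have "take m ?z = xs" using xs by simp
      ultimately show "xs \<in> take m ` (A \<inter> B)" by (metis IntI imageI)
    qed
  qed
  then show ?thesis using take_image_mem[OF Int_mem[OF A B]] by simp
qed

text \<open>The number of variables recorded in \<open>dfn\<close> is only some bound. It may be
  replaced by any other \<open>m\<close> on which the formula depends, by padding when
  \<open>m\<close> is larger and by projecting when it is smaller.\<close>

lemma dfn_mem:
  assumes "dfn S \<phi>" and dep: "\<And>e e'. (\<forall>i<m. e i = e' i) \<Longrightarrow> \<phi> e = \<phi> e'"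
  shows "{xs \<in> tuples m. \<phi> ((!) xs)} \<in> S m"
proof -
  obtain k where k: "\<And>e e'. (\<forall>i<k. e i = e' i) \<Longrightarrow> \<phi> e = \<phi> e'" "{xs \<in> tuples k. \<phi> ((!) xs)} \<in> S k" (is "?A \<in> _")
    using assms unfolding dfn_def by blast
  show ?thesis
  proof (cases "k \<le> m")
    case True
    have "{xs @ ys | xs ys. length ys = m - k \<and> xs \<in> ?A} = {xs \<in> tuples m. \<phi> ((!) xs)}" (is "?l = ?r")
    proof
      show "?l \<subseteq> ?r"
      proof clarify
        fix xs ys :: "'a list" assume *: "length ys = m - k" "xs \<in> tuples k" "\<phi> ((!) xs)"
        then have "\<phi> ((!) (xs @ ys))" using k(1)[of "(!) (xs @ ys)" "(!) xs"] by (simp add: nth_append)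
        then show "xs @ ys \<in> tuples m \<and> \<phi> ((!) (xs @ ys))" using * True by simp
      qed
      show "?r \<subseteq> ?l"
      proof clarify
        fix xs :: "'a list" assume *: "xs \<in> tuples m" "\<phi> ((!) xs)"
        then have "\<phi> ((!) (take k xs))" using k(1)[of "(!) (take k xs)" "(!) xs"] by simp
        then have "take k xs \<in> ?A" using * True by simp
        then show "\<exists>xsa ys. xs = xsa @ ys \<and> length ys = m - k \<and> xsa \<in> ?A"
          using * by (intro exI[of _ "take k xs"] exI[of _ "drop k xs"]) auto
      qed
    qed
    then show ?thesis using padR_mem[OF k(2), of "m - k"] True by simp
  next
    case False
    then obtain l where l: "k = m + l" using nat_le_linear le_Suc_ex by blast
    have "take m ` ?A = {xs \<in> tuples m. \<phi> ((!) xs)}" (is "?l = ?r")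
    proof
      show "?l \<subseteq> ?r"
      proof clarify
        fix xs :: "'a list" assume *: "xs \<in> tuples k" "\<phi> ((!) xs)"
        then show "take m xs \<in> tuples m \<and> \<phi> ((!) (take m xs))"
          using dep[of "(!) (take m xs)" "(!) xs"] l by simp
      qed
      show "?r \<subseteq> ?l"
      proof clarify
        fix xs :: "'a list" assume *: "xs \<in> tuples m" "\<phi> ((!) xs)"
        \<comment> \<open>The default entries are harmless: by \<open>dep\<close> the formula reads
          only the first \<open>m\<close> variables.\<close>
        let ?y = "xs @ replicate l undefined"
        have "?y \<in> ?A" using * dep[of "(!) ?y" "(!) xs"] l by (simp add: nth_append)
        moreover have "take m ?y = xs" using * by simp
        ultimately show "xs \<in> take m ` ?A" by (metis imageI)
      qed
    qed
    then show ?thesis using take_image_mem[of ?A m l] k(2) l by simp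
  qed
qed

lemma dfn_atom: assumes "X \<in> S (length js)" shows "dfn S (\<lambda>e. map e js \<in> X)"
proof -
  define m where "m = Suc (Max (insert 0 (set js)))"
  have j: "\<forall>j\<in>set js. j < m" unfolding m_def by (simp add: less_Suc_eq_le)
  have "\<forall>e e'. (\<forall>i<m. e i = e' i) \<longrightarrow> (map e js \<in> X) = (map e' js \<in> X)"
  proof (intro allI impI)
    fix e e' :: "nat \<Rightarrow> 'a" assume "\<forall>i<m. e i = e' i"
    then have "map e js = map e' js" using j by simp
    then show "(map e js \<in> X) = (map e' js \<in> X)" by (simp only:)
  qed
  then show ?thesis unfolding dfn_def using reindex_mem[OF assms refl j] by blast
qed

lemma dfn_const: "dfn S (\<lambda>e. c)"
  unfolding dfn_def by (rule exI[of _ 0]) (use full_mem[of 0] in \<open>cases c; simp add: empty_mem tuples_def\<close>)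

lemma dfn_not: assumes "dfn S \<phi>" shows "dfn S (\<lambda>e. \<not> \<phi> e)"
proof -
  obtain k where k: "\<forall>e e'. (\<forall>i<k. e i = e' i) \<longrightarrow> \<phi> e = \<phi> e'" "{xs \<in> tuples k. \<phi> ((!) xs)} \<in> S k" (is "?A \<in> _")
    using assms unfolding dfn_def by blast
  have "{xs \<in> tuples k. \<not> \<phi> ((!) xs)} = tuples k - ?A" by auto
  then show ?thesis unfolding dfn_def using k compl_mem[OF k(2)] by (intro exI[of _ k]) auto
qed

lemma dfn_conj: assumes "dfn S \<phi>" "dfn S \<psi>" shows "dfn S (\<lambda>e. \<phi> e \<and> \<psi> e)"
proof -
  obtain k where k: "\<And>e e'. (\<forall>i<k. e i = e' i) \<Longrightarrow> \<phi> e = \<phi> e'"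
    using assms unfolding dfn_def by blast
  obtain l where l: "\<And>e e'. (\<forall>i<l. e i = e' i) \<Longrightarrow> \<psi> e = \<psi> e'"
    using assms unfolding dfn_def by blast
  define m where "m = max k l"
  have k': "\<phi> e = \<phi> e'" and l': "\<psi> e = \<psi> e'" if "\<forall>i<m. e i = e' i" for e e'
    using k[of e e'] l[of e e'] that unfolding m_def by auto
  have "{xs \<in> tuples m. \<phi> ((!) xs) \<and> \<psi> ((!) xs)} = {xs \<in> tuples m. \<phi> ((!) xs)} \<inter> {xs \<in> tuples m. \<psi> ((!) xs)}"
    by auto
  then have "{xs \<in> tuples m. \<phi> ((!) xs) \<and> \<psi> ((!) xs)} \<in> S m"
    using Int_mem dfn_mem[OF assms(1) k'] dfn_mem[OF assms(2) l'] by simp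
  then show ?thesis unfolding dfn_def using k' l' by (intro exI[of _ m]) blast
qed

lemma dfn_disj: assumes "dfn S \<phi>" "dfn S \<psi>" shows "dfn S (\<lambda>e. \<phi> e \<or> \<psi> e)"
  using dfn_not[OF dfn_conj[OF dfn_not[OF assms(1)] dfn_not[OF assms(2)]]] by simp

lemma dfn_imp: assumes "dfn S \<phi>" "dfn S \<psi>" shows "dfn S (\<lambda>e. \<phi> e \<longrightarrow> \<psi> e)"
  using dfn_disj[OF dfn_not[OF assms(1)] assms(2)] by simp

lemma dfn_eq: "dfn S (\<lambda>e. e i = e j)"
proof -
  have "(\<lambda>e. e i = e j) = (\<lambda>e. map e [i, j] \<in> {xs \<in> tuples 2. xs ! 0 = xs ! 1})"
    by (simp add: fun_eq_iff)
  then show ?thesis using dfn_atom[of "{xs \<in> tuples 2. xs ! 0 = xs ! 1}" "[i,j]"] eq_mem[of 0 2 1]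
    by (simp add: numeral_2_eq_2)
qed

lemma dfn_ex_upd: assumes "dfn S \<phi>" shows "dfn S (\<lambda>e. \<exists>b. \<phi> (e(v := b)))"
proof -
  obtain k where k: "\<And>e e'. (\<forall>i<k. e i = e' i) \<Longrightarrow> \<phi> e = \<phi> e'"
    using assms unfolding dfn_def by blast
  define m where "m = max k (Suc v)"
  have k': "\<phi> e = \<phi> e'" if "\<forall>i<m. e i = e' i" for e e'
    using k[of e e'] that unfolding m_def by auto
  have vm: "v < m" unfolding m_def by simp
  let ?A = "{xs \<in> tuples m. \<phi> ((!) xs)}"
  have A: "?A \<in> S m" using dfn_mem[OF assms k'] by simp
  \<comment> \<open>The projection axiom removes only the last coordinate, so the bound variable
    \<open>v\<close> is read from a new coordinate \<open>m\<close>; coordinate \<open>v\<close>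
    itself becomes a dummy.\<close>
  define js where "js = map (\<lambda>i. if i = v then m else i) [0..<m]"
  have js: "length js = m" "\<forall>j\<in>set js. j < Suc m" unfolding js_def by auto
  let ?B = "{xs \<in> tuples (Suc m). map ((!) xs) js \<in> ?A}"
  have B: "?B \<in> S (Suc m)" by (rule reindex_mem[OF A js])
  have mp: "map ((!) (xs @ [y])) js \<in> ?A \<longleftrightarrow> \<phi> (((!) xs)(v := y))" if "length xs = m" for xs y
  proof -
    have "\<phi> ((!) (map ((!) (xs @ [y])) js)) = \<phi> (((!) xs)(v := y))"
      by (rule k') (use that in \<open>auto simp: js_def nth_append\<close>)
    then show ?thesis using js by simp
  qed
  have "butlast ` ?B = {xs \<in> tuples m. \<exists>b. \<phi> (((!) xs)(v := b))}"
  proof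
    show "butlast ` ?B \<subseteq> {xs \<in> tuples m. \<exists>b. \<phi> (((!) xs)(v := b))}"
    proof clarify
      fix zs :: "'a list" assume z: "zs \<in> tuples (Suc m)" "map ((!) zs) js \<in> tuples m" "\<phi> ((!) (map ((!) zs) js))"
      then obtain xs y where xy: "zs = xs @ [y]" "length xs = m" by (metis tuples_iff length_Suc_conv_rev)
      then have "\<phi> (((!) xs)(v := y))" using mp[of xs y] z by simp
      then show "butlast zs \<in> tuples m \<and> (\<exists>b. \<phi> (((!) (butlast zs))(v := b)))" using xy by auto
    qed
    show "{xs \<in> tuples m. \<exists>b. \<phi> (((!) xs)(v := b))} \<subseteq> butlast ` ?B"
    proof clarify
      fix xs :: "'a list" and b assume "xs \<in> tuples m" "\<phi> (((!) xs)(v := b))"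
      then have "xs @ [b] \<in> ?B" using mp[of xs b] by simp
      then show "xs \<in> butlast ` ?B" by (rule image_eqI[rotated]) simp
    qed
  qed
  then have 1: "{xs \<in> tuples m. \<exists>b. \<phi> (((!) xs)(v := b))} \<in> S m" using proj_mem[OF B] by simp
  have "\<forall>e e'. (\<forall>i<m. e i = e' i) \<longrightarrow> (\<exists>b. \<phi> (e(v := b))) = (\<exists>b. \<phi> (e'(v := b)))"
  proof (intro allI impI)
    fix e e' :: "nat \<Rightarrow> 'a" assume "\<forall>i<m. e i = e' i"
    then have "\<phi> (e(v := b)) = \<phi> (e'(v := b))" for b by (intro k') auto
    then show "(\<exists>b. \<phi> (e(v := b))) = (\<exists>b. \<phi> (e'(v := b)))" by simp
  qed
  with 1 show ?thesis unfolding dfn_def by blast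
qed

text \<open>The second premise says that \<open>v\<close> is fresh: apart from the place marked by
  \<open>b\<close>, the formula does not read it. Later definability proofs name such a variable
  explicitly.\<close>

lemma dfn_ex:
  assumes "dfn S (\<lambda>e. \<phi> e (e v))" "\<And>e b c. \<phi> (e(v := c)) b = \<phi> e b"
  shows "dfn S (\<lambda>e. \<exists>b. \<phi> e b)"
  using dfn_ex_upd[OF assms(1), of v] assms(2) by simp

lemma dfn_all:
  assumes "dfn S (\<lambda>e. \<phi> e (e v))" "\<And>e b c. \<phi> (e(v := c)) b = \<phi> e b"
  shows "dfn S (\<lambda>e. \<forall>b. \<phi> e b)"
  using dfn_not[OF dfn_ex[of "\<lambda>e b. \<not> \<phi> e b" v, OF dfn_not[OF assms(1)]]] assms(2) by simp

lemma dfn_Ball: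
  assumes "finite I" "\<And>i. i \<in> I \<Longrightarrow> dfn S (\<phi> i)" shows "dfn S (\<lambda>e. \<forall>i\<in>I. \<phi> i e)"
  using assms by (induction I) (auto intro: dfn_const dfn_conj)

lemma dfn_Bex:
  assumes "finite I" "\<And>i. i \<in> I \<Longrightarrow> dfn S (\<phi> i)" shows "dfn S (\<lambda>e. \<exists>i\<in>I. \<phi> i e)"
  using assms by (induction I) (auto intro: dfn_const dfn_disj)

lemma dfn_exs_upds:
  assumes "dfn S \<phi>" shows "dfn S (\<lambda>e. \<exists>ys. length ys = k \<and> \<phi> (upds e l ys))"
  using assms
proof (induction k arbitrary: \<phi>)
  case 0
  have "upds e l [] = e" for e :: "nat \<Rightarrow> 'a" unfolding upds_def by (auto simp: fun_eq_iff)
  with 0 show ?case by simp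
next
  case (Suc k)
  have 1: "dfn S (\<lambda>e. \<exists>b. \<phi> (e(l + k := b)))" by (rule dfn_ex_upd[OF Suc.prems])
  have eq: "(upds e l ys)(l + k := b) = upds e l (ys @ [b])" if "length ys = k" for e :: "nat \<Rightarrow> 'a" and ys b
    using that unfolding upds_def by (auto simp: nth_append fun_eq_iff)
  have "(\<exists>ys. length ys = Suc k \<and> \<phi> (upds e l ys)) \<longleftrightarrow> (\<exists>ys. length ys = k \<and> (\<exists>b. \<phi> ((upds e l ys)(l + k := b))))" for e
    using eq by (metis length_Suc_conv_rev)
  then show ?case using Suc.IH[OF 1] by (simp only:)
qed

lemma dfn_exs:
  assumes "dfn S (\<lambda>e. \<phi> e (map e [l..<l + k]))" "\<And>e ys zs. length zs = k \<Longrightarrow> \<phi> (upds e l zs) ys = \<phi> e ys"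
  shows "dfn S (\<lambda>e. \<exists>ys. length ys = k \<and> \<phi> e ys)"
proof -
  have "\<phi> (upds e l ys) (map (upds e l ys) [l..<l + k]) = \<phi> e ys" if "length ys = k" for e ys
    using assms(2)[OF that] upds_simps(2)[OF that] by (simp only:)
  then show ?thesis using dfn_exs_upds[OF assms(1), of k l] by (simp cong: conj_cong)
qed

lemma dfn_snoc_mem:
  assumes "dfn S (\<lambda>e. \<phi> (map e [0..<n]) (e n))"
  shows "{as @ [u] | as u. length as = n \<and> \<phi> as u} \<in> S (Suc n)"
proof -
  have "{xs \<in> tuples (Suc n). \<phi> (map ((!) xs) [0..<n]) (xs ! n)} \<in> S (Suc n)"
    by (rule dfn_mem[OF assms]) (metis (mono_tags, lifting) atLeastLessThan_iff lessI less_Suc_eq map_eq_conv set_upt)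
  moreover have "{xs \<in> tuples (Suc n). \<phi> (map ((!) xs) [0..<n]) (xs ! n)} = {as @ [u] | as u. length as = n \<and> \<phi> as u}"
  proof -
    have "map ((!) (as @ [u])) [0..<n] = as" if "length as = n" for as and u :: 'a
      using that by (intro nth_equalityI) (auto simp: nth_append)
    then show ?thesis by (auto simp: length_Suc_conv_rev)
  qed
  ultimately show ?thesis by simp
qed

lemma finite_INT_mem: "finite \<Y> \<Longrightarrow> \<Y> \<subseteq> S n \<Longrightarrow> tuples n \<inter> \<Inter>\<Y> \<in> S n"
proof (induction \<Y> rule: finite_induct)
  case (insert Y \<Y>)
  have "tuples n \<inter> \<Inter>(insert Y \<Y>) = Y \<inter> (tuples n \<inter> \<Inter>\<Y>)" using insert.prems length_mem by auto
  then show ?case using insert Int_mem by simp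
qed (simp add: full_mem)

lemma finite_UN_mem: "finite \<Y> \<Longrightarrow> \<Y> \<subseteq> S n \<Longrightarrow> \<Union>\<Y> \<in> S n"
  by (induction \<Y> rule: finite_induct) (auto simp: empty_mem Un_mem)

end

section \<open>Finite and countable generation\<close>

lemma struct_gen: "(\<And>n. G n \<subseteq> Pow (tuples n)) \<Longrightarrow> struct (gen_structure G)"
  using is_structure_gen by unfold_locales blast

text \<open>Each closure condition has at most two arguments, so the sets generated by finite
  subfamilies of \<open>G\<close> already form a structure; it contains \<open>G\<close>, hence
  everything that \<open>G\<close> generates.\<close>

lemma gen_structure_finite:
  assumes G: "\<And>n. G n \<subseteq> Pow (tuples n)" and X: "X \<in> gen_structure G n"
  shows "\<exists>F. finite F \<and> (\<forall>(m, Y) \<in> F. Y \<in> G m) \<and> X \<in> gen_structure (\<lambda>m. {Y. (m, Y) \<in> F}) n"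
proof -
  define fin where "fin F \<longleftrightarrow> finite F \<and> (\<forall>(m, Y) \<in> F. Y \<in> G m)" for F
  define g where "g F = gen_structure (\<lambda>m. {Y. (m, Y) \<in> F})" for F :: "(nat \<times> 'a list set) set"
  define T where "T n = {X. \<exists>F. fin F \<and> X \<in> g F n}" for n
  have st: "struct (g F)" if "fin F" for F
  proof -
    have "{Y. (m, Y) \<in> F} \<subseteq> G m" for m using that unfolding fin_def by auto
    then show ?thesis unfolding g_def using G by (intro struct_gen) (meson subset_trans)
  qed
  have mono: "g F m \<subseteq> g F' m" if "F \<subseteq> F'" for F F' m
    unfolding g_def by (rule gen_structure_mono) (use that in auto)
  have TI: "X \<in> T m" if "fin F" "X \<in> g F m" for F X m unfolding T_def using that by blast
  have fe: "fin {}" unfolding fin_def by simp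
  have "is_structure T"
    unfolding is_structure_def
  proof (intro conjI allI impI)
    fix n show "T n \<subseteq> Pow (tuples n)"
      unfolding T_def using struct.length_mem[OF st] by fastforce
    show "{} \<in> T n" using TI[OF fe struct.empty_mem[OF st[OF fe]]] .
    show "n \<ge> 1 \<Longrightarrow> {xs \<in> tuples n. xs ! 0 = xs ! (n - 1)} \<in> T n"
      using TI[OF fe struct.diag_mem[OF st[OF fe]]] .
  next
    fix n A B assume "A \<in> T n" "B \<in> T n"
    then obtain F F' where f: "fin F" "A \<in> g F n" "fin F'" "B \<in> g F' n" unfolding T_def by blast
    have u: "fin (F \<union> F')" using f unfolding fin_def by auto
    show "A \<union> B \<in> T n"
      by (rule TI[OF u struct.Un_mem[OF st[OF u]]]) (use f mono[of F "F \<union> F'"] mono[of F' "F \<union> F'"] in auto)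
  next
    fix n A assume "A \<in> T n"
    then obtain F where f: "fin F" "A \<in> g F n" unfolding T_def by blast
    show "tuples n - A \<in> T n" by (rule TI[OF f(1) struct.compl_mem[OF st[OF f(1)] f(2)]])
    show "{x # xs |x xs. xs \<in> A} \<in> T (Suc n)" by (rule TI[OF f(1) struct.cons_mem[OF st[OF f(1)] f(2)]])
    show "{xs @ [x] |x xs. xs \<in> A} \<in> T (Suc n)" by (rule TI[OF f(1) struct.snoc_mem[OF st[OF f(1)] f(2)]])
  next
    fix n A assume "A \<in> T (Suc n)"
    then obtain F where f: "fin F" "A \<in> g F (Suc n)" unfolding T_def by blast
    show "butlast ` A \<in> T n" by (rule TI[OF f(1) struct.proj_mem[OF st[OF f(1)] f(2)]])
  qed
  moreover have "G m \<subseteq> T m" for m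
  proof
    fix Y assume "Y \<in> G m"
    then have "fin {(m, Y)}" unfolding fin_def by simp
    moreover have "Y \<in> g {(m, Y)} m" unfolding g_def using gen_structure_incl[of "\<lambda>n. {Z. (n, Z) \<in> {(m, Y)}}" m] by simp
    ultimately show "Y \<in> T m" by (rule TI)
  qed
  ultimately have "gen_structure G n \<subseteq> T n" by (rule gen_structure_least)
  then show ?thesis using X unfolding T_def fin_def g_def by blast
qed

text \<open>Generation from below: \<open>step\<close> applies every operation once, and countably
  many rounds starting from the generators, the empty sets and the diagonals exhaust the structure.
  Countability is what allows types to be realised by countable saturation.\<close>

lemma gen_structure_countable:
  fixes G :: "nat \<Rightarrow> 'a list set set"
  assumes G: "\<And>n. G n \<subseteq> Pow (tuples n)" and c: "\<And>n. countable (G n)"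
  shows "countable (gen_structure G n)"
proof -
  define step :: "(nat \<times> 'a list set) set \<Rightarrow> (nat \<times> 'a list set) set" where
    "step A = A \<union> (\<lambda>((n, X), (m, Y)). (n, X \<union> Y)) ` {(p, q). p \<in> A \<and> q \<in> A \<and> fst p = fst q}
      \<union> (\<lambda>(n, X). (n, tuples n - X)) ` A
      \<union> (\<lambda>(n, X). (Suc n, {x # xs | x xs. xs \<in> X})) ` A
      \<union> (\<lambda>(n, X). (Suc n, {xs @ [x] | x xs. xs \<in> X})) ` A
      \<union> (\<lambda>(n, X). (n - 1, butlast ` X)) ` {(n, X) \<in> A. n \<noteq> 0}" for A
  define A0 :: "(nat \<times> 'a list set) set" where
    "A0 = (SIGMA n:UNIV. G n) \<union> range (\<lambda>n. (n, {})) \<union> (\<lambda>n. (n, {xs \<in> tuples n. xs ! 0 = xs ! (n - 1)})) ` {1..}"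
  define st where "st k = (step ^^ k) A0" for k
  have sub: "A \<subseteq> step A" for A unfolding step_def by blast
  have st_Suc: "st (Suc k) = step (st k)" for k unfolding st_def by simp
  have cA0: "countable A0" unfolding A0_def using c by (intro countable_Un countable_SIGMA) auto
  have cstep: "countable (step A)" if "countable A" for A
  proof -
    have "countable {(p, q). p \<in> A \<and> q \<in> A \<and> fst p = fst q}"
      by (rule countable_subset[of _ "A \<times> A"]) (use that in auto)
    moreover have "countable {(n, X) \<in> A. n \<noteq> 0}"
      by (rule countable_subset[of _ A]) (use that in auto)
    ultimately show ?thesis unfolding step_def using that by (intro countable_Un countable_image) auto
  qed
  have cst: "countable (st k)" for k
    by (induction k) (use cA0 cstep st_Suc in \<open>auto simp: st_def\<close>)
  define U where "U = (\<Union>k. st k)"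
  have cU: "countable U" unfolding U_def using cst by blast
  have stm: "st k \<subseteq> st l" if "k \<le> l" for k l
    using lift_Suc_mono_le[of st, OF _ that] st_Suc sub by simp
  have lenok: "\<forall>(n, X) \<in> st k. X \<subseteq> tuples n" for k
  proof (induction k)
    case 0 show ?case using G by (auto simp: st_def A0_def)
  next
    case (Suc k)
    have b: "length (butlast xs) = n - 1" if "length xs = n" for xs :: "'a list" and n using that by simp
    show ?case unfolding st_Suc step_def using Suc by (auto simp: tuples_def; fastforce)
  qed
  define T where "T n = {X. (n, X) \<in> U}" for n
  have TI: "X \<in> T m" if "(m, X) \<in> st k" for m X k unfolding T_def U_def using that by blast
  have T: "is_structure T" unfolding is_structure_def
  proof (intro conjI allI impI)
    fix n show "T n \<subseteq> Pow (tuples n)" unfolding T_def U_def using lenok by blast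
    show "{} \<in> T n" by (rule TI[of _ _ 0]) (simp add: st_def A0_def)
    show "n \<ge> 1 \<Longrightarrow> {xs \<in> tuples n. xs ! 0 = xs ! (n - 1)} \<in> T n"
      by (rule TI[of _ _ 0]) (auto simp: st_def A0_def)
  next
    fix n A B assume "A \<in> T n" "B \<in> T n"
    then obtain k l where "(n, A) \<in> st k" "(n, B) \<in> st l" unfolding T_def U_def by blast
    then have "(n, A) \<in> st (max k l)" "(n, B) \<in> st (max k l)" using stm[of k "max k l"] stm[of l "max k l"] by auto
    then have "(n, A \<union> B) \<in> st (Suc (max k l))" unfolding st_Suc step_def
      by (intro UnI1 UnI2 image_eqI[of _ _ "((n, A), (n, B))"]) auto
    then show "A \<union> B \<in> T n" by (rule TI)
  next
    fix n A assume "A \<in> T n"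
    then obtain k where k: "(n, A) \<in> st k" unfolding T_def U_def by blast
    show "tuples n - A \<in> T n" by (rule TI[of _ _ "Suc k"], unfold st_Suc step_def)
       (use k in \<open>auto intro: rev_image_eqI\<close>)
    show "{x # xs |x xs. xs \<in> A} \<in> T (Suc n)" by (rule TI[of _ _ "Suc k"], unfold st_Suc step_def)
       (use k in \<open>auto intro: rev_image_eqI\<close>)
    show "{xs @ [x] |x xs. xs \<in> A} \<in> T (Suc n)" by (rule TI[of _ _ "Suc k"], unfold st_Suc step_def)
       (use k in \<open>auto intro: rev_image_eqI\<close>)
  next
    fix n A assume "A \<in> T (Suc n)"
    then obtain k where k: "(Suc n, A) \<in> st k" unfolding T_def U_def by blast
    show "butlast ` A \<in> T n" by (rule TI[of _ _ "Suc k"], unfold st_Suc step_def)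
       (intro UnI2 image_eqI[of _ _ "(Suc n, A)"], use k in auto)
  qed
  have "G m \<subseteq> T m" for m
    unfolding T_def U_def by (auto simp: st_def A0_def intro!: exI[of _ 0])
  then have "gen_structure G n \<subseteq> T n" by (rule gen_structure_least[OF T])
  moreover have "T n \<subseteq> snd ` U" unfolding T_def by force
  ultimately show ?thesis using cU by (meson countable_image countable_subset)
qed

section \<open>Pregeometries of finite fibres\<close>

locale pregeometry =
  fixes cl :: "'b set \<Rightarrow> 'b set"
  assumes cl_ext: "A \<subseteq> cl A"
    and cl_mono: "A \<subseteq> B \<Longrightarrow> cl A \<subseteq> cl B"
    and cl_idem: "cl (cl A) \<subseteq> cl A"
    and cl_finitary: "x \<in> cl A \<Longrightarrow> \<exists>B. finite B \<and> B \<subseteq> A \<and> x \<in> cl B"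
    and cl_exchange: "x \<in> cl (insert y A) \<Longrightarrow> x \<notin> cl A \<Longrightarrow> y \<in> cl (insert x A)"
begin

lemma cl_minimal: "A \<subseteq> cl B \<Longrightarrow> cl A \<subseteq> cl B"
  using cl_mono[of A "cl B"] cl_idem by blast

lemma cl_Un_absorb: "B \<subseteq> cl A \<Longrightarrow> cl (A \<union> B) = cl A"
  by (meson Un_upper1 cl_ext cl_minimal cl_mono le_sup_iff subset_antisym)

lemma cl_insert_absorb: "b \<in> cl A \<Longrightarrow> cl (insert b A) = cl A"
  using cl_Un_absorb[of "{b}" A] by simp

definition addpt :: "'b \<Rightarrow> 'b set \<times> nat \<Rightarrow> 'b set \<times> nat" where
  "addpt a p = (insert a (fst p), snd p + (if a \<in> cl (fst p) then 0 else 1))"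

lemma addpt_simps: "fst (addpt a p) = insert a (fst p)" "snd (addpt a p) = snd p + (if a \<in> cl (fst p) then 0 else 1)"
  by (simp_all add: addpt_def)

text \<open>The dimension of \<open>A\<close> over \<open>C\<close>, computed greedily: points are
  adjoined one at a time and each one outside the closure reached so far counts 1. The definition as
  a fold yields independence of the order and the recursion \<open>rk_insert\<close> at
  once.\<close>

definition rk :: "'b set \<Rightarrow> 'b set \<Rightarrow> nat" where
  "rk C A = snd (Finite_Set.fold addpt (C, 0) A)"

text \<open>That two greedy steps commute is the exchange property when both points are new;
  otherwise it follows from monotonicity and absorption.\<close>

sublocale addpt: comp_fun_commute addpt
proof
  fix a b
  have "addpt b (addpt a (X, n)) = addpt a (addpt b (X, n))" for X n
  proof -
    have "a \<in> cl (insert b X)" if "a \<in> cl X" using that cl_mono[of X "insert b X"] by blast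
    moreover have "b \<in> cl (insert a X)" if "b \<in> cl X" using that cl_mono[of X "insert a X"] by blast
    moreover have "cl (insert a X) = cl X" if "a \<in> cl X" using that by (rule cl_insert_absorb)
    moreover have "cl (insert b X) = cl X" if "b \<in> cl X" using that by (rule cl_insert_absorb)
    moreover have "b \<in> cl (insert a X) \<longleftrightarrow> a \<in> cl (insert b X)" if "a \<notin> cl X" "b \<notin> cl X"
      using that cl_exchange by blast
    ultimately show ?thesis by (cases "a \<in> cl X"; cases "b \<in> cl X"; simp add: addpt_def insert_commute)
  qed
  then show "addpt b \<circ> addpt a = addpt a \<circ> addpt b" by (auto simp: fun_eq_iff)
qed

lemma fold_addpt_fst: "finite A \<Longrightarrow> fst (Finite_Set.fold addpt (C, k) A) = C \<union> A"
proof (induction A rule: finite_induct)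
  case (insert a A)
  then show ?case using addpt.fold_insert[OF insert(1,2), of "(C, k)"] by (simp add: addpt_simps)
qed simp

lemma rk_empty [simp]: "rk C {} = 0" by (simp add: rk_def)

lemma rk_insert: "finite A \<Longrightarrow> rk C (insert a A) = rk C A + (if a \<in> cl (C \<union> A) then 0 else 1)"
proof (cases "a \<in> A")
  case True
  then have "a \<in> cl (C \<union> A)" using cl_ext by blast
  then show ?thesis using True by (simp add: insert_absorb)
next
  case False
  assume "finite A"
  then show ?thesis using False fold_addpt_fst[of A C 0] by (simp add: rk_def addpt_simps)
qed

lemma rk_Un:
  assumes "finite A" "finite B" shows "rk C (A \<union> B) = rk C A + rk (C \<union> A) B"
  using assms(2)
proof (induction B rule: finite_induct)
  case (insert b B)
  with assms(1) have "finite (A \<union> B)" by simp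
  then have "rk C (insert b (A \<union> B)) = rk C (A \<union> B) + (if b \<in> cl (C \<union> (A \<union> B)) then 0 else 1)" by (rule rk_insert)
  then show ?case using insert rk_insert[of B "C \<union> A" b] by (simp add: Un_assoc)
qed simp

lemma rk_antimono: "finite A \<Longrightarrow> C \<subseteq> cl C' \<Longrightarrow> rk C' A \<le> rk C A"
proof (induction A rule: finite_induct)
  case (insert a A)
  have "C \<union> A \<subseteq> cl (C' \<union> A)"
    using insert.prems cl_mono[of C' "C' \<union> A"] cl_ext[of "C' \<union> A"] by blast
  then have "cl (C \<union> A) \<subseteq> cl (C' \<union> A)" by (rule cl_minimal)
  then show ?case using insert by (auto simp: rk_insert)
qed simp

lemma rk_eq_0: "finite A \<Longrightarrow> A \<subseteq> cl C \<Longrightarrow> rk C A = 0"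
proof (induction A rule: finite_induct)
  case (insert a A)
  then have "a \<in> cl (C \<union> A)" using cl_mono[of C "C \<union> A"] by blast
  then show ?case using insert by (simp add: rk_insert)
qed simp

lemma rk_eq_0D: "finite A \<Longrightarrow> rk C A = 0 \<Longrightarrow> A \<subseteq> cl C"
proof (induction A rule: finite_induct)
  case (insert a A)
  then have "a \<in> cl (C \<union> A)" "A \<subseteq> cl C" by (auto simp: rk_insert split: if_splits)
  then show ?case using cl_Un_absorb[of A C] by simp
qed simp

lemma rk_absorb: "finite A \<Longrightarrow> finite B \<Longrightarrow> B \<subseteq> cl (C \<union> A) \<Longrightarrow> rk C (A \<union> B) = rk C A"
  by (simp add: rk_Un rk_eq_0)

lemma rk_mono: "finite B \<Longrightarrow> A \<subseteq> B \<Longrightarrow> rk C A \<le> rk C B"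
  by (metis Un_absorb1 finite_subset le_add1 rk_Un)

lemma rk_le_cl: "finite A \<Longrightarrow> finite B \<Longrightarrow> A \<subseteq> cl (C \<union> B) \<Longrightarrow> rk C A \<le> rk C B"
  by (metis finite_UnI rk_absorb rk_mono sup_ge2)

lemma rk_Un_le: "finite A \<Longrightarrow> finite B \<Longrightarrow> rk C (A \<union> B) \<le> rk C A + rk C B"
proof -
  assume f: "finite A" "finite B"
  have "C \<subseteq> cl (C \<union> A)" using cl_ext by blast
  then show ?thesis using f rk_antimono[of B C "C \<union> A"] by (simp add: rk_Un)
qed

lemma rk_le_card: "finite A \<Longrightarrow> rk C A \<le> card A"
  by (induction A rule: finite_induct) (auto simp: rk_insert)

text \<open>Additivity read in both orders. It exchanges the roles of the two sets, which turns
  dependence of a point of \<open>P\<close> on \<open>X\<close> into a comparison of two ranks of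
  \<open>X\<close>, and failure of genericity over \<open>A\<close> into a loss of rank of
  \<open>A\<close>.\<close>

lemma rk_shift: "finite A \<Longrightarrow> finite B \<Longrightarrow> rk C A + rk (C \<union> A) B = rk C B + rk (C \<union> B) A"
  by (metis rk_Un Un_commute)

end

text \<open>\<open>F n\<close> plays the role of the 0-definable subsets of \<open>M\<close> to the power \<open>n + 1\<close> whose fibres over the
  first \<open>n\<close> coordinates are finite; the axioms survive passage to an ultrapower, finiteness does not.\<close>
locale finfam =
  fixes F :: "nat \<Rightarrow> 'b list set set"
  assumes F_len: "X \<in> F n \<Longrightarrow> xs \<in> X \<Longrightarrow> length xs = Suc n"
    and F_id: "{xs \<in> tuples 2. xs ! 0 = xs ! 1} \<in> F 1"
    and F_Un: "X \<in> F n \<Longrightarrow> Y \<in> F n \<Longrightarrow> X \<union> Y \<in> F n"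
    and F_reindex: "X \<in> F n \<Longrightarrow> length js = n \<Longrightarrow> \<forall>j\<in>set js. j < m \<Longrightarrow>
       {as @ [u] | as u. length as = m \<and> map ((!) as) js @ [u] \<in> X} \<in> F m"
    and F_comp: "X \<in> F (Suc n) \<Longrightarrow> Y \<in> F n \<Longrightarrow> {as @ [u] | as u. \<exists>b. as @ [b] \<in> Y \<and> as @ [b, u] \<in> X} \<in> F n"
    and F_exch: "X \<in> F (Suc n) \<Longrightarrow> \<exists>Y\<in>F n. \<exists>Z\<in>F (Suc n). \<forall>as b u. as @ [b, u] \<in> X \<longrightarrow> as @ [u] \<in> Y \<or> as @ [u, b] \<in> Z"
begin

definition cl :: "'b set \<Rightarrow> 'b set" where
  "cl B = {u. \<exists>as X. set as \<subseteq> B \<and> X \<in> F (length as) \<and> as @ [u] \<in> X}"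

text \<open>Reindexing replaces a witness list by any list with at least the same entries, so that
  dependence on a tuple \<open>as\<close> is witnessed at \<open>as\<close> itself.\<close>

lemma cl_set_iff: "u \<in> cl (set as) \<longleftrightarrow> (\<exists>X\<in>F (length as). as @ [u] \<in> X)"
proof
  assume "u \<in> cl (set as)"
  then obtain bs X where b: "set bs \<subseteq> set as" "X \<in> F (length bs)" "bs @ [u] \<in> X" unfolding cl_def by blast
  have "\<forall>b\<in>set bs. \<exists>j<length as. as ! j = b" using b(1) by (metis in_set_conv_nth subsetD)
  then obtain h where h: "\<And>b. b \<in> set bs \<Longrightarrow> h b < length as \<and> as ! h b = b" by metis
  let ?js = "map h bs"
  have "map ((!) as) ?js = bs" using h by (simp add: map_idI)
  moreover have "\<forall>j\<in>set ?js. j < length as" using h by auto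
  ultimately show "\<exists>X\<in>F (length as). as @ [u] \<in> X"
    using F_reindex[OF b(2), of ?js "length as"] b(3) by (intro bexI[rotated]) auto
next
  assume "\<exists>X\<in>F (length as). as @ [u] \<in> X"
  then show "u \<in> cl (set as)" unfolding cl_def by blast
qed

lemma cl_set_mono: "A \<subseteq> B \<Longrightarrow> cl A \<subseteq> cl B" unfolding cl_def by blast

lemma cl_finite_list: "u \<in> cl B \<Longrightarrow> \<exists>as. set as \<subseteq> B \<and> u \<in> cl (set as)" unfolding cl_def by blast

text \<open>Composition of correspondences: the intermediate point \<open>b\<close> is eliminated by
  \<open>F_comp\<close>. Iterated over a list this yields idempotence of the closure.\<close>

lemma cl_step: assumes "b \<in> cl (set cs)" "u \<in> cl (insert b (set cs))" shows "u \<in> cl (set cs)"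
proof -
  obtain Y where Y: "Y \<in> F (length cs)" "cs @ [b] \<in> Y" using assms(1) cl_set_iff by blast
  have "u \<in> cl (set (cs @ [b]))" using assms(2) by simp
  then obtain X where X: "X \<in> F (Suc (length cs))" "(cs @ [b]) @ [u] \<in> X" using cl_set_iff[of u "cs @ [b]"] by auto
  have "cs @ [u] \<in> {as @ [u] | as u. \<exists>b. as @ [b] \<in> Y \<and> as @ [b, u] \<in> X}" using X Y by auto
  then show ?thesis by (intro cl_set_iff[THEN iffD2] bexI[OF _ F_comp[OF X(1) Y(1)]])
qed

lemma cl_steps: "set as \<subseteq> cl (set bs) \<Longrightarrow> u \<in> cl (set bs \<union> set as) \<Longrightarrow> u \<in> cl (set bs)"
proof (induction as)
  case (Cons a as)
  have "a \<in> cl (set (bs @ as))" using Cons.prems(1) cl_set_mono[of "set bs" "set (bs @ as)"] by auto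
  moreover have "u \<in> cl (insert a (set (bs @ as)))" using Cons.prems(2) by simp
  ultimately have "u \<in> cl (set (bs @ as))" by (rule cl_step)
  then show ?case using Cons by simp
qed simp

sublocale pregeometry cl
proof
  fix A B :: "'b set" and x y
  show "A \<subseteq> cl A"
  proof
    fix a assume "a \<in> A"
    moreover have "[a] @ [a] \<in> {xs \<in> tuples 2. xs ! 0 = xs ! 1}" by simp
    ultimately show "a \<in> cl A" unfolding cl_def using F_id
      by (intro CollectI exI[of _ "[a]"] exI[of _ "{xs \<in> tuples 2. xs ! 0 = xs ! 1}"]) simp
  qed
  show "A \<subseteq> B \<Longrightarrow> cl A \<subseteq> cl B" by (rule cl_set_mono)
  show "x \<in> cl A \<Longrightarrow> \<exists>B. finite B \<and> B \<subseteq> A \<and> x \<in> cl B" using cl_finite_list by blast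
  show "cl (cl A) \<subseteq> cl A"
  proof
    fix u assume "u \<in> cl (cl A)"
    then obtain as where as: "set as \<subseteq> cl A" "u \<in> cl (set as)" using cl_finite_list by blast
    have "\<exists>bs. set bs \<subseteq> A \<and> set as \<subseteq> cl (set bs)" using as(1)
    proof (induction as)
      case (Cons a as)
      then obtain bs cs where "set bs \<subseteq> A" "set as \<subseteq> cl (set bs)" "set cs \<subseteq> A" "a \<in> cl (set cs)"
        using cl_finite_list by (metis list.set_intros(1) set_subset_Cons subset_iff)
      then show ?case using cl_set_mono[of "set bs" "set (bs @ cs)"] cl_set_mono[of "set cs" "set (bs @ cs)"]
        by (intro exI[of _ "bs @ cs"]) auto
    qed (auto intro: exI[of _ "[]"])
    then obtain bs where bs: "set bs \<subseteq> A" "set as \<subseteq> cl (set bs)" by blast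
    have "u \<in> cl (set bs \<union> set as)" using as(2) cl_set_mono[of "set as" "set bs \<union> set as"] by auto
    then have "u \<in> cl (set bs)" using cl_steps bs by blast
    then show "u \<in> cl A" using cl_set_mono[OF bs(1)] by blast
  qed
  show "x \<in> cl (insert y A) \<Longrightarrow> x \<notin> cl A \<Longrightarrow> y \<in> cl (insert x A)"
  proof -
    assume x: "x \<in> cl (insert y A)" "x \<notin> cl A"
    then obtain as where as: "set as \<subseteq> insert y A" "x \<in> cl (set as)" using cl_finite_list by blast
    \<comment> \<open>\<open>y\<close> is removed and appended again at the end, the position at
      which \<open>F_exch\<close> swaps it with \<open>x\<close>.\<close>
    define bs where "bs = filter (\<lambda>a. a \<noteq> y) as"
    have bs: "set bs \<subseteq> A" "set as \<subseteq> set (bs @ [y])" using as(1) unfolding bs_def by auto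
    have "x \<in> cl (set (bs @ [y]))" using cl_set_mono[OF bs(2)] as(2) by blast
    then obtain X where X: "X \<in> F (Suc (length bs))" "bs @ [y, x] \<in> X"
      using cl_set_iff[of x "bs @ [y]"] by auto
    obtain Y Z where YZ: "Y \<in> F (length bs)" "Z \<in> F (Suc (length bs))" "bs @ [x] \<in> Y \<or> bs @ [x, y] \<in> Z"
      using F_exch[OF X(1)] X(2) by blast
    moreover have "bs @ [x] \<notin> Y" using x(2) YZ(1) cl_set_iff[of x bs] cl_set_mono[OF bs(1)] by blast
    ultimately have "y \<in> cl (set (bs @ [x]))" using cl_set_iff[of y "bs @ [x]"] by auto
    moreover have "set (bs @ [x]) \<subseteq> insert x A" using bs(1) by auto
    ultimately show "y \<in> cl (insert x A)" using cl_set_mono by blast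
  qed
qed

end

section \<open>O-minimal structures\<close>

locale pstruct = struct +
  assumes point_mem: "{[a]} \<in> S 1"
begin

lemma dfn_eq_const: "dfn S (\<lambda>e. e i = c)"
proof -
  have "(\<lambda>e. e i = c) = (\<lambda>e. map e [i] \<in> {[c]})" by auto
  then show ?thesis using dfn_atom[of "{[c]}" "[i]"] point_mem by simp
qed

lemma dfn_inst: "dfn S \<phi> \<Longrightarrow> dfn S (\<lambda>e. \<phi> (e(v := c)))"
  using dfn_ex_upd[OF dfn_conj[OF dfn_eq_const[of v c]], of \<phi> v] by simp

lemma dfn_inst_finite:
  assumes "finite V" "dfn S \<phi>" shows "dfn S (\<lambda>e'. \<phi> (\<lambda>i. if i \<in> V then e i else e' i))"
  using assms(1)
proof (induction V rule: finite_induct)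
  case empty then show ?case using assms(2) by simp
next
  case (insert v V)
  have "(\<lambda>i. if i \<in> V then e i else (e'(v := e v)) i) = (\<lambda>i. if i \<in> insert v V then e i else e' i)" for e'
    using insert.hyps by (auto simp: fun_eq_iff)
  then show ?case using dfn_inst[OF insert.IH, of v "e v"] by simp
qed

text \<open>All variables outside \<open>V\<close> receive constants. There may be infinitely many
  of them, but a formula depends on finitely many variables, so finitely many substitutions
  suffice.\<close>

lemma dfn_inst_but:
  assumes "dfn S \<phi>" shows "dfn S (\<lambda>e'. \<phi> (\<lambda>i. if i \<in> V then e' i else e i))"
proof -
  obtain m where m: "\<And>e e'. (\<forall>i<m. e i = e' i) \<Longrightarrow> \<phi> e = \<phi> e'" using assms unfolding dfn_def by blast
  have "\<phi> (\<lambda>i. if i \<in> {..<m} - V then e i else e' i) = \<phi> (\<lambda>i. if i \<in> V then e' i else e i)" for e'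
    by (rule m) auto
  then show ?thesis using dfn_inst_finite[of "{..<m} - V" \<phi> e] assms by simp
qed

lemma dset_dfn:
  assumes "dfn S (\<lambda>e. \<chi> (e v))" shows "{[x] | x. \<chi> x} \<in> S 1"
proof -
  have 1: "dfn S (\<lambda>e. \<chi> (e 0))"
  proof (cases "v = 0")
    case True then show ?thesis using assms by simp
  next
    case False
    have "dfn S (\<lambda>e. \<exists>b. b = e 0 \<and> \<chi> b)"
      by (rule dfn_ex[where v = v]) (use assms False dfn_eq in \<open>auto intro!: dfn_conj\<close>)
    then show ?thesis by simp
  qed
  have "{xs \<in> tuples 1. \<chi> (xs ! 0)} = {[x] | x. \<chi> x}" by (auto simp: length_Suc_conv)
  then show ?thesis using dfn_mem[OF 1, of 1] by simp
qed

lemma dset_dfn_upd: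
  assumes "dfn S \<psi>" shows "{[x] | x. \<psi> (e(v := x))} \<in> S 1"
proof (rule dset_dfn[of _ v])
  have "(\<lambda>i. if i \<in> {v} then e' i else e i) = e(v := e' v)" for e' by auto
  then show "dfn S (\<lambda>e'. \<psi> (e(v := e' v)))" using dfn_inst_but[OF assms, of "{v}" e] by simp
qed

lemma dset_fiber:
  assumes "X \<in> S (Suc n)" "length as = n" shows "{[x] | x. as @ [x] \<in> X} \<in> S 1"
proof -
  have "dfn S (\<lambda>e. map e ([0..<n] @ [n]) \<in> X)" by (rule dfn_atom) (use assms in simp)
  from dset_dfn_upd[OF this, of "(!) as" n]
  have "{[x] | x. map (((!) as)(n := x)) [0..<n] @ [x] \<in> X} \<in> S 1" by simp
  moreover have "map (((!) as)(n := x)) [0..<n] = as" for x using assms(2) by (simp add: list_eq_iff_nth_eq)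
  ultimately show ?thesis by simp
qed

lemma dfn_fiber2:
  assumes "X \<in> S (Suc (Suc n))" "length as = n" shows "dfn S (\<lambda>e. as @ [e 0, e 1] \<in> X)"
proof -
  have "dfn S (\<lambda>e. map e ([2..<n+2] @ [0,1]) \<in> X)" by (rule dfn_atom) (use assms in \<open>simp del: upt_Suc\<close>)
  from dfn_inst_but[OF this, of "{0,1}" "\<lambda>i. as ! (i - 2)"]
  have "dfn S (\<lambda>e. map (\<lambda>i. if i \<in> {0,1} then e i else as ! (i - 2)) [2..<n+2] @ [e 0, e 1] \<in> X)"
    by simp
  moreover have "map (\<lambda>i. if i \<in> {0,1} then e i else as ! (i - 2)) [2..<n+2] = as" for e
    using assms(2) by (intro nth_equalityI) (auto simp del: upt_Suc)
  ultimately show ?thesis by simp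
qed

end

section \<open>Infima and finiteness in an o-minimal group\<close>

locale omin = pstruct D for D :: "nat \<Rightarrow> ('a::linordered_ab_group_add) list set set" +
  assumes less_mem: "{[x, y] | x y. x < y} \<in> D 2"
    and plus_mem: "{[x, y, z] | x y z. x + y = z} \<in> D 3"
    and intervals: "X \<in> D 1 \<Longrightarrow> \<exists>F. finite F \<and> (\<forall>I \<in> F. interval_or_point I) \<and> X = {[x] | x. x \<in> \<Union>F}"
    and dense: "(a::'a) < b \<Longrightarrow> \<exists>c. a < c \<and> c < b"
begin

lemma infinite_interval: assumes "a < b" shows "infinite {x::'a. a < x \<and> x < b}"
proof
  assume f: "finite {x. a < x \<and> x < b}"
  obtain c where "a < c" "c < b" using dense assms by blast
  then have ne: "{x. a < x \<and> x < b} \<noteq> {}" by blast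
  then have "Min {x. a < x \<and> x < b} \<in> {x. a < x \<and> x < b}" using f Min_in by blast
  then obtain c' where "a < c'" "c' < Min {x. a < x \<and> x < b}" "Min {x. a < x \<and> x < b} < b" using dense by blast
  moreover from this have "c' \<in> {x. a < x \<and> x < b}" by auto
  ultimately show False using Min_le[OF f] by fastforce
qed

lemma infinite_contains_interval:
  assumes "{[x] | x. x \<in> X} \<in> D 1" "infinite X"
  shows "\<exists>a b. a < b \<and> (\<forall>x. a < x \<and> x < b \<longrightarrow> x \<in> X)"
proof -
  obtain F where F: "finite F" "\<forall>I \<in> F. interval_or_point I" "{[x] | x. x \<in> X} = {[x] | x. x \<in> \<Union>F}"
    using intervals[OF assms(1)] by blast
  have "[x] \<in> {[x] | x. x \<in> X} \<longleftrightarrow> [x] \<in> {[x] | x. x \<in> \<Union>F}" for x using F(3) by (simp only:)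
  then have X: "X = \<Union>F" by auto
  then obtain I where I: "I \<in> F" "infinite I" using assms(2) F(1) by auto
  have sub: "I \<subseteq> X" using X I by blast
  obtain y where y: "y \<in> I" using I(2) by fastforce
  obtain z where z: "z \<in> I" "z \<noteq> y" using I(2) by (metis finite.emptyI finite_insert finite_subset insertI1 subsetI)
  have "interval_or_point I" using F I by blast
  then consider a where "I = {a}" | a b where "I = {x. a < x \<and> x < b}" | a where "I = {x. a < x}"
    | b where "I = {x. x < b}" | "I = UNIV" unfolding interval_or_point_def by blast
  then show ?thesis
  proof cases
    case 1 then show ?thesis using I by simp
  next
    case (2 a b) then show ?thesis using y sub by (intro exI[of _ a] exI[of _ b]) auto
  next
    case (3 a) then show ?thesis using y sub by (intro exI[of _ a] exI[of _ y]) auto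
  next
    case (4 b) then show ?thesis using y sub by (intro exI[of _ y] exI[of _ b]) auto
  next
    case 5
    then have "x \<in> X" for x using sub by blast
    then show ?thesis using z(2) by (meson linorder_neqE)
  qed
qed

text \<open>Makes finiteness a first-order condition; from here on finite fibres can be spoken of
  uniformly in the base tuple.\<close>

lemma infinite_iff_interval:
  assumes "{[x] | x. x \<in> X} \<in> D 1"
  shows "infinite X \<longleftrightarrow> (\<exists>a b. a < b \<and> (\<forall>x. a < x \<and> x < b \<longrightarrow> x \<in> X))"
proof
  assume "\<exists>a b. a < b \<and> (\<forall>x. a < x \<and> x < b \<longrightarrow> x \<in> X)"
  then obtain a b where ab: "a < b" "{x. a < x \<and> x < b} \<subseteq> X" by blast
  show "infinite X" using infinite_interval[OF ab(1)] finite_subset[OF ab(2)] by blast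
qed (use infinite_contains_interval[OF assms] in blast)

lemma interval_has_inf:
  assumes "interval_or_point (I :: 'a set)" "I \<noteq> {}" "\<And>x. x \<in> I \<Longrightarrow> l \<le> x" "(0::'a) < c"
  shows "\<exists>s. (\<forall>x\<in>I. s \<le> x) \<and> (\<forall>s'>s. \<exists>x\<in>I. x < s')"
proof -
  from assms(1) consider a where "I = {a}" | a b where "I = {x. a < x \<and> x < b}" | a where "I = {x. a < x}"
    | b where "I = {x. x < b}" | "I = UNIV" unfolding interval_or_point_def by blast
  then show ?thesis
  proof cases
    case (1 a) then show ?thesis by (intro exI[of _ a]) auto
  next
    case (2 a b)
    then have "a < b" using assms(2) by auto
    have "\<exists>x. a < x \<and> x < b \<and> x < s'" if "a < s'" for s'
      using dense[of a "min b s'"] that \<open>a < b\<close> by auto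
    then show ?thesis using 2 by (intro exI[of _ a]) auto
  next
    case (3 a) then show ?thesis using dense by (intro exI[of _ a]) auto
  next
    case (4 b)
    then obtain x where x: "x \<in> I" "x < b" using assms(2) by auto
    \<comment> \<open>A half-line unbounded below contains a point below \<open>l\<close>, obtained
      by translating with the positive element \<open>c\<close>; this contradicts the lower
      bound.\<close>
    have "min x l - c < b" using x(2) assms(4) by (metis diff_less_eq less_add_same_cancel1 min.coboundedI1 order_le_less_trans less_imp_le order_less_trans min_less_iff_conj)
    then have "l \<le> min x l - c" using assms(3) 4 by blast
    moreover have "min x l - c < l" using assms(4) by (metis diff_less_eq less_add_same_cancel1 min.cobounded2 order_le_less_trans)
    ultimately show ?thesis by simp
  next
    case 5
    then have "l \<le> l - c" using assms(3) by blast
    then show ?thesis using assms(4) by simp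
  qed
qed

text \<open>Definable completeness. The order need not be complete, but the infimum of an interval
  bounded below is an endpoint, and a finite union has the least of the infima.\<close>

lemma has_inf:
  assumes "{[x] | x. x \<in> X} \<in> D 1" "X \<noteq> {}" "\<And>x. x \<in> X \<Longrightarrow> l \<le> x" "(0::'a) < c"
  shows "\<exists>s. (\<forall>x\<in>X. s \<le> x) \<and> (\<forall>s'>s. \<exists>x\<in>X. x < s')"
proof -
  obtain F where F: "finite F" "\<forall>I \<in> F. interval_or_point I" "{[x] | x. x \<in> X} = {[x] | x. x \<in> \<Union>F}"
    using intervals[OF assms(1)] by blast
  have "[x] \<in> {[x] | x. x \<in> X} \<longleftrightarrow> [x] \<in> {[x] | x. x \<in> \<Union>F}" for x using F(3) by (simp only:)
  then have X: "X = \<Union>F" by auto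
  have g: "\<Union>F \<noteq> {} \<longrightarrow> (\<exists>s. (\<forall>x\<in>\<Union>F. s \<le> x) \<and> (\<forall>s'>s. \<exists>x\<in>\<Union>F. x < s'))"
    if "finite F" "\<forall>I \<in> F. interval_or_point I" "\<forall>x\<in>\<Union>F. l \<le> x" for F
    using that
  proof (induction F rule: finite_induct)
    case (insert I F)
    then have IH: "\<Union>F \<noteq> {} \<longrightarrow> (\<exists>s. (\<forall>x\<in>\<Union>F. s \<le> x) \<and> (\<forall>s'>s. \<exists>x\<in>\<Union>F. x < s'))" by simp
    have II: "I \<noteq> {} \<longrightarrow> (\<exists>s. (\<forall>x\<in>I. s \<le> x) \<and> (\<forall>s'>s. \<exists>x\<in>I. x < s'))"
      using interval_has_inf[of I l c] insert.prems assms(4) by auto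
    show ?case
    proof (cases "I = {} \<or> \<Union>F = {}")
      case True
      then have "\<Union>(insert I F) = I \<or> \<Union>(insert I F) = \<Union>F" by auto
      then show ?thesis
      proof
        assume eq: "\<Union>(insert I F) = I" show ?thesis unfolding eq by (rule II)
      next
        assume eq: "\<Union>(insert I F) = \<Union>F" show ?thesis unfolding eq by (rule IH)
      qed
    next
      case False
      then obtain s t where s: "\<forall>x\<in>\<Union>F. s \<le> x" "\<forall>s'>s. \<exists>x\<in>\<Union>F. x < s'"
        and t: "\<forall>x\<in>I. t \<le> x" "\<forall>s'>t. \<exists>x\<in>I. x < s'" using IH II by blast
      have "\<forall>x\<in>\<Union>(insert I F). min s t \<le> x" using s(1) t(1) by (auto simp: min.coboundedI1 min.coboundedI2)
      moreover have "\<forall>s'>min s t. \<exists>x\<in>\<Union>(insert I F). x < s'"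
      proof (intro allI impI)
        fix s' assume "min s t < s'"
        then have "s < s' \<or> t < s'" by (simp add: min_less_iff_disj)
        then show "\<exists>x\<in>\<Union>(insert I F). x < s'" using s(2) t(2) by blast
      qed
      ultimately show ?thesis by blast
    qed
  qed simp
  have "\<forall>x\<in>X. l \<le> x" using assms(3) by blast
  then show ?thesis using g[OF F(1,2)] assms(2) unfolding X by (simp only: simp_thms)
qed

lemma dfn_less: "dfn D (\<lambda>e. e i < e j)"
proof -
  have "(\<lambda>e. e i < e j) = (\<lambda>e. map e [i, j] \<in> {[x, y] | x y. x < y})" by auto
  then show ?thesis using dfn_atom[of "{[x, y] | x y. x < y}" "[i,j]"] less_mem by (simp add: numeral_2_eq_2)
qed

lemma dfn_plus: "dfn D (\<lambda>e. e i + e j = e k)"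
proof -
  have eq: "(\<lambda>e. e i + e j = e k) = (\<lambda>e. map e [i, j, k] \<in> {[x, y, z] | x y z. x + y = z})" by auto
  have "length [i, j, k] = 3" by simp
  then show ?thesis unfolding eq by (intro dfn_atom) (simp only: plus_mem)
qed

lemma dfn_less_const: "dfn D (\<lambda>e. c < e j)"
proof -
  have "dfn D (\<lambda>e. \<exists>b. b = c \<and> b < e j)"
    by (rule dfn_ex[where v = "Suc j"]) (auto intro!: dfn_conj dfn_eq_const dfn_less)
  then show ?thesis by simp
qed

text \<open>The sets \<open>I t\<close> grow as \<open>t\<close> decreases to 0. To each
  \<open>u\<close> that enters the family without lying in all members belongs a threshold, the
  infimum of the parameters at which \<open>u\<close> is missing. If the thresholds contain an
  interval, a parameter \<open>m\<close> inside it has infinitely many \<open>u\<close>, coming from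
  the thresholds above \<open>m\<close>; if they are finite in number, one is shared by infinitely
  many \<open>u\<close>, and any smaller positive parameter will do.\<close>

lemma increasing_family_infinite:
  assumes I: "dfn D (\<lambda>e. I (e 0) (e 1))"
    and anti: "\<And>s t u. 0 < s \<Longrightarrow> s < t \<Longrightarrow> I t u \<Longrightarrow> I s u"
    and inf: "infinite {u. \<exists>t>0. I t u}"
  shows "\<exists>t>0. infinite {u. I t u}"
proof (rule ccontr)
  assume "\<not> ?thesis"
  then have fin: "finite {u. I t u}" if "0 < t" for t using that by blast
  have "{u. \<exists>t>0. I t u} \<noteq> {}" using inf by (metis finite.emptyI)
  then obtain c where c: "(0::'a) < c" by blast
  define N where "N = {u. \<forall>t>0. I t u}"
  have "N \<subseteq> {u. I c u}" unfolding N_def using c by blast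
  then have "finite N" using fin[OF c] finite_subset by blast
  define U where "U = {u. \<exists>t>0. I t u} - N"
  have U: "infinite U" unfolding U_def using inf \<open>finite N\<close> by (rule Diff_infinite_finite[rotated])
  \<comment> \<open>\<open>s\<close> is the infimum of the positive \<open>t\<close> with
    \<open>u\<close> outside \<open>I t\<close>.\<close>
  define \<delta> where "\<delta> u s \<longleftrightarrow> (\<forall>t. 0 < t \<and> \<not> I t u \<longrightarrow> \<not> t < s) \<and> (\<forall>s'. s < s' \<longrightarrow> (\<exists>t. 0 < t \<and> t < s' \<and> \<not> I t u))" for u s
  have dI: "dfn D (\<lambda>e. I (e i) (e j))" if "i > 1" "j > 1" for i j
  proof -
    have "dfn D (\<lambda>e. \<exists>a. a = e i \<and> (\<exists>b. b = e j \<and> I a b))"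
      by (rule dfn_ex[where v = 0], rule dfn_conj[OF dfn_eq], rule dfn_ex[where v = 1], rule dfn_conj[OF dfn_eq])
        (use I that in auto)
    then show ?thesis by simp
  qed
  have dd: "dfn D (\<lambda>e. \<delta> (e 2) (e 3))" unfolding \<delta>_def
    by (intro dfn_conj; (rule dfn_all[where v = 4], intro dfn_imp dfn_conj dfn_not dfn_less dfn_less_const dI;
       (simp; fail)?)?) (rule dfn_ex[where v = 5], auto intro!: dfn_conj dfn_not dfn_less dfn_less_const dI)
  have ex: "\<exists>s. \<delta> u s" if "u \<in> U" for u
  proof -
    define T where "T = {t. 0 < t \<and> \<not> I t u}"
    have "{[x] | x. x \<in> T} \<in> D 1"
    proof -
      have "dfn D (\<lambda>e. 0 < e 2 \<and> \<not> I (e 2) (e 3))" by (intro dfn_conj dfn_not dfn_less_const dI) auto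
      from dset_dfn_upd[OF this, of "\<lambda>_. u" 2] show ?thesis unfolding T_def by simp
    qed
    moreover have "T \<noteq> {}" using that unfolding T_def U_def N_def by blast
    moreover have "0 \<le> x" if "x \<in> T" for x using that unfolding T_def by (auto simp: less_imp_le)
    ultimately obtain s where "\<forall>x\<in>T. s \<le> x" "\<forall>s'>s. \<exists>x\<in>T. x < s'" using has_inf[of T 0 c] c by blast
    then have "\<delta> u s" unfolding \<delta>_def T_def by (auto simp: not_less)
    then show ?thesis by blast
  qed
  have uni: "s = s'" if "\<delta> u s" "\<delta> u s'" for u s s'
    using that unfolding \<delta>_def by (metis linorder_neqE)
  have pos: "0 < s" if du: "\<delta> u s" and uU: "u \<in> U" for u s
  proof -
    obtain t where t: "0 < t" "I t u" using uU unfolding U_def by blast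
    have "\<not> s < t"
    proof
      assume "s < t"
      then obtain t' where "0 < t'" "t' < t" "\<not> I t' u" using du unfolding \<delta>_def by blast
      then show False using anti t by blast
    qed
    then show ?thesis using t by auto
  qed
  have below: "I t u" if "\<delta> u s" "0 < t" "t < s" for t u s using that unfolding \<delta>_def by blast
  have Udfn: "dfn D (\<lambda>e. e 2 \<in> U)" unfolding U_def N_def mem_Collect_eq Diff_iff
    by (intro dfn_conj dfn_not; (rule dfn_ex[where v = 4] | rule dfn_all[where v = 4]))
      (auto intro!: dfn_conj dfn_imp dfn_less_const dI)
  define V where "V = {s. \<exists>u. u \<in> U \<and> \<delta> u s}"
  have Vdfn: "{[x] | x. x \<in> V} \<in> D 1" unfolding V_def mem_Collect_eq
    by (rule dset_dfn[of _ 3], rule dfn_ex[where v = 2]) (auto intro!: dfn_conj dd Udfn)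
  show False
  proof (cases "finite V")
    case False
    then obtain a b where ab: "a < b" "\<And>x. a < x \<Longrightarrow> x < b \<Longrightarrow> x \<in> V" using infinite_contains_interval[OF Vdfn] by blast
    obtain m where m: "a < m" "m < b" using dense ab by blast
    then have "m \<in> V" using ab by blast
    then have "0 < m" unfolding V_def using pos by blast
    \<comment> \<open>A threshold is determined by its point, so an interval of thresholds is
      covered by the image of the single set \<open>I m\<close>.\<close>
    have "{x. m < x \<and> x < b} \<subseteq> (\<lambda>u. THE s. \<delta> u s) ` {u. I m u}"
    proof clarify
      fix x assume x: "m < x" "x < b"
      then have "x \<in> V" using ab(2) m(1) by (meson less_trans)
      then obtain u where u: "u \<in> U" "\<delta> u x" unfolding V_def by blast
      then have "(THE s. \<delta> u s) = x" using uni by blast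
      then show "x \<in> (\<lambda>u. THE s. \<delta> u s) ` {u. I m u}" using below[OF u(2) \<open>0 < m\<close> x(1)] by force
    qed
    then show False using infinite_interval[OF m(2)] fin[OF \<open>0 < m\<close>] by (meson finite_imageI finite_subset)
  next
    case True
    have "U \<subseteq> (\<Union>s\<in>V. {u \<in> U. \<delta> u s})" using ex unfolding V_def by blast
    then have "\<exists>s\<in>V. infinite {u \<in> U. \<delta> u s}" using U True by (meson finite_UN finite_subset)
    then obtain s where s: "s \<in> V" "infinite {u \<in> U. \<delta> u s}" by blast
    then have "0 < s" unfolding V_def using pos by blast
    then obtain m where m: "0 < m" "m < s" using dense by blast
    then have "{u \<in> U. \<delta> u s} \<subseteq> {u. I m u}" using below by blast
    then show False using s fin[OF m(1)] finite_subset by blast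
  qed
qed

end

context struct begin

lemma dfn_rename2:
  assumes "dfn S (\<lambda>e. I (e i) (e j))" "i \<noteq> j" shows "dfn S (\<lambda>e. I (e k) (e l))"
proof -
  have st: "dfn S (\<lambda>e. I (e k) (e l))" if I: "dfn S (\<lambda>e. I (e i) (e j))" and ij: "i \<noteq> j" "{i,j} \<inter> {k,l} = {}" for i j k l
  proof -
    have "dfn S (\<lambda>e. \<exists>a. a = e k \<and> (\<exists>b. b = e l \<and> I a b))"
      by (rule dfn_ex[where v = i], rule dfn_conj[OF dfn_eq], rule dfn_ex[where v = j], rule dfn_conj[OF dfn_eq])
        (use I ij in auto)
    then show ?thesis by simp
  qed
  \<comment> \<open>A direct renaming needs the new variables disjoint from the old ones; passing
    through a fresh pair removes that restriction.\<close>
  define p where "p = Suc (i + j + k + l)"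
  have "dfn S (\<lambda>e. I (e p) (e (Suc p)))" by (rule st[OF assms]) (auto simp: p_def)
  then show ?thesis by (rule st) (auto simp: p_def)
qed

end

context omin begin

text \<open>The heart of exchange. Were infinitely many \<open>u\<close> to have infinite fibres,
  infinitely many fibres would contain an interval of one common length \<open>t\<close>. Take in
  each such fibre an interval of length \<open>t\<close> that cannot be extended to the left. The
  left ends are infinite in number, since a point just above a left end has finitely many
  \<open>u\<close>, so they fill an interval. Left ends closer together than \<open>t\<close> give
  overlapping intervals: all contain one point \<open>x\<close>, yet they belong to different
  \<open>u\<close> by left maximality, against the finiteness of the fibre at
  \<open>x\<close>.\<close>

lemma fibres_exchange_pos:
  assumes Z: "dfn D (\<lambda>e. Z (e 0) (e 1))" and fin: "\<And>b. finite {u. Z b u}" and pos: "\<And>b u. Z b u \<Longrightarrow> 0 < b"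
  shows "finite {u. infinite {b. Z b u}}"
proof (rule ccontr)
  assume inf: "infinite {u. infinite {b. Z b u}}"
  have dZ: "dfn D (\<lambda>e. Z (e i) (e j))" for i j by (rule dfn_rename2[of Z 0 1, OF Z]) simp
  have zset: "{[x] | x. x \<in> {b. Z b u}} \<in> D 1" for u
    using dset_dfn_upd[OF dZ[of 0 1], of "\<lambda>_. u" 0] by simp
  define J where "J t u \<longleftrightarrow> (\<exists>c w. c + t = w \<and> (\<forall>x. c < x \<and> x < w \<longrightarrow> Z x u))" for t u
  have J: "J t u \<longleftrightarrow> (\<exists>c. \<forall>x. c < x \<and> x < c + t \<longrightarrow> Z x u)" for t u unfolding J_def by simp
  have dJ: "dfn D (\<lambda>e. J (e 0) (e 1))" unfolding J_def
    by (rule dfn_ex[where v = 2], rule dfn_ex[where v = 3], intro dfn_conj dfn_plus, rule dfn_all[where v = 4])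
      (auto intro!: dfn_imp dfn_conj dfn_less dZ)
  have "{u. \<exists>t>0. J t u} = {u. infinite {b. Z b u}}"
  proof (intro Collect_cong iffI)
    fix u assume "\<exists>t>0. J t u"
    then obtain t c where t: "0 < t" "\<forall>x. c < x \<and> x < c + t \<longrightarrow> Z x u" unfolding J by blast
    then have "c < c + t" by simp
    then show "infinite {b. Z b u}" using t(2) infinite_iff_interval[OF zset, of u] by blast
  next
    fix u assume "infinite {b. Z b u}"
    then obtain a b where ab: "a < b" "\<forall>x. a < x \<and> x < b \<longrightarrow> Z x u" using infinite_contains_interval[OF zset, of u] by blast
    then have "J (b - a) u" unfolding J by (intro exI[of _ a]) simp
    then show "\<exists>t>0. J t u" using ab(1) by (intro exI[of _ "b - a"]) simp
  qed
  then have inf': "infinite {u. \<exists>t>0. J t u}" using inf by simp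
  have anti: "J s u" if st: "s < t" and Jt: "J t u" for s t u
  proof -
    obtain c where "\<forall>x. c < x \<and> x < c + t \<longrightarrow> Z x u" using Jt unfolding J by blast
    moreover have "c + s < c + t" using st by simp
    ultimately show ?thesis unfolding J by (meson less_trans)
  qed
  obtain t where t: "0 < t" "infinite {u. J t u}"
    using increasing_family_infinite[OF dJ _ inf'] anti by blast
  \<comment> \<open>\<open>c\<close> is the left end of an interval of length \<open>t\<close> in
    the fibre over \<open>u\<close> that cannot be prolonged to the left. The variables
    \<open>w\<close> and \<open>t'\<close> only name \<open>c + t\<close> and the constant
    \<open>t\<close> for the calculus of definable formulas.\<close>
  define E where "E c u \<longleftrightarrow> (\<exists>w. \<exists>t'. t' = t \<and> c + t' = w \<and> (\<forall>x. c < x \<and> x < w \<longrightarrow> Z x u) \<and> (\<forall>s. s < c \<longrightarrow> (\<exists>x. s < x \<and> x < w \<and> \<not> Z x u)))" for c u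
  have E: "E c u \<longleftrightarrow> (\<forall>x. c < x \<and> x < c + t \<longrightarrow> Z x u) \<and> (\<forall>s. s < c \<longrightarrow> (\<exists>x. s < x \<and> x < c + t \<and> \<not> Z x u))" for c u
    unfolding E_def by simp
  have dE: "dfn D (\<lambda>e. E (e 0) (e 1))" unfolding E_def
    by (rule dfn_ex[where v = 2], rule dfn_ex[where v = 3], intro dfn_conj dfn_plus dfn_eq_const, rule dfn_all[where v = 4])
      ((auto intro!: dfn_imp dfn_conj dfn_less dZ dfn_all[where v = 4] dfn_ex[where v = 5] dfn_not)+)
  have lend: "\<exists>c. E c u" if Jt: "J t u" for u
  proof -
    obtain c0 where c0: "\<forall>x. c0 < x \<and> x < c0 + t \<longrightarrow> Z x u" using Jt unfolding J by blast
    define w where "w = c0 + t"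
    define T where "T = {s. s < w \<and> (\<forall>x. s < x \<and> x < w \<longrightarrow> Z x u)}"
    have "dfn D (\<lambda>e. e 0 < e 1 \<and> (\<forall>x. e 0 < x \<and> x < e 1 \<longrightarrow> Z x (e 2)))"
      by (intro dfn_conj dfn_less, rule dfn_all[where v = 4]) (auto intro!: dfn_imp dfn_conj dfn_less dZ)
    from dset_dfn_upd[OF this, of "(\<lambda>_. u)(1 := w)" 0] have Tset: "{[x] | x. x \<in> T} \<in> D 1"
      unfolding T_def by simp
    have wc: "c0 < w" unfolding w_def using t(1) by simp
    then have c0T: "c0 \<in> T" unfolding T_def using c0 by (simp add: w_def)
    \<comment> \<open>Positivity of the fibre bounds the possible left ends below, so that their
      infimum exists.\<close>
    have "0 \<le> s" if sT: "s \<in> T" for s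
    proof (rule ccontr)
      assume "\<not> 0 \<le> s"
      then have "s < 0" by (simp only: not_le)
      moreover have "s < w" using sT unfolding T_def by blast
      ultimately obtain x where "s < x" "x < min 0 w" using dense[of s "min 0 w"] by auto
      then have "Z x u" "x < 0" using sT unfolding T_def by auto
      then show False using pos by fastforce
    qed
    then obtain c1 where c1: "\<forall>x\<in>T. c1 \<le> x" "\<forall>s'>c1. \<exists>x\<in>T. x < s'"
      using has_inf[OF Tset _ _ t(1), of 0] c0T by blast
    have c1w: "Z x u" if x: "c1 < x" "x < w" for x
    proof -
      obtain s where "s \<in> T" "s < x" using c1(2) x(1) by blast
      then show ?thesis using x(2) unfolding T_def by blast
    qed
    have "c1 \<le> c0" using c1(1) c0T by blast
    then have le: "c1 + t \<le> w" unfolding w_def by simp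
    have "E c1 u" unfolding E
    proof (intro conjI allI impI)
      fix x assume "c1 < x \<and> x < c1 + t"
      then show "Z x u" using c1w le by force
    next
      fix s assume s: "s < c1"
      show "\<exists>x>s. x < c1 + t \<and> \<not> Z x u"
      proof (rule ccontr)
        assume n: "\<not> ?thesis"
        have "Z x u" if x: "s < x" "x < w" for x
        proof (cases "x < c1 + t")
          case True then show ?thesis using n x by blast
        next
          case False
          moreover have "c1 < c1 + t" using t(1) by simp
          ultimately have "c1 < x" by (meson not_less order_less_le_trans)
          then show ?thesis using c1w x by blast
        qed
        then have "s \<in> T" unfolding T_def using s \<open>c1 \<le> c0\<close> wc by auto
        then show False using c1(1) s by auto
      qed
    qed
    then show ?thesis by blast
  qed
  define C where "C = {c. \<exists>u. E c u}"
  have Cset: "{[x] | x. x \<in> C} \<in> D 1" unfolding C_def mem_Collect_eq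
    by (rule dset_dfn[of _ 0], rule dfn_ex[where v = 1]) (use dE in auto)
  have finE: "finite {u. E c u}" for c
  proof -
    obtain x where "c < x" "x < c + t" using dense[of c "c + t"] t(1) by auto
    then have "{u. E c u} \<subseteq> {u. Z x u}" unfolding E by blast
    then show ?thesis using fin finite_subset by blast
  qed
  have "infinite C"
  proof
    assume "finite C"
    then have "finite (\<Union>c\<in>C. {u. E c u})" using finE by blast
    moreover have "{u. J t u} \<subseteq> (\<Union>c\<in>C. {u. E c u})" using lend unfolding C_def by blast
    ultimately show False using t(2) finite_subset by blast
  qed
  then obtain \<alpha> \<beta> where ab: "\<alpha> < \<beta>" "\<forall>x. \<alpha> < x \<and> x < \<beta> \<longrightarrow> x \<in> C" using infinite_contains_interval[OF Cset] by blast
  \<comment> \<open>\<open>x\<close> is so close to \<open>\<alpha>\<close> that every interval of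
    length \<open>t\<close> starting between \<open>\<alpha>\<close> and \<open>x\<close> contains
    \<open>x\<close>.\<close>
  obtain x where x: "\<alpha> < x" "x < min \<beta> (\<alpha> + t)" using dense[of \<alpha> "min \<beta> (\<alpha> + t)"] ab(1) t(1) by auto
  let ?I = "{c. \<alpha> < c \<and> c < x}"
  have "\<forall>c\<in>?I. \<exists>u. E c u" using ab(2) x(2) unfolding C_def by auto
  then obtain h where h: "\<And>c. c \<in> ?I \<Longrightarrow> E c (h c)" by metis
  have near: "x < c + t" if "c \<in> ?I" for c
  proof -
    have "\<alpha> + t < c + t" using that by simp
    then show ?thesis using x(2) by (meson less_trans min_less_iff_conj)
  qed
  have "h ` ?I \<subseteq> {u. Z x u}" using h near unfolding E by auto
  then have "finite (h ` ?I)" using fin finite_subset by blast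
  moreover have "inj_on h ?I"
  proof (rule linorder_inj_onI)
    fix c c' assume cc: "c < c'" "c \<in> ?I" "c' \<in> ?I"
    show "h c \<noteq> h c'"
    proof
      assume eq: "h c = h c'"
      obtain y where y: "c < y" "y < c' + t" "\<not> Z y (h c)" using h[OF cc(3)] cc(1) eq unfolding E by auto
      have "Z y (h c)"
      proof (cases "y < c + t")
        case True then show ?thesis using h[OF cc(2)] y unfolding E by blast
      next
        case False
        then have "c' < y" using near[OF cc(2)] cc(3) by auto
        then show ?thesis using h[OF cc(3)] y eq unfolding E by auto
      qed
      then show False using y by blast
    qed
  qed auto
  ultimately have "finite ?I" using finite_imageD by blast
  then show False using infinite_interval[OF x(1)] by blast
qed

text \<open>Reflection at 0 reduces negative \<open>b\<close> to positive ones, and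
  \<open>b = 0\<close> adds at most one point to a fibre.\<close>

lemma fibres_exchange:
  assumes Z: "dfn D (\<lambda>e. Z (e 0) (e 1))" and fin: "\<And>b. finite {u. Z b u}"
  shows "finite {u. infinite {b. Z b u}}"
proof -
  have dZ: "dfn D (\<lambda>e. Z (e i) (e j))" for i j by (rule dfn_rename2[of Z 0 1, OF Z]) simp
  have f1: "finite {u. infinite {b. Z b u \<and> 0 < b}}"
  proof (rule fibres_exchange_pos)
    show "dfn D (\<lambda>e. Z (e 0) (e 1) \<and> 0 < e 0)" by (intro dfn_conj dZ dfn_less_const)
    show "finite {u. Z b u \<and> 0 < b}" for b using fin[of b] by (rule finite_subset[rotated]) auto
  qed simp
  have f2: "finite {u. infinite {b. Z (- b) u \<and> 0 < b}}"
  proof (rule fibres_exchange_pos)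
    have "dfn D (\<lambda>e. (\<exists>c. (\<exists>z. z = 0 \<and> e 0 + c = z) \<and> Z c (e 1)) \<and> 0 < e 0)"
      by (intro dfn_conj dfn_less_const, rule dfn_ex[where v = 2], rule dfn_conj[OF _ dZ], rule dfn_ex[where v = 3])
        (auto intro!: dfn_conj dfn_eq_const dfn_plus)
    moreover have "(\<exists>c. (\<exists>z. z = 0 \<and> b + c = z) \<and> Z c u) \<longleftrightarrow> Z (- b) u" for b u
      by (metis add.right_inverse add_eq_0_iff)
    ultimately show "dfn D (\<lambda>e. Z (- e 0) (e 1) \<and> 0 < e 0)" by simp
    show "finite {u. Z (- b) u \<and> 0 < b}" for b using fin[of "- b"] by (rule finite_subset[rotated]) auto
  qed simp
  have "{u. infinite {b. Z b u}} \<subseteq> {u. infinite {b. Z b u \<and> 0 < b}} \<union> {u. infinite {b. Z (- b) u \<and> 0 < b}}"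
  proof (rule ccontr)
    assume "\<not> ?thesis"
    then obtain u where u: "infinite {b. Z b u}" "finite {b. Z b u \<and> 0 < b}" "finite {b. Z (- b) u \<and> 0 < b}" by blast
    have "{b. Z b u} \<subseteq> {b. Z b u \<and> 0 < b} \<union> {0} \<union> uminus ` {b. Z (- b) u \<and> 0 < b}"
    proof
      fix b assume b: "b \<in> {b. Z b u}"
      consider "0 < b" | "b = 0" | "b < 0" by (meson linorder_neqE)
      then show "b \<in> {b. Z b u \<and> 0 < b} \<union> {0} \<union> uminus ` {b. Z (- b) u \<and> 0 < b}"
      proof cases
        case 3
        then have "- b \<in> {b. Z (- b) u \<and> 0 < b}" using b by simp
        then show ?thesis by (intro UnI2 image_eqI[of b uminus "- b"]) simp_all
      qed (use b in auto)
    qed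
    then have "finite {b. Z b u}" by (rule finite_subset) (use u in simp)
    then show False using u(1) by blast
  qed
  then show ?thesis using f1 f2 by (meson finite_UnI finite_subset)
qed

end

section \<open>Dependence given by finite fibres in a reduct\<close>

locale omin_reduct = omin D + L: struct L
  for D :: "nat \<Rightarrow> ('a::linordered_ab_group_add) list set set" and L +
  assumes L_sub: "L n \<subseteq> D n" and L_less: "{[x, y] | x y. x < y} \<in> L 2"
    and L_plus: "{[x, y, z] | x y z. x + y = z} \<in> L 3"
begin

lemma L_dfn_less: "dfn L (\<lambda>e. e i < e j)"
proof -
  have "(\<lambda>e. e i < e j) = (\<lambda>e. map e [i, j] \<in> {[x, y] | x y. x < y})" by auto
  then show ?thesis using L.dfn_atom[of "{[x, y] | x y. x < y}" "[i,j]"] L_less by (simp add: numeral_2_eq_2)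
qed

lemma L_dfn_D: "dfn L \<phi> \<Longrightarrow> dfn D \<phi>" unfolding dfn_def using L_sub by blast

text \<open>A definable set is finite exactly when it contains no interval, and this is expressed
  with the order alone. So finiteness of a fibre is definable in \<open>L\<close>, without the
  parameters of \<open>D\<close>.\<close>

lemma L_dfn_finite:
  assumes "dfn L (\<lambda>e. \<phi> e (e v))" and fr: "\<And>e b c. \<phi> (e(v := c)) b = \<phi> e b"
  shows "dfn L (\<lambda>e. finite {y. \<phi> e y})"
proof -
  let ?\<psi> = "\<lambda>e. \<phi> e (e v)"
  obtain m where m: "\<And>e e'. (\<forall>i<m. e i = e' i) \<Longrightarrow> ?\<psi> e = ?\<psi> e'" using assms(1) unfolding dfn_def by blast
  \<comment> \<open>\<open>p\<close> and \<open>Suc p\<close> serve as variables for the two ends of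
    an interval; they exceed \<open>v\<close> and every variable read by the formula.\<close>
  define p where "p = Suc (m + v)"
  have fr': "\<phi> (e(w := c)) b = \<phi> e b" if "w \<ge> p" for e w c b
  proof -
    have "?\<psi> ((e(v := b))(w := c)) = ?\<psi> (e(v := b))" by (rule m) (use that in \<open>auto simp: p_def\<close>)
    moreover have "((e(v := b))(w := c)) = (e(w := c))(v := b)" using that by (auto simp: p_def)
    ultimately show ?thesis using that fr by (simp add: p_def)
  qed
  have "finite {y. \<phi> e y} \<longleftrightarrow> \<not> (\<exists>a b. a < b \<and> (\<forall>x. a < x \<and> x < b \<longrightarrow> \<phi> e x))" for e
  proof -
    have "{[x] | x. x \<in> {y. \<phi> e y}} \<in> D 1"
      using dset_dfn_upd[OF L_dfn_D[OF assms(1)], of e v] fr by simp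
    from infinite_iff_interval[OF this] show ?thesis by blast
  qed
  moreover have "dfn L (\<lambda>e. \<not> (\<exists>a b. a < b \<and> (\<forall>x. a < x \<and> x < b \<longrightarrow> \<phi> e x)))"
    by (rule L.dfn_not, rule L.dfn_ex[where v = p], rule L.dfn_ex[where v = "Suc p"], rule L.dfn_conj[OF L_dfn_less],
      rule L.dfn_all[where v = v]) (use assms(1) fr fr' in \<open>auto intro!: L.dfn_imp L.dfn_conj L_dfn_less simp: p_def\<close>)
  ultimately show ?thesis by simp
qed

definition FL :: "nat \<Rightarrow> 'a list set set" where
  "FL n = {X \<in> L (Suc n). \<forall>as. finite {y. as @ [y] \<in> X}}"

lemma FL_I: "X \<in> L (Suc n) \<Longrightarrow> (\<And>as. {y. as @ [y] \<in> X} \<subseteq> B as) \<Longrightarrow> (\<And>as. finite (B as)) \<Longrightarrow> X \<in> FL n"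
  unfolding FL_def by (intro CollectI conjI allI) (assumption, rule finite_subset)

lemma L_dfn_snoc: assumes "X \<in> L (Suc n)" shows "dfn L (\<lambda>e. map e [0..<n] @ [e n] \<in> X)"
  using L.dfn_atom[of X "[0..<n] @ [n]"] assms by simp

lemma finite_fibre_mem: assumes "X \<in> L (Suc n)" shows "{as \<in> tuples n. finite {y. as @ [y] \<in> X}} \<in> L n"
proof -
  have "dfn L (\<lambda>e. finite {y. map e [0..<n] @ [y] \<in> X})"
    by (rule L_dfn_finite[where v = n]) (use L_dfn_snoc[OF assms] in auto)
  then have "{xs \<in> tuples n. finite {y. map ((!) xs) [0..<n] @ [y] \<in> X}} \<in> L n"
  proof (rule L.dfn_mem)
    fix e e' :: "nat \<Rightarrow> 'a" assume "\<forall>i<n. e i = e' i"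
    then have "map e [0..<n] = map e' [0..<n]" by simp
    then show "finite {y. map e [0..<n] @ [y] \<in> X} = finite {y. map e' [0..<n] @ [y] \<in> X}" by (simp only:)
  qed
  moreover have "map ((!) xs) [0..<n] = xs" if "length xs = n" for xs :: "'a list" using that map_nth by blast
  ultimately show ?thesis by (simp cong: conj_cong)
qed

text \<open>Exchange is the axiom that rests on o-minimality. \<open>Y\<close> collects the
  \<open>u\<close> with infinitely many \<open>b\<close>, finite over each base tuple by
  \<open>fibres_exchange\<close>; for every other \<open>u\<close> the finitely many
  \<open>b\<close> form a fibre of \<open>Z\<close>.\<close>

sublocale FL: finfam FL
proof
  show "X \<in> FL n \<Longrightarrow> xs \<in> X \<Longrightarrow> length xs = Suc n" for X n xs unfolding FL_def using L.length_mem by blast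
  show "{xs \<in> tuples 2. xs ! 0 = xs ! 1} \<in> FL 1"
  proof -
    have "{xs \<in> tuples 2. xs ! 0 = xs ! 1} \<in> L 2" by (rule L.eq_mem) auto
    moreover have "{y. as @ [y] \<in> {xs \<in> tuples 2. xs ! 0 = xs ! 1}} \<subseteq> {as ! 0}" for as :: "'a list" by (auto simp: nth_append split: if_splits)
    ultimately show ?thesis by (intro FL_I[where B = "\<lambda>as. {as ! 0}"]) (simp_all add: numeral_2_eq_2)
  qed
  show "X \<in> FL n \<Longrightarrow> Y \<in> FL n \<Longrightarrow> X \<union> Y \<in> FL n" for X Y n unfolding FL_def using L.Un_mem by (auto simp: Collect_disj_eq)
next
  fix X n m and js :: "nat list" assume X: "X \<in> FL n" and js: "length js = n" "\<forall>j\<in>set js. j < m"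
  have "dfn L (\<lambda>e. map e (js @ [m]) \<in> X)" by (rule L.dfn_atom) (use X js in \<open>simp add: FL_def\<close>)
  moreover have "map e (js @ [m]) = map ((!) (map e [0..<m])) js @ [e m]" for e :: "nat \<Rightarrow> 'a" using js by simp
  ultimately have "dfn L (\<lambda>e. map ((!) (map e [0..<m])) js @ [e m] \<in> X)" by (simp only:)
  from L.dfn_snoc_mem[OF this]
  show "{as @ [u] |as u. length as = m \<and> map ((!) as) js @ [u] \<in> X} \<in> FL m"
  proof -
    assume a: "{as @ [u] |as u. length as = m \<and> map ((!) as) js @ [u] \<in> X} \<in> L (Suc m)"
    have "{y. as @ [y] \<in> {as @ [u] |as u. length as = m \<and> map ((!) as) js @ [u] \<in> X}} \<subseteq> {y. map ((!) as) js @ [y] \<in> X}" for as by auto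
    then show ?thesis by (rule FL_I[OF a]) (use X in \<open>simp add: FL_def\<close>)
  qed
next
  fix X n Y assume X: "X \<in> FL (Suc n)" and Y: "Y \<in> FL n"
  let ?A = "{as @ [u] |as u. \<exists>b. as @ [b] \<in> Y \<and> as @ [b, u] \<in> X}"
  have "dfn L (\<lambda>e. \<exists>b. map e [0..<n] @ [b] \<in> Y \<and> map e [0..<n] @ [b, e n] \<in> X)"
  proof (rule L.dfn_ex[where v = "Suc n"], rule L.dfn_conj)
    show "dfn L (\<lambda>e. map e [0..<n] @ [e (Suc n)] \<in> Y)" using L.dfn_atom[of Y "[0..<n] @ [Suc n]"] Y by (simp add: FL_def)
    show "dfn L (\<lambda>e. map e [0..<n] @ [e (Suc n), e n] \<in> X)" using L.dfn_atom[of X "[0..<n] @ [Suc n, n]"] X by (simp add: FL_def)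
  qed simp
  from L.dfn_snoc_mem[OF this] have "{as @ [u] |as u. length as = n \<and> (\<exists>b. as @ [b] \<in> Y \<and> as @ [b, u] \<in> X)} \<in> L (Suc n)" .
  moreover have "{as @ [u] |as u. length as = n \<and> (\<exists>b. as @ [b] \<in> Y \<and> as @ [b, u] \<in> X)} = ?A"
    using L.length_mem Y unfolding FL_def by fastforce
  moreover have "finite {u. as @ [u] \<in> ?A}" for as
  proof -
    have "{u. as @ [u] \<in> ?A} \<subseteq> (\<Union>b\<in>{b. as @ [b] \<in> Y}. {u. (as @ [b]) @ [u] \<in> X})" by auto
    moreover have "finite (\<Union>b\<in>{b. as @ [b] \<in> Y}. {u. (as @ [b]) @ [u] \<in> X})" using X Y unfolding FL_def by blast
    ultimately show ?thesis by (rule finite_subset)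
  qed
  ultimately show "?A \<in> FL n" unfolding FL_def by simp
next
  fix X n assume X: "X \<in> FL (Suc n)"
  then have XL: "X \<in> L (Suc (Suc n))" unfolding FL_def by simp
  define Y where "Y = {as @ [u] |as u. length as = n \<and> \<not> finite {b. as @ [b, u] \<in> X}}"
  define Z where "Z = {as @ [u] |as u. length as = Suc n \<and> as @ [u] \<in> {bs @ [u, b] | bs u b. length bs = n \<and> bs @ [b, u] \<in> X \<and> finite {b. bs @ [b, u] \<in> X}}}"
  have df: "dfn L (\<lambda>e. finite {b. map e [0..<n] @ [b, e n] \<in> X})"
  proof (rule L_dfn_finite[where v = "Suc n"])
    show "dfn L (\<lambda>e. map e [0..<n] @ [e (Suc n), e n] \<in> X)" using L.dfn_atom[of X "[0..<n] @ [Suc n, n]"] XL by simp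
  qed simp
  have YL: "Y \<in> L (Suc n)" unfolding Y_def by (rule L.dfn_snoc_mem) (rule L.dfn_not[OF df])
  have Yf: "finite {y. as @ [y] \<in> Y}" for as
  proof (cases "length as = n")
    case True
    have "dfn D (\<lambda>e. as @ [e 0, e 1] \<in> X)" by (rule dfn_fiber2) (use XL L_sub True in auto)
    moreover have "finite {u. as @ [b, u] \<in> X}" for b
      using X spec[of "\<lambda>as. finite {y. as @ [y] \<in> X}" "as @ [b]"] unfolding FL_def by simp
    ultimately have "finite {u. infinite {b. as @ [b, u] \<in> X}}" by (rule fibres_exchange)
    then show ?thesis unfolding Y_def by (rule finite_subset[rotated]) auto
  qed (simp add: Y_def)
  have "dfn L (\<lambda>e. map e [0..<n] @ [e (Suc n), e n] \<in> X \<and> finite {b. map e [0..<n] @ [b, e n] \<in> X})"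
    by (rule L.dfn_conj[OF _ df]) (use L.dfn_atom[of X "[0..<n] @ [Suc n, n]"] XL in simp)
  then have 1: "dfn L (\<lambda>e. map e [0..<Suc n] @ [e (Suc n)] \<in> {bs @ [u, b] | bs u b. length bs = n \<and> bs @ [b, u] \<in> X \<and> finite {b. bs @ [b, u] \<in> X}})"
    by simp
  have ZL: "Z \<in> L (Suc (Suc n))" unfolding Z_def by (rule L.dfn_snoc_mem[OF 1])
  have Zf: "finite {y. as @ [y] \<in> Z}" for as
  proof (cases "\<exists>bs u. as = bs @ [u] \<and> finite {b. bs @ [b, u] \<in> X}")
    case True
    then obtain bs u where b: "as = bs @ [u]" "finite {b. bs @ [b, u] \<in> X}" by blast
    have "{y. as @ [y] \<in> Z} \<subseteq> {b. bs @ [b, u] \<in> X}" unfolding Z_def b(1) by auto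
    then show ?thesis using b(2) finite_subset by blast
  next
    case False
    then have "{y. as @ [y] \<in> Z} = {}" unfolding Z_def by fastforce
    then show ?thesis by simp
  qed
  have "\<forall>as b u. as @ [b, u] \<in> X \<longrightarrow> as @ [u] \<in> Y \<or> as @ [u, b] \<in> Z"
  proof (intro allI impI)
    fix as b u assume a: "as @ [b, u] \<in> X"
    then have l: "length as = n" using L.length_mem[OF XL a] by simp
    show "as @ [u] \<in> Y \<or> as @ [u, b] \<in> Z"
    proof (cases "finite {b. as @ [b, u] \<in> X}")
      case True
      then have "(as @ [u]) @ [b] \<in> Z" unfolding Z_def using a l by simp
      then show ?thesis by simp
    next
      case False
      then show ?thesis unfolding Y_def using l by auto
    qed
  qed
  moreover have "Y \<in> FL n" "Z \<in> FL (Suc n)" unfolding FL_def using YL Yf ZL Zf by auto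
  ultimately show "\<exists>Y\<in>FL n. \<exists>Z\<in>FL (Suc n). \<forall>as b u. as @ [b, u] \<in> X \<longrightarrow> as @ [u] \<in> Y \<or> as @ [u, b] \<in> Z" by blast
qed

text \<open>The order makes the least element of a finite fibre definable; remove it and repeat.\<close>
lemma finite_fibre_dcl:
  assumes "X \<in> L (Suc n)" "length as = n" "finite {y. as @ [y] \<in> X}" "as @ [p] \<in> X" "set as \<subseteq> A"
  shows "p \<in> dcl L A"
  using assms(1,3,4)
proof (induction "card {y. as @ [y] \<in> X}" arbitrary: X rule: less_induct)
  case less
  define Y where "Y = {bs @ [y] | bs y. length bs = n \<and> (bs @ [y] \<in> X \<and> \<not> (\<exists>z. z < y \<and> bs @ [z] \<in> X))}"
  have Y: "Y \<in> L (Suc n)" unfolding Y_def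
  proof (rule L.dfn_snoc_mem, rule L.dfn_conj[OF L_dfn_snoc[OF less.prems(1)]], rule L.dfn_not, rule L.dfn_ex[where v = "Suc n"], rule L.dfn_conj[OF L_dfn_less])
    show "dfn L (\<lambda>e. map e [0..<n] @ [e (Suc n)] \<in> X)" using L.dfn_atom[of X "[0..<n] @ [Suc n]"] less.prems(1) by simp
  qed simp
  let ?m = "Min {y. as @ [y] \<in> X}"
  have mX: "as @ [?m] \<in> X" using Min_in[OF less.prems(2)] less.prems(3) by blast
  have le: "?m \<le> y" if "as @ [y] \<in> X" for y using that Min_le[OF less.prems(2)] by simp
  have Yas: "as @ [y] \<in> Y \<longleftrightarrow> y = ?m" for y
    unfolding Y_def using assms(2) mX le by (auto simp: not_less) (metis leD order_le_imp_less_or_eq)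
  show ?case
  proof (cases "p = ?m")
    case True
    then have "{y. as @ [y] \<in> Y} = {p}" using Yas by simp
    then show ?thesis unfolding dcl_def using Y assms(2,5) by blast
  next
    case False
    have eq: "{y. as @ [y] \<in> X - Y} = {y. as @ [y] \<in> X} - {?m}" using Yas by auto
    have "card {y. as @ [y] \<in> X - Y} < card {y. as @ [y] \<in> X}" unfolding eq using less.prems(2) mX by (intro psubset_card_mono) auto
    moreover have "X - Y \<in> L (Suc n)" using L.Diff_mem less.prems(1) Y by blast
    moreover have "finite {y. as @ [y] \<in> X - Y}" unfolding eq using less.prems(2) by simp
    moreover have "as @ [p] \<in> X - Y" using less.prems(3) False Yas by simp
    ultimately show ?thesis using less.hyps by blast
  qed
qed

text \<open>Serves to recover one summand of a sum of points of \<open>P\<close> from the sum and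
  the other summands.\<close>

lemma FL_minus: "x \<in> FL.cl A \<Longrightarrow> y \<in> FL.cl A \<Longrightarrow> x - y \<in> FL.cl A"
proof -
  assume a: "x \<in> FL.cl A" "y \<in> FL.cl A"
  define W :: "'a list set" where "W = {as @ [u] | as u. length as = 2 \<and> [as ! 1, u, as ! 0] \<in> {[x, y, z] | x y z. x + y = z}}"
  have l3: "length [1, 2, 0::nat] = 3" by simp
  have "dfn L (\<lambda>e. map e [1, 2, 0] \<in> {[x, y, z] | x y z. x + y = z})"
    by (rule L.dfn_atom, unfold l3, rule L_plus)
  then have "dfn L (\<lambda>e. [map e [0..<2] ! 1, e 2, map e [0..<2] ! 0] \<in> {[x, y, z] | x y z. x + y = z})"
    by (simp add: numeral_2_eq_2)
  from L.dfn_snoc_mem[OF this] have "W \<in> L (Suc 2)" unfolding W_def .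
  moreover have "{y. as @ [y] \<in> W} \<subseteq> {as ! 0 - as ! 1}" for as unfolding W_def by (auto simp: algebra_simps)
  ultimately have "W \<in> FL (length [x, y])"
    by (intro FL_I[where B = "\<lambda>as. {as ! 0 - as ! 1}"]) (simp_all add: numeral_2_eq_2)
  moreover have "[x, y] @ [x - y] \<in> W" unfolding W_def by (intro CollectI exI[of _ "[x, y]"] exI[of _ "x - y"]) simp
  ultimately have "x - y \<in> FL.cl {x, y}" using FL.cl_set_iff[of "x - y" "[x, y]"] by auto
  then show ?thesis using FL.cl_minimal[of "{x, y}" A] a by auto
qed

end

section \<open>Types in saturated pairs\<close>

text \<open>\<open>L\<close> and \<open>K\<close> are the 0-definable sets of a countably saturated model of the theory of the pair
  \<open>(M, P)\<close>, without and with the predicate. In \<open>split\<close>, infinite fibres meet \<open>P\<close> generically (density)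
  and contain points outside every small closure of \<open>P\<close> (codensity).\<close>
locale sat = L: struct L + K: struct K + F: finfam F
  for L K F :: "nat \<Rightarrow> 'b list set set" and P :: "'b set" +
  assumes L_K: "L n \<subseteq> K n"
    and L_countable: "countable (L n)"
    and P_mem: "{[p] | p. p \<in> P} \<in> K 1"
    and K_gen: "K n \<subseteq> gen_structure (\<lambda>n. L n \<union> (if n = 1 then {{[p] | p. p \<in> P}} else {})) n"
    and saturated: "(\<And>j::nat. XX j \<in> K (m + k)) \<Longrightarrow> length a = m \<Longrightarrow>
        (\<And>J. \<exists>x. length x = k \<and> (\<forall>j<J. a @ x \<in> XX j)) \<Longrightarrow> \<exists>x. length x = k \<and> (\<forall>j. a @ x \<in> XX j)"
    and F_L: "F n \<subseteq> L (Suc n)"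
    and F_empty: "{} \<in> F n"
    and split: "X \<in> L (Suc n) \<Longrightarrow> \<exists>E\<in>L n. {as @ [u] | as u. as @ [u] \<in> X \<and> as \<notin> E} \<in> F n \<and>
        (\<forall>as\<in>E. (\<forall>bs. \<forall>Z\<in>F (n + length bs). \<exists>p\<in>P. as @ [p] \<in> X \<and> as @ bs @ [p] \<notin> Z) \<and>
          (\<forall>bs \<Z>. finite \<Z> \<longrightarrow> (\<forall>(k, Z)\<in>\<Z>. Z \<in> F (n + length bs + k)) \<longrightarrow>
             (\<exists>u. as @ [u] \<in> X \<and> (\<forall>(k, Z)\<in>\<Z>. \<forall>q. set q \<subseteq> P \<longrightarrow> length q = k \<longrightarrow> as @ bs @ q @ [u] \<notin> Z))))"
    and P_indep: "Z \<in> F n \<Longrightarrow> length ps = n \<Longrightarrow> set ps \<subseteq> P \<Longrightarrow> p \<in> P \<Longrightarrow> ps @ [p] \<in> Z \<Longrightarrow> p \<in> set ps"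
begin

section \<open>Saturation and compactness\<close>

abbreviation "cl \<equiv> F.cl"
abbreviation "rk \<equiv> F.rk"

lemma F_countable: "countable (F n)"
  using F_L L_countable countable_subset by blast

lemma F_finite_UN: "finite \<Z> \<Longrightarrow> \<Z> \<subseteq> F n \<Longrightarrow> \<Union>\<Z> \<in> F n"
  by (induction \<Z> rule: finite_induct) (auto simp: F_empty F.F_Un)

lemma saturation:
  assumes cI: "countable I" and X: "\<And>i. i \<in> I \<Longrightarrow> X i \<in> K (m + k)" and a: "length a = m"
    and fin: "\<And>I'. finite I' \<Longrightarrow> I' \<subseteq> I \<Longrightarrow> \<exists>x. length x = k \<and> (\<forall>i\<in>I'. a @ x \<in> X i)"
  shows "\<exists>x. length x = k \<and> (\<forall>i\<in>I. a @ x \<in> X i)"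
proof (cases "I = {}")
  case True then show ?thesis using fin[of "{}"] by auto
next
  case False
  let ?f = "from_nat_into I"
  have f: "?f j \<in> I" for j using False by (rule from_nat_into)
  have "\<exists>x. length x = k \<and> (\<forall>j. a @ x \<in> X (?f j))"
  proof (rule saturated[OF _ a])
    fix J :: nat
    have "finite (?f ` {..<J})" "?f ` {..<J} \<subseteq> I" using f by auto
    from fin[OF this] show "\<exists>x. length x = k \<and> (\<forall>j<J. a @ x \<in> X (?f j))" by auto
  qed (use X f in blast)
  moreover have "I \<subseteq> range ?f" using range_from_nat_into[OF False cI] by simp
  ultimately show ?thesis by blast
qed

text \<open>In applications one family consists of the sets that a new tuple must meet and the other
  of the complements of sets that it must avoid, with index sets of different types.\<close>

lemma saturation2:
  assumes cI: "countable I" and cJ: "countable J"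
    and X: "\<And>i. i \<in> I \<Longrightarrow> X i \<in> K (m + k)" and Y: "\<And>j. j \<in> J \<Longrightarrow> Y j \<in> K (m + k)" and a: "length a = m"
    and fin: "\<And>I' J'. finite I' \<Longrightarrow> I' \<subseteq> I \<Longrightarrow> finite J' \<Longrightarrow> J' \<subseteq> J \<Longrightarrow>
        \<exists>x. length x = k \<and> (\<forall>i\<in>I'. a @ x \<in> X i) \<and> (\<forall>j\<in>J'. a @ x \<in> Y j)"
  shows "\<exists>x. length x = k \<and> (\<forall>i\<in>I. a @ x \<in> X i) \<and> (\<forall>j\<in>J. a @ x \<in> Y j)"
proof -
  define W where "W = case_sum X Y"
  have "\<exists>x. length x = k \<and> (\<forall>i\<in>I <+> J. a @ x \<in> W i)"
  proof (rule saturation[OF _ _ a])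
    show "countable (I <+> J)" using cI cJ by (simp add: countable_Plus)
    show "\<And>i. i \<in> I <+> J \<Longrightarrow> W i \<in> K (m + k)" unfolding W_def using X Y by auto
    fix H assume H: "finite H" "H \<subseteq> I <+> J"
    have "finite (Inl -` H)" "finite (Inr -` H)" using H(1) by (auto intro: finite_vimageI)
    moreover have "Inl -` H \<subseteq> I" "Inr -` H \<subseteq> J" using H(2) by auto
    ultimately obtain x where x: "length x = k" "\<forall>i\<in>Inl -` H. a @ x \<in> X i" "\<forall>j\<in>Inr -` H. a @ x \<in> Y j"
      using fin[of "Inl -` H" "Inr -` H"] by blast
    have "a @ x \<in> W i" if "i \<in> H" for i
      using that x H(2) unfolding W_def by (cases i) auto
    then show "\<exists>x. length x = k \<and> (\<forall>i\<in>H. a @ x \<in> W i)" using x(1) by blast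
  qed
  then obtain x where x: "length x = k" "\<forall>i\<in>I <+> J. a @ x \<in> W i" by blast
  have "a @ x \<in> X i" if "i \<in> I" for i using bspec[OF x(2) InlI[OF that, of J]] unfolding W_def by simp
  moreover have "a @ x \<in> Y j" if "j \<in> J" for j using bspec[OF x(2) InrI[OF that, of I]] unfolding W_def by simp
  ultimately show ?thesis using x(1) by blast
qed

text \<open>If no finite subfamily covered \<open>X\<close>, saturation would supply a point of
  \<open>X\<close> outside every member of \<A>.\<close>

lemma compactness:
  assumes "X \<in> K n" "countable \<A>" "\<A> \<subseteq> K n" "X \<subseteq> \<Union>\<A>"
  shows "\<exists>\<B>. finite \<B> \<and> \<B> \<subseteq> \<A> \<and> X \<subseteq> \<Union>\<B>"
proof (rule ccontr)
  assume neg: "\<not> ?thesis"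
  have "\<exists>x. length x = n \<and> (\<forall>A\<in>\<A>. [] @ x \<in> X - A)"
  proof (rule saturation[OF assms(2), of _ 0])
    show "\<And>A. A \<in> \<A> \<Longrightarrow> X - A \<in> K (0 + n)" using assms K.Diff_mem by auto
    fix \<B> assume "finite \<B>" "\<B> \<subseteq> \<A>"
    then obtain x where "x \<in> X" "x \<notin> \<Union>\<B>" using neg by blast
    then show "\<exists>x. length x = n \<and> (\<forall>A\<in>\<B>. [] @ x \<in> X - A)" using K.length_mem[OF assms(1)] by auto
  qed simp
  moreover have "\<A> \<noteq> {} \<or> X = {}" using assms(4) by blast
  ultimately show False using neg assms(4) by (metis DiffD1 DiffD2 UnionE append_Nil empty_subsetI finite.emptyI in_mono ex_in_conv)
qed

lemma K_dfn_P: "dfn K (\<lambda>e. e i \<in> P)"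
proof -
  have "(\<lambda>e. e i \<in> P) = (\<lambda>e. map e [i] \<in> {[p] | p. p \<in> P})" by auto
  then show ?thesis using K.dfn_atom[of "{[p] | p. p \<in> P}" "[i]"] P_mem by simp
qed

text \<open>The part of the closure over \<open>P\<close> that is witnessed by the single set
  \<open>Z\<close> and \<open>k\<close> points of \<open>P\<close>. Closure over a tuple and
  \<open>P\<close> is the union of countably many of these, each definable in \<open>K\<close>,
  which is the form in which saturation can deal with it.\<close>

definition Pcl :: "nat \<Rightarrow> nat \<Rightarrow> 'b list set \<Rightarrow> 'b list set" where
  "Pcl n k Z = {as @ [u] | as u. length as = n \<and> (\<exists>q. length q = k \<and> set q \<subseteq> P \<and> as @ q @ [u] \<in> Z)}"

lemma Pcl_mem: assumes "Z \<in> F (n + k)" shows "Pcl n k Z \<in> K (Suc n)"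
  unfolding Pcl_def
proof (rule K.dfn_snoc_mem, rule K.dfn_exs[where l = "Suc n"])
  have "Z \<in> K (length ([0..<n] @ [Suc n..<Suc n + k] @ [n]))" 
  proof -
    have "Z \<in> K (Suc (n + k))" using assms F_L[of "n + k"] L_K[of "Suc (n + k)"] by blast
    then show ?thesis by (simp del: upt_Suc)
  qed
  from K.dfn_atom[OF this]
  have "dfn K (\<lambda>e. map e [0..<n] @ map e [Suc n..<Suc n + k] @ [e n] \<in> Z)" by simp
  moreover have 1: "dfn K (\<lambda>e. \<forall>i\<in>{Suc n..<Suc n + k}. e i \<in> P)" by (rule K.dfn_Ball) (auto intro: K_dfn_P)
  have eq: "(\<forall>i\<in>{Suc n..<Suc n + k}. e i \<in> P) \<longleftrightarrow> set (map e [Suc n..<Suc n + k]) \<subseteq> P" for e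
    by (simp only: set_map set_upt image_subset_iff)
  have "dfn K (\<lambda>e. set (map e [Suc n..<Suc n + k]) \<subseteq> P)" using 1 unfolding eq .
  ultimately show "dfn K (\<lambda>e. set (map e [Suc n..<Suc n + k]) \<subseteq> P \<and> map e [0..<n] @ map e [Suc n..<Suc n + k] @ [e n] \<in> Z)"
    by (intro K.dfn_conj)
qed (simp add: upds_simps)

lemma cl_P_iff: "u \<in> cl (set a \<union> P) \<longleftrightarrow> (\<exists>k. \<exists>Z\<in>F (length a + k). a @ [u] \<in> Pcl (length a) k Z)"
proof
  assume "u \<in> cl (set a \<union> P)"
  then obtain as where as: "set as \<subseteq> set a \<union> P" "u \<in> cl (set as)" using F.cl_finite_list by blast
  define q where "q = filter (\<lambda>x. x \<in> P) as"
  have "set as \<subseteq> set (a @ q)" using as(1) unfolding q_def by auto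
  then have "u \<in> cl (set (a @ q))" using as(2) F.cl_mono by blast
  then obtain Z where Z: "Z \<in> F (length a + length q)" "a @ q @ [u] \<in> Z" using F.cl_set_iff[of u "a @ q"] by auto
  moreover have "set q \<subseteq> P" unfolding q_def by auto
  ultimately have "a @ [u] \<in> Pcl (length a) (length q) Z" unfolding Pcl_def by auto
  then show "\<exists>k. \<exists>Z\<in>F (length a + k). a @ [u] \<in> Pcl (length a) k Z" using Z(1) by blast
next
  assume "\<exists>k. \<exists>Z\<in>F (length a + k). a @ [u] \<in> Pcl (length a) k Z"
  then obtain q Z where "Z \<in> F (length (a @ q))" "set q \<subseteq> P" "(a @ q) @ [u] \<in> Z" unfolding Pcl_def by auto
  then have "u \<in> cl (set (a @ q))" using F.cl_set_iff by blast
  moreover have "set (a @ q) \<subseteq> set a \<union> P" using \<open>set q \<subseteq> P\<close> by auto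
  ultimately show "u \<in> cl (set a \<union> P)" using F.cl_mono by blast
qed

lemma P_indep_cl: "p \<in> P \<Longrightarrow> p \<notin> cl (P - {p})"
  using P_indep unfolding F.cl_def by blast

section \<open>Types in the language without the predicate\<close>

definition eqtp :: "'b list \<Rightarrow> 'b list \<Rightarrow> bool" where
  "eqtp x y \<longleftrightarrow> length x = length y \<and> (\<forall>X\<in>L (length x). x \<in> X \<longleftrightarrow> y \<in> X)"

lemma eqtp_refl: "eqtp x x" unfolding eqtp_def by simp
lemma eqtp_sym: "eqtp x y \<Longrightarrow> eqtp y x" unfolding eqtp_def by auto

lemma eqtpD: "eqtp x y \<Longrightarrow> X \<in> L (length x) \<Longrightarrow> x \<in> X \<Longrightarrow> y \<in> X" unfolding eqtp_def by simp

lemma eqtpI: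
  assumes "length x = length y" "\<And>X. X \<in> L (length x) \<Longrightarrow> x \<in> X \<Longrightarrow> y \<in> X" shows "eqtp x y"
  unfolding eqtp_def
proof (intro conjI ballI iffI)
  fix X assume X: "X \<in> L (length x)"
  show "x \<in> X \<Longrightarrow> y \<in> X" using assms X by blast
  show "y \<in> X \<Longrightarrow> x \<in> X"
    using assms(2)[OF L.compl_mem[OF X]] assms(1) by auto
qed (use assms in auto)

lemma eqtp_reindex:
  assumes "eqtp x y" "\<forall>j\<in>set js. j < length x" shows "eqtp (map ((!) x) js) (map ((!) y) js)"
proof (rule eqtpI)
  fix X assume X: "X \<in> L (length (map ((!) x) js))" "map ((!) x) js \<in> X"
  then have "{xs \<in> tuples (length x). map ((!) xs) js \<in> X} \<in> L (length x)" using L.reindex_mem assms by simp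
  then show "map ((!) y) js \<in> X" using assms X unfolding eqtp_def by auto
qed simp

lemma eqtp_nth_eq:
  assumes "eqtp x y" "i < length x" "j < length x" "x ! i = x ! j" shows "y ! i = y ! j"
proof -
  have "{xs \<in> tuples (length x). xs ! i = xs ! j} \<in> L (length x)" by (rule L.eq_mem[OF assms(2,3)])
  then have "y \<in> {xs \<in> tuples (length x). xs ! i = xs ! j}" by (rule eqtpD[OF assms(1)]) (use assms(4) in simp)
  then show ?thesis by simp
qed

lemma eqtp_length: "eqtp x y \<Longrightarrow> length x = length y" unfolding eqtp_def by simp

lemma eqtp_cl:
  assumes "eqtp (x @ [u]) (y @ [v])" "u \<in> cl (set x)" shows "v \<in> cl (set y)"
proof -
  have l: "length y = length x" using eqtp_length[OF assms(1)] by simp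
  obtain X where X: "X \<in> F (length x)" "x @ [u] \<in> X" using assms(2) F.cl_set_iff by blast
  have "X \<in> L (length (x @ [u]))" using X(1) F_L by auto
  then have "y @ [v] \<in> X" using assms(1) X(2) unfolding eqtp_def by blast
  then show ?thesis using X l F.cl_set_iff by metis
qed

lemma eqtp_prefix: assumes "eqtp (x @ q) (y @ q')" "length x = length y" shows "eqtp x y"
proof -
  have "map ((!) (x @ q)) [0..<length x] = x" "map ((!) (y @ q')) [0..<length x] = y"
    using assms(2) by (auto intro!: nth_equalityI simp: nth_append)
  then show ?thesis using eqtp_reindex[OF assms(1), of "[0..<length x]"] by simp
qed

lemma ext_any: assumes "eqtp x y" shows "\<exists>v. eqtp (x @ [u]) (y @ [v])"
proof -
  let ?n = "length x"
  define \<X> where "\<X> = {X \<in> L (Suc ?n). x @ [u] \<in> X}"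
  have "\<exists>z. length z = 1 \<and> (\<forall>X\<in>\<X>. y @ z \<in> X)"
  proof (rule saturation)
    show "countable \<X>" unfolding \<X>_def using L_countable by (rule countable_subset[rotated]) blast
    show "\<And>i. i \<in> \<X> \<Longrightarrow> i \<in> K (?n + 1)" unfolding \<X>_def using L_K by auto
    show "length y = ?n" using assms eqtp_length by simp
    fix \<Y> assume Y: "finite \<Y>" "\<Y> \<subseteq> \<X>"
    let ?W = "tuples (Suc ?n) \<inter> \<Inter>\<Y>"
    have W: "?W \<in> L (Suc ?n)" by (rule L.finite_INT_mem) (use Y in \<open>auto simp: \<X>_def\<close>)
    have "x @ [u] \<in> ?W" using Y unfolding \<X>_def by auto
    then have "x \<in> butlast ` ?W" by (rule image_eqI[rotated]) simp
    then have "y \<in> butlast ` ?W" using assms L.proj_mem[OF W] unfolding eqtp_def by blast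
    then obtain w where w: "w \<in> ?W" "y = butlast w" by blast
    then have "w = y @ [last w]" by (metis IntD1 append_butlast_last_id length_0_conv nat.distinct(1) tuples_iff)
    then show "\<exists>z. length z = 1 \<and> (\<forall>X\<in>\<Y>. y @ z \<in> X)" using w by (intro exI[of _ "[last w]"]) auto
  qed
  then obtain v where v: "\<forall>X\<in>\<X>. y @ [v] \<in> X" by (metis One_nat_def length_0_conv length_Suc_conv)
  have "eqtp (x @ [u]) (y @ [v])" by (rule eqtpI) (use v assms eqtp_length in \<open>auto simp: \<X>_def\<close>)
  then show ?thesis by blast
qed

lemma pad_mid_mem:
  assumes "X \<in> S' (Suc n)" "struct S'"
  shows "{as @ [u] | as u. length as = n + l \<and> take n as @ [u] \<in> X} \<in> S' (Suc (n + l))"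
proof -
  interpret S: struct S' by fact
  have "dfn S' (\<lambda>e. map e ([0..<n] @ [n + l]) \<in> X)" by (rule S.dfn_atom) (use assms(1) in simp)
  then have "dfn S' (\<lambda>e. take n (map e [0..<n + l]) @ [e (n + l)] \<in> X)" by (simp add: take_map)
  from S.dfn_snoc_mem[OF this] show ?thesis by simp
qed

text \<open>Since \<open>u\<close> is not in the closure of \<open>x\<close>, the tuple
  \<open>x\<close> belongs to the set \<open>E\<close> of base points with large fibres;
  \<open>E\<close> lies in \<open>L\<close>, so \<open>y\<close>, having the same type, belongs to
  it too.\<close>

lemma ext_fat:
  assumes "X \<in> L (Suc n)" "x @ [u] \<in> X" "u \<notin> cl (set x)" "eqtp x y"
  shows "(\<forall>bs. \<forall>Z\<in>F (n + length bs). \<exists>p\<in>P. y @ [p] \<in> X \<and> y @ bs @ [p] \<notin> Z) \<and>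
          (\<forall>bs \<Z>. finite \<Z> \<longrightarrow> (\<forall>(k, Z)\<in>\<Z>. Z \<in> F (n + length bs + k)) \<longrightarrow>
             (\<exists>u. y @ [u] \<in> X \<and> (\<forall>(k, Z)\<in>\<Z>. \<forall>q. set q \<subseteq> P \<longrightarrow> length q = k \<longrightarrow> y @ bs @ q @ [u] \<notin> Z)))"
proof -
  have n: "length x = n" using L.length_mem[OF assms(1,2)] by simp
  obtain E where E: "E \<in> L n" "{as @ [u] | as u. as @ [u] \<in> X \<and> as \<notin> E} \<in> F n"
    and fat: "\<forall>as\<in>E. (\<forall>bs. \<forall>Z\<in>F (n + length bs). \<exists>p\<in>P. as @ [p] \<in> X \<and> as @ bs @ [p] \<notin> Z) \<and>
          (\<forall>bs \<Z>. finite \<Z> \<longrightarrow> (\<forall>(k, Z)\<in>\<Z>. Z \<in> F (n + length bs + k)) \<longrightarrow>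
             (\<exists>u. as @ [u] \<in> X \<and> (\<forall>(k, Z)\<in>\<Z>. \<forall>q. set q \<subseteq> P \<longrightarrow> length q = k \<longrightarrow> as @ bs @ q @ [u] \<notin> Z)))"
    by (rule bexE[OF split[OF assms(1)]]) (elim conjE, rule that)
  have "x \<in> E"
  proof (rule ccontr)
    assume "x \<notin> E"
    then have "x @ [u] \<in> {as @ [u] | as u. as @ [u] \<in> X \<and> as \<notin> E}" using assms(2) by blast
    then have "u \<in> cl (set x)" using E(2) unfolding n[symmetric] by (intro F.cl_set_iff[THEN iffD2] bexI)
    then show False using assms(3) by blast
  qed
  then have "y \<in> E" using assms(4) E(1) n unfolding eqtp_def by blast
  then show ?thesis using fat by (rule bspec[rotated])
qed

text \<open>Codensity: the type of \<open>u\<close> over \<open>x\<close>, moved to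
  \<open>y\<close>, is realised outside the closure of \<open>y\<close>, \<open>B\<close> and
  \<open>P\<close>. Finitely many conditions are compatible with finitely many exclusions by the
  second clause of \<open>split\<close>, and saturation does the rest.\<close>

lemma ext_generic:
  assumes e: "eqtp x y" and u: "u \<notin> cl (set x)"
  shows "\<exists>v. v \<notin> cl (set y \<union> set B \<union> P) \<and> eqtp (x @ [u]) (y @ [v])"
proof -
  let ?n = "length x" let ?l = "length B"
  have ly: "length y = ?n" using e eqtp_length by simp
  define \<X> where "\<X> = {X \<in> L (Suc ?n). x @ [u] \<in> X}"
  define \<Z> where "\<Z> = (SIGMA k:UNIV. F (?n + ?l + k))"
  \<comment> \<open>The parameters are now \<open>y\<close> followed by \<open>B\<close>; conditions
    that concern \<open>y\<close> alone are padded by dummy coordinates for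
    \<open>B\<close>.\<close>
  define pad where "pad X = {as @ [u] | as u. length as = ?n + ?l \<and> take ?n as @ [u] \<in> X}" for X :: "'b list set"
  define neg where "neg = (\<lambda>(k, Z). tuples (Suc (?n + ?l)) - Pcl (?n + ?l) k Z)"
  have "\<exists>z. length z = 1 \<and> (\<forall>X\<in>\<X>. (y @ B) @ z \<in> pad X) \<and> (\<forall>j\<in>\<Z>. (y @ B) @ z \<in> neg j)"
  proof (rule saturation2)
    show "countable \<X>" unfolding \<X>_def using L_countable by (rule countable_subset[rotated]) blast
    show "countable \<Z>" unfolding \<Z>_def by (intro countable_SIGMA F_countable) auto
    show "pad X \<in> K ((?n + ?l) + 1)" if "X \<in> \<X>" for X
    proof -
      have "X \<in> K (Suc ?n)" using that L_K unfolding \<X>_def by auto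
      then show ?thesis using pad_mid_mem[of X K ?n ?l] K.struct_axioms unfolding pad_def by simp
    qed
    show "neg j \<in> K ((?n + ?l) + 1)" if "j \<in> \<Z>" for j
      using that Pcl_mem[of _ "?n + ?l"] K.compl_mem unfolding neg_def \<Z>_def by auto
    show "length (y @ B) = ?n + ?l" using ly by simp
    fix \<Y> \<W> assume Y: "finite \<Y>" "\<Y> \<subseteq> \<X>" and W: "finite \<W>" "\<W> \<subseteq> \<Z>"
    let ?W = "tuples (Suc ?n) \<inter> \<Inter>\<Y>"
    have WL: "?W \<in> L (Suc ?n)" by (rule L.finite_INT_mem) (use Y in \<open>auto simp: \<X>_def\<close>)
    have xW: "x @ [u] \<in> ?W" using Y unfolding \<X>_def by auto
    have "\<forall>(k, Z)\<in>\<W>. Z \<in> F (?n + ?l + k)" using W unfolding \<Z>_def by auto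
    then obtain v where v: "y @ [v] \<in> ?W" "\<forall>(k, Z)\<in>\<W>. \<forall>q. set q \<subseteq> P \<longrightarrow> length q = k \<longrightarrow> y @ B @ q @ [v] \<notin> Z"
      using conjunct2[OF ext_fat[OF WL xW u e]] W(1) by blast
    have "\<forall>X\<in>\<Y>. (y @ B) @ [v] \<in> pad X" using v(1) ly unfolding pad_def by auto
    moreover have "\<forall>j\<in>\<W>. (y @ B) @ [v] \<in> neg j" using v(2) ly unfolding neg_def Pcl_def by force
    ultimately show "\<exists>z. length z = 1 \<and> (\<forall>X\<in>\<Y>. (y @ B) @ z \<in> pad X) \<and> (\<forall>j\<in>\<W>. (y @ B) @ z \<in> neg j)"
      by (intro exI[of _ "[v]"]) auto
  qed
  then obtain v where v: "\<forall>X\<in>\<X>. (y @ B) @ [v] \<in> pad X" "\<forall>j\<in>\<Z>. (y @ B) @ [v] \<in> neg j"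
    by (metis One_nat_def length_0_conv length_Suc_conv)
  have "v \<notin> cl (set (y @ B) \<union> P)" unfolding cl_P_iff using v(2) ly unfolding neg_def \<Z>_def by auto
  moreover have "eqtp (x @ [u]) (y @ [v])" by (rule eqtpI) (use v(1) ly in \<open>auto simp: \<X>_def pad_def\<close>)
  ultimately show ?thesis by (intro exI[of _ v]) simp
qed

text \<open>Density: the same with the first clause of \<open>split\<close>, the realisation being a
  point of \<open>P\<close> that is kept away from the closure of \<open>y\<close> and
  \<open>B\<close>.\<close>

lemma ext_P:
  assumes e: "eqtp x y" and u: "u \<notin> cl (set x)"
  shows "\<exists>p\<in>P. p \<notin> cl (set y \<union> set B) \<and> eqtp (x @ [u]) (y @ [p])"
proof -
  let ?n = "length x" let ?l = "length B"
  have ly: "length y = ?n" using e eqtp_length by simp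
  define \<X> where "\<X> = {X \<in> L (Suc ?n). x @ [u] \<in> X}"
  define \<Z> where "\<Z> = F (?n + ?l)"
  define pad where "pad X = {as @ [u] | as u. length as = ?n + ?l \<and> take ?n as @ [u] \<in> X}" for X :: "'b list set"
  define neg where "neg Z = {as @ [u] | as u. length as = ?n + ?l \<and> (u \<in> P \<and> as @ [u] \<notin> Z)}" for Z
  have "\<exists>z. length z = 1 \<and> (\<forall>X\<in>\<X>. (y @ B) @ z \<in> pad X) \<and> (\<forall>j\<in>\<Z>. (y @ B) @ z \<in> neg j)"
  proof (rule saturation2)
    show "countable \<X>" unfolding \<X>_def using L_countable by (rule countable_subset[rotated]) blast
    show "countable \<Z>" unfolding \<Z>_def by (rule F_countable)
    show "pad X \<in> K ((?n + ?l) + 1)" if "X \<in> \<X>" for X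
    proof -
      have "X \<in> K (Suc ?n)" using that L_K unfolding \<X>_def by auto
      then show ?thesis using pad_mid_mem[of X K ?n ?l] K.struct_axioms unfolding pad_def by simp
    qed
    show "neg Z \<in> K ((?n + ?l) + 1)" if "Z \<in> \<Z>" for Z
    proof -
      have "Z \<in> K (Suc (?n + ?l))" using that F_L L_K unfolding \<Z>_def by blast
      then have "dfn K (\<lambda>e. e (?n + ?l) \<in> P \<and> map e [0..<?n + ?l] @ [e (?n + ?l)] \<notin> Z)"
        using K.dfn_atom[of Z "[0..<?n + ?l] @ [?n + ?l]"] by (intro K.dfn_conj K_dfn_P K.dfn_not) simp
      from K.dfn_snoc_mem[OF this] show ?thesis unfolding neg_def by simp
    qed
    show "length (y @ B) = ?n + ?l" using ly by simp
    fix \<Y> \<W> assume Y: "finite \<Y>" "\<Y> \<subseteq> \<X>" and W: "finite \<W>" "\<W> \<subseteq> \<Z>"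
    let ?W = "tuples (Suc ?n) \<inter> \<Inter>\<Y>"
    have WL: "?W \<in> L (Suc ?n)" by (rule L.finite_INT_mem) (use Y in \<open>auto simp: \<X>_def\<close>)
    have xW: "x @ [u] \<in> ?W" using Y unfolding \<X>_def by auto
    have "\<Union>\<W> \<in> F (?n + ?l)" using W unfolding \<Z>_def by (intro F_finite_UN)
    then obtain p where p: "p \<in> P" "y @ [p] \<in> ?W" "y @ B @ [p] \<notin> \<Union>\<W>"
      using conjunct1[OF ext_fat[OF WL xW u e]] by blast
    have "\<forall>X\<in>\<Y>. (y @ B) @ [p] \<in> pad X" using p(2) ly unfolding pad_def by auto
    moreover have "\<forall>j\<in>\<W>. (y @ B) @ [p] \<in> neg j" using p ly unfolding neg_def by auto
    ultimately show "\<exists>z. length z = 1 \<and> (\<forall>X\<in>\<Y>. (y @ B) @ z \<in> pad X) \<and> (\<forall>j\<in>\<W>. (y @ B) @ z \<in> neg j)"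
      by (intro exI[of _ "[p]"]) auto
  qed
  then obtain p where p: "\<forall>X\<in>\<X>. (y @ B) @ [p] \<in> pad X" "\<forall>j\<in>\<Z>. (y @ B) @ [p] \<in> neg j"
    by (metis One_nat_def length_0_conv length_Suc_conv)
  have "{} \<in> \<Z>" unfolding \<Z>_def by (rule F_empty)
  then have "p \<in> P" using p(2) unfolding neg_def by auto
  moreover have "p \<notin> cl (set (y @ B))" unfolding F.cl_set_iff using p(2) ly unfolding neg_def \<Z>_def by auto
  moreover have "eqtp (x @ [u]) (y @ [p])" by (rule eqtpI) (use p(1) ly in \<open>auto simp: \<X>_def pad_def\<close>)
  ultimately show ?thesis by (intro bexI[of _ p]) simp_all
qed

text \<open>Over \<open>W\<close> the points of \<open>P\<close> outside \<open>W\<close> are still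
  independent of each other. On good tuples the type in \<open>L\<close> together with the positions
  of the entries in \<open>P\<close> controls the whole pair, which is why the back-and-forth is
  confined to them.\<close>

definition good :: "'b set \<Rightarrow> bool" where
  "good W \<longleftrightarrow> (\<forall>p\<in>P - W. p \<notin> cl (W \<union> (P - {p})))"

text \<open>The finite part of \<open>P\<close> on which \<open>X\<close> depends.\<close>
definition Psupp :: "'b set \<Rightarrow> 'b set" where
  "Psupp X = {p \<in> P. p \<in> cl (X \<union> (P - {p}))}"

lemma good_empty: "good {}" unfolding good_def using P_indep_cl by simp

lemma good_insert_P:
  assumes "good W" "p \<in> P" shows "good (insert p W)"
  unfolding good_def
proof
  fix p' assume p': "p' \<in> P - insert p W"
  then have "insert p W \<union> (P - {p'}) = W \<union> (P - {p'})" using assms(2) by auto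
  then show "p' \<notin> cl (insert p W \<union> (P - {p'}))" using assms(1) p' unfolding good_def by simp
qed

lemma good_insert_generic:
  assumes "good W" "u \<notin> cl (W \<union> P)" shows "good (insert u W)"
  unfolding good_def
proof
  fix p assume p: "p \<in> P - insert u W"
  then have 1: "p \<notin> cl (W \<union> (P - {p}))" using assms(1) unfolding good_def by blast
  show "p \<notin> cl (insert u W \<union> (P - {p}))"
  proof
    assume "p \<in> cl (insert u W \<union> (P - {p}))"
    then have "u \<in> cl (insert p (W \<union> (P - {p})))" using 1 F.cl_exchange[of p u "W \<union> (P - {p})"] by simp
    moreover have "insert p (W \<union> (P - {p})) = W \<union> P" using p by auto
    ultimately show False using assms(2) by simp
  qed
qed

lemma good_insert_cl:
  assumes "good W" "u \<in> cl W" shows "good (insert u W)"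
  unfolding good_def
proof
  fix p assume p: "p \<in> P - insert u W"
  have "u \<in> cl (W \<union> (P - {p}))" using assms(2) F.cl_mono[of W "W \<union> (P - {p})"] by blast
  then have "cl (insert u W \<union> (P - {p})) = cl (W \<union> (P - {p}))"
    using F.cl_insert_absorb by simp
  then show "p \<notin> cl (insert u W \<union> (P - {p}))" using assms(1) p unfolding good_def by simp
qed

lemma good_Un_P: "finite Q \<Longrightarrow> Q \<subseteq> P \<Longrightarrow> good W \<Longrightarrow> good (W \<union> Q)"
  by (induction Q rule: finite_induct) (auto simp: good_insert_P)

lemma cl_Un_P_finite: assumes "u \<in> cl (W \<union> P)" shows "\<exists>Q. finite Q \<and> Q \<subseteq> P \<and> u \<in> cl (W \<union> Q)"
proof -
  obtain B where B: "finite B" "B \<subseteq> W \<union> P" "u \<in> cl B" using F.cl_finitary[OF assms] by blast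
  have "B \<subseteq> W \<union> (B \<inter> P)" using B(2) by blast
  then have "u \<in> cl (W \<union> (B \<inter> P))" using B(3) F.cl_mono by blast
  then show ?thesis using B(1) by (intro exI[of _ "B \<inter> P"]) auto
qed

text \<open>A point outside the closure over \<open>P\<close> may be added freely; any other point
  is added after the finitely many points of \<open>P\<close> on which it depends. Finiteness of
  supports follows.\<close>

lemma good_extension: "finite X \<Longrightarrow> \<exists>Q. finite Q \<and> Q \<subseteq> P \<and> good (X \<union> Q)"
proof (induction X rule: finite_induct)
  case empty then show ?case using good_empty by (intro exI[of _ "{}"]) simp
next
  case (insert u X)
  then obtain Q where Q: "finite Q" "Q \<subseteq> P" "good (X \<union> Q)" by blast
  show ?case
  proof (cases "u \<in> cl (X \<union> Q \<union> P)")
    case False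
    then show ?thesis using good_insert_generic[OF Q(3)] Q by (intro exI[of _ Q]) simp
  next
    case True
    then obtain Q' where Q': "finite Q'" "Q' \<subseteq> P" "u \<in> cl (X \<union> Q \<union> Q')" using cl_Un_P_finite by blast
    have "good (insert u (X \<union> Q \<union> Q'))" by (rule good_insert_cl[OF good_Un_P[OF Q'(1,2) Q(3)] Q'(3)])
    then show ?thesis using Q Q' by (intro exI[of _ "Q \<union> Q'"]) (simp add: Un_assoc)
  qed
qed

lemma Psupp_mono_cl: assumes "X \<subseteq> cl Y" shows "Psupp X \<subseteq> Psupp Y"
proof
  fix p assume p: "p \<in> Psupp X"
  have "X \<union> (P - {p}) \<subseteq> cl (Y \<union> (P - {p}))"
    using assms F.cl_mono[of Y "Y \<union> (P - {p})"] F.cl_ext[of "Y \<union> (P - {p})"] by blast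
  then have "cl (X \<union> (P - {p})) \<subseteq> cl (Y \<union> (P - {p}))" by (rule F.cl_minimal)
  then show "p \<in> Psupp Y" using p unfolding Psupp_def by blast
qed

lemma Psupp_mono: "X \<subseteq> Y \<Longrightarrow> Psupp X \<subseteq> Psupp Y"
  using Psupp_mono_cl F.cl_ext by blast

lemma good_Un_Psupp: "good (X \<union> Psupp X)"
  unfolding good_def
proof
  fix p assume p: "p \<in> P - (X \<union> Psupp X)"
  then have "X \<union> Psupp X \<union> (P - {p}) = X \<union> (P - {p})" unfolding Psupp_def by auto
  then show "p \<notin> cl (X \<union> Psupp X \<union> (P - {p}))" using p unfolding Psupp_def by auto
qed

lemma Psupp_good: "good W \<Longrightarrow> Psupp W \<subseteq> W" unfolding good_def Psupp_def by blast

lemma Psupp_P: "Psupp X \<subseteq> P" unfolding Psupp_def by blast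

lemma Psupp_finite: assumes "finite X" shows "finite (Psupp X)"
proof -
  obtain Q where Q: "finite Q" "good (X \<union> Q)" using good_extension[OF assms] by blast
  have "Psupp X \<subseteq> X \<union> Q" using Psupp_mono[of X "X \<union> Q"] Psupp_good[OF Q(2)] by blast
  then show ?thesis using Q assms finite_subset by blast
qed

lemma Psupp_absorb: assumes "Z \<subseteq> cl (X \<union> Psupp X)" shows "Psupp (X \<union> Z) = Psupp X"
proof
  show "Psupp (X \<union> Z) \<subseteq> Psupp X"
  proof
    fix p assume p: "p \<in> Psupp (X \<union> Z)"
    show "p \<in> Psupp X"
    proof (rule ccontr)
      assume n: "p \<notin> Psupp X"
      then have "X \<union> Psupp X \<subseteq> X \<union> (P - {p})" using Psupp_P by blast
      then have "Z \<subseteq> cl (X \<union> (P - {p}))" using assms F.cl_mono by blast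
      then have "cl (X \<union> (P - {p}) \<union> Z) = cl (X \<union> (P - {p}))" by (rule F.cl_Un_absorb)
      then show False using p n unfolding Psupp_def by (simp add: Un_ac)
    qed
  qed
qed (rule Psupp_mono, blast)

text \<open>Additivity for \<open>X\<close> and the single point \<open>p\<close> over
  \<open>P - {p}\<close>: \<open>p\<close> itself has rank 1 there, and after adjoining
  \<open>X\<close> it keeps that rank exactly when it is not in the support.\<close>

lemma Psupp_rk: assumes "p \<in> P" "finite X" shows "p \<notin> Psupp X \<longleftrightarrow> rk (P - {p}) X = rk P X"
proof -
  have "rk (P - {p}) {p} + rk (P - {p} \<union> {p}) X = rk (P - {p}) X + rk (P - {p} \<union> X) {p}"
    by (rule F.rk_shift) (use assms in auto)
  moreover have "rk (P - {p}) {p} = 1" using F.rk_insert[of "{}" "P - {p}" p] P_indep_cl[OF assms(1)] by simp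
  moreover have "P - {p} \<union> {p} = P" using assms(1) by auto
  moreover have "rk (P - {p} \<union> X) {p} = (if p \<in> Psupp X then 0 else 1)"
    using F.rk_insert[of "{}" "P - {p} \<union> X" p] assms(1) by (simp add: Psupp_def Un_commute)
  ultimately show ?thesis by (simp split: if_splits)
qed

text \<open>Were \<open>p\<close> in the support but not in \<open>Q\<close>, then \<open>Q\<close>
  would lie in \<open>P - {p}\<close>, and over \<open>P - {p}\<close> the rank of \<open>X\<close>
  would already have dropped to its value over \<open>P\<close>, contrary to
  \<open>Psupp_rk\<close>. A bound on the size of \<open>Q\<close> thus bounds supports.\<close>

lemma Psupp_bound: assumes "Q \<subseteq> P" "finite X" "rk Q X \<le> rk P X" shows "Psupp X \<subseteq> Q"
proof (rule ccontr)
  assume "\<not> ?thesis"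
  then obtain p where p: "p \<in> P" "p \<in> Psupp X" "p \<notin> Q" using Psupp_P by blast
  have "Q \<subseteq> cl (P - {p})" using assms(1) p F.cl_ext[of "P - {p}"] by blast
  then have "rk (P - {p}) X \<le> rk Q X" by (rule F.rk_antimono[OF assms(2)])
  moreover have "P - {p} \<subseteq> cl P" using F.cl_ext by blast
  then have "rk P X \<le> rk (P - {p}) X" by (rule F.rk_antimono[OF assms(2)])
  ultimately show False using assms(3) Psupp_rk[OF p(1) assms(2)] p(2) by simp
qed

text \<open>Deleting \<open>p\<close> from \<open>P\<close> changes neither the rank of
  \<open>X\<close> nor that of \<open>Y\<close> when \<open>p\<close> is in neither support;
  subadditivity and the assumed independence then leave no room for the rank of the union to
  grow.\<close>

lemma Psupp_indep:
  assumes "finite X" "finite Y" "rk P (X \<union> Y) = rk P X + rk P Y"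
  shows "Psupp (X \<union> Y) = Psupp X \<union> Psupp Y"
proof
  show "Psupp X \<union> Psupp Y \<subseteq> Psupp (X \<union> Y)" using Psupp_mono[of X "X \<union> Y"] Psupp_mono[of Y "X \<union> Y"] by blast
  show "Psupp (X \<union> Y) \<subseteq> Psupp X \<union> Psupp Y"
  proof (rule ccontr)
    assume "\<not> ?thesis"
    then obtain p where p: "p \<in> P" "p \<in> Psupp (X \<union> Y)" "p \<notin> Psupp X" "p \<notin> Psupp Y" using Psupp_P by blast
    have "rk (P - {p}) (X \<union> Y) \<le> rk P (X \<union> Y)"
      using F.rk_Un_le[OF assms(1,2), of "P - {p}"] assms(3) Psupp_rk[OF p(1) assms(1)] Psupp_rk[OF p(1) assms(2)] p by simp
    moreover have "P - {p} \<subseteq> cl P" using F.cl_ext by blast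
    then have "rk P (X \<union> Y) \<le> rk (P - {p}) (X \<union> Y)" by (intro F.rk_antimono) (use assms in auto)
    ultimately show False using Psupp_rk[OF p(1), of "X \<union> Y"] assms(1,2) p(2) by simp
  qed
qed

lemma cl_drop_P:
  assumes "u \<in> cl (W \<union> P')" "\<And>p. p \<in> P' - W \<Longrightarrow> p \<notin> cl (insert u W \<union> (P' - {p}))"
  shows "u \<in> cl W"
proof -
  obtain B where B: "finite B" "B \<subseteq> W \<union> P'" "u \<in> cl B" using F.cl_finitary[OF assms(1)] by blast
  have "B \<subseteq> W \<union> (B - W)" by blast
  then have 1: "u \<in> cl (W \<union> (B - W))" using B(3) F.cl_mono by blast
  have "u \<in> cl W" if "finite Q" "Q \<subseteq> P' - W" "u \<in> cl (W \<union> Q)" for Q using that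
  proof (induction Q rule: finite_induct)
    case (insert p Q)
    show ?case
    proof (cases "u \<in> cl (W \<union> Q)")
      case True then show ?thesis using insert by simp
    next
      case False
      then have "p \<in> cl (insert u (W \<union> Q))" using F.cl_exchange[of u p "W \<union> Q"] insert.prems by simp
      moreover have "insert u (W \<union> Q) \<subseteq> insert u W \<union> (P' - {p})" using insert by blast
      ultimately have "p \<in> cl (insert u W \<union> (P' - {p}))" using F.cl_mono by blast
      then show ?thesis using assms(2)[of p] insert.prems by blast
    qed
  qed simp
  then show ?thesis using 1 B by blast
qed

lemma cl_drop_good: assumes "u \<in> cl (W \<union> P)" "Psupp (insert u W) \<subseteq> W" shows "u \<in> cl W"
  using cl_drop_P[OF assms(1)] assms(2) unfolding Psupp_def by blast

lemma Psupp_empty_rk: "finite X \<Longrightarrow> Psupp X = {} \<Longrightarrow> rk {} X = rk P X"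
proof (induction X rule: finite_induct)
  case (insert u X)
  then have e: "Psupp X = {}" using Psupp_mono[of X "insert u X"] by blast
  have "u \<in> cl (P \<union> X) \<longleftrightarrow> u \<in> cl X"
    using cl_drop_good[of u X] insert.prems F.cl_mono[of X "P \<union> X"] by (auto simp: Un_commute)
  then show ?case using insert e by (simp add: F.rk_insert)
qed simp

text \<open>By definition of the support, \<open>p\<close> depends on \<open>X\<close> and all other
  points of \<open>P\<close>. Those outside the support are dropped, which leaves a dependence on
  \<open>X\<close> and the rest of the support; for finite \<open>X\<close> this is visible in a
  type.\<close>

lemma Psupp_self: assumes "p \<in> Psupp X" shows "p \<in> cl (X \<union> (Psupp X - {p}))"
proof (rule cl_drop_P[where P' = "P - {p}"])
  have "X \<union> (P - {p}) \<subseteq> X \<union> (Psupp X - {p}) \<union> (P - {p})" by blast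
  then show "p \<in> cl (X \<union> (Psupp X - {p}) \<union> (P - {p}))" using assms F.cl_mono unfolding Psupp_def by blast
  fix p' assume p': "p' \<in> P - {p} - (X \<union> (Psupp X - {p}))"
  have pP: "p \<in> P" using assms Psupp_P by blast
  have "insert p (X \<union> (Psupp X - {p})) \<union> (P - {p} - {p'}) \<subseteq> X \<union> (P - {p'})" using p' pP Psupp_P by blast
  moreover have "p' \<notin> cl (X \<union> (P - {p'}))" using p' unfolding Psupp_def by blast
  ultimately show "p' \<notin> cl (insert p (X \<union> (Psupp X - {p})) \<union> (P - {p} - {p'}))" using F.cl_mono by blast
qed

text \<open>The back-and-forth system. Goodness of both sides keeps the points of \<open>P\<close>
  not yet matched independent, so that matching can continue.\<close>

definition sim :: "'b list \<Rightarrow> 'b list \<Rightarrow> bool" where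
  "sim w w' \<longleftrightarrow> eqtp w w' \<and> good (set w) \<and> good (set w') \<and> (\<forall>i<length w. w ! i \<in> P \<longleftrightarrow> w' ! i \<in> P)"

lemma sim_sym: "sim w w' \<Longrightarrow> sim w' w" unfolding sim_def using eqtp_sym eqtp_length by metis

lemma sim_length: "sim w w' \<Longrightarrow> length w = length w'" unfolding sim_def using eqtp_length by blast

lemma sim_refl: "good (set w) \<Longrightarrow> sim w w" unfolding sim_def using eqtp_refl by blast

lemma sim_reindex:
  assumes "sim w w'" "set js = {..<length w}" shows "sim (map ((!) w) js) (map ((!) w') js)"
proof -
  have l: "length w' = length w" using sim_length[OF assms(1)] by simp
  have "set (map ((!) w) js) = set w" "set (map ((!) w') js) = set w'"
    using assms(2) l nth_image[of "length w" w] nth_image[of "length w'" w'] by (auto simp: lessThan_atLeast0)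
  moreover have "eqtp (map ((!) w) js) (map ((!) w') js)" using assms eqtp_reindex unfolding sim_def by auto
  moreover have "\<forall>i<length js. w ! (js ! i) \<in> P \<longleftrightarrow> w' ! (js ! i) \<in> P"
    using assms nth_mem unfolding sim_def by (metis lessThan_iff)
  ultimately show ?thesis using assms(1) unfolding sim_def by simp
qed

lemma sim_snocI:
  assumes "sim w w'" "eqtp (w @ [u]) (w' @ [v])" "good (insert u (set w))" "good (insert v (set w'))" "u \<in> P \<longleftrightarrow> v \<in> P"
  shows "sim (w @ [u]) (w' @ [v])"
  using assms eqtp_length[of w w'] unfolding sim_def by (auto simp: nth_append less_Suc_eq)

lemma sim_ext_P:
  assumes s: "sim w w'" and p: "p \<in> P"
  shows "\<exists>p'\<in>P. sim (w @ [p]) (w' @ [p']) \<and> (p \<notin> set w \<longrightarrow> p' \<notin> cl (set w' \<union> set B))"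
proof (cases "p \<in> set w")
  case True
  then obtain i where i: "i < length w" "w ! i = p" by (auto simp: in_set_conv_nth)
  have l: "length w' = length w" using sim_length[OF s] by simp
  have m: "map ((!) w) [0..<length w] = w" "map ((!) w') [0..<length w] = w'" using l map_nth[of w] map_nth[of w'] by simp_all
  have "sim (map ((!) w) ([0..<length w] @ [i])) (map ((!) w') ([0..<length w] @ [i]))"
    by (rule sim_reindex[OF s]) (use i in auto)
  then have "sim (w @ [p]) (w' @ [w' ! i])" using i m by simp
  moreover have "w' ! i \<in> P" using s i p unfolding sim_def by blast
  ultimately show ?thesis using True by blast
next
  case False
  then have "p \<notin> cl (set w \<union> (P - {p}))" using s p unfolding sim_def good_def by blast
  then have "p \<notin> cl (set w)" using F.cl_mono[of "set w" "set w \<union> (P - {p})"] by blast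
  then obtain p' where p': "p' \<in> P" "p' \<notin> cl (set w' \<union> set B)" "eqtp (w @ [p]) (w' @ [p'])"
    using ext_P[of w w' p B] s unfolding sim_def by blast
  have "sim (w @ [p]) (w' @ [p'])" by (rule sim_snocI[OF s p'(3)]) (use s p p' good_insert_P in \<open>auto simp: sim_def\<close>)
  then show ?thesis using p' by blast
qed

lemma sim_ext_generic:
  assumes s: "sim w w'" and u: "u \<notin> cl (set w \<union> P)"
  shows "\<exists>v. v \<notin> cl (set w' \<union> set B \<union> P) \<and> sim (w @ [u]) (w' @ [v])"
proof -
  have "u \<notin> cl (set w)" using u F.cl_mono[of "set w" "set w \<union> P"] by blast
  then obtain v where v: "v \<notin> cl (set w' \<union> set B \<union> P)" "eqtp (w @ [u]) (w' @ [v])"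
    using ext_generic[of w w' u B] s unfolding sim_def by blast
  have v': "v \<notin> cl (set w' \<union> P)" using v(1) F.cl_mono[of "set w' \<union> P" "set w' \<union> set B \<union> P"] by blast
  have "u \<notin> P" "v \<notin> P" using u v' F.cl_ext by blast+
  then have "sim (w @ [u]) (w' @ [v])"
    by (intro sim_snocI[OF s v(2)]) (use s u v' good_insert_generic in \<open>auto simp: sim_def\<close>)
  then show ?thesis using v by blast
qed

text \<open>A point of \<open>P\<close> in the closure of a good tuple is already an entry of it.
  Hence membership in \<open>P\<close> is determined by equalities between entries, which the type
  records.\<close>

lemma sim_ext_cl:
  assumes s: "sim w w'" and u: "u \<in> cl (set w)"
  shows "\<exists>v. v \<in> cl (set w') \<and> sim (w @ [u]) (w' @ [v])"
proof -
  obtain v where v: "eqtp (w @ [u]) (w' @ [v])" using ext_any s unfolding sim_def by blast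
  have vc: "v \<in> cl (set w')" by (rule eqtp_cl[OF v u])
  have st: "v \<in> P" if "eqtp (w @ [u]) (w' @ [v])" "good (set w)" "u \<in> cl (set w)" "u \<in> P"
     "\<forall>i<length w. w ! i \<in> P \<longrightarrow> w' ! i \<in> P" for w w' u v
  proof -
    have "u \<in> set w"
    proof (rule ccontr)
      assume "u \<notin> set w"
      then have "u \<notin> cl (set w \<union> (P - {u}))" using that unfolding good_def by blast
      then show False using that(3) F.cl_mono[of "set w" "set w \<union> (P - {u})"] by blast
    qed
    then obtain i where i: "i < length w" "w ! i = u" by (auto simp: in_set_conv_nth)
    have l: "length w' = length w" using eqtp_length[OF that(1)] by simp
    have "(w' @ [v]) ! i = (w' @ [v]) ! length w" by (rule eqtp_nth_eq[OF that(1)]) (use i in \<open>auto simp: nth_append\<close>)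
    then have "v = w' ! i" using i l by (simp add: nth_append)
    then show ?thesis using that(4,5) i by auto
  qed
  have "u \<in> P \<longleftrightarrow> v \<in> P"
    using st[OF v _ u] st[OF eqtp_sym[OF v] _ vc] s sim_length[OF s] unfolding sim_def by auto
  then have "sim (w @ [u]) (w' @ [v])"
    by (intro sim_snocI[OF s v]) (use s u vc good_insert_cl in \<open>auto simp: sim_def\<close>)
  then show ?thesis using vc by blast
qed

lemma sim_ext_Ps:
  assumes "sim w w'" "set q \<subseteq> P" "distinct q" "set q \<inter> set w = {}"
  shows "\<exists>q'. set q' \<subseteq> P \<and> sim (w @ q) (w' @ q') \<and> rk (set w' \<union> set B) (set q') = length q \<and> set q' \<inter> set B = {}"
  using assms(2-)
proof (induction q rule: rev_induct)
  case Nil then show ?case using assms(1) by (intro exI[of _ "[]"]) simp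
next
  case (snoc p q)
  then obtain q' where q': "set q' \<subseteq> P" "sim (w @ q) (w' @ q')" "rk (set w' \<union> set B) (set q') = length q" "set q' \<inter> set B = {}"
    by auto
  have "p \<notin> set (w @ q)" using snoc.prems by auto
  then obtain p' where p': "p' \<in> P" "sim ((w @ q) @ [p]) ((w' @ q') @ [p'])" "p' \<notin> cl (set (w' @ q') \<union> set B)"
    using sim_ext_P[OF q'(2), of p B] snoc.prems by auto
  have "p' \<notin> cl (set w' \<union> set B \<union> set q')" using p'(3) by (simp add: Un_ac)
  moreover from this have "p' \<notin> set B" using F.cl_ext[of "set w' \<union> set B \<union> set q'"] by blast
  ultimately show ?case using q' p' F.rk_insert[of "set q'" "set w' \<union> set B" p']
    by (intro exI[of _ "q' @ [p']"]) auto
qed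

lemma sim_ext_Ps_any:
  assumes "sim w w'" "set q \<subseteq> P" shows "\<exists>q'. sim (w @ q) (w' @ q')"
  using assms(2)
proof (induction q rule: rev_induct)
  case Nil then show ?case using assms(1) by (intro exI[of _ "[]"]) simp
next
  case (snoc p q)
  then obtain q' where q': "sim (w @ q) (w' @ q')" by auto
  then obtain p' where "sim ((w @ q) @ [p]) ((w' @ q') @ [p'])" using sim_ext_P[OF q', of p "[]"] snoc.prems by auto
  then show ?case by (intro exI[of _ "q' @ [p']"]) simp
qed

text \<open>The forth step. A point outside the closure over \<open>P\<close> is matched directly;
  any other point waits until the points of \<open>P\<close> on which it depends have been
  matched.\<close>

lemma sim_ext:
  assumes "sim w w'" shows "\<exists>q q' v. sim (w @ q @ [u]) (w' @ q' @ [v])"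
proof (cases "u \<in> cl (set w \<union> P)")
  case False
  then obtain v where "sim (w @ [u]) (w' @ [v])" using sim_ext_generic[OF assms] by blast
  then show ?thesis by (intro exI[of _ "[]"] exI[of _ v]) simp
next
  case True
  then obtain Q where Q: "finite Q" "Q \<subseteq> P" "u \<in> cl (set w \<union> Q)" using cl_Un_P_finite by blast
  obtain q where q: "set q = Q" using finite_list[OF Q(1)] by blast
  then obtain q' where q': "sim (w @ q) (w' @ q')" using sim_ext_Ps_any[OF assms] Q(2) by blast
  then obtain v where "sim ((w @ q) @ [u]) ((w' @ q') @ [v])" using sim_ext_cl[OF q', of u] Q(3) q by auto
  then show ?thesis by auto
qed

text \<open>Tuples that become matched good tuples after adding suitable hidden entries
  \<open>q\<close> and \<open>q'\<close>. Every tuple can be completed to a good one by its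
  support.\<close>

definition R :: "'b list \<Rightarrow> 'b list \<Rightarrow> bool" where
  "R x y \<longleftrightarrow> length x = length y \<and> (\<exists>q q'. sim (x @ q) (y @ q'))"

lemma R_sym: "R x y \<Longrightarrow> R y x" unfolding R_def using sim_sym by metis

lemma R_eqtp: "R x y \<Longrightarrow> eqtp x y" unfolding R_def sim_def using eqtp_prefix by blast

lemma R_match: "R x y \<Longrightarrow> i < length x \<Longrightarrow> x ! i \<in> P \<longleftrightarrow> y ! i \<in> P"
proof -
  assume "R x y" and i: "i < length x"
  then obtain q q' where "length x = length y" "\<forall>i<length (x @ q). (x @ q) ! i \<in> P \<longleftrightarrow> (y @ q') ! i \<in> P"
    unfolding R_def sim_def by blast
  then show ?thesis using i by (metis length_append nth_append trans_less_add1)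
qed

lemma R_of_sim:
  assumes s: "sim (x @ q @ [u]) (y @ q' @ [v])" and l: "length x = length y" shows "R (x @ [u]) (y @ [v])"
proof -
  let ?n = "length x" let ?m = "length q"
  have lq: "length q' = ?m" using sim_length[OF s] l by simp
  let ?js = "[0..<?n] @ [?n + ?m] @ [?n..<?n + ?m]"
  have "map ((!) (x @ q @ [u])) ?js = (x @ [u]) @ q"
    by (intro nth_equalityI) (auto simp: nth_append nth_Cons')
  moreover have "map ((!) (y @ q' @ [v])) ?js = (y @ [v]) @ q'"
    by (intro nth_equalityI) (use l lq in \<open>auto simp: nth_append nth_Cons'\<close>)
  moreover have "set ?js = {..<length (x @ q @ [u])}" by auto
  ultimately have "sim ((x @ [u]) @ q) ((y @ [v]) @ q')" using sim_reindex[OF s, of ?js] by simp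
  then show ?thesis unfolding R_def using l by (simp del: append_assoc) blast
qed

lemma R_ext: assumes "R x y" shows "\<exists>v. R (x @ [u]) (y @ [v])"
proof -
  obtain q q' where s: "sim (x @ q) (y @ q')" and l: "length x = length y" using assms unfolding R_def by blast
  obtain r r' v where "sim ((x @ q) @ r @ [u]) ((y @ q') @ r' @ [v])" using sim_ext[OF s] by blast
  then have "sim (x @ (q @ r) @ [u]) (y @ (q' @ r') @ [v])" by simp
  then show ?thesis using R_of_sim l by blast
qed

lemma R_butlast: assumes "R (x @ [u]) (y @ [v])" shows "R x y"
  using assms unfolding R_def by (metis append.assoc butlast_snoc length_butlast)

lemma R_tl: assumes "R (u # x) (v # y)" shows "R x y"
proof -
  obtain q q' where s: "sim ((u # x) @ q) ((v # y) @ q')" and l: "length x = length y" using assms unfolding R_def by auto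
  let ?k = "length (x @ q)"
  have lq: "length (y @ q') = ?k" using sim_length[OF s] by simp
  let ?js = "[1..<Suc ?k] @ [0]"
  have m: "map ((!) (a # w)) ([1..<Suc k] @ [0]) = w @ [a]" if "length w = k" for a :: 'b and w k
    using that by (intro nth_equalityI) (auto simp: nth_append simp del: upt_Suc)
  have "set ?js = {..<length ((u # x) @ q)}" by auto
  then have "sim (map ((!) ((u # x) @ q)) ?js) (map ((!) ((v # y) @ q')) ?js)" by (rule sim_reindex[OF s])
  then have "sim ((x @ q) @ [u]) ((y @ q') @ [v])" using m[of "x @ q" ?k u] m[OF lq, of v] by simp
  then have "sim (x @ (q @ [u])) (y @ (q' @ [v]))" by simp
  then show ?thesis unfolding R_def using l by blast
qed

text \<open>The sets invariant under \<open>R\<close> form a structure that contains the generators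
  of \<open>K\<close>. Closure under projection is the forth property \<open>R_ext\<close>, closure
  under complement is symmetry of \<open>R\<close>.\<close>

lemma K_invariant: assumes "X \<in> K n" "R x y" "x \<in> X" shows "y \<in> X"
proof -
  define I where "I n = {X. X \<subseteq> tuples n \<and> (\<forall>x y. R x y \<longrightarrow> x \<in> X \<longrightarrow> y \<in> X)}" for n
  have II: "X \<in> I n" if "X \<subseteq> tuples n" "\<And>x y. R x y \<Longrightarrow> x \<in> X \<Longrightarrow> y \<in> X" for X n
    unfolding I_def using that by blast
  have Rl: "R x y \<Longrightarrow> length x = length y" for x y unfolding R_def by blast
  have "is_structure I"
    unfolding is_structure_def
  proof (intro conjI allI impI)
    fix n show "I n \<subseteq> Pow (tuples n)" unfolding I_def by blast
    show "{} \<in> I n" unfolding I_def by blast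
  next
    fix n A B assume "A \<in> I n" "B \<in> I n"
    then show "A \<union> B \<in> I n" unfolding I_def by blast
  next
    fix n A assume A: "A \<in> I n"
    show "tuples n - A \<in> I n"
    proof (rule II)
      fix x y assume xy: "R x y" "x \<in> tuples n - A"
      then have "y \<notin> A" using R_sym[OF xy(1)] A unfolding I_def by blast
      then show "y \<in> tuples n - A" using xy Rl[OF xy(1)] by simp
    qed auto
    show "{x # xs |x xs. xs \<in> A} \<in> I (Suc n)"
    proof (rule II)
      show "{x # xs |x xs. xs \<in> A} \<subseteq> tuples (Suc n)" using A unfolding I_def by auto
      fix x y assume xy: "R x y" "x \<in> {x # xs |x xs. xs \<in> A}"
      then obtain u z where x: "x = u # z" "z \<in> A" by blast
      then obtain v w where y: "y = v # w" using Rl[OF xy(1)] by (cases y) auto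
      then have "w \<in> A" using R_tl xy(1) x A unfolding I_def by blast
      then show "y \<in> {x # xs |x xs. xs \<in> A}" using y by blast
    qed
    show "{xs @ [x] |x xs. xs \<in> A} \<in> I (Suc n)"
    proof (rule II)
      show "{xs @ [x] |x xs. xs \<in> A} \<subseteq> tuples (Suc n)" using A unfolding I_def by auto
      fix x y assume xy: "R x y" "x \<in> {xs @ [x] |x xs. xs \<in> A}"
      then obtain u z where x: "x = z @ [u]" "z \<in> A" by blast
      then obtain v w where y: "y = w @ [v]" using Rl[OF xy(1)] by (cases y rule: rev_cases) auto
      then have "w \<in> A" using R_butlast xy(1) x A unfolding I_def by blast
      then show "y \<in> {xs @ [x] |x xs. xs \<in> A}" using y by blast
    qed
  next
    fix n :: nat assume n: "n \<ge> 1"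
    show "{xs \<in> tuples n. xs ! 0 = xs ! (n - 1)} \<in> I n"
    proof (rule II)
      fix x y assume xy: "R x y" "x \<in> {xs \<in> tuples n. xs ! 0 = xs ! (n - 1)}"
      then show "y \<in> {xs \<in> tuples n. xs ! 0 = xs ! (n - 1)}"
        using eqtp_nth_eq[OF R_eqtp[OF xy(1)], of 0 "n - 1"] Rl[OF xy(1)] n by auto
    qed auto
  next
    fix n A assume A: "A \<in> I (Suc n)"
    show "butlast ` A \<in> I n"
    proof (rule II)
      show "butlast ` A \<subseteq> tuples n" using A unfolding I_def by auto
      fix x y assume xy: "R x y" "x \<in> butlast ` A"
      then obtain z where z: "z \<in> A" "x = butlast z" by blast
      then have "length z = Suc n" using A unfolding I_def by auto
      then have "z = x @ [last z]" using z by (metis append_butlast_last_id length_0_conv nat.distinct(1))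
      then obtain v where "R z (y @ [v])" using R_ext[OF xy(1), of "last z"] by auto
      then have "y @ [v] \<in> A" using A z(1) unfolding I_def by blast
      then show "y \<in> butlast ` A" by (rule image_eqI[rotated]) simp
    qed
  qed
  moreover have "L m \<union> (if m = 1 then {{[p] | p. p \<in> P}} else {}) \<subseteq> I m" for m
  proof -
    have "X \<in> I m" if X: "X \<in> L m" for X
      unfolding I_def using L.length_mem[OF X] R_eqtp eqtpD X by fastforce
    moreover have "{[p] | p. p \<in> P} \<in> I 1"
    proof (rule II)
      fix x y assume xy: "R x y" "x \<in> {[p] | p. p \<in> P}"
      then obtain p where p: "x = [p]" "p \<in> P" by blast
      then obtain q where "y = [q]" using Rl[OF xy(1)] by (cases y) auto
      then show "y \<in> {[p] | p. p \<in> P}" using R_match[OF xy(1), of 0] p by simp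
    qed auto
    ultimately show ?thesis by auto
  qed
  ultimately have "gen_structure (\<lambda>n. L n \<union> (if n = 1 then {{[p] | p. p \<in> P}} else {})) n \<subseteq> I n"
    by (rule gen_structure_least)
  then have "X \<in> I n" using assms(1) K_gen by blast
  then show ?thesis using assms unfolding I_def by blast
qed

text \<open>Outside the closure of \<open>x\<close> and its support, \<open>u\<close> can be moved
  while \<open>x\<close> stays fixed up to \<open>R\<close>, so no set in \<open>K\<close> can
  single it out. If \<open>u\<close> is not in the closure over \<open>P\<close>, another point of
  the same kind is taken; otherwise the points of \<open>P\<close> that \<open>u\<close> needs are
  moved to independent ones.\<close>

lemma dcl_cl:
  assumes X: "X \<in> K (Suc n)" and u: "x @ [u] \<in> X" and uni: "\<And>v. x @ [v] \<in> X \<Longrightarrow> v = u"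
  shows "u \<in> cl (set x \<union> Psupp (set x))"
proof (rule ccontr)
  assume nu: "u \<notin> cl (set x \<union> Psupp (set x))"
  obtain q where q: "set q = Psupp (set x)" using finite_list[OF Psupp_finite, of "set x"] by auto
  define w where "w = x @ q"
  have w: "set w = set x \<union> Psupp (set x)" using q unfolding w_def by simp
  have sw: "sim w w" by (rule sim_refl) (simp add: w good_Un_Psupp)
  have "\<exists>v. v \<noteq> u \<and> R (x @ [u]) (x @ [v])"
  proof (cases "u \<in> cl (set w \<union> P)")
    case False
    then obtain v where v: "v \<notin> cl (set w \<union> set [u] \<union> P)" "sim (w @ [u]) (w @ [v])"
      using sim_ext_generic[OF sw, of u "[u]"] by blast
    have "v \<noteq> u" using v(1) F.cl_ext[of "set w \<union> set [u] \<union> P"] by auto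
    moreover have "R (x @ [u]) (x @ [v])" by (rule R_of_sim[of _ q _ _ q]) (use v(2) in \<open>simp_all add: w_def\<close>)
    ultimately show ?thesis by blast
  next
    case True
    then obtain Q where Q: "finite Q" "Q \<subseteq> P" "u \<in> cl (set w \<union> Q)" using cl_Un_P_finite by blast
    obtain r where r: "set r = Q - set w" "distinct r" using finite_distinct_list[of "Q - set w"] Q(1) by blast
    have ur: "u \<in> cl (set w \<union> set r)" using Q(3) r(1) by simp
    obtain r' where r': "set r' \<subseteq> P" "sim (w @ r) (w @ r')" "rk (set w \<union> set r) (set r') = length r"
      using sim_ext_Ps[OF sw _ r(2), of r] r(1) Q(2) by auto
    obtain v where v: "v \<in> cl (set (w @ r'))" "sim ((w @ r) @ [u]) ((w @ r') @ [v])"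
      using sim_ext_cl[OF r'(2), of u] ur by auto
    \<comment> \<open>If \<open>u\<close> stayed fixed, it would lie in the closure over
      \<open>w\<close> of both \<open>r\<close> and \<open>r'\<close>. As \<open>r'\<close> is
      independent over \<open>w\<close> and \<open>r\<close>, counting ranks leaves rank 0 for
      \<open>u\<close> over \<open>w\<close>.\<close>
    have "v \<noteq> u"
    proof
      assume "v = u"
      then have "u \<in> cl (set w \<union> set r')" using v(1) by simp
      then have 1: "rk (set w) (set r' \<union> {u}) = rk (set w) (set r')" by (intro F.rk_absorb) auto
      have 2: "rk (set w) ({u} \<union> set r') = rk (set w) {u} + rk (set w \<union> {u}) (set r')" by (rule F.rk_Un) auto
      have 3: "rk (set w) {u} = 1" using F.rk_insert[of "{}" "set w" u] nu w by simp
      have 4: "rk (set w) (set r') \<le> length r" using F.rk_le_card[of "set r'" "set w"] card_length[of r'] sim_length[OF r'(2)] by simp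
      have "set w \<union> {u} \<subseteq> cl (set w \<union> set r)" using ur F.cl_ext[of "set w \<union> set r"] by blast
      then have "rk (set w \<union> set r) (set r') \<le> rk (set w \<union> {u}) (set r')" by (intro F.rk_antimono) auto
      then show False using 1 2 3 4 r'(3) by (simp add: Un_commute)
    qed
    moreover have "R (x @ [u]) (x @ [v])" by (rule R_of_sim[of _ "q @ r" _ _ "q @ r'"]) (use v(2) in \<open>simp_all add: w_def\<close>)
    ultimately show ?thesis by blast
  qed
  then show False using K_invariant[OF X _ u] uni by blast
qed

lemma dcl_cl_tuple:
  assumes X: "X \<in> K (n + k)" and z: "x @ z \<in> X" "length x = n" and uni: "\<And>z'. x @ z' \<in> X \<Longrightarrow> z' = z"
  shows "set z \<subseteq> cl (set x \<union> Psupp (set x))"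
proof
  fix u assume "u \<in> set z"
  have lz: "length z = k" using K.length_mem[OF X z(1)] z(2) by simp
  obtain i where i: "i < k" "z ! i = u" using \<open>u \<in> set z\<close> lz by (metis in_set_conv_nth)
  define Y where "Y = {as @ [v] | as v. length as = n \<and> (\<exists>ys. length ys = k \<and> (as @ ys \<in> X \<and> ys ! i = v))}"
  have "Y \<in> K (Suc n)"
    unfolding Y_def
  proof (rule K.dfn_snoc_mem, rule K.dfn_exs[where l = "Suc n"])
    have "X \<in> K (length ([0..<n] @ [Suc n..<Suc n + k]))" using X by (simp del: upt_Suc)
    from K.dfn_conj[OF K.dfn_atom[OF this] K.dfn_eq[of "Suc n + i" n]]
    show "dfn K (\<lambda>e. map e [0..<n] @ map e [Suc n..<Suc n + k] \<in> X \<and> map e [Suc n..<Suc n + k] ! i = e n)"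
      using i by (simp del: upt_Suc)
  qed (simp add: upds_simps)
  moreover have "x @ [u] \<in> Y" unfolding Y_def using z lz i by auto
  moreover have "v = u" if "x @ [v] \<in> Y" for v using that uni i unfolding Y_def by auto
  ultimately show "u \<in> cl (set x \<union> Psupp (set x))" by (rule dcl_cl)
qed

end

section \<open>Generic points and their definability\<close>

context pregeometry begin

lemma basis_exists: "finite A \<Longrightarrow> \<exists>B\<subseteq>A. card B = rk C A \<and> A \<subseteq> cl (C \<union> B)"
proof (induction A rule: finite_induct)
  case (insert a A)
  then obtain B where B: "B \<subseteq> A" "card B = rk C A" "A \<subseteq> cl (C \<union> B)" by blast
  have fB: "finite B" using B(1) insert.hyps finite_subset by blast
  show ?case
  proof (cases "a \<in> cl (C \<union> A)")
    case True
    have "C \<union> A \<subseteq> cl (C \<union> B)" using B(3) cl_ext[of "C \<union> B"] by blast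
    then have "a \<in> cl (C \<union> B)" using True cl_minimal by blast
    then have "insert a A \<subseteq> cl (C \<union> B)" "card B = rk C (insert a A)" "B \<subseteq> insert a A"
      using B True insert.hyps by (auto simp: rk_insert)
    then show ?thesis by blast
  next
    case False
    have "A \<subseteq> cl (C \<union> insert a B)" using B(3) cl_mono[of "C \<union> B" "C \<union> insert a B"] by blast
    moreover have "a \<in> cl (C \<union> insert a B)" using cl_ext[of "C \<union> insert a B"] by blast
    moreover have "a \<notin> B" using B(1) insert.hyps by blast
    ultimately have "insert a A \<subseteq> cl (C \<union> insert a B)" "card (insert a B) = rk C (insert a A)" "insert a B \<subseteq> insert a A"
      using B False insert.hyps fB by (auto simp: rk_insert)
    then show ?thesis by blast
  qed
qed simp

end

context sat begin

text \<open>The last coordinate either raises the rank or lies in the closure over \<open>P\<close>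
  by some witness \<open>Z\<close> with \<open>k\<close> points of \<open>P\<close>. There are
  countably many choices, hence countably many sets in \<open>K\<close>; each involves a bounded
  number of points of \<open>P\<close>, which after compactness becomes a uniform bound on
  supports.\<close>

lemma rank_le_family:
  "\<exists>\<A>. countable \<A> \<and> \<A> \<subseteq> K n \<and> (\<forall>x. length x = n \<longrightarrow> (rk P (set x) \<le> r \<longleftrightarrow> (\<exists>B\<in>\<A>. x \<in> B))) \<and>
     (\<forall>B\<in>\<A>. \<exists>k. \<forall>x\<in>B. \<exists>Q\<subseteq>P. finite Q \<and> card Q \<le> k \<and> rk Q (set x) \<le> r)"
proof (induction n arbitrary: r)
  case 0
  have "\<exists>k. \<forall>x\<in>tuples 0. \<exists>Q\<subseteq>P. finite Q \<and> card Q \<le> k \<and> rk Q (set x) \<le> r"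
    by (intro exI[of _ 0] ballI exI[of _ "{}"]) auto
  then show ?case by (intro exI[of _ "{tuples 0}"]) (auto simp: K.full_mem)
next
  case (Suc n)
  obtain \<A> where A: "countable \<A>" "\<A> \<subseteq> K n" "\<forall>x. length x = n \<longrightarrow> (rk P (set x) \<le> r \<longleftrightarrow> (\<exists>B\<in>\<A>. x \<in> B))"
    "\<forall>B\<in>\<A>. \<exists>k. \<forall>x\<in>B. \<exists>Q\<subseteq>P. finite Q \<and> card Q \<le> k \<and> rk Q (set x) \<le> r"
    by (rule exE[OF Suc.IH[of r]]) (elim conjE, rule that)
  \<comment> \<open>For \<open>r = 0\<close> the truncated \<open>r - 1\<close> does not express a
    smaller rank; the definition of \<B> leaves out these sets in that case.\<close>
  obtain \<A>' where A': "countable \<A>'" "\<A>' \<subseteq> K n" "\<forall>x. length x = n \<longrightarrow> (rk P (set x) \<le> r - 1 \<longleftrightarrow> (\<exists>B\<in>\<A>'. x \<in> B))"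
    "\<forall>B\<in>\<A>'. \<exists>k. \<forall>x\<in>B. \<exists>Q\<subseteq>P. finite Q \<and> card Q \<le> k \<and> rk Q (set x) \<le> r - 1"
    by (rule exE[OF Suc.IH[of "r - 1"]]) (elim conjE, rule that)
  define pad where "pad B = {xs @ [x] | x xs. xs \<in> B}" for B :: "'b list set"
  define \<B> where "\<B> = (if r = 0 then {} else pad ` \<A>') \<union> (\<lambda>(B, k, Z). pad B \<inter> Pcl n k Z) ` (\<A> \<times> (SIGMA k:UNIV. F (n + k)))"
  have "countable \<B>" unfolding \<B>_def using A(1) A'(1) F_countable
    by (intro countable_Un countable_image countable_SIGMA) auto
  moreover have "\<B> \<subseteq> K (Suc n)"
  proof -
    have p: "pad B \<in> K (Suc n)" if "B \<in> K n" for B using K.snoc_mem[OF that] unfolding pad_def .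
    have "pad B \<in> K (Suc n)" if "B \<in> \<A>'" for B using p that A'(2) by blast
    moreover have "pad B \<inter> Pcl n k Z \<in> K (Suc n)" if "B \<in> \<A>" "Z \<in> F (n + k)" for B k Z
      using K.Int_mem[OF p Pcl_mem[OF that(2)]] that(1) A(2) by blast
    ultimately show ?thesis unfolding \<B>_def by auto
  qed
  moreover have "rk P (set z) \<le> r \<longleftrightarrow> (\<exists>B\<in>\<B>. z \<in> B)" if lz: "length z = Suc n" for z
  proof -
    obtain x u where z: "z = x @ [u]" "length x = n" using lz by (metis length_Suc_conv_rev)
    have "rk P (set z) = rk P (set x) + (if u \<in> cl (set x \<union> P) then 0 else 1)"
      using F.rk_insert[of "set x" P u] z by (simp add: Un_commute)
    then have "rk P (set z) \<le> r \<longleftrightarrow> (r \<noteq> 0 \<and> rk P (set x) \<le> r - 1) \<or> (rk P (set x) \<le> r \<and> u \<in> cl (set x \<union> P))"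
      by auto
    also have "\<dots> \<longleftrightarrow> (r \<noteq> 0 \<and> (\<exists>B\<in>\<A>'. x \<in> B)) \<or> ((\<exists>B\<in>\<A>. x \<in> B) \<and> (\<exists>k. \<exists>Z\<in>F (n + k). x @ [u] \<in> Pcl n k Z))"
      using A(3) A'(3) cl_P_iff[of u x] z(2) by simp
    also have "\<dots> \<longleftrightarrow> (\<exists>B\<in>\<B>. z \<in> B)" unfolding \<B>_def pad_def z(1) by (auto simp: bex_Un)
    finally show ?thesis .
  qed
  moreover have "\<exists>k. \<forall>x\<in>B. \<exists>Q\<subseteq>P. finite Q \<and> card Q \<le> k \<and> rk Q (set x) \<le> r" if BB: "B \<in> \<B>" for B
  proof -
    consider (1) C where "r \<noteq> 0" "C \<in> \<A>'" "B = pad C" | (2) C k Z where "C \<in> \<A>" "Z \<in> F (n + k)" "B = pad C \<inter> Pcl n k Z"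
      using BB unfolding \<B>_def by (auto split: if_splits)
    then show ?thesis
    proof cases
      case 1
      then obtain k where k: "\<forall>x\<in>C. \<exists>Q\<subseteq>P. finite Q \<and> card Q \<le> k \<and> rk Q (set x) \<le> r - 1" using A'(4) by blast
      have "\<exists>Q\<subseteq>P. finite Q \<and> card Q \<le> k \<and> rk Q (set z) \<le> r" if zB: "z \<in> B" for z
      proof -
        obtain x u where z: "z = x @ [u]" "x \<in> C" using zB 1 unfolding pad_def by blast
        then obtain Q where Q: "Q \<subseteq> P" "finite Q" "card Q \<le> k" "rk Q (set x) \<le> r - 1" using k by blast
        have "rk Q (set z) \<le> r" using Q(4) 1(1) F.rk_insert[of "set x" Q u] z by auto
        then show ?thesis using Q by blast
      qed
      then show ?thesis by blast
    next
      case 2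
      then obtain l where l: "\<forall>x\<in>C. \<exists>Q\<subseteq>P. finite Q \<and> card Q \<le> l \<and> rk Q (set x) \<le> r" using A(4) by blast
      have "\<exists>Q\<subseteq>P. finite Q \<and> card Q \<le> l + k \<and> rk Q (set z) \<le> r" if zB: "z \<in> B" for z
      proof -
        obtain x u where z: "z = x @ [u]" "x \<in> C" using zB 2 unfolding pad_def by blast
        then obtain Q where Q: "Q \<subseteq> P" "finite Q" "card Q \<le> l" "rk Q (set x) \<le> r" using l by blast
        have "x @ [u] \<in> Pcl n k Z" using zB 2 z by simp
        then obtain q where q: "length q = k" "set q \<subseteq> P" "length x = n" "(x @ q) @ [u] \<in> Z" unfolding Pcl_def by auto
        then have "u \<in> cl (set (x @ q))" using 2(2) F.cl_set_iff[of u "x @ q"] by auto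
        moreover have "set (x @ q) \<subseteq> Q \<union> set q \<union> set x" by auto
        ultimately have "u \<in> cl (Q \<union> set q \<union> set x)" using F.cl_mono by blast
        then have "rk (Q \<union> set q) (set z) = rk (Q \<union> set q) (set x)" using F.rk_insert[of "set x" "Q \<union> set q" u] z by simp
        moreover have "Q \<subseteq> cl (Q \<union> set q)" using F.cl_ext by blast
        then have "rk (Q \<union> set q) (set x) \<le> rk Q (set x)" by (intro F.rk_antimono) auto
        moreover have "card (Q \<union> set q) \<le> l + k"
          using card_Un_le[of Q "set q"] Q(3) card_length[of q] q(1) by simp
        ultimately show ?thesis using Q q by (intro exI[of _ "Q \<union> set q"]) auto
      qed
      then show ?thesis by blast
    qed
  qed
  ultimately show ?case by (intro exI[of _ \<B>]) blast
qed

lemma nongeneric_family: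
  "\<exists>\<A>. countable \<A> \<and> \<A> \<subseteq> K n \<and> (\<forall>x. length x = n \<longrightarrow> (\<not> r \<le> rk P (set x) \<longleftrightarrow> (\<exists>B\<in>\<A>. x \<in> B)))"
proof (cases r)
  case 0 then show ?thesis by (intro exI[of _ "{}"]) simp
next
  case (Suc r')
  then have "\<not> r \<le> rk P (set x) \<longleftrightarrow> rk P (set x) \<le> r'" for x by auto
  then show ?thesis using rank_le_family[of n r'] by (simp only:) blast
qed

text \<open>A tuple that is independent from \<open>P\<close> has its \<open>K\<close>-type determined by its \<open>L\<close>-type.\<close>
lemma sim_of_eqtp:
  assumes "eqtp x y" "rk {} (set x) \<le> rk P (set x)" "rk {} (set y) \<le> rk P (set y)"
  shows "R x y"
proof -
  have *: "good (set z) \<and> set z \<inter> P = {}" if "rk {} (set z) \<le> rk P (set z)" for z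
  proof -
    have e: "Psupp (set z) = {}" using Psupp_bound[of "{}" "set z"] that by simp
    have "p \<in> Psupp (set z)" if "p \<in> set z" "p \<in> P" for p
      using that F.cl_ext[of "set z \<union> (P - {p})"] unfolding Psupp_def by blast
    then show ?thesis using good_Un_Psupp[of "set z"] e by auto
  qed
  have "sim x y" unfolding sim_def using assms(1) *[OF assms(2)] *[OF assms(3)] eqtp_length[OF assms(1)]
    by (metis disjoint_iff nth_mem)
  then show ?thesis unfolding R_def using eqtp_length[OF assms(1)] by (intro conjI exI[of _ "[]"]) auto
qed

text \<open>A tuple whose rank is at most \<open>r\<close> over the empty set and at least
  \<open>r\<close> over \<open>P\<close> is independent from \<open>P\<close>, so its type in
  \<open>L\<close> decides membership in \<open>X\<close>. Saturation therefore gives each generic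
  point of \<open>X\<close> a neighbourhood in \<open>L\<close> that stays in \<open>X\<close> up to
  points of smaller rank; finitely many of them cover the generic part by compactness. The condition
  \<Phi> holds throughout the approximation and caps the rank.\<close>

lemma definable_approx:
  assumes X: "X \<in> K n" and ex: "\<And>x. x \<in> X \<Longrightarrow> r \<le> rk P (set x) \<Longrightarrow> \<exists>W\<in>L n. x \<in> W \<and> (\<forall>y\<in>W. \<Phi> y)"
    and \<Phi>: "\<And>y. \<Phi> y \<Longrightarrow> rk {} (set y) \<le> r"
  shows "\<exists>Y\<in>L n. (\<forall>y\<in>Y. \<Phi> y) \<and> (\<forall>x. r \<le> rk P (set x) \<longrightarrow> (x \<in> Y \<longleftrightarrow> x \<in> X))"
proof -
  obtain \<A> where A: "countable \<A>" "\<A> \<subseteq> K n" "\<And>x. length x = n \<Longrightarrow> \<not> r \<le> rk P (set x) \<longleftrightarrow> (\<exists>B\<in>\<A>. x \<in> B)"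
    using nongeneric_family[of n r] by blast
  define \<V> where "\<V> = {V \<in> L n. (\<forall>y\<in>V. \<Phi> y) \<and> (\<forall>y\<in>V. r \<le> rk P (set y) \<longrightarrow> y \<in> X)}"
  have cover: "\<exists>V\<in>\<V>. x \<in> V" if x: "x \<in> X" "r \<le> rk P (set x)" for x
  proof (rule ccontr)
    assume neg: "\<not> (\<exists>V\<in>\<V>. x \<in> V)"
    obtain W where W: "W \<in> L n" "x \<in> W" "\<forall>y\<in>W. \<Phi> y" using ex[OF x] by blast
    have lx: "length x = n" using K.length_mem[OF X x(1)] .
    define I where "I = {V \<in> L n. x \<in> V}"
    have "\<exists>y. length y = n \<and> (\<forall>V\<in>I. [] @ y \<in> V - X) \<and> (\<forall>B\<in>\<A>. [] @ y \<in> tuples n - B)"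
    proof (rule saturation2[where m = 0])
      show "countable I" unfolding I_def using L_countable by (rule countable_subset[rotated]) blast
      show "countable \<A>" by fact
      show "V - X \<in> K (0 + n)" if "V \<in> I" for V using that L_K[of n] X K.Diff_mem[of V n X] unfolding I_def by auto
      show "tuples n - B \<in> K (0 + n)" if "B \<in> \<A>" for B using that A(2) K.compl_mem by auto
      fix I' J' assume I': "finite I'" "I' \<subseteq> I" and J': "finite J'" "J' \<subseteq> \<A>"
      let ?V = "W \<inter> (tuples n \<inter> \<Inter>I')"
      have "?V \<in> L n" by (intro L.Int_mem[OF W(1)] L.finite_INT_mem) (use I' in \<open>auto simp: I_def\<close>)
      moreover have xV: "x \<in> ?V" using W(2) I' lx unfolding I_def by auto
      moreover have "\<forall>y\<in>?V. \<Phi> y" using W(3) by blast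
      moreover have "?V \<notin> \<V>"
      proof
        assume "?V \<in> \<V>"
        then have "\<exists>V\<in>\<V>. x \<in> V" using xV by (intro bexI[of _ ?V])
        then show False using neg by (rule notE[rotated])
      qed
      ultimately have "\<not> (\<forall>y\<in>?V. r \<le> rk P (set y) \<longrightarrow> y \<in> X)" unfolding \<V>_def by simp
      then obtain y where y: "y \<in> ?V" "r \<le> rk P (set y)" "y \<notin> X" by blast
      then have "\<forall>B\<in>J'. y \<notin> B" using A(3)[of y] J' by auto
      then show "\<exists>y. length y = n \<and> (\<forall>V\<in>I'. [] @ y \<in> V - X) \<and> (\<forall>B\<in>J'. [] @ y \<in> tuples n - B)"
        using y by (intro exI[of _ y]) auto
    qed simp
    then obtain y where y: "length y = n" "\<And>V. V \<in> I \<Longrightarrow> y \<in> V - X" "\<And>B. B \<in> \<A> \<Longrightarrow> y \<notin> B" by auto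
    have e: "eqtp x y" by (rule eqtpI) (use y lx in \<open>auto simp: I_def\<close>)
    have "W \<in> I" unfolding I_def using W(1,2) by simp
    then have "\<Phi> y" using y(2) W(3) by blast
    then have "rk {} (set y) \<le> r" by (rule \<Phi>)
    moreover have "r \<le> rk P (set y)" using A(3)[OF y(1)] y(3) by blast
    ultimately have "rk {} (set y) \<le> rk P (set y)" by simp
    moreover have "\<Phi> x" using W by blast
    then have "rk {} (set x) \<le> rk P (set x)" using x(2) \<Phi>[of x] by simp
    ultimately have "R x y" by (intro sim_of_eqtp[OF e])
    then have "y \<in> X" by (rule K_invariant[OF X _ x(1)])
    moreover have "tuples n \<in> I" unfolding I_def using L.full_mem lx by simp
    ultimately show False using y(2) by blast
  qed
  have c3: "X \<subseteq> \<Union>(\<V> \<union> \<A>)"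
  proof
    fix x assume x: "x \<in> X"
    then show "x \<in> \<Union>(\<V> \<union> \<A>)" using cover[OF x] A(3)[of x] K.length_mem[OF X x] by blast
  qed
  have "countable \<V>" by (rule countable_subset[OF _ L_countable[of n]]) (auto simp: \<V>_def)
  then have c1: "countable (\<V> \<union> \<A>)" using A(1) by simp
  have c2: "\<V> \<union> \<A> \<subseteq> K n" unfolding \<V>_def using A(2) L_K by blast
  obtain \<B> where B: "finite \<B>" "\<B> \<subseteq> \<V> \<union> \<A>" "X \<subseteq> \<Union>\<B>"
    by (rule exE[OF compactness[OF X c1 c2 c3]]) (elim conjE, rule that)
  let ?Y = "\<Union>(\<B> \<inter> \<V>)"
  have "?Y \<in> L n" by (rule L.finite_UN_mem) (use B(1) in \<open>auto simp: \<V>_def\<close>)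
  moreover have "\<forall>y\<in>?Y. \<Phi> y" unfolding \<V>_def by blast
  moreover have "\<forall>x. r \<le> rk P (set x) \<longrightarrow> (x \<in> ?Y \<longleftrightarrow> x \<in> X)"
  proof (intro allI impI iffI)
    fix x assume r: "r \<le> rk P (set x)"
    show "x \<in> ?Y \<Longrightarrow> x \<in> X" using r unfolding \<V>_def by blast
    assume x: "x \<in> X"
    then obtain B' where B': "B' \<in> \<B>" "x \<in> B'" using B(3) by blast
    then have "B' \<notin> \<A>" using A(3)[of x] r K.length_mem[OF X x] by blast
    then show "x \<in> ?Y" using B' B(2) by blast
  qed
  ultimately show ?thesis by blast
qed

text \<open>Each single dependence is witnessed by one set in \<open>F\<close>, so it persists on
  the set in \<open>L\<close> defined by that witness. Sets in \<open>L\<close> act here as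
  neighbourhoods.\<close>

lemma open_cl:
  assumes "length w = n" "\<forall>j\<in>set J. j < n" "\<forall>i\<in>set I. i < n" "set (map ((!) w) I) \<subseteq> cl (set (map ((!) w) J))"
  shows "\<exists>W\<in>L n. w \<in> W \<and> (\<forall>w'\<in>W. set (map ((!) w') I) \<subseteq> cl (set (map ((!) w') J)))"
  using assms(3,4)
proof (induction I)
  case Nil then show ?case using assms(1) L.full_mem by (intro bexI[of _ "tuples n"]) auto
next
  case (Cons i I)
  then obtain W where W: "W \<in> L n" "w \<in> W" "\<forall>w'\<in>W. set (map ((!) w') I) \<subseteq> cl (set (map ((!) w') J))" by auto
  have "w ! i \<in> cl (set (map ((!) w) J))" using Cons by simp
  then obtain X where X: "X \<in> F (length (map ((!) w) J))" "map ((!) w) J @ [w ! i] \<in> X" using F.cl_set_iff by blast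
  let ?V = "{w' \<in> tuples n. map ((!) w') (J @ [i]) \<in> X}"
  have "X \<in> L (length (J @ [i]))" using X(1) F_L by auto
  then have V: "?V \<in> L n" by (rule L.reindex_mem) (use assms(2) Cons.prems in auto)
  have "w' ! i \<in> cl (set (map ((!) w') J))" if "w' \<in> ?V" for w'
    by (rule F.cl_set_iff[THEN iffD2], rule bexI[of _ X]) (use that X(1) in auto)
  moreover have "w \<in> ?V" using X(2) assms(1) by simp
  ultimately show ?case using W L.Int_mem[OF W(1) V] by (intro bexI[of _ "W \<inter> ?V"]) auto
qed

text \<open>A basis of \<open>x\<close> is fixed by its positions; the entries at the same positions
  generate every tuple on which the dependences of the remaining entries persist.\<close>

lemma open_rk:
  assumes "rk {} (set x) \<le> r" "length x = n" shows "\<exists>W\<in>L n. x \<in> W \<and> (\<forall>y\<in>W. rk {} (set y) \<le> r)"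
proof -
  obtain B where B: "B \<subseteq> set x" "card B = rk {} (set x)" "set x \<subseteq> cl ({} \<union> B)" using F.basis_exists[of "set x" "{}"] by auto
  have fB: "finite B" using B(1) finite_subset by blast
  have "\<forall>b\<in>B. \<exists>j<n. x ! j = b" using B(1) assms(2) by (metis in_set_conv_nth subsetD)
  then obtain h where h: "\<And>b. b \<in> B \<Longrightarrow> h b < n \<and> x ! h b = b" by metis
  obtain bs where bs: "set bs = B" "distinct bs" using finite_distinct_list[OF fB] by blast
  let ?J = "map h bs"
  have mJ: "map ((!) x) ?J = bs" unfolding map_map by (rule map_idI) (use h bs in auto)
  have lJ: "length ?J \<le> r" using bs B(2) assms(1) distinct_card[OF bs(2)] by simp
  have mI: "set (map ((!) y) [0..<n]) = set y" if "length y = n" for y :: "'b list" using that map_nth[of y] by simp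
  obtain W where W: "W \<in> L n" "x \<in> W" "\<forall>w'\<in>W. set (map ((!) w') [0..<n]) \<subseteq> cl (set (map ((!) w') ?J))"
    using open_cl[OF assms(2), of ?J "[0..<n]"] h bs mJ mI[OF assms(2)] B(3) by auto
  have "rk {} (set y) \<le> r" if y: "y \<in> W" for y
  proof -
    have "set y \<subseteq> cl ({} \<union> set (map ((!) y) ?J))" using bspec[OF W(3) y] mI[OF L.length_mem[OF W(1) y]] by (simp only: Un_empty_left)
    then have "rk {} (set y) \<le> rk {} (set (map ((!) y) ?J))" by (intro F.rk_le_cl) auto
    also have "\<dots> \<le> card (set (map ((!) y) ?J))" by (rule F.rk_le_card) simp
    also have "\<dots> \<le> r" using card_length[of "map ((!) y) ?J"] lJ by simp
    finally show ?thesis .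
  qed
  then show ?thesis using W by blast
qed

text \<open>The condition on the right mentions \<open>P\<close> and a closure, yet defines a set in
  \<open>L\<close>: the set \<open>E\<close> of \<open>split\<close> consists of the base points
  with large fibres, and by codensity and saturation these are the ones whose fibre has a point
  outside the closure over \<open>P\<close>.\<close>

lemma generic_ex1:
  assumes X: "X \<in> L (Suc n)"
  shows "\<exists>E\<in>L n. \<forall>a. length a = n \<longrightarrow> (a \<in> E \<longleftrightarrow> (\<exists>u. a @ [u] \<in> X \<and> u \<notin> cl (P \<union> set a)))"
proof -
  obtain E where E: "E \<in> L n" "{as @ [u] | as u. as @ [u] \<in> X \<and> as \<notin> E} \<in> F n"
    and fat: "\<forall>as\<in>E. (\<forall>bs. \<forall>Z\<in>F (n + length bs). \<exists>p\<in>P. as @ [p] \<in> X \<and> as @ bs @ [p] \<notin> Z) \<and>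
          (\<forall>bs \<Z>. finite \<Z> \<longrightarrow> (\<forall>(k, Z)\<in>\<Z>. Z \<in> F (n + length bs + k)) \<longrightarrow>
             (\<exists>u. as @ [u] \<in> X \<and> (\<forall>(k, Z)\<in>\<Z>. \<forall>q. set q \<subseteq> P \<longrightarrow> length q = k \<longrightarrow> as @ bs @ q @ [u] \<notin> Z)))"
    by (rule bexE[OF split[OF assms(1)]]) (elim conjE, rule that)
  have "a \<in> E \<longleftrightarrow> (\<exists>u. a @ [u] \<in> X \<and> u \<notin> cl (P \<union> set a))" if la: "length a = n" for a
  proof
    assume "\<exists>u. a @ [u] \<in> X \<and> u \<notin> cl (P \<union> set a)"
    then obtain u where u: "a @ [u] \<in> X" "u \<notin> cl (P \<union> set a)" by blast
    show "a \<in> E"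
    proof (rule ccontr)
      assume "a \<notin> E"
      then have "a @ [u] \<in> {as @ [u] | as u. as @ [u] \<in> X \<and> as \<notin> E}" using u(1) by blast
      then have "u \<in> cl (set a)" using E(2) unfolding la[symmetric] by (intro F.cl_set_iff[THEN iffD2] bexI)
      then show False using u(2) F.cl_mono[of "set a" "P \<union> set a"] by blast
    qed
  next
    assume aE: "a \<in> E"
    define \<Z> where "\<Z> = (SIGMA k:UNIV. F (n + k))"
    define neg where "neg = (\<lambda>(k, Z). tuples (Suc n) - Pcl n k Z)"
    have "\<exists>z. length z = 1 \<and> (\<forall>Y\<in>{X}. a @ z \<in> Y) \<and> (\<forall>j\<in>\<Z>. a @ z \<in> neg j)"
    proof (rule saturation2)
      show "countable \<Z>" unfolding \<Z>_def by (intro countable_SIGMA F_countable) auto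
      show "Y \<in> K (n + 1)" if "Y \<in> {X}" for Y using that X L_K by auto
      show "neg j \<in> K (n + 1)" if "j \<in> \<Z>" for j
        using that Pcl_mem[of _ n] K.compl_mem unfolding neg_def \<Z>_def by auto
      show "length a = n" by fact
      fix \<Y> \<W> assume Y: "finite \<Y>" "\<Y> \<subseteq> {X}" and W: "finite \<W>" "\<W> \<subseteq> \<Z>"
      have "\<forall>(k, Z)\<in>\<W>. Z \<in> F (n + length ([]::'b list) + k)" using W unfolding \<Z>_def by auto
      then obtain v where v: "a @ [v] \<in> X" "\<forall>(k, Z)\<in>\<W>. \<forall>q. set q \<subseteq> P \<longrightarrow> length q = k \<longrightarrow> a @ [] @ q @ [v] \<notin> Z"
        using conjunct2[OF bspec[OF fat aE]] W(1) by blast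
      have "\<forall>j\<in>\<W>. a @ [v] \<in> neg j" using v(2) la unfolding neg_def Pcl_def by force
      then show "\<exists>z. length z = 1 \<and> (\<forall>X\<in>\<Y>. a @ z \<in> X) \<and> (\<forall>j\<in>\<W>. a @ z \<in> neg j)"
        using v(1) Y by (intro exI[of _ "[v]"]) auto
    qed simp
    then obtain v where v: "a @ [v] \<in> X" "\<forall>j\<in>\<Z>. a @ [v] \<in> neg j"
      by (metis One_nat_def length_0_conv length_Suc_conv singletonI)
    have "v \<notin> cl (set a \<union> P)" unfolding cl_P_iff using v(2) la unfolding neg_def \<Z>_def by auto
    then show "\<exists>u. a @ [u] \<in> X \<and> u \<notin> cl (P \<union> set a)" using v(1) by (auto simp: Un_commute)
  qed
  then show ?thesis using E(1) by blast
qed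

text \<open>The last coordinate is eliminated with \<open>generic_ex1\<close>: either it raises the
  rank by one, or it is arbitrary and the remaining coordinates have rank at least \<open>r\<close>
  already. Quantifiers over generic tuples thus stay within \<open>L\<close>.\<close>

lemma generic_ex:
  "X \<in> L (m + k) \<Longrightarrow> \<exists>E\<in>L m. \<forall>a. length a = m \<longrightarrow>
     (a \<in> E \<longleftrightarrow> (\<exists>x. length x = k \<and> a @ x \<in> X \<and> r \<le> rk (P \<union> set a) (set x)))"
proof (induction k arbitrary: X r)
  case 0
  show ?case
  proof (cases "r = 0")
    case True then show ?thesis using 0 by (intro bexI[of _ X]) auto
  next
    case False then show ?thesis using L.empty_mem by (intro bexI[of _ "{}"]) auto
  qed
next
  case (Suc k)
  then have X: "X \<in> L (Suc (m + k))" by simp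
  obtain E0 where E0: "E0 \<in> L (m + k)" "\<And>a. length a = m + k \<Longrightarrow> a \<in> E0 \<longleftrightarrow> (\<exists>u. a @ [u] \<in> X \<and> u \<notin> cl (P \<union> set a))"
    using generic_ex1[OF X] by blast
  obtain E1 where E1: "E1 \<in> L m" "\<And>a. length a = m \<Longrightarrow>
     a \<in> E1 \<longleftrightarrow> (\<exists>x. length x = k \<and> a @ x \<in> E0 \<and> r - 1 \<le> rk (P \<union> set a) (set x))" using Suc.IH[OF E0(1)] by blast
  obtain E2 where E2: "E2 \<in> L m" "\<And>a. length a = m \<Longrightarrow>
     a \<in> E2 \<longleftrightarrow> (\<exists>x. length x = k \<and> a @ x \<in> butlast ` X \<and> r \<le> rk (P \<union> set a) (set x))" using Suc.IH[OF L.proj_mem[OF X]] by blast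
  have bl: "w \<in> butlast ` X \<longleftrightarrow> (\<exists>u. w @ [u] \<in> X)" for w
  proof
    assume "w \<in> butlast ` X"
    then obtain z where z: "z \<in> X" "w = butlast z" by blast
    then have "z \<noteq> []" using L.length_mem[OF X] by fastforce
    then have "w @ [last z] = z" using z(2) by simp
    then show "\<exists>u. w @ [u] \<in> X" using z(1) by metis
  next
    assume "\<exists>u. w @ [u] \<in> X"
    then obtain u where "w @ [u] \<in> X" by blast
    then show "w \<in> butlast ` X" by (rule image_eqI[rotated]) simp
  qed
  have "a \<in> E1 \<union> E2 \<longleftrightarrow> (\<exists>x. length x = Suc k \<and> a @ x \<in> X \<and> r \<le> rk (P \<union> set a) (set x))" if la: "length a = m" for a
  proof -
    have rkx: "rk (P \<union> set a) (set (x @ [u])) = rk (P \<union> set a) (set x) + (if u \<in> cl (P \<union> set (a @ x)) then 0 else 1)" for x u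
      using F.rk_insert[of "set x" "P \<union> set a" u] by (simp add: Un_assoc)
    have "a \<in> E1 \<union> E2 \<longleftrightarrow> (\<exists>x u. length x = k \<and> (a @ x) @ [u] \<in> X \<and>
       ((u \<notin> cl (P \<union> set (a @ x)) \<and> r - 1 \<le> rk (P \<union> set a) (set x)) \<or> r \<le> rk (P \<union> set a) (set x)))"
      unfolding Un_iff E1(2)[OF la] E2(2)[OF la] bl using E0(2) la by (metis length_append)
    also have "\<dots> \<longleftrightarrow> (\<exists>x u. length x = k \<and> a @ (x @ [u]) \<in> X \<and> r \<le> rk (P \<union> set a) (set (x @ [u])))"
      unfolding rkx by (intro ex_cong1) auto
    also have "\<dots> \<longleftrightarrow> (\<exists>x. length x = Suc k \<and> a @ x \<in> X \<and> r \<le> rk (P \<union> set a) (set x))"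
      by (metis length_Suc_conv_rev)
    finally show ?thesis .
  qed
  then show ?case using L.Un_mem[OF E1(1) E2(1)] by blast
qed

text \<open>A free extension of the type of \<open>x\<close>. The support is copied to points of
  \<open>P\<close> outside \<open>B\<close>; then each entry of \<open>x\<close> either follows
  because it depends on what has been copied, or is chosen outside the closure over \<open>P\<close>
  and \<open>B\<close>. A non-empty support stays non-empty, since by \<open>Psupp_self\<close> it
  is visible in the type.\<close>

lemma independent_copy:
  "\<exists>x'. R x x' \<and> rk (P \<union> set B) (set x') = rk P (set x) \<and> Psupp (set x') \<inter> set B = {} \<and>
     (Psupp (set x) \<noteq> {} \<longrightarrow> Psupp (set x') \<noteq> {})"
proof -
  obtain q where q: "set q = Psupp (set x)" "distinct q" using finite_distinct_list[OF Psupp_finite[of "set x"]] by auto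
  have s0: "sim [] []" by (rule sim_refl) (simp add: good_empty)
  obtain q' where q': "set q' \<subseteq> P" "sim q q'" "set q' \<inter> set B = {}"
    using sim_ext_Ps[OF s0 _ q(2), of B] q(1) Psupp_P by auto
  have lq: "length q' = length q" using sim_length[OF q'(2)] by simp
  have step: "\<exists>xs'. sim (q @ xs) (q' @ xs') \<and> rk (P \<union> set B) (set xs') = rk P (set xs)" if "set xs \<subseteq> set x" for xs
    using that
  proof (induction xs rule: rev_induct)
    case Nil then show ?case using q'(2) by (intro exI[of _ "[]"]) simp
  next
    case (snoc u xs)
    then obtain xs' where s: "sim (q @ xs) (q' @ xs')" and r: "rk (P \<union> set B) (set xs') = rk P (set xs)" by auto
    show ?case
    proof (cases "u \<in> cl (set (q @ xs))")
      case True
      then obtain v where v: "v \<in> cl (set (q' @ xs'))" "sim ((q @ xs) @ [u]) ((q' @ xs') @ [v])" using sim_ext_cl[OF s] by blast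
      have "u \<in> cl (P \<union> set xs)" using True F.cl_mono[of "set (q @ xs)" "P \<union> set xs"] q(1) Psupp_P by auto
      moreover have "v \<in> cl (P \<union> set B \<union> set xs')" using v(1) F.cl_mono[of "set (q' @ xs')" "P \<union> set B \<union> set xs'"] q'(1) by auto
      ultimately show ?thesis using v(2) r F.rk_insert[of "set xs" P u] F.rk_insert[of "set xs'" "P \<union> set B" v]
        by (intro exI[of _ "xs' @ [v]"]) simp
    next
      case False
      \<comment> \<open>The support \<open>q\<close> already accounts for all dependence on
        \<open>P\<close>: further points of \<open>P\<close> cannot help to reach
        \<open>u\<close>.\<close>
      have "u \<notin> cl (set (q @ xs) \<union> P)"
      proof
        assume a: "u \<in> cl (set (q @ xs) \<union> P)"
        have "Psupp (insert u (set (q @ xs))) \<subseteq> set (q @ xs)"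
        proof (rule ccontr)
          assume "\<not> ?thesis"
          then obtain p where p: "p \<in> P" "p \<in> cl (insert u (set (q @ xs)) \<union> (P - {p}))" "p \<notin> set (q @ xs)" unfolding Psupp_def by blast
          have "insert u (set (q @ xs)) \<union> (P - {p}) \<subseteq> set x \<union> (P - {p})" using p(3) q(1) Psupp_P snoc.prems by auto
          then have "p \<in> Psupp (set x)" using p F.cl_mono unfolding Psupp_def by blast
          then show False using p(3) q(1) by simp
        qed
        then show False using cl_drop_good[OF a] False by blast
      qed
      moreover from this have "u \<notin> cl (P \<union> set xs)" using F.cl_mono[of "P \<union> set xs" "set (q @ xs) \<union> P"] by auto
      moreover obtain v where v: "v \<notin> cl (set (q' @ xs') \<union> set B \<union> P)" "sim ((q @ xs) @ [u]) ((q' @ xs') @ [v])"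
        using sim_ext_generic[OF s] calculation by blast
      moreover have "v \<notin> cl (P \<union> set B \<union> set xs')"
        using v(1) F.cl_mono[of "P \<union> set B \<union> set xs'" "set (q' @ xs') \<union> set B \<union> P"] by auto
      ultimately show ?thesis using r F.rk_insert[of "set xs" P u] F.rk_insert[of "set xs'" "P \<union> set B" v]
        by (intro exI[of _ "xs' @ [v]"]) simp
    qed
  qed
  obtain x' where s: "sim (q @ x) (q' @ x')" and r: "rk (P \<union> set B) (set x') = rk P (set x)" using step[of x] by blast
  have lx: "length x' = length x" using sim_length[OF s] lq by simp
  let ?n = "length x" let ?m = "length q"
  let ?js = "[?m..<?m + ?n] @ [0..<?m]"
  have mj: "map ((!) (a @ b)) ([length a..<length a + length b] @ [0..<length a]) = b @ a" for a b :: "'b list"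
    by (intro nth_equalityI) (auto simp: nth_append)
  have "sim (map ((!) (q @ x)) ?js) (map ((!) (q' @ x')) ?js)" by (rule sim_reindex[OF s]) auto
  then have s2: "sim (x @ q) (x' @ q')" using mj[of q x] mj[of q' x'] lq lx by simp
  then have "R x x'" unfolding R_def using lx by auto
  moreover have "Psupp (set x') \<subseteq> set q'"
  proof
    fix p assume p: "p \<in> Psupp (set x')"
    have "good (set (x' @ q'))" using s2 unfolding sim_def by blast
    then have "p \<in> set (x' @ q')" using p Psupp_good Psupp_mono[of "set x'" "set (x' @ q')"] by auto
    moreover have "p \<in> set q'" if "p \<in> set x'"
    proof -
      obtain i where i: "i < ?n" "x' ! i = p" using \<open>p \<in> set x'\<close> lx by (metis in_set_conv_nth)
      have "x ! i \<in> P" using R_match[OF \<open>R x x'\<close> i(1)] i(2) p Psupp_P by auto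
      then have "x ! i \<in> Psupp (set x)"
        using i(1) F.cl_ext[of "set x \<union> (P - {x ! i})"] unfolding Psupp_def by auto
      then obtain j where j: "j < ?m" "q ! j = x ! i" using q(1) by (metis in_set_conv_nth)
      have "(x' @ q') ! i = (x' @ q') ! (?n + j)"
        by (rule eqtp_nth_eq[of "x @ q"]) (use s2 i j in \<open>auto simp: sim_def nth_append\<close>)
      then have "p = q' ! j" using i j lx by (simp add: nth_append)
      then show ?thesis using j lq by simp
    qed
    ultimately show "p \<in> set q'" by auto
  qed
  moreover have "Psupp (set x') \<noteq> {}" if ne: "Psupp (set x) \<noteq> {}"
  proof -
    obtain p qs where qs: "q = p # qs" using ne q(1) by (cases q) auto
    then obtain p' qs' where qs': "q' = p' # qs'" using lq by (cases q') auto
    have "Psupp (set x) - {p} = set qs" using q qs by auto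
    moreover have "p \<in> Psupp (set x)" using q(1) qs by auto
    ultimately have "p \<in> cl (set (x @ qs))" using Psupp_self[of p "set x"] by simp
    moreover have "eqtp ((x @ qs) @ [p]) ((x' @ qs') @ [p'])"
    proof -
      let ?k = "length qs"
      let ?is = "[0..<?n] @ [Suc ?n..<Suc ?n + ?k] @ [?n]"
      have mm: "map ((!) (a @ c # b)) ([0..<length a] @ [Suc (length a)..<Suc (length a) + length b] @ [length a]) = (a @ b) @ [c]" for a b :: "'b list" and c
        by (intro nth_equalityI) (auto simp: nth_append simp del: upt_Suc)
      have "eqtp (map ((!) (x @ q)) ?is) (map ((!) (x' @ q')) ?is)"
        by (rule eqtp_reindex) (use s2 qs in \<open>auto simp: sim_def\<close>)
      moreover have "length qs' = ?k" using lq qs qs' by simp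
      ultimately show ?thesis using mm[of x p qs] mm[of x' p' qs'] qs qs' lx by simp
    qed
    ultimately have "p' \<in> cl (set (x' @ qs'))" by (rule eqtp_cl[rotated])
    \<comment> \<open>An equality among entries of \<open>q'\<close> would transfer back to
      \<open>q\<close>, which is distinct.\<close>
    moreover have "p' \<notin> set qs'"
    proof
      assume "p' \<in> set qs'"
      then obtain j where j: "j < length qs'" "qs' ! j = p'" by (metis in_set_conv_nth)
      have "q ! 0 = q ! Suc j"
        by (rule eqtp_nth_eq[of q']) (use q'(2) j qs' eqtp_sym in \<open>auto simp: sim_def\<close>)
      moreover have "Suc j < length q" using j lq qs' by simp
      ultimately show False using q(2) by (metis Zero_not_Suc length_greater_0_conv list.discI nth_eq_iff_index_eq qs)
    qed
    then have "set (x' @ qs') \<subseteq> set x' \<union> (P - {p'})" using q'(1) qs' by auto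
    ultimately have "p' \<in> Psupp (set x')" using q'(1) qs' F.cl_mono[of "set (x' @ qs')" "set x' \<union> (P - {p'})"] unfolding Psupp_def by auto
    then show ?thesis by blast
  qed
  ultimately show ?thesis using r q'(3) by blast
qed

end

section \<open>Group chunks\<close>

text \<open>The calculus of \<open>dfn\<close> with variables ranging over \<open>n\<close>-tuples: variable \<open>v\<close> stands for the
  block of coordinates from \<open>v * n\<close> to \<open>v * n + n - 1\<close>.\<close>
definition bset :: "nat \<Rightarrow> nat \<Rightarrow> ((nat \<Rightarrow> 'a list) \<Rightarrow> bool) \<Rightarrow> 'a list set" where
  "bset n m \<phi> = {concat bs | bs. length bs = m \<and> (\<forall>b\<in>set bs. length b = n) \<and> \<phi> ((!) bs)}"

lemma in_bset:
  assumes "length bs = m" "\<forall>b\<in>set bs. length b = n" shows "concat bs \<in> bset n m \<phi> \<longleftrightarrow> \<phi> ((!) bs)"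
proof
  assume "concat bs \<in> bset n m \<phi>"
  then obtain cs where cs: "concat bs = concat cs" "length cs = m" "\<forall>b\<in>set cs. length b = n" "\<phi> ((!) cs)"
    unfolding bset_def by blast
  have "\<forall>(x, y)\<in>set (zip bs cs). length x = length y"
  proof clarify
    fix x y assume "(x, y) \<in> set (zip bs cs)"
    then have "x \<in> set bs" "y \<in> set cs" by (auto dest: set_zip_leftD set_zip_rightD)
    then show "length x = length y" using assms(2) cs(3) by simp
  qed
  then have "bs = cs" using concat_injective[of bs cs] cs assms by simp
  then show "\<phi> ((!) bs)" using cs by simp
qed (use assms in \<open>auto simp: bset_def\<close>)

definition bdfn :: "(nat \<Rightarrow> 'a list set set) \<Rightarrow> nat \<Rightarrow> ((nat \<Rightarrow> 'a list) \<Rightarrow> bool) \<Rightarrow> bool" where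
  "bdfn S n \<phi> \<longleftrightarrow> dfn S (\<lambda>e. \<phi> (\<lambda>v. map e [v * n..<v * n + n]))"

lemma block_less: "v < m \<Longrightarrow> v * n + n \<le> m * (n::nat)"
  by (metis Suc_leI add.commute mult_Suc mult_le_mono1)

lemma block_upds:
  assumes "length zs = n"
  shows "(\<lambda>w. map (upds e (v * n) zs) [w * n..<w * n + n]) = (\<lambda>w. map e [w * n..<w * n + n])(v := zs)"
proof
  fix w
  show "map (upds e (v * n) zs) [w * n..<w * n + n] = ((\<lambda>w. map e [w * n..<w * n + n])(v := zs)) w"
  proof (cases "w = v")
    case True then show ?thesis using upds_simps(2)[OF assms] by simp
  next
    case False
    have "upds e (v * n) zs i = e i" if i: "i \<in> set [w * n..<w * n + n]" for i
    proof (cases "w < v")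
      case True
      then show ?thesis using block_less[OF True, of n] i unfolding upds_def by auto
    next
      case False
      with \<open>w \<noteq> v\<close> have "v < w" by simp
      then show ?thesis using block_less[of v w n] i assms unfolding upds_def by auto
    qed
    then show ?thesis using False by simp
  qed
qed

context struct begin

lemma bdfn_atom: assumes "X \<in> S (n * length vs)" shows "bdfn S n (\<lambda>E. concat (map E vs) \<in> X)"
proof -
  let ?js = "concat (map (\<lambda>v. [v * n..<v * n + n]) vs)"
  have "length ?js = n * length vs" by (induction vs) auto
  then have "dfn S (\<lambda>e. map e ?js \<in> X)" using dfn_atom[of X ?js] assms by simp
  moreover have "map e ?js = concat (map (\<lambda>v. map e [v * n..<v * n + n]) vs)" for e :: "nat \<Rightarrow> 'a"
    by (simp add: map_concat comp_def)
  ultimately show ?thesis unfolding bdfn_def by (simp only:)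
qed

lemma bdfn_atom1: "X \<in> S n \<Longrightarrow> bdfn S n (\<lambda>E. E a \<in> X)"
  using bdfn_atom[of X n "[a]"] by simp

lemma bdfn_atom3: "X \<in> S (n * 3) \<Longrightarrow> bdfn S n (\<lambda>E. E a @ E b @ E c \<in> X)"
  using bdfn_atom[of X n "[a, b, c]"] by (simp add: numeral_3_eq_3)

lemma bdfn_not: "bdfn S n \<phi> \<Longrightarrow> bdfn S n (\<lambda>E. \<not> \<phi> E)" unfolding bdfn_def by (rule dfn_not)
lemma bdfn_conj: "bdfn S n \<phi> \<Longrightarrow> bdfn S n \<psi> \<Longrightarrow> bdfn S n (\<lambda>E. \<phi> E \<and> \<psi> E)" unfolding bdfn_def by (rule dfn_conj)
lemma bdfn_imp: "bdfn S n \<phi> \<Longrightarrow> bdfn S n \<psi> \<Longrightarrow> bdfn S n (\<lambda>E. \<phi> E \<longrightarrow> \<psi> E)" unfolding bdfn_def by (rule dfn_imp)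
lemma bdfn_Ball: "finite I \<Longrightarrow> (\<And>i. i \<in> I \<Longrightarrow> bdfn S n (\<phi> i)) \<Longrightarrow> bdfn S n (\<lambda>E. \<forall>i\<in>I. \<phi> i E)"
  unfolding bdfn_def by (rule dfn_Ball)
lemma bdfn_Bex: "finite I \<Longrightarrow> (\<And>i. i \<in> I \<Longrightarrow> bdfn S n (\<phi> i)) \<Longrightarrow> bdfn S n (\<lambda>E. \<exists>i\<in>I. \<phi> i E)"
  unfolding bdfn_def by (rule dfn_Bex)

lemma bdfn_eq: "bdfn S n (\<lambda>E. E a = E b)"
proof -
  have "dfn S (\<lambda>e. \<forall>i\<in>{..<n}. e (a * n + i) = e (b * n + i))" by (rule dfn_Ball) (auto intro: dfn_eq)
  moreover have "(\<forall>i\<in>{..<n}. e (a * n + i) = e (b * n + i)) \<longleftrightarrow> map e [a * n..<a * n + n] = map e [b * n..<b * n + n]" for e :: "nat \<Rightarrow> 'a"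
    by (auto simp: list_eq_iff_nth_eq)
  ultimately show ?thesis unfolding bdfn_def by (simp only:)
qed

lemma bdfn_ex:
  assumes "bdfn S n (\<lambda>E. \<phi> E (E v))" "\<And>E b c. \<phi> (E(v := c)) b = \<phi> E b"
  shows "bdfn S n (\<lambda>E. \<exists>b. length b = n \<and> \<phi> E b)"
  unfolding bdfn_def
proof (rule dfn_exs[where l = "v * n"])
  show "dfn S (\<lambda>e. \<phi> (\<lambda>v. map e [v * n..<v * n + n]) (map e [v * n..<v * n + n]))"
    using assms(1) unfolding bdfn_def .
  fix e :: "nat \<Rightarrow> 'a" and ys zs :: "'a list" assume "length zs = n"
  then show "\<phi> (\<lambda>va. map (upds e (v * n) zs) [va * n..<va * n + n]) ys = \<phi> (\<lambda>v. map e [v * n..<v * n + n]) ys"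
    using block_upds[of zs n e v] assms(2) by simp
qed

lemma bdfn_all:
  assumes "bdfn S n (\<lambda>E. \<phi> E (E v))" "\<And>E b c. \<phi> (E(v := c)) b = \<phi> E b"
  shows "bdfn S n (\<lambda>E. \<forall>b. length b = n \<longrightarrow> \<phi> E b)"
proof -
  have "bdfn S n (\<lambda>E. \<exists>b. length b = n \<and> \<not> \<phi> E b)"
    by (rule bdfn_ex[where v = v]) (use assms bdfn_not in auto)
  from bdfn_not[OF this] show ?thesis by simp
qed

lemma bset_mem:
  assumes "bdfn S n \<phi>" and dep: "\<And>E E'. (\<forall>v<m. E v = E' v) \<Longrightarrow> \<phi> E = \<phi> E'"
  shows "bset n m \<phi> \<in> S (n * m)"
proof -
  let ?b = "\<lambda>xs v. map ((!) xs) [v * n..<v * n + n]"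
  have "{xs \<in> tuples (m * n). \<phi> (?b xs)} \<in> S (m * n)"
  proof (rule dfn_mem)
    show "dfn S (\<lambda>e. \<phi> (\<lambda>v. map e [v * n..<v * n + n]))" using assms(1) unfolding bdfn_def .
    fix e e' :: "nat \<Rightarrow> 'a" assume a: "\<forall>i<m * n. e i = e' i"
    have "map e [v * n..<v * n + n] = map e' [v * n..<v * n + n]" if "v < m" for v
      using a block_less[OF that, of n] by auto
    then show "\<phi> (\<lambda>v. map e [v * n..<v * n + n]) = \<phi> (\<lambda>v. map e' [v * n..<v * n + n])" by (intro dep) blast
  qed
  moreover have "{xs \<in> tuples (m * n). \<phi> (?b xs)} = bset n m \<phi>"
  proof -
    have len: "length (concat bs) = m * n" if "length bs = m" "\<forall>b\<in>set bs. length b = n" for bs :: "'a list list" and m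
      using that by (induction bs arbitrary: m) auto
    have blk: "?b (concat bs) v = bs ! v" if "v < length bs" "\<forall>b\<in>set bs. length b = n" for bs :: "'a list list" and v
      using that
    proof (induction bs arbitrary: v)
      case (Cons b bs)
      have l: "length b = n" using Cons.prems by simp
      show ?case
      proof (cases v)
        case 0 then show ?thesis using l by (intro nth_equalityI) (auto simp: nth_append)
      next
        case (Suc u)
        have "?b (concat (b # bs)) v = ?b (concat bs) u"
          by (rule nth_equalityI) (use l Suc in \<open>auto simp: nth_append\<close>)
        then show ?thesis using Cons Suc by simp
      qed
    qed simp
    have dec: "\<exists>bs. length bs = m \<and> (\<forall>b\<in>set bs. length b = n) \<and> concat bs = xs" if "length xs = m * n" for xs :: "'a list" and m
      using that
    proof (induction m arbitrary: xs)
      case (Suc m)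
      have "length (drop n xs) = m * n" using Suc.prems by simp
      then obtain bs where "length bs = m" "\<forall>b\<in>set bs. length b = n" "concat bs = drop n xs"
        using Suc.IH by blast
      then show ?case using Suc.prems by (intro exI[of _ "take n xs # bs"]) auto
    qed simp
    have "\<phi> (?b (concat bs)) = \<phi> ((!) bs)" if "length bs = m" "\<forall>b\<in>set bs. length b = n" for bs
      by (rule dep) (use blk that in auto)
    then show ?thesis unfolding bset_def using len dec by (auto 4 4) blast
  qed
  ultimately show ?thesis by (simp add: mult.commute)
qed

end

lemma map_nth_blocks:
  "length x = n \<Longrightarrow> length y = n \<Longrightarrow> length z = n \<Longrightarrow> map ((!) (x @ y @ z)) [0..<n] = x"
  "length x = n \<Longrightarrow> length y = n \<Longrightarrow> length z = n \<Longrightarrow> map ((!) (x @ y @ z)) [n..<2*n] = y"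
  "length x = n \<Longrightarrow> length y = n \<Longrightarrow> length z = n \<Longrightarrow> map ((!) (x @ y @ z)) [2*n..<3*n] = z"
  by (auto intro!: nth_equalityI simp: nth_append)

section \<open>Supports of generic group elements\<close>

locale sat_group = sat L K F P for L K F :: "nat \<Rightarrow> 'b list set set" and P :: "'b set" +
  fixes n :: nat and G :: "'b list set" and mul :: "'b list \<Rightarrow> 'b list \<Rightarrow> 'b list" and one :: "'b list"
  assumes G_K: "G \<in> K n" and Gr_K: "{x @ y @ mul x y | x y. x \<in> G \<and> y \<in> G} \<in> K (3 * n)"
    and group_G: "group (grp G mul one)"
begin

interpretation Gp: group "grp G mul one" by (rule group_G)

definition iv :: "'b list \<Rightarrow> 'b list" where "iv x = inv\<^bsub>grp G mul one\<^esub> x"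

lemma G_length: "x \<in> G \<Longrightarrow> length x = n" using K.length_mem[OF G_K] .

lemma grp_simps [simp]: "carrier (grp G mul one) = G" "x \<otimes>\<^bsub>grp G mul one\<^esub> y = mul x y" "\<one>\<^bsub>grp G mul one\<^esub> = one"
  by (simp_all add: grp_def)

lemma mul_closed: "x \<in> G \<Longrightarrow> y \<in> G \<Longrightarrow> mul x y \<in> G" using Gp.m_closed by simp
lemma mul_assoc: "x \<in> G \<Longrightarrow> y \<in> G \<Longrightarrow> z \<in> G \<Longrightarrow> mul (mul x y) z = mul x (mul y z)" using Gp.m_assoc by simp
lemma one_closed: "one \<in> G" using Gp.one_closed by simp
lemma iv_closed: "x \<in> G \<Longrightarrow> iv x \<in> G" using Gp.inv_closed unfolding iv_def by simp
lemma mul_one: "x \<in> G \<Longrightarrow> mul x one = x" "x \<in> G \<Longrightarrow> mul one x = x" using Gp.r_one Gp.l_one by simp_all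
lemma mul_iv: "x \<in> G \<Longrightarrow> mul x (iv x) = one" "x \<in> G \<Longrightarrow> mul (iv x) x = one"
  using Gp.r_inv Gp.l_inv unfolding iv_def by simp_all
lemma mul_left_cancel: "x \<in> G \<Longrightarrow> y \<in> G \<Longrightarrow> z \<in> G \<Longrightarrow> mul x y = mul x z \<longleftrightarrow> y = z" 
  by (metis mul_assoc mul_iv(2) mul_one(2) iv_closed)
lemma mul_right_cancel: "x \<in> G \<Longrightarrow> y \<in> G \<Longrightarrow> z \<in> G \<Longrightarrow> mul y x = mul z x \<longleftrightarrow> y = z" 
  by (metis mul_assoc mul_iv(1) mul_one(1) iv_closed)
lemma mul_iv_cancel: "x \<in> G \<Longrightarrow> y \<in> G \<Longrightarrow> mul x (mul (iv x) y) = y" "x \<in> G \<Longrightarrow> y \<in> G \<Longrightarrow> mul (mul y x) (iv x) = y"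
  "x \<in> G \<Longrightarrow> y \<in> G \<Longrightarrow> mul (mul y (iv x)) x = y"
  using mul_assoc mul_iv mul_one iv_closed by (metis, metis, metis)

definition d :: nat where "d = Max ((\<lambda>x. rk P (set x)) ` G)"

lemma rk_finite: "finite ((\<lambda>x. rk P (set x)) ` G)"
proof (rule finite_subset)
  show "(\<lambda>x. rk P (set x)) ` G \<subseteq> {..n}"
    using F.rk_le_card[of "set _" P] card_length G_length by (auto intro: order_trans)
qed simp

lemma rk_le_d: "x \<in> G \<Longrightarrow> rk P (set x) \<le> d"
  unfolding d_def using Max_ge[OF rk_finite] by blast

lemma ex_rk_d: "\<exists>x\<in>G. rk P (set x) = d"
  proof -
  have "d \<in> (\<lambda>x. rk P (set x)) ` G" unfolding d_def using Max_in[OF rk_finite] one_closed by blast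
  then show ?thesis by force
qed

abbreviation "Gr \<equiv> {x @ y @ mul x y | x y. x \<in> G \<and> y \<in> G}"

lemma in_Gr: "length x = n \<Longrightarrow> length y = n \<Longrightarrow> x @ y @ z \<in> Gr \<longleftrightarrow> x \<in> G \<and> y \<in> G \<and> z = mul x y"
proof
  assume l: "length x = n" "length y = n" and "x @ y @ z \<in> Gr"
  then obtain x' y' where xy: "x @ y @ z = x' @ y' @ mul x' y'" "x' \<in> G" "y' \<in> G" by blast
  then have "x = x' \<and> y = y' \<and> z = mul x' y'" using l G_length[OF xy(2)] G_length[OF xy(3)] by (metis append_eq_append_conv)
  then show "x \<in> G \<and> y \<in> G \<and> z = mul x y" using xy by blast
qed blast

text \<open>Each of \<open>x\<close>, \<open>y\<close> and \<open>mul x y\<close> is determined by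
  the other two, by cancellation, so \<open>dcl_cl_tuple\<close> applies to the graph with its
  blocks permuted accordingly.\<close>

lemma mul_dcl:
  assumes "x \<in> G" "y \<in> G" "z = mul x y"
  shows "set z \<subseteq> cl (set x \<union> set y \<union> Psupp (set x \<union> set y))"
    and "set y \<subseteq> cl (set x \<union> set z \<union> Psupp (set x \<union> set z))"
    and "set x \<subseteq> cl (set y \<union> set z \<union> Psupp (set y \<union> set z))"
proof -
  have l: "length x = n" "length y = n" "length z = n" "z \<in> G" using assms G_length mul_closed by auto
  have Gr2: "Gr \<in> K ((n + n) + n)" using Gr_K by (simp add: numeral_3_eq_3 add_ac)
  have "set z \<subseteq> cl (set (x @ y) \<union> Psupp (set (x @ y)))"
  proof (rule dcl_cl_tuple[OF Gr2])
    show "(x @ y) @ z \<in> Gr" using assms by auto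
    show "z' = z" if "(x @ y) @ z' \<in> Gr" for z' using that in_Gr[OF l(1,2)] assms by simp
  qed (use l in simp)
  then show "set z \<subseteq> cl (set x \<union> set y \<union> Psupp (set x \<union> set y))" by simp
  have ri: "{ws \<in> tuples (3 * n). map ((!) ws) js \<in> Gr} \<in> K ((n + n) + n)"
    if "length js = 3 * n" "\<forall>j\<in>set js. j < 3 * n" for js
    using K.reindex_mem[OF Gr_K that] by (simp add: numeral_3_eq_3 add_ac)
  have "set y \<subseteq> cl (set (x @ z) \<union> Psupp (set (x @ z)))"
  proof (rule dcl_cl_tuple[OF ri[of "[0..<n] @ [2*n..<3*n] @ [n..<2*n]"]])
    have m: "map ((!) (x @ z @ y')) ([0..<n] @ [2*n..<3*n] @ [n..<2*n]) = x @ y' @ z" if "length y' = n" for y'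
      using map_nth_blocks[OF l(1,3) that] by simp
    show "(x @ z) @ y \<in> {ws \<in> tuples (3 * n). map ((!) ws) ([0..<n] @ [2*n..<3*n] @ [n..<2*n]) \<in> Gr}"
      using m[OF l(2)] assms l by auto
    show "y' = y" if "(x @ z) @ y' \<in> {ws \<in> tuples (3 * n). map ((!) ws) ([0..<n] @ [2*n..<3*n] @ [n..<2*n]) \<in> Gr}" for y'
    proof -
      have ly: "length y' = n" using that l by simp
      then have "x @ y' @ z \<in> Gr" using that m[OF ly] by simp
      then have "y' \<in> G" "mul x y' = mul x y" using in_Gr[OF l(1) ly] assms by auto
      then show ?thesis using mul_left_cancel assms by blast
    qed
  qed (use l in auto)
  then show "set y \<subseteq> cl (set x \<union> set z \<union> Psupp (set x \<union> set z))" by simp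
  have "set x \<subseteq> cl (set (y @ z) \<union> Psupp (set (y @ z)))"
  proof (rule dcl_cl_tuple[OF ri[of "[2*n..<3*n] @ [0..<n] @ [n..<2*n]"]])
    have m: "map ((!) (y @ z @ x')) ([2*n..<3*n] @ [0..<n] @ [n..<2*n]) = x' @ y @ z" if "length x' = n" for x'
      using map_nth_blocks[OF l(2,3) that] by simp
    show "(y @ z) @ x \<in> {ws \<in> tuples (3 * n). map ((!) ws) ([2*n..<3*n] @ [0..<n] @ [n..<2*n]) \<in> Gr}"
      using m[OF l(1)] assms l by auto
    show "x' = x" if "(y @ z) @ x' \<in> {ws \<in> tuples (3 * n). map ((!) ws) ([2*n..<3*n] @ [0..<n] @ [n..<2*n]) \<in> Gr}" for x'
    proof -
      have lx: "length x' = n" using that l by simp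
      then have "x' @ y @ z \<in> Gr" using that m[OF lx] by simp
      then have "x' \<in> G" "mul x' y = mul x y" using in_Gr[OF lx l(2)] assms by auto
      then show ?thesis using mul_right_cancel assms by blast
    qed
  qed (use l in auto)
  then show "set x \<subseteq> cl (set y \<union> set z \<union> Psupp (set y \<union> set z))" by simp
qed

lemma mul_cl_P:
  assumes "x \<in> G" "y \<in> G" "z = mul x y" "P \<subseteq> C"
  shows "set z \<subseteq> cl (C \<union> (set x \<union> set y))" "set y \<subseteq> cl (C \<union> (set x \<union> set z))" "set x \<subseteq> cl (C \<union> (set y \<union> set z))"
proof -
  have "cl (A \<union> Psupp A) \<subseteq> cl (C \<union> A)" for A using Psupp_P[of A] assms(4) by (intro F.cl_mono) blast
  then show "set z \<subseteq> cl (C \<union> (set x \<union> set y))" "set y \<subseteq> cl (C \<union> (set x \<union> set z))" "set x \<subseteq> cl (C \<union> (set y \<union> set z))"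
    using mul_dcl[OF assms(1-3)] by blast+
qed

text \<open>Over a set containing \<open>P\<close> the supports are absorbed, so any two of the
  three elements generate the third and all these ranks agree.\<close>

lemma rk_triple:
  assumes "x \<in> G" "y \<in> G" "z = mul x y" "P \<subseteq> C"
  shows "rk C (set x \<union> set z) = rk C (set x \<union> set y)" "rk C (set y \<union> set z) = rk C (set x \<union> set y)"
    and "rk C (set x \<union> set y \<union> set z) = rk C (set x \<union> set y)"
proof -
  note m = mul_cl_P[OF assms]
  have 1: "rk C (set x \<union> set y \<union> set z) = rk C (set x \<union> set y)" using m(1) by (intro F.rk_absorb) auto
  have 2: "rk C (set x \<union> set z \<union> set y) = rk C (set x \<union> set z)" using m(2) by (intro F.rk_absorb) auto
  have 3: "rk C (set y \<union> set z \<union> set x) = rk C (set y \<union> set z)" using m(3) by (intro F.rk_absorb) auto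
  show "rk C (set x \<union> set y \<union> set z) = rk C (set x \<union> set y)" by (rule 1)
  show "rk C (set x \<union> set z) = rk C (set x \<union> set y)" "rk C (set y \<union> set z) = rk C (set x \<union> set y)"
    using 1 2 3 by (simp_all add: Un_ac)
qed

lemma rk_Un_le_2d: "x \<in> G \<Longrightarrow> y \<in> G \<Longrightarrow> rk P (set x \<union> set y) \<le> 2 * d"
  using F.rk_Un_le[of "set x" "set y" P] rk_le_d[of x] rk_le_d[of y] by simp

lemma rk_2d: "x \<in> G \<Longrightarrow> y \<in> G \<Longrightarrow> 2 * d \<le> rk P (set x \<union> set y) \<Longrightarrow> rk P (set x) = d \<and> rk P (set y) = d"
  using F.rk_Un_le[of "set x" "set y" P] rk_le_d[of x] rk_le_d[of y] by simp

text \<open>For an independent pair of generic elements the supports of two of \<open>x\<close>, \<open>y\<close>, \<open>mul x y\<close>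
  determine the third, so supports would add up under multiplication; compactness bounds their size.\<close>
lemma generic_Psupp_empty: assumes "x \<in> G" "rk P (set x) = d" shows "Psupp (set x) = {}"
proof -
  obtain \<A> where A: "countable \<A>" "\<A> \<subseteq> K n" "\<forall>x. length x = n \<longrightarrow> (rk P (set x) \<le> d \<longleftrightarrow> (\<exists>B\<in>\<A>. x \<in> B))"
    "\<forall>B\<in>\<A>. \<exists>k. \<forall>x\<in>B. \<exists>Q\<subseteq>P. finite Q \<and> card Q \<le> k \<and> rk Q (set x) \<le> d"
    by (rule exE[OF rank_le_family[of n d]]) (elim conjE, rule that)
  have "G \<subseteq> \<Union>\<A>"
  proof
    fix g assume g: "g \<in> G"
    then show "g \<in> \<Union>\<A>" using A(3) rk_le_d[OF g] G_length[OF g] by blast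
  qed
  from compactness[OF G_K A(1,2) this] obtain \<B> where B: "finite \<B>" "\<B> \<subseteq> \<A>" "G \<subseteq> \<Union>\<B>" by blast
  obtain kk where kk: "\<And>B x. B \<in> \<A> \<Longrightarrow> x \<in> B \<Longrightarrow> \<exists>Q\<subseteq>P. finite Q \<and> card Q \<le> kk B \<and> rk Q (set x) \<le> d" using A(4) by metis
  let ?gen = "\<lambda>x. x \<in> G \<and> rk P (set x) = d"
  have bound: "card (Psupp (set x)) \<le> Max (insert 0 (kk ` \<B>))" if gx: "?gen x" for x
  proof -
    obtain B' where B': "B' \<in> \<B>" "x \<in> B'" using gx B(3) by blast
    then obtain Q where Q: "Q \<subseteq> P" "finite Q" "card Q \<le> kk B'" "rk Q (set x) \<le> d" using kk B(2) by blast
    have "Psupp (set x) \<subseteq> Q" by (rule Psupp_bound) (use Q gx in auto)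
    then have "card (Psupp (set x)) \<le> card Q" using Q(2) by (rule card_mono[rotated])
    also have "\<dots> \<le> kk B'" by (rule Q(3))
    also have "\<dots> \<le> Max (insert 0 (kk ` \<B>))" using B(1) B'(1) by (intro Max_ge) auto
    finally show ?thesis .
  qed
  \<comment> \<open>Compactness has bounded the size of the support on all generics, so one of
    maximal size can be chosen; the successor turns the bound into a strict one.\<close>
  obtain s where s: "?gen s" "\<And>y. ?gen y \<Longrightarrow> card (Psupp (set y)) \<le> card (Psupp (set s))"
    using ex_has_greatest_nat[of ?gen x "\<lambda>x. card (Psupp (set x))" "Suc (Max (insert 0 (kk ` \<B>)))"] bound assms
    unfolding less_Suc_eq_le by blast
  have "Psupp (set s) = {}"
  proof (rule ccontr)
    assume ne: "Psupp (set s) \<noteq> {}"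
    obtain ql where ql: "set ql = Psupp (set s)" using finite_list[OF Psupp_finite[of "set s"]] by auto
    \<comment> \<open>\<open>y\<close> is a generic independent from \<open>s\<close> whose support
      is non-empty and disjoint from that of \<open>s\<close>; the product of \<open>s\<close> and
      \<open>y\<close> will have too large a support.\<close>
    obtain y where y: "R s y" "rk (P \<union> set (s @ ql)) (set y) = rk P (set s)" "Psupp (set y) \<inter> set (s @ ql) = {}" "Psupp (set y) \<noteq> {}"
      using independent_copy[of s "s @ ql"] ne by blast
    have yG: "y \<in> G" using K_invariant[OF G_K y(1)] s(1) by blast
    have "P \<union> set s \<subseteq> cl (P \<union> set (s @ ql))" using F.cl_ext[of "P \<union> set (s @ ql)"] by auto
    then have "d \<le> rk (P \<union> set s) (set y)" using F.rk_antimono[of "set y" "P \<union> set s" "P \<union> set (s @ ql)"] y(2) s(1) by simp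
    then have two: "rk P (set s \<union> set y) = 2 * d" using F.rk_Un[of "set s" "set y" P] s(1) rk_Un_le_2d[of s y] yG by simp
    define z where "z = mul s y"
    have zG: "z \<in> G" unfolding z_def using mul_closed s(1) yG by blast
    note t = rk_triple[OF _ yG z_def order_refl]
    have sz: "rk P (set s \<union> set z) = 2 * d" and yz: "rk P (set y \<union> set z) = 2 * d" using t two s(1) by auto
    have gy: "rk P (set y) = d" and gz: "rk P (set z) = d" using rk_2d[of s y] rk_2d[of s z] two sz s(1) yG zG by auto
    have 1: "Psupp (set s \<union> set y) = Psupp (set s) \<union> Psupp (set y)" by (rule Psupp_indep) (use two s gy in auto)
    have 2: "Psupp (set s \<union> set z) = Psupp (set s) \<union> Psupp (set z)" by (rule Psupp_indep) (use sz s gz in auto)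
    have 3: "Psupp (set y \<union> set z) = Psupp (set y) \<union> Psupp (set z)" by (rule Psupp_indep) (use yz gy gz in auto)
    note c = mul_dcl[OF _ yG z_def]
    have "Psupp (set s \<union> set y \<union> set z) = Psupp (set s \<union> set y)" using c(1) s(1) by (intro Psupp_absorb) auto
    moreover have "Psupp (set s \<union> set z \<union> set y) = Psupp (set s \<union> set z)" using c(2) s(1) by (intro Psupp_absorb) auto
    moreover have "Psupp (set y \<union> set z \<union> set s) = Psupp (set y \<union> set z)" using c(3) s(1) by (intro Psupp_absorb) auto
    ultimately have "Psupp (set s) \<union> Psupp (set y) = Psupp (set s) \<union> Psupp (set z)" "Psupp (set s) \<union> Psupp (set y) = Psupp (set y) \<union> Psupp (set z)"
      using 1 2 3 by (simp_all add: Un_ac)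
    moreover have dis: "Psupp (set s) \<inter> Psupp (set y) = {}" using y(3) ql by auto
    \<comment> \<open>Any two of the three supports have the same union. As those of
      \<open>s\<close> and \<open>y\<close> are disjoint, both lie in that of \<open>z\<close>,
      whose size then exceeds the maximum.\<close>
    ultimately have "Psupp (set s) \<union> Psupp (set y) \<subseteq> Psupp (set z)" by blast
    then have "card (Psupp (set s) \<union> Psupp (set y)) \<le> card (Psupp (set z))" by (intro card_mono Psupp_finite) auto
    moreover have "card (Psupp (set s) \<union> Psupp (set y)) = card (Psupp (set s)) + card (Psupp (set y))"
      by (rule card_Un_disjoint) (use dis Psupp_finite in auto)
    moreover have "card (Psupp (set y)) > 0" using y(4) Psupp_finite by (simp add: card_gt_0_iff)
    ultimately show False using s(2)[of z] zG gz by simp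
  qed
  then have "card (Psupp (set x)) = 0" using s(2)[of x] assms by simp
  then show ?thesis using Psupp_finite by simp
qed

lemma Psupp_pair:
  assumes "x \<in> G" "y \<in> G" "2 * d \<le> rk P (set x \<union> set y)" shows "Psupp (set x \<union> set y) = {}"
proof -
  have g: "rk P (set x) = d" "rk P (set y) = d" using rk_2d[OF assms] by auto
  then have "rk P (set x \<union> set y) = rk P (set x) + rk P (set y)" using assms rk_Un_le_2d[OF assms(1,2)] by simp
  then have "Psupp (set x \<union> set y) = Psupp (set x) \<union> Psupp (set y)" by (intro Psupp_indep) auto
  then show ?thesis using generic_Psupp_empty g assms by simp
qed

text \<open>\<open>Y\<close> and \<Gamma> are substitutes in \<open>L\<close> for the group and the
  graph of its multiplication. They agree with these on tuples of the largest rank, \<open>d\<close>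
  and \<open>2 * d\<close>. The closure relations are required on all of \<Gamma>, so that
  genericity can be carried along \<Gamma> even at tuples where it is not yet known to describe the
  group.\<close>

definition chunk :: "'b list set \<Rightarrow> 'b list set \<Rightarrow> bool" where
  "chunk Y \<Gamma> \<longleftrightarrow> Y \<in> L n \<and> (\<forall>y\<in>Y. rk {} (set y) \<le> d) \<and> (\<forall>x. d \<le> rk P (set x) \<longrightarrow> (x \<in> Y \<longleftrightarrow> x \<in> G)) \<and>
     \<Gamma> \<in> L (3 * n) \<and>
     (\<forall>x y z. length x = n \<longrightarrow> length y = n \<longrightarrow> length z = n \<longrightarrow> x @ y @ z \<in> \<Gamma> \<longrightarrow> x \<in> Y \<and> y \<in> Y \<and> z \<in> Y \<and>
        set z \<subseteq> cl (set x \<union> set y) \<and> set y \<subseteq> cl (set x \<union> set z) \<and> set x \<subseteq> cl (set y \<union> set z)) \<and>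
     (\<forall>x y z. length x = n \<longrightarrow> length y = n \<longrightarrow> length z = n \<longrightarrow> 2 * d \<le> rk P (set x \<union> set y \<union> set z) \<longrightarrow>
        (x @ y @ z \<in> \<Gamma> \<longleftrightarrow> x \<in> G \<and> y \<in> G \<and> z = mul x y))"

text \<open>Generic elements and independent pairs of them have empty support, hence rank at most
  \<open>d\<close> and \<open>2 * d\<close> over the empty set; these bounds and the closure
  relations hold on whole sets in \<open>L\<close>, as \<open>definable_approx\<close>
  requires.\<close>

lemma chunk_exists: "\<exists>Y \<Gamma>. chunk Y \<Gamma>"
proof -
  obtain Y where Y: "Y \<in> L n" "\<forall>y\<in>Y. rk {} (set y) \<le> d" "\<forall>x. d \<le> rk P (set x) \<longrightarrow> (x \<in> Y \<longleftrightarrow> x \<in> G)"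
  proof -
    have "\<exists>Y\<in>L n. (\<forall>y\<in>Y. rk {} (set y) \<le> d) \<and> (\<forall>x. d \<le> rk P (set x) \<longrightarrow> (x \<in> Y \<longleftrightarrow> x \<in> G))"
    proof (rule definable_approx[OF G_K])
      fix x assume x: "x \<in> G" "d \<le> rk P (set x)"
      then have "rk P (set x) = d" using rk_le_d[of x] by simp
      then have "rk {} (set x) \<le> d" using Psupp_empty_rk[of "set x"] generic_Psupp_empty[OF x(1)] by simp
      then show "\<exists>W\<in>L n. x \<in> W \<and> (\<forall>y\<in>W. rk {} (set y) \<le> d)" using open_rk G_length[OF x(1)] by blast
    qed
    then show ?thesis using that by blast
  qed
  let ?x = "\<lambda>w::'b list. map ((!) w) [0..<n]" let ?y = "\<lambda>w::'b list. map ((!) w) [n..<2*n]" let ?z = "\<lambda>w::'b list. map ((!) w) [2*n..<3*n]"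
  define \<Phi> where "\<Phi> w \<longleftrightarrow> length w = 3 * n \<and> ?x w \<in> Y \<and> ?y w \<in> Y \<and> ?z w \<in> Y \<and>
    set (?z w) \<subseteq> cl (set (?x w) \<union> set (?y w)) \<and> set (?y w) \<subseteq> cl (set (?x w) \<union> set (?z w)) \<and> set (?x w) \<subseteq> cl (set (?y w) \<union> set (?z w))" for w :: "'b list"
  have dec: "set w = set (?x w) \<union> set (?y w) \<union> set (?z w)" if lw: "length w = 3 * n" for w :: "'b list"
  proof -
    have "w = map ((!) w) [0..<3*n]" using map_nth[of w] lw by simp
    moreover have "[0..<3*n] = [0..<n] @ [n..<2*n] @ [2*n..<3*n]"
    proof -
      have e: "3 * n = n + n + n" "2 * n = n + n" by simp_all
      show ?thesis unfolding e using upt_add_eq_append[of 0 n n] upt_add_eq_append[of 0 "n + n" n] by simp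
    qed
    ultimately have "set w = set (map ((!) w) ([0..<n] @ [n..<2*n] @ [2*n..<3*n]))" by metis
    then show ?thesis by (simp only: map_append set_append Un_assoc)
  qed
  have "\<exists>\<Gamma>\<in>L (3 * n). (\<forall>w\<in>\<Gamma>. \<Phi> w) \<and> (\<forall>w. 2 * d \<le> rk P (set w) \<longrightarrow> (w \<in> \<Gamma> \<longleftrightarrow> w \<in> Gr))"
  proof (rule definable_approx[OF Gr_K])
    fix w assume w: "w \<in> Gr" "2 * d \<le> rk P (set w)"
    then obtain x y where xy: "w = x @ y @ mul x y" "x \<in> G" "y \<in> G" by blast
    define z where "z = mul x y"
    have zG: "z \<in> G" unfolding z_def using mul_closed xy by blast
    have l: "length x = n" "length y = n" "length z = n" using xy zG G_length by auto
    note bl = map_nth_blocks[OF l]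
    have wz: "w = x @ y @ z" using xy(1) z_def by simp
    have 2: "2 * d \<le> rk P (set x \<union> set y)" using w(2) rk_triple(3)[OF xy(2,3) z_def order_refl] unfolding wz by (simp add: Un_assoc)
    have 3: "2 * d \<le> rk P (set x \<union> set z)" "2 * d \<le> rk P (set y \<union> set z)" using rk_triple(1,2)[OF xy(2,3) z_def order_refl] 2 by auto
    have g: "rk P (set x) = d" "rk P (set y) = d" "rk P (set z) = d" using rk_2d[OF xy(2,3) 2] rk_2d[OF xy(2) zG 3(1)] by auto
    have YY: "x \<in> Y" "y \<in> Y" "z \<in> Y" using Y(3) g xy zG by auto
    have c: "set z \<subseteq> cl (set x \<union> set y)" "set y \<subseteq> cl (set x \<union> set z)" "set x \<subseteq> cl (set y \<union> set z)"
      using mul_dcl[OF xy(2,3) z_def] Psupp_pair[OF xy(2,3) 2] Psupp_pair[OF xy(2) zG 3(1)] Psupp_pair[OF xy(3) zG 3(2)] by auto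
    have lw: "length w = 3 * n" using wz l by simp
    have b: "?x w = x" "?y w = y" "?z w = z" using bl unfolding wz by auto
    have o: "\<exists>W\<in>L (3 * n). w \<in> W \<and> (\<forall>w'\<in>W. set (map ((!) w') I) \<subseteq> cl (set (map ((!) w') J)))"
      if "\<forall>j\<in>set J. j < 3 * n" "\<forall>i\<in>set I. i < 3 * n" "set (map ((!) w) I) \<subseteq> cl (set (map ((!) w) J))" for I J
      by (rule open_cl[OF lw that])
    obtain W1 where W1: "W1 \<in> L (3 * n)" "w \<in> W1" "\<forall>w'\<in>W1. set (?z w') \<subseteq> cl (set (map ((!) w') ([0..<n] @ [n..<2*n])))"
    proof -
      have "\<exists>W\<in>L (3 * n). w \<in> W \<and> (\<forall>w'\<in>W. set (map ((!) w') [2*n..<3*n]) \<subseteq> cl (set (map ((!) w') ([0..<n] @ [n..<2*n]))))"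
      proof (rule o)
        show "set (map ((!) w) [2*n..<3*n]) \<subseteq> cl (set (map ((!) w) ([0..<n] @ [n..<2*n])))" using c(1) b by (simp only: map_append set_append)
      qed auto
      then show ?thesis using that by blast
    qed
    obtain W2 where W2: "W2 \<in> L (3 * n)" "w \<in> W2" "\<forall>w'\<in>W2. set (?y w') \<subseteq> cl (set (map ((!) w') ([0..<n] @ [2*n..<3*n])))"
    proof -
      have "\<exists>W\<in>L (3 * n). w \<in> W \<and> (\<forall>w'\<in>W. set (map ((!) w') [n..<2*n]) \<subseteq> cl (set (map ((!) w') ([0..<n] @ [2*n..<3*n]))))"
      proof (rule o)
        show "set (map ((!) w) [n..<2*n]) \<subseteq> cl (set (map ((!) w) ([0..<n] @ [2*n..<3*n])))" using c(2) b by (simp only: map_append set_append)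
      qed auto
      then show ?thesis using that by blast
    qed
    obtain W3 where W3: "W3 \<in> L (3 * n)" "w \<in> W3" "\<forall>w'\<in>W3. set (?x w') \<subseteq> cl (set (map ((!) w') ([n..<2*n] @ [2*n..<3*n])))"
    proof -
      have "\<exists>W\<in>L (3 * n). w \<in> W \<and> (\<forall>w'\<in>W. set (map ((!) w') [0..<n]) \<subseteq> cl (set (map ((!) w') ([n..<2*n] @ [2*n..<3*n]))))"
      proof (rule o)
        show "set (map ((!) w) [0..<n]) \<subseteq> cl (set (map ((!) w) ([n..<2*n] @ [2*n..<3*n])))" using c(3) b by (simp only: map_append set_append)
      qed auto
      then show ?thesis using that by blast
    qed
    have V: "{w \<in> tuples (3*n). ?x w \<in> Y} \<in> L (3*n)" "{w \<in> tuples (3*n). ?y w \<in> Y} \<in> L (3*n)" "{w \<in> tuples (3*n). ?z w \<in> Y} \<in> L (3*n)"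
      by (rule L.reindex_mem[OF Y(1)]; auto)+
    let ?W = "W1 \<inter> W2 \<inter> W3 \<inter> {w \<in> tuples (3*n). ?x w \<in> Y} \<inter> {w \<in> tuples (3*n). ?y w \<in> Y} \<inter> {w \<in> tuples (3*n). ?z w \<in> Y}"
    have "?W \<in> L (3 * n)" using W1(1) W2(1) W3(1) V by (intro L.Int_mem)
    moreover have "w \<in> ?W" using W1(2) W2(2) W3(2) b YY lw by simp
    moreover have "\<Phi> w'" if "w' \<in> ?W" for w'
      unfolding \<Phi>_def using that W1(3) W2(3) W3(3) unfolding map_append set_append by auto
    ultimately show "\<exists>W\<in>L (3 * n). w \<in> W \<and> (\<forall>w'\<in>W. \<Phi> w')" by (intro bexI[of _ ?W] conjI ballI)
  next
    fix w assume w: "\<Phi> w"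
    then have "set w = set (?x w) \<union> set (?y w) \<union> set (?z w)" using dec unfolding \<Phi>_def by blast
    moreover have "set (?z w) \<subseteq> cl ({} \<union> (set (?x w) \<union> set (?y w)))" using w unfolding \<Phi>_def by simp
    ultimately have "rk {} (set w) = rk {} (set (?x w) \<union> set (?y w))" using F.rk_absorb[of "set (?x w) \<union> set (?y w)" "set (?z w)" "{}"] by simp
    also have "\<dots> \<le> rk {} (set (?x w)) + rk {} (set (?y w))" by (rule F.rk_Un_le) auto
    also have "\<dots> \<le> d + d" using w Y(2) unfolding \<Phi>_def by (intro add_mono) auto
    finally show "rk {} (set w) \<le> 2 * d" by simp
  qed
  then obtain \<Gamma> where \<Gamma>: "\<Gamma> \<in> L (3 * n)" "\<forall>w\<in>\<Gamma>. \<Phi> w" "\<forall>w. 2 * d \<le> rk P (set w) \<longrightarrow> (w \<in> \<Gamma> \<longleftrightarrow> w \<in> Gr)" by blast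
  have "chunk Y \<Gamma>"
    unfolding chunk_def
  proof (intro conjI allI impI)
    fix x y z :: "'b list" assume l: "length x = n" "length y = n" "length z = n"
    { assume "x @ y @ z \<in> \<Gamma>"
      then have "\<Phi> (x @ y @ z)" using \<Gamma>(2) by blast
      then have "x \<in> Y \<and> y \<in> Y \<and> z \<in> Y \<and> set z \<subseteq> cl (set x \<union> set y) \<and> set y \<subseteq> cl (set x \<union> set z) \<and> set x \<subseteq> cl (set y \<union> set z)"
        unfolding \<Phi>_def map_nth_blocks[OF l] by blast
      then show "x \<in> Y" "y \<in> Y" "z \<in> Y" "set z \<subseteq> cl (set x \<union> set y)" "set y \<subseteq> cl (set x \<union> set z)" "set x \<subseteq> cl (set y \<union> set z)" by auto }
    assume "2 * d \<le> rk P (set x \<union> set y \<union> set z)"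
    then have "x @ y @ z \<in> \<Gamma> \<longleftrightarrow> x @ y @ z \<in> Gr" using \<Gamma>(3) by (simp add: Un_assoc)
    then show "(x @ y @ z \<in> \<Gamma>) = (x \<in> G \<and> y \<in> G \<and> z = mul x y)" unfolding in_Gr[OF l(1,2)] .
  qed (use Y \<Gamma>(1) in auto)
  then show ?thesis by blast
qed

end

section \<open>Codes of group elements by germs of translations\<close>

locale sat_chunk = sat_group L K F P n G mul one
  for L K F :: "nat \<Rightarrow> 'b list set set" and P :: "'b set" and n G mul one +
  fixes Y \<Gamma> :: "'b list set"
  assumes chunk: "chunk Y \<Gamma>"
begin

lemma Y_L: "Y \<in> L n" using chunk unfolding chunk_def by simp
lemma Y_rk: "y \<in> Y \<Longrightarrow> rk {} (set y) \<le> d" using chunk unfolding chunk_def by simp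
lemma Y_iff_G: "d \<le> rk P (set x) \<Longrightarrow> x \<in> Y \<longleftrightarrow> x \<in> G" using chunk unfolding chunk_def by simp
lemma \<Gamma>_L: "\<Gamma> \<in> L (3 * n)" using chunk unfolding chunk_def by simp
lemma Y_length: "y \<in> Y \<Longrightarrow> length y = n" using L.length_mem[OF Y_L] .

definition gam :: "'b list \<Rightarrow> 'b list \<Rightarrow> 'b list \<Rightarrow> bool" where
  "gam x y z \<longleftrightarrow> length x = n \<and> length y = n \<and> length z = n \<and> x @ y @ z \<in> \<Gamma>"

lemma gamD:
  assumes "gam x y z"
  shows "x \<in> Y" "y \<in> Y" "z \<in> Y" "set z \<subseteq> cl (set x \<union> set y)" "set y \<subseteq> cl (set x \<union> set z)" "set x \<subseteq> cl (set y \<union> set z)"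
    "length x = n" "length y = n" "length z = n"
proof -
  have l: "length x = n" "length y = n" "length z = n" "x @ y @ z \<in> \<Gamma>" using assms unfolding gam_def by auto
  have "\<forall>x y z. length x = n \<longrightarrow> length y = n \<longrightarrow> length z = n \<longrightarrow> x @ y @ z \<in> \<Gamma> \<longrightarrow> x \<in> Y \<and> y \<in> Y \<and> z \<in> Y \<and>
        set z \<subseteq> cl (set x \<union> set y) \<and> set y \<subseteq> cl (set x \<union> set z) \<and> set x \<subseteq> cl (set y \<union> set z)"
    using chunk unfolding chunk_def by (elim conjE)
  then have "x \<in> Y \<and> y \<in> Y \<and> z \<in> Y \<and>
        set z \<subseteq> cl (set x \<union> set y) \<and> set y \<subseteq> cl (set x \<union> set z) \<and> set x \<subseteq> cl (set y \<union> set z)" using l by blast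
  then show "x \<in> Y" "y \<in> Y" "z \<in> Y" "set z \<subseteq> cl (set x \<union> set y)" "set y \<subseteq> cl (set x \<union> set z)" "set x \<subseteq> cl (set y \<union> set z)" by auto
qed (use assms in \<open>auto simp: gam_def\<close>)

lemma gam_iff:
  assumes "length x = n" "length y = n" "2 * d \<le> rk P (set x \<union> set y)"
  shows "gam x y z \<longleftrightarrow> x \<in> G \<and> y \<in> G \<and> z = mul x y"
proof -
  have "\<forall>x y z. length x = n \<longrightarrow> length y = n \<longrightarrow> length z = n \<longrightarrow> 2 * d \<le> rk P (set x \<union> set y \<union> set z) \<longrightarrow>
        (x @ y @ z \<in> \<Gamma> \<longleftrightarrow> x \<in> G \<and> y \<in> G \<and> z = mul x y)"
    using chunk unfolding chunk_def by (elim conjE)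
  moreover have "2 * d \<le> rk P (set x \<union> set y \<union> set z)" using assms(3) F.rk_mono[of "set x \<union> set y \<union> set z" "set x \<union> set y" P] by simp
  ultimately have "length z = n \<Longrightarrow> x @ y @ z \<in> \<Gamma> \<longleftrightarrow> x \<in> G \<and> y \<in> G \<and> z = mul x y" using assms by blast
  then show ?thesis unfolding gam_def using assms G_length mul_closed by blast
qed

definition gen :: "'b set \<Rightarrow> 'b list \<Rightarrow> bool" where
  "gen A x \<longleftrightarrow> x \<in> G \<and> rk (P \<union> A) (set x) = d"

lemma rk_P_anti: "P \<union> A \<subseteq> cl (P \<union> B) \<Longrightarrow> rk (P \<union> B) (set x) \<le> rk (P \<union> A) (set x)"
  by (rule F.rk_antimono) auto

lemma rk_rel_le: "rk (P \<union> A) (set x) \<le> rk P (set x)"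
  using F.rk_antimono[of "set x" P "P \<union> A"] F.cl_ext[of "P \<union> A"] by blast

lemma genI: "x \<in> G \<Longrightarrow> d \<le> rk (P \<union> A) (set x) \<Longrightarrow> gen A x"
  unfolding gen_def using rk_rel_le[of A x] rk_le_d[of x] by simp

lemma Y_gen: assumes "x \<in> Y" "d \<le> rk (P \<union> A) (set x)" shows "gen A x"
proof (rule genI[OF _ assms(2)])
  show "x \<in> G" using Y_iff_G[of x] assms rk_rel_le[of A x] by simp
qed

lemma gen_G: "gen A x \<Longrightarrow> x \<in> G" unfolding gen_def by simp
lemma gen_length: "gen A x \<Longrightarrow> length x = n" using gen_G G_length by blast

lemma gen_rk_P: "gen A x \<Longrightarrow> rk P (set x) = d"
  unfolding gen_def using rk_rel_le[of A x] rk_le_d[of x] by simp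

lemma gen_Y: "gen A x \<Longrightarrow> x \<in> Y" using Y_iff_G[of x] gen_rk_P[of A x] gen_G by simp

lemma gen_mono: "gen A x \<Longrightarrow> B \<subseteq> A \<Longrightarrow> gen B x"
  using rk_P_anti[of B A x] F.cl_ext[of "P \<union> A"] gen_G[of A x] by (intro genI) (auto simp: gen_def)

lemma gen_exists: assumes "finite A" shows "\<exists>x. gen A x"
proof -
  obtain b where b: "set b = A" using finite_list[OF assms] by blast
  obtain x0 where x0: "x0 \<in> G" "rk P (set x0) = d" using ex_rk_d by blast
  obtain x where x: "R x0 x" "rk (P \<union> set b) (set x) = rk P (set x0)" using independent_copy[of x0 b] by blast
  then have "x \<in> G" using K_invariant[OF G_K x(1) x0(1)] by simp
  then show ?thesis using x x0 b unfolding gen_def by auto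
qed

text \<open>\<open>z\<close> has at least the rank of \<open>x\<close> over \<open>P\<close> and
  \<open>A\<close>, hence full rank, and a member of \<open>Y\<close> of full rank is a group
  element.\<close>

lemma gen_transfer:
  assumes "gen A x" "z \<in> Y" "set x \<subseteq> cl (P \<union> A \<union> set z)" shows "gen A z"
proof (rule Y_gen[OF assms(2)])
  have "rk (P \<union> A) (set x) \<le> rk (P \<union> A) (set z)" using assms(3) by (intro F.rk_le_cl) auto
  then show "d \<le> rk (P \<union> A) (set z)" using assms(1) unfolding gen_def by simp
qed

definition gen2 :: "'b set \<Rightarrow> 'b list \<Rightarrow> 'b list \<Rightarrow> bool" where
  "gen2 A x y \<longleftrightarrow> x \<in> G \<and> y \<in> G \<and> 2 * d \<le> rk (P \<union> A) (set x \<union> set y)"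

lemma gen2I: "gen A x \<Longrightarrow> gen (A \<union> set x) y \<Longrightarrow> gen2 A x y"
  unfolding gen2_def gen_def using F.rk_Un[of "set x" "set y" "P \<union> A"] by (simp add: Un_assoc)

lemma gen2_sym: "gen2 A x y \<Longrightarrow> gen2 A y x" unfolding gen2_def by (simp add: Un_commute)

lemma gen2D: assumes "gen2 A x y" shows "gen A x" "gen (A \<union> set x) y"
proof -
  have xy: "x \<in> G" "y \<in> G" and r: "2 * d \<le> rk (P \<union> A) (set x) + rk (P \<union> A \<union> set x) (set y)"
    using assms F.rk_Un[of "set x" "set y" "P \<union> A"] unfolding gen2_def by auto
  have "rk (P \<union> A) (set x) \<le> d" using rk_rel_le[of A x] rk_le_d[OF xy(1)] by simp
  moreover have "rk (P \<union> (A \<union> set x)) (set y) \<le> d" using rk_rel_le[of "A \<union> set x" y] rk_le_d[OF xy(2)] by simp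
  ultimately show "gen A x" "gen (A \<union> set x) y" using r xy by (auto intro!: genI simp: Un_assoc)
qed

lemma gen2_mono: assumes "gen2 A x y" "B \<subseteq> A" shows "gen2 B x y"
proof -
  have "P \<union> B \<subseteq> cl (P \<union> A)" using assms(2) F.cl_ext[of "P \<union> A"] by blast
  then have "rk (P \<union> A) (set x \<union> set y) \<le> rk (P \<union> B) (set x \<union> set y)" by (intro F.rk_antimono) auto
  then show ?thesis using assms unfolding gen2_def by simp
qed

lemma gen2_P: "gen2 A x y \<Longrightarrow> 2 * d \<le> rk P (set x \<union> set y)"
  using gen2_mono[of A x y "{}"] unfolding gen2_def by simp

lemma gen2_mul: assumes "gen2 A x y" shows "gen2 A x (mul x y)" "gen2 A (mul x y) y"
proof -
  have xy: "x \<in> G" "y \<in> G" using assms unfolding gen2_def by auto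
  have "P \<subseteq> P \<union> A" by simp
  note t = rk_triple[OF xy refl this]
  show "gen2 A x (mul x y)" "gen2 A (mul x y) y"
    using t assms mul_closed[OF xy] unfolding gen2_def by (auto simp: Un_commute)
qed

lemma gen2_div: assumes "gen2 A x z" shows "gen2 A x (mul (iv x) z)"
proof -
  have xz: "x \<in> G" "z \<in> G" using assms unfolding gen2_def by auto
  let ?y = "mul (iv x) z"
  have y: "?y \<in> G" using xz mul_closed iv_closed by blast
  have "z = mul x ?y" using mul_iv_cancel(1)[OF xz] by simp
  moreover have "P \<subseteq> P \<union> A" by simp
  ultimately show ?thesis using rk_triple(1)[OF xz(1) y] assms y unfolding gen2_def by metis
qed

lemma gam_gen2: "gen2 A x y \<Longrightarrow> gam x y z \<longleftrightarrow> z = mul x y"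
  using gam_iff[of x y z] gen2_P[of A x y] G_length unfolding gen2_def by auto

text \<open>The partial map given by \<open>a\<close> through \<Gamma> has a single value
  \<open>z\<close> at \<open>x\<close> and commutes with right multiplication by \<open>y\<close>:
  the common value \<open>v\<close> is reached by applying \<open>a\<close> to the product
  \<open>w\<close> of \<open>x\<close> and \<open>y\<close>, and by multiplying \<open>z\<close>
  with \<open>y\<close>. Commuting with right multiplication characterises left translations, and
  here it is said in terms of \<Gamma> only.\<close>

definition good_at :: "'b list \<Rightarrow> 'b list \<Rightarrow> 'b list \<Rightarrow> bool" where
  "good_at a x y \<longleftrightarrow> (\<exists>z. length z = n \<and> (gam a x z \<and> (\<forall>z'. length z' = n \<longrightarrow> gam a x z' \<longrightarrow> z' = z) \<and>
     (\<exists>w. length w = n \<and> (gam x y w \<and> (\<exists>v. length v = n \<and> (gam a w v \<and> gam z y v))))))"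

definition nice :: "'b list \<Rightarrow> bool" where
  "nice a \<longleftrightarrow> a \<in> Y \<and> (\<forall>x y. gen2 (set a) x y \<longrightarrow> good_at a x y)"

lemma nice_Y: "nice a \<Longrightarrow> a \<in> Y" unfolding nice_def by simp

lemma gam_gen_right:
  assumes "gam a x z" "gen A x" "set a \<subseteq> A" shows "gen A z"
proof -
  have "set x \<subseteq> cl (P \<union> A \<union> set z)" using gamD(5)[OF assms(1)] F.cl_mono[of "set a \<union> set z" "P \<union> A \<union> set z"] assms(3) by blast
  then show ?thesis using gen_transfer[OF assms(2) gamD(3)[OF assms(1)]] by blast
qed

text \<open>Let \<open>f\<close> be the map on generics given by \<open>a\<close>. Since
  \<open>f\<close> commutes with right multiplication, the quotient \<open>g x\<close> of
  \<open>f x\<close> by \<open>x\<close> is unchanged when \<open>x\<close> is multiplied on the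
  right by an independent generic. Any two generics are linked through a third one independent from
  both, so this quotient is constant, and it is the desired translation.\<close>

lemma nice_realised:
  assumes "nice a" shows "\<exists>g\<in>G. \<forall>x. gen (set a) x \<longrightarrow> (\<forall>z. gam a x z \<longleftrightarrow> z = mul g x)"
proof -
  have st: "\<exists>z. gam a x z \<and> (\<forall>z'. gam a x z' \<longrightarrow> z' = z) \<and> gam a (mul x y) (mul z y)" if xy: "gen2 (set a) x y" for x y
  proof -
    obtain z w v where z: "gam a x z" "\<forall>z'. gam a x z' \<longrightarrow> z' = z" "gam x y w" "gam a w v" "gam z y v"
      using assms xy gamD(9) unfolding nice_def good_at_def by blast
    have w: "w = mul x y" using gam_gen2[OF xy] z(3) by blast
    have gz: "gen (set a \<union> set y) z" using gam_gen_right[OF z(1) gen2D(2)[OF gen2_sym[OF xy]]] by simp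
    have "gen2 (set a) y z" by (rule gen2I[OF gen2D(1)[OF gen2_sym[OF xy]] gz])
    then have "v = mul z y" using gam_gen2[OF gen2_sym] z(5) by blast
    then show ?thesis using z w by blast
  qed
  have ex: "\<exists>z. \<forall>z'. gam a x z' \<longleftrightarrow> z' = z" if x: "gen (set a) x" for x
  proof -
    obtain y where "gen (set a \<union> set x) y" using gen_exists[of "set a \<union> set x"] by auto
    then show ?thesis using st[OF gen2I[OF x]] by blast
  qed
  define f where "f x = (SOME z. \<forall>z'. gam a x z' \<longleftrightarrow> z' = z)" for x
  have f: "gam a x z' \<longleftrightarrow> z' = f x" if x: "gen (set a) x" for x z'
    using someI_ex[OF ex[OF x]] unfolding f_def by blast
  have fG: "f x \<in> G" if x: "gen (set a) x" for x
    using gam_gen_right[OF _ x order_refl, of "f x"] f[OF x] gen_G by blast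
  define g where "g x = mul (f x) (iv x)" for x
  have g2: "g (mul x y) = g x" if xy: "gen2 (set a) x y" for x y
  proof -
    have x: "gen (set a) x" and w: "gen (set a) (mul x y)" using gen2D[OF xy] gen2D[OF gen2_mul(2)[OF xy]] by auto
    have xG: "x \<in> G" "y \<in> G" using xy unfolding gen2_def by auto
    obtain z where z: "gam a x z" "gam a (mul x y) (mul z y)" using st[OF xy] by blast
    have fw: "f (mul x y) = mul (f x) y" using f[OF x, of z] f[OF w, of "mul z y"] z by simp
    have gG: "g x \<in> G" unfolding g_def using fG[OF x] xG mul_closed iv_closed by blast
    have "f x = mul (g x) x" unfolding g_def using mul_iv_cancel(3)[OF xG(1) fG[OF x]] by simp
    then have "f (mul x y) = mul (g x) (mul x y)" using fw mul_assoc[OF gG xG] by simp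
    then show ?thesis unfolding g_def[of "mul x y"] using mul_iv_cancel(2)[OF mul_closed[OF xG] gG] by simp
  qed
  have g3: "g x' = g x" if "gen2 (set a) x x'" for x x'
    using g2[OF gen2_div[OF that]] mul_iv_cancel(1)[of x x'] that unfolding gen2_def by simp
  obtain x0 where x0: "gen (set a) x0" using gen_exists[of "set a"] by auto
  have g4: "g x = g x0" if x: "gen (set a) x" for x
  proof -
    obtain y where y: "gen (set a \<union> set x \<union> set x0) y" using gen_exists[of "set a \<union> set x \<union> set x0"] by auto
    have "gen (set a \<union> set x) y" "gen (set a \<union> set x0) y" by (rule gen_mono[OF y]; blast)+
    then have "gen2 (set a) x y" "gen2 (set a) x0 y" using gen2I[OF x] gen2I[OF x0] by auto
    then have "g y = g x" "g y = g x0" using g3 by blast+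
    then show ?thesis by simp
  qed
  have "g x0 \<in> G" unfolding g_def using fG[OF x0] gen_G[OF x0] mul_closed iv_closed by blast
  moreover have "gam a x z \<longleftrightarrow> z = mul (g x0) x" if x: "gen (set a) x" for x z
  proof -
    have "mul (g x) x = f x" unfolding g_def using mul_iv_cancel(3)[OF gen_G[OF x] fG[OF x]] by simp
    then show ?thesis using f[OF x] g4[OF x] by simp
  qed
  ultimately show ?thesis by blast
qed

text \<open>The element of the group whose germ of left translations is the one coded by \<open>a\<close>.\<close>
definition gv :: "'b list \<Rightarrow> 'b list" where
  "gv a = (SOME g. g \<in> G \<and> (\<forall>x. gen (set a) x \<longrightarrow> (\<forall>z. gam a x z \<longleftrightarrow> z = mul g x)))"

lemma gv: assumes "nice a" shows "gv a \<in> G" "gen (set a) x \<Longrightarrow> gam a x z \<longleftrightarrow> z = mul (gv a) x"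
proof -
  have "gv a \<in> G \<and> (\<forall>x. gen (set a) x \<longrightarrow> (\<forall>z. gam a x z \<longleftrightarrow> z = mul (gv a) x))"
    unfolding gv_def by (rule someI_ex) (use nice_realised[OF assms] in blast)
  then show "gv a \<in> G" "gen (set a) x \<Longrightarrow> gam a x z \<longleftrightarrow> z = mul (gv a) x" by blast+
qed

lemma gv_unique:
  assumes "nice a" "g \<in> G" "gen (set a) x" "gam a x (mul g x)" shows "gv a = g"
  using gv[OF assms(1)] assms mul_right_cancel[of x "gv a" g] gen_G by metis

lemma act_nice:
  assumes "nice a" "set a \<subseteq> A" "gen A x"
  shows "gam a x z \<longleftrightarrow> z = mul (gv a) x" "gen A (mul (gv a) x)"
proof -
  have *: "gam a x z \<longleftrightarrow> z = mul (gv a) x" for z by (rule gv(2)[OF assms(1) gen_mono[OF assms(3,2)]])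
  then show "gam a x z \<longleftrightarrow> z = mul (gv a) x" .
  show "gen A (mul (gv a) x)" using gam_gen_right[OF _ assms(3,2)] * by blast
qed

lemma act_gen:
  assumes "gen {} s" "set s \<subseteq> A" "gen A x"
  shows "gam s x z \<longleftrightarrow> z = mul s x" "gen A (mul s x)"
proof -
  have "gen2 {} s x" using gen2I[OF assms(1)] gen_mono[OF assms(3)] assms(2) by simp
  then have *: "gam s x z \<longleftrightarrow> z = mul s x" for z using gam_gen2 by blast
  then show "gam s x z \<longleftrightarrow> z = mul s x" .
  show "gen A (mul s x)" using gam_gen_right[OF _ assms(3,2)] * by blast
qed

lemma gen_nice: assumes a: "gen {} a" shows "nice a" "gv a = a"
proof -
  have "good_at a x y" if xy: "gen2 (set a) x y" for x y
  proof -
    have x: "gen (set a) x" and y: "gen (set a) y" using gen2D[OF xy] gen2D[OF gen2_sym[OF xy]] by auto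
    have w: "gen (set a) (mul x y)" using gen2D[OF gen2_mul(2)[OF xy]] by auto
    have G: "a \<in> G" "x \<in> G" "y \<in> G" using a x y gen_G by auto
    have gz: "gen (set a \<union> set y) (mul a x)" using act_gen(2)[OF a _ gen2D(2)[OF gen2_sym[OF xy]]] by simp
    have "gen2 (set a) y (mul a x)" by (rule gen2I[OF y gz])
    then have "gam (mul a x) y (mul (mul a x) y)" using gam_gen2[OF gen2_sym] by blast
    moreover have "gam a (mul x y) (mul a (mul x y))" using act_gen(1)[OF a order_refl w] by blast
    moreover have "gam x y (mul x y)" using gam_gen2[OF xy] by blast
    moreover have "gam a x z \<longleftrightarrow> z = mul a x" for z using act_gen(1)[OF a order_refl x] .
    ultimately show ?thesis unfolding good_at_def using mul_assoc[OF G] gamD(9) by metis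
  qed
  then show n: "nice a" unfolding nice_def using gen_Y[OF a] by blast
  obtain x where x: "gen (set a) x" using gen_exists[of "set a"] by auto
  show "gv a = a" by (rule gv_unique[OF n gen_G[OF a] x]) (use act_gen(1)[OF a order_refl x] in blast)
qed

text \<open>If \<open>b\<close> acts as multiplication by \<open>a\<close>, then \<open>a\<close> is
  in the closure of \<open>b\<close> and \<open>x\<close> for an \<open>x\<close> that is generic
  over both. By symmetry of dependence \<open>a\<close> is in the closure of \<open>P\<close> and
  \<open>b\<close>, so \<open>b\<close> has full rank, is itself a generic group element, and acts
  as multiplication by \<open>b\<close>.\<close>

lemma gen_of_gv:
  assumes a: "gen {} a" and b: "nice b" "gv b = a" shows "b = a"
proof -
  obtain x where x: "gen (set a \<union> set b) x" using gen_exists[of "set a \<union> set b"] by auto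
  have "gam b x (mul a x)" using act_nice(1)[OF b(1) _ x] b(2) by blast
  then have zb: "set (mul a x) \<subseteq> cl (set b \<union> set x)" by (rule gamD(4))
  have "gam a x (mul a x)" using act_gen(1)[OF a _ x] by blast
  then have "set a \<subseteq> cl (set x \<union> set (mul a x))" by (rule gamD(6))
  moreover have "set x \<union> set (mul a x) \<subseteq> cl (set b \<union> set x)" using zb F.cl_ext[of "set b \<union> set x"] by blast
  ultimately have "set a \<subseteq> cl (set b \<union> set x)" using F.cl_minimal by blast
  then have "set a \<subseteq> cl (P \<union> set b \<union> set x)" using F.cl_mono[of "set b \<union> set x" "P \<union> set b \<union> set x"] by blast
  then have "rk (P \<union> set b) (set x \<union> set a) = rk (P \<union> set b) (set x)" by (intro F.rk_absorb) auto
  moreover have "rk (P \<union> set b) (set a \<union> set x) = rk (P \<union> set b) (set a) + rk (P \<union> set b \<union> set a) (set x)" by (rule F.rk_Un) auto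
  moreover have "rk (P \<union> set b \<union> set a) (set x) = d" "rk (P \<union> set b) (set x) = d"
    using x gen_mono[OF x, of "set b"] unfolding gen_def by (auto simp: Un_ac)
  ultimately have "rk (P \<union> set b) (set a) = 0" by (simp add: Un_commute)
  then have "set a \<subseteq> cl (P \<union> set b)" by (intro F.rk_eq_0D) auto
  then have "gen {} b" using gen_transfer[OF a nice_Y[OF b(1)]] by simp
  then show ?thesis using gen_nice(2) b(2) by simp
qed

text \<open>Compares \<open>mul s (gv a)\<close> with \<open>mul s' (gv b)\<close> by applying both
  to a test point \<open>x\<close> through \<Gamma>, so that neither the group operation nor
  \<open>gv\<close> occurs.\<close>

definition eq_at :: "'b list \<Rightarrow> 'b list \<Rightarrow> 'b list \<Rightarrow> 'b list \<Rightarrow> 'b list \<Rightarrow> bool" where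
  "eq_at s a s' b x \<longleftrightarrow> (\<exists>z. length z = n \<and> (gam a x z \<and> (\<exists>z'. length z' = n \<and> (gam b x z' \<and> (\<exists>v. length v = n \<and> (gam s z v \<and> gam s' z' v))))))"

definition mul_at :: "'b list \<Rightarrow> 'b list \<Rightarrow> 'b list \<Rightarrow> 'b list \<Rightarrow> 'b list \<Rightarrow> 'b list \<Rightarrow> 'b list \<Rightarrow> bool" where
  "mul_at s1 a1 s2 a2 s3 a3 x \<longleftrightarrow> (\<exists>z1. length z1 = n \<and> (gam a2 x z1 \<and> (\<exists>z2. length z2 = n \<and> (gam s2 z1 z2 \<and>
     (\<exists>z3. length z3 = n \<and> (gam a1 z2 z3 \<and> (\<exists>z4. length z4 = n \<and> (gam s1 z3 z4 \<and>
     (\<exists>w. length w = n \<and> (gam a3 x w \<and> gam s3 w z4))))))))))"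

lemma eq_at_iff:
  assumes "gen {} s" "gen {} s'" "nice a" "nice b" "set s \<union> set a \<union> set s' \<union> set b \<subseteq> A" "gen A x"
  shows "eq_at s a s' b x \<longleftrightarrow> mul s (gv a) = mul s' (gv b)"
proof -
  have sub: "set s \<subseteq> A" "set a \<subseteq> A" "set s' \<subseteq> A" "set b \<subseteq> A" using assms(5) by auto
  note n1 = act_nice[OF assms(3) sub(2) assms(6)] note n2 = act_nice[OF assms(4) sub(4) assms(6)]
  note a1 = act_gen[OF assms(1) sub(1) n1(2)] note a2 = act_gen[OF assms(2) sub(3) n2(2)]
  have l: "length (mul (gv a) x) = n" "length (mul (gv b) x) = n" "length (mul s (mul (gv a) x)) = n" using n1(2) n2(2) a1(2) gen_length by blast+
  have "eq_at s a s' b x \<longleftrightarrow> mul s (mul (gv a) x) = mul s' (mul (gv b) x)"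
    unfolding eq_at_def n1(1) n2(1) using a1(1) a2(1) l by metis
  also have "\<dots> \<longleftrightarrow> mul s (gv a) = mul s' (gv b)"
  proof -
    have G: "s \<in> G" "s' \<in> G" "gv a \<in> G" "gv b \<in> G" "x \<in> G" using assms gv(1) gen_G by auto
    show ?thesis using mul_right_cancel[of x "mul s (gv a)" "mul s' (gv b)"] G mul_closed mul_assoc by simp
  qed
  finally show ?thesis .
qed

lemma mul_at_iff:
  assumes "gen {} s1" "gen {} s2" "gen {} s3" "nice a1" "nice a2" "nice a3"
    "set s1 \<union> set a1 \<union> set s2 \<union> set a2 \<union> set s3 \<union> set a3 \<subseteq> A" "gen A x"
  shows "mul_at s1 a1 s2 a2 s3 a3 x \<longleftrightarrow> mul (mul s1 (gv a1)) (mul s2 (gv a2)) = mul s3 (gv a3)"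
proof -
  have sub: "set s1 \<subseteq> A" "set a1 \<subseteq> A" "set s2 \<subseteq> A" "set a2 \<subseteq> A" "set s3 \<subseteq> A" "set a3 \<subseteq> A" using assms(7) by auto
  note z1 = act_nice[OF assms(5) sub(4) assms(8)] note z2 = act_gen[OF assms(2) sub(3) z1(2)]
  note z3 = act_nice[OF assms(4) sub(2) z2(2)] note z4 = act_gen[OF assms(1) sub(1) z3(2)]
  note w = act_nice[OF assms(6) sub(6) assms(8)] note w2 = act_gen[OF assms(3) sub(5) w(2)]
  note l = gen_length[OF z1(2)] gen_length[OF z2(2)] gen_length[OF z3(2)] gen_length[OF z4(2)] gen_length[OF w(2)]
  let ?z1 = "mul (gv a2) x" let ?z2 = "mul s2 ?z1" let ?z3 = "mul (gv a1) ?z2" let ?z4 = "mul s1 ?z3"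
  have "mul_at s1 a1 s2 a2 s3 a3 x \<longleftrightarrow> gam s3 (mul (gv a3) x) ?z4"
  proof
    assume "mul_at s1 a1 s2 a2 s3 a3 x"
    then obtain y1 y2 y3 y4 v where y: "gam a2 x y1" "gam s2 y1 y2" "gam a1 y2 y3" "gam s1 y3 y4" "gam a3 x v" "gam s3 v y4"
      unfolding mul_at_def by blast
    have 1: "y1 = ?z1" using z1(1) y(1) by blast
    have 2: "y2 = ?z2" using z2(1) y(2) unfolding 1 by blast
    have 3: "y3 = ?z3" using z3(1) y(3) unfolding 2 by blast
    have 4: "y4 = ?z4" using z4(1) y(4) unfolding 3 by blast
    have 5: "v = mul (gv a3) x" using w(1) y(5) by blast
    show "gam s3 (mul (gv a3) x) ?z4" using y(6) unfolding 4 5 .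
  next
    assume "gam s3 (mul (gv a3) x) ?z4"
    then show "mul_at s1 a1 s2 a2 s3 a3 x"
      unfolding mul_at_def
      by (intro exI[of _ ?z1] exI[of _ ?z2] exI[of _ ?z3] exI[of _ ?z4] exI[of _ "mul (gv a3) x"] conjI l)
        (assumption | rule z1(1)[THEN iffD2] z2(1)[THEN iffD2] z3(1)[THEN iffD2] z4(1)[THEN iffD2] w(1)[THEN iffD2] refl)+
  qed
  also have "\<dots> \<longleftrightarrow> ?z4 = mul s3 (mul (gv a3) x)" by (rule w2(1))
  also have "\<dots> \<longleftrightarrow> mul (mul s1 (gv a1)) (mul s2 (gv a2)) = mul s3 (gv a3)"
  proof -
    have G: "s1 \<in> G" "s2 \<in> G" "s3 \<in> G" "gv a1 \<in> G" "gv a2 \<in> G" "gv a3 \<in> G" "x \<in> G" using assms gv(1) gen_G by auto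
    show ?thesis using mul_right_cancel[of x "mul (mul s1 (gv a1)) (mul s2 (gv a2))" "mul s3 (gv a3)"] G mul_closed mul_assoc by simp
  qed
  finally show ?thesis .
qed

lemma bdfn_gam: "bdfn L n (\<lambda>E. gam (E a) (E b) (E c))"
proof -
  have "bdfn L n (\<lambda>E. E a @ E b @ E c \<in> \<Gamma>)" using L.bdfn_atom3[of \<Gamma> n a b c] \<Gamma>_L by (simp add: mult.commute)
  then show ?thesis unfolding bdfn_def gam_def by simp
qed

text \<open>The exceptions form a condition on independent generic pairs, which
  \<open>generic_ex\<close> makes definable in \<open>L\<close>. The bound \<open>Y_rk\<close>
  ensures that two members of \<open>Y\<close> of joint rank at least \<open>2 * d\<close> are an
  independent pair of group elements.\<close>

lemma nice_L: "{a. nice a} \<in> L n"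
proof -
  define \<phi> where "\<phi> E \<longleftrightarrow> E 1 \<in> Y \<and> E 2 \<in> Y \<and> \<not> good_at (E 0) (E 1) (E 2)" for E :: "nat \<Rightarrow> 'b list"
  have "bdfn L n (\<lambda>E. good_at (E 0) (E 1) (E 2))"
    unfolding good_at_def
    by (rule L.bdfn_ex[where v = 3], intro L.bdfn_conj bdfn_gam, rule L.bdfn_all[where v = 4], intro L.bdfn_imp bdfn_gam L.bdfn_eq, simp,
      rule L.bdfn_ex[where v = 4], intro L.bdfn_conj bdfn_gam, rule L.bdfn_ex[where v = 5], intro L.bdfn_conj bdfn_gam) simp_all
  then have "bdfn L n \<phi>" unfolding \<phi>_def by (intro L.bdfn_conj L.bdfn_not L.bdfn_atom1 Y_L)
  then have "bset n 3 \<phi> \<in> L (n * 3)" by (rule L.bset_mem) (simp add: \<phi>_def)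
  then have X: "bset n 3 \<phi> \<in> L (n + 2 * n)" by (simp add: mult.commute)
  obtain E where E: "E \<in> L n" "\<And>a. length a = n \<Longrightarrow> a \<in> E \<longleftrightarrow> (\<exists>w. length w = 2 * n \<and> a @ w \<in> bset n 3 \<phi> \<and> 2 * d \<le> rk (P \<union> set a) (set w))"
    using generic_ex[OF X, of "2 * d"] by blast
  have "nice a \<longleftrightarrow> a \<in> Y - E" for a
  proof (cases "a \<in> Y")
    case True
    then have la: "length a = n" by (rule Y_length)
    have "a \<in> E \<longleftrightarrow> (\<exists>x y. x \<in> Y \<and> y \<in> Y \<and> \<not> good_at a x y \<and> 2 * d \<le> rk (P \<union> set a) (set x \<union> set y))"
    proof
      assume "a \<in> E"
      then obtain w where w: "length w = 2 * n" "a @ w \<in> bset n 3 \<phi>" "2 * d \<le> rk (P \<union> set a) (set w)" using E(2)[OF la] by blast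
      define x y where "x = take n w" and "y = drop n w"
      have l: "length x = n" "length y = n" "w = x @ y" unfolding x_def y_def using w(1) by auto
      have "concat [a, x, y] \<in> bset n 3 \<phi>" using w(2) l by simp
      then have "\<phi> ((!) [a, x, y])" using in_bset[of "[a, x, y]" 3 n \<phi>] la l by simp
      then show "\<exists>x y. x \<in> Y \<and> y \<in> Y \<and> \<not> good_at a x y \<and> 2 * d \<le> rk (P \<union> set a) (set x \<union> set y)"
        using w(3) l unfolding \<phi>_def by auto
    next
      assume "\<exists>x y. x \<in> Y \<and> y \<in> Y \<and> \<not> good_at a x y \<and> 2 * d \<le> rk (P \<union> set a) (set x \<union> set y)"
      then obtain x y where xy: "x \<in> Y" "y \<in> Y" "\<not> good_at a x y" "2 * d \<le> rk (P \<union> set a) (set x \<union> set y)" by blast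
      have l: "length x = n" "length y = n" using xy Y_length by auto
      have "\<phi> ((!) [a, x, y])" unfolding \<phi>_def using xy by simp
      then have "concat [a, x, y] \<in> bset n 3 \<phi>" using in_bset[of "[a, x, y]" 3 n \<phi>] la l by simp
      then show "a \<in> E" using E(2)[OF la] xy(4) l by (auto intro!: exI[of _ "x @ y"])
    qed
    moreover have "x \<in> Y \<and> y \<in> Y \<and> 2 * d \<le> rk (P \<union> set a) (set x \<union> set y) \<longleftrightarrow> gen2 (set a) x y" for x y
    proof
      assume "gen2 (set a) x y"
      then show "x \<in> Y \<and> y \<in> Y \<and> 2 * d \<le> rk (P \<union> set a) (set x \<union> set y)"
        using gen_Y gen2D gen2_sym unfolding gen2_def by metis
    next
      assume xy: "x \<in> Y \<and> y \<in> Y \<and> 2 * d \<le> rk (P \<union> set a) (set x \<union> set y)"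
      have le: "rk (P \<union> set a) (set z) \<le> d" if "z \<in> Y" for z
        using F.rk_antimono[of "set z" "{}" "P \<union> set a"] Y_rk[OF that] by simp
      have "rk (P \<union> set a) (set x \<union> set y) \<le> rk (P \<union> set a) (set x) + rk (P \<union> set a) (set y)" by (rule F.rk_Un_le) auto
      then have "d \<le> rk (P \<union> set a) (set x)" "d \<le> rk (P \<union> set a) (set y)" using xy le[of x] le[of y] by auto
      then have "gen (set a) x" "gen (set a) y" using Y_gen xy by auto
      then show "gen2 (set a) x y" unfolding gen2_def using xy gen_G by blast
    qed
    ultimately show ?thesis unfolding nice_def using True by blast
  qed (auto simp: nice_def)
  then have "{a. nice a} = Y - E" by blast
  then show ?thesis using L.Diff_mem[OF Y_L E(1)] by simp
qed

text \<open>The quantifier over all \<open>x\<close> generic over the parameters, as the dual of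
  \<open>generic_ex\<close>; variable \<open>m\<close> carries \<open>x\<close>.\<close>

lemma generic_all_mem:
  assumes "bdfn L n \<phi>" "\<And>E E'. (\<forall>v<Suc m. E v = E' v) \<Longrightarrow> \<phi> E = \<phi> E'"
  shows "\<exists>Q\<in>L (n * m). \<forall>bs. length bs = m \<longrightarrow> (\<forall>b\<in>set bs. length b = n) \<longrightarrow>
     (concat bs \<in> Q \<longleftrightarrow> (\<forall>x. gen (set (concat bs)) x \<longrightarrow> \<phi> ((!) (bs @ [x]))))"
proof -
  define \<psi> where "\<psi> E \<longleftrightarrow> E m \<in> Y \<and> \<not> \<phi> E" for E
  have "bdfn L n \<psi>" unfolding \<psi>_def using assms(1) by (intro L.bdfn_conj L.bdfn_not L.bdfn_atom1 Y_L)
  then have "bset n (Suc m) \<psi> \<in> L (n * Suc m)"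
  proof (rule L.bset_mem)
    fix E E' :: "nat \<Rightarrow> 'b list" assume "\<forall>v<Suc m. E v = E' v"
    then show "\<psi> E = \<psi> E'" unfolding \<psi>_def using assms(2)[of E E'] by simp
  qed
  then have X: "bset n (Suc m) \<psi> \<in> L (n * m + n)" by (simp add: add.commute)
  obtain E where E: "E \<in> L (n * m)" "\<And>a. length a = n * m \<Longrightarrow> a \<in> E \<longleftrightarrow> (\<exists>x. length x = n \<and> a @ x \<in> bset n (Suc m) \<psi> \<and> d \<le> rk (P \<union> set a) (set x))"
    using generic_ex[OF X, of d] by blast
  have "concat bs \<in> tuples (n * m) - E \<longleftrightarrow> (\<forall>x. gen (set (concat bs)) x \<longrightarrow> \<phi> ((!) (bs @ [x])))"
    if bs: "length bs = m" "\<forall>b\<in>set bs. length b = n" for bs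
  proof -
    have "length (concat bs) = n * length bs" using bs(2) by (induction bs) auto
    then have lc: "length (concat bs) = n * m" using bs by simp
    have "concat bs \<in> E \<longleftrightarrow> (\<exists>x. length x = n \<and> concat bs @ x \<in> bset n (Suc m) \<psi> \<and> d \<le> rk (P \<union> set (concat bs)) (set x))" by (rule E(2)[OF lc])
    also have "\<dots> \<longleftrightarrow> (\<exists>x. gen (set (concat bs)) x \<and> \<not> \<phi> ((!) (bs @ [x])))"
    proof (rule ex_cong1)
      fix x
      have "concat bs @ x \<in> bset n (Suc m) \<psi> \<longleftrightarrow> x \<in> Y \<and> \<not> \<phi> ((!) (bs @ [x]))" if "length x = n"
        using in_bset[of "bs @ [x]" "Suc m" n \<psi>] bs that unfolding \<psi>_def by (simp add: nth_append)
      moreover have "x \<in> Y \<and> d \<le> rk (P \<union> set (concat bs)) (set x) \<longleftrightarrow> gen (set (concat bs)) x"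
      proof
        assume "x \<in> Y \<and> d \<le> rk (P \<union> set (concat bs)) (set x)"
        then show "gen (set (concat bs)) x" by (elim conjE) (rule Y_gen)
      next
        assume g: "gen (set (concat bs)) x"
        then show "x \<in> Y \<and> d \<le> rk (P \<union> set (concat bs)) (set x)" using gen_Y[OF g] unfolding gen_def by (simp only: order_refl)
      qed
      moreover have "gen (set (concat bs)) x \<Longrightarrow> length x = n" by (rule gen_length)
      ultimately show "(length x = n \<and> concat bs @ x \<in> bset n (Suc m) \<psi> \<and> d \<le> rk (P \<union> set (concat bs)) (set x)) =
         (gen (set (concat bs)) x \<and> \<not> \<phi> ((!) (bs @ [x])))" by metis
    qed
    finally show ?thesis using lc by auto
  qed
  then show ?thesis using L.compl_mem[OF E(1)] by (intro bexI[of _ "tuples (n * m) - E"]) auto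
qed

text \<open>At a generic test point the truth value of \<open>eq_at\<close> does not depend on the
  point, and generic points exist, so the universal quantifier expresses the equation
  itself.\<close>

lemma eq_set:
  "\<exists>Q\<in>L (n * 4). \<forall>s a s' b. gen {} s \<longrightarrow> gen {} s' \<longrightarrow> nice a \<longrightarrow> nice b \<longrightarrow> (s @ a @ s' @ b \<in> Q \<longleftrightarrow> mul s (gv a) = mul s' (gv b))"
proof -
  define \<phi> where "\<phi> E \<longleftrightarrow> eq_at (E 0) (E 1) (E 2) (E 3) (E 4)" for E :: "nat \<Rightarrow> 'b list"
  have "bdfn L n \<phi>" unfolding \<phi>_def eq_at_def
    by (rule L.bdfn_ex[where v = 5], intro L.bdfn_conj bdfn_gam, rule L.bdfn_ex[where v = 6], intro L.bdfn_conj bdfn_gam,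
      rule L.bdfn_ex[where v = 7], intro L.bdfn_conj bdfn_gam) simp_all
  then obtain Q where Q: "Q \<in> L (n * 4)" "\<forall>bs. length bs = 4 \<longrightarrow> (\<forall>b\<in>set bs. length b = n) \<longrightarrow>
     (concat bs \<in> Q \<longleftrightarrow> (\<forall>x. gen (set (concat bs)) x \<longrightarrow> \<phi> ((!) (bs @ [x]))))"
    using generic_all_mem[of \<phi> 4] unfolding \<phi>_def by (auto simp: numeral_eq_Suc)
  have "s @ a @ s' @ b \<in> Q \<longleftrightarrow> mul s (gv a) = mul s' (gv b)" if h: "gen {} s" "gen {} s'" "nice a" "nice b" for s a s' b
  proof -
    let ?A = "set (concat [s, a, s', b])"
    have l: "\<forall>b\<in>set [s, a, s', b]. length b = n" using h gen_length nice_Y Y_length by auto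
    have "s @ a @ s' @ b \<in> Q \<longleftrightarrow> (\<forall>x. gen ?A x \<longrightarrow> \<phi> ((!) ([s, a, s', b] @ [x])))" using Q(2)[rule_format, of "[s, a, s', b]"] l by simp
    also have "\<dots> \<longleftrightarrow> (\<forall>x. gen ?A x \<longrightarrow> mul s (gv a) = mul s' (gv b))"
    proof -
      have "\<phi> ((!) ([s, a, s', b] @ [x])) \<longleftrightarrow> mul s (gv a) = mul s' (gv b)" if "gen ?A x" for x
        using eq_at_iff[OF h _ that] unfolding \<phi>_def by (simp add: numeral_eq_Suc Un_assoc)
      then show ?thesis by blast
    qed
    also have "\<dots> \<longleftrightarrow> mul s (gv a) = mul s' (gv b)" using gen_exists[of ?A] by blast
    finally show ?thesis .
  qed
  then show ?thesis by (intro bexI[OF _ Q(1)] allI impI)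
qed

lemma mul_set:
  "\<exists>Q\<in>L (n * 6). \<forall>s1 a1 s2 a2 s3 a3. gen {} s1 \<longrightarrow> gen {} s2 \<longrightarrow> gen {} s3 \<longrightarrow> nice a1 \<longrightarrow> nice a2 \<longrightarrow> nice a3 \<longrightarrow>
     (s1 @ a1 @ s2 @ a2 @ s3 @ a3 \<in> Q \<longleftrightarrow> mul (mul s1 (gv a1)) (mul s2 (gv a2)) = mul s3 (gv a3))"
proof -
  define \<phi> where "\<phi> E \<longleftrightarrow> mul_at (E 0) (E 1) (E 2) (E 3) (E 4) (E 5) (E 6)" for E :: "nat \<Rightarrow> 'b list"
  have "bdfn L n \<phi>" unfolding \<phi>_def mul_at_def
    by (rule L.bdfn_ex[where v = 7], intro L.bdfn_conj bdfn_gam, rule L.bdfn_ex[where v = 8], intro L.bdfn_conj bdfn_gam,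
      rule L.bdfn_ex[where v = 9], intro L.bdfn_conj bdfn_gam, rule L.bdfn_ex[where v = 10], intro L.bdfn_conj bdfn_gam,
      rule L.bdfn_ex[where v = 11], intro L.bdfn_conj bdfn_gam) simp_all
  then obtain Q where Q: "Q \<in> L (n * 6)" "\<forall>bs. length bs = 6 \<longrightarrow> (\<forall>b\<in>set bs. length b = n) \<longrightarrow>
     (concat bs \<in> Q \<longleftrightarrow> (\<forall>x. gen (set (concat bs)) x \<longrightarrow> \<phi> ((!) (bs @ [x]))))"
    using generic_all_mem[of \<phi> 6] unfolding \<phi>_def by (auto simp: numeral_eq_Suc)
  have "s1 @ a1 @ s2 @ a2 @ s3 @ a3 \<in> Q \<longleftrightarrow> mul (mul s1 (gv a1)) (mul s2 (gv a2)) = mul s3 (gv a3)"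
    if h: "gen {} s1" "gen {} s2" "gen {} s3" "nice a1" "nice a2" "nice a3" for s1 a1 s2 a2 s3 a3
  proof -
    let ?bs = "[s1, a1, s2, a2, s3, a3]"
    let ?A = "set (concat ?bs)"
    have l: "\<forall>b\<in>set ?bs. length b = n" using h gen_length nice_Y Y_length by auto
    have "s1 @ a1 @ s2 @ a2 @ s3 @ a3 \<in> Q \<longleftrightarrow> (\<forall>x. gen ?A x \<longrightarrow> \<phi> ((!) (?bs @ [x])))" using Q(2)[rule_format, of ?bs] l by simp
    also have "\<dots> \<longleftrightarrow> (\<forall>x. gen ?A x \<longrightarrow> mul (mul s1 (gv a1)) (mul s2 (gv a2)) = mul s3 (gv a3))"
    proof -
      have "\<phi> ((!) (?bs @ [x])) \<longleftrightarrow> mul (mul s1 (gv a1)) (mul s2 (gv a2)) = mul s3 (gv a3)" if "gen ?A x" for x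
        using mul_at_iff[OF h _ that] unfolding \<phi>_def by (simp add: numeral_eq_Suc Un_assoc)
      then show ?thesis by blast
    qed
    also have "\<dots> \<longleftrightarrow> mul (mul s1 (gv a1)) (mul s2 (gv a2)) = mul s3 (gv a3)" using gen_exists[of ?A] by blast
    finally show ?thesis .
  qed
  then show ?thesis by (intro bexI[OF _ Q(1)] allI impI)
qed

end

text \<open>The fibres of \<open>Hs\<close>, \<open>Ms\<close> and \<open>Fs\<close> over the parameter tuple \<open>t\<close> are the carrier and multiplication
  of a group and the graph of an isomorphism from \<open>G\<close> onto it. Stated in first-order form, so that it
  transfers from the ultrapower to the original structure.\<close>
definition coded_iso :: "nat \<Rightarrow> 'a list set \<Rightarrow> 'a list set \<Rightarrow> 'a list set \<Rightarrow> 'a list set \<Rightarrow> 'a list set \<Rightarrow> 'a list \<Rightarrow> bool" where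
  "coded_iso n G Gr Hs Ms Fs t \<longleftrightarrow>
    (\<forall>g. length g = n \<longrightarrow> g \<in> G \<longrightarrow> (\<exists>h. length h = 2 * n \<and> t @ g @ h \<in> Fs)) \<and>
    (\<forall>g h. length g = n \<longrightarrow> length h = 2 * n \<longrightarrow> t @ g @ h \<in> Fs \<longrightarrow> g \<in> G \<and> t @ h \<in> Hs) \<and>
    (\<forall>g h h'. length g = n \<longrightarrow> length h = 2 * n \<longrightarrow> length h' = 2 * n \<longrightarrow> t @ g @ h \<in> Fs \<longrightarrow> t @ g @ h' \<in> Fs \<longrightarrow> h = h') \<and>
    (\<forall>g g' h. length g = n \<longrightarrow> length g' = n \<longrightarrow> length h = 2 * n \<longrightarrow> t @ g @ h \<in> Fs \<longrightarrow> t @ g' @ h \<in> Fs \<longrightarrow> g = g') \<and>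
    (\<forall>h. length h = 2 * n \<longrightarrow> t @ h \<in> Hs \<longrightarrow> (\<exists>g. length g = n \<and> t @ g @ h \<in> Fs)) \<and>
    (\<forall>g1 g2 g3 h1 h2 h3. length g1 = n \<longrightarrow> length g2 = n \<longrightarrow> length g3 = n \<longrightarrow>
       length h1 = 2 * n \<longrightarrow> length h2 = 2 * n \<longrightarrow> length h3 = 2 * n \<longrightarrow>
       t @ g1 @ h1 \<in> Fs \<longrightarrow> t @ g2 @ h2 \<in> Fs \<longrightarrow> g1 @ g2 @ g3 \<in> Gr \<longrightarrow> (t @ h1 @ h2 @ h3 \<in> Ms \<longleftrightarrow> t @ g3 @ h3 \<in> Fs))"

section \<open>Unique representatives and the isomorphism\<close>

context sat_chunk begin

lemma test_points: "\<exists>ts. length ts = N \<and> (\<forall>i<N. gen (\<Union>j<i. set (ts ! j)) (ts ! i))"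
proof (induction N)
  case (Suc N)
  then obtain ts where ts: "length ts = N" "\<forall>i<N. gen (\<Union>j<i. set (ts ! j)) (ts ! i)" by blast
  obtain x where x: "gen (\<Union>j<N. set (ts ! j)) x" using gen_exists[of "\<Union>j<N. set (ts ! j)"] by auto
  have eq: "(\<Union>j<i. set ((ts @ [x]) ! j)) = (\<Union>j<i. set (ts ! j))" if "i \<le> N" for i
    using that ts(1) by (auto simp: nth_append)
  have "gen (\<Union>j<i. set ((ts @ [x]) ! j)) ((ts @ [x]) ! i)" if "i < Suc N" for i
    using that ts x eq[of i] by (cases "i = N") (auto simp: nth_append)
  then show ?case using ts(1) by (intro exI[of _ "ts @ [x]"]) auto
qed simp

text \<open>The rank of \<open>A\<close> is spent: by \<open>rk_shift\<close>, each list member that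
  is not generic over \<open>A\<close> lowers the rank of \<open>A\<close> over \<open>P\<close> and
  the members so far by at least one.\<close>

lemma few_nongeneric:
  assumes ts: "\<And>i. i < N \<Longrightarrow> gen (\<Union>j<i. set (ts ! j)) (ts ! i)" and A: "finite A" and i: "i \<le> N"
  shows "card {j. j < i \<and> \<not> gen A (ts ! j)} + rk (P \<union> (\<Union>j<i. set (ts ! j))) A \<le> rk P A"
  using i
proof (induction i)
  case (Suc i)
  let ?T = "\<lambda>i. \<Union>j<i. set (ts ! j)"
  let ?C = "P \<union> ?T i"
  let ?t = "set (ts ! i)"
  have T: "P \<union> ?T (Suc i) = ?C \<union> ?t" by (auto simp: lessThan_Suc)
  have g: "gen (?T i) (ts ! i)" using ts Suc.prems by simp
  have sh: "rk ?C ?t + rk (?C \<union> ?t) A = rk ?C A + rk (?C \<union> A) ?t" using A by (intro F.rk_shift) auto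
  have d: "rk ?C ?t = d" using g unfolding gen_def by simp
  have le: "rk (?C \<union> A) ?t \<le> d" using F.rk_antimono[of ?t ?C "?C \<union> A"] F.cl_ext[of "?C \<union> A"] d by auto
  show ?case
  proof (cases "gen A (ts ! i)")
    case True
    then have "{j. j < Suc i \<and> \<not> gen A (ts ! j)} = {j. j < i \<and> \<not> gen A (ts ! j)}" by (auto simp: less_Suc_eq)
    then show ?thesis using Suc sh d le unfolding T by simp
  next
    case False
    then have "{j. j < Suc i \<and> \<not> gen A (ts ! j)} = insert i {j. j < i \<and> \<not> gen A (ts ! j)}" by (auto simp: less_Suc_eq)
    then have c: "card {j. j < Suc i \<and> \<not> gen A (ts ! j)} = Suc (card {j. j < i \<and> \<not> gen A (ts ! j)})" by simp
    have "rk (P \<union> A) ?t < d" using False genI[of "ts ! i" A] gen_G[OF g] by force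
    moreover have "rk (?C \<union> A) ?t \<le> rk (P \<union> A) ?t"
      using F.rk_antimono[of ?t "P \<union> A" "?C \<union> A"] F.cl_ext[of "?C \<union> A"] by auto
    ultimately show ?thesis using Suc c sh d unfolding T by simp
  qed
qed simp

theorem coded_iso_exists:
  "\<exists>N T Hs Ms Fs. length T = n * N \<and> Hs \<in> L (n * (N + 2)) \<and> Ms \<in> L (n * (N + 6)) \<and> Fs \<in> K (n * (N + 3)) \<and>
     coded_iso n G Gr Hs Ms Fs T"
proof -
  \<comment> \<open>At most \<open>d\<close> of the \<open>N\<close> points fail to be generic over
    a given tuple of rank at most \<open>d\<close>, so at least \<open>d + 1\<close>
    succeed.\<close>
  define N where "N = Suc (2 * d)"
  obtain ts where lts: "length ts = N" and ts: "\<And>i. i < N \<Longrightarrow> gen (\<Union>j<i. set (ts ! j)) (ts ! i)"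
    using test_points[of N] by blast
  have ts0: "gen {} (ts ! i)" if "i < N" for i using gen_mono[OF ts[OF that], of "{}"] by simp
  have tsn: "\<forall>b\<in>set ts. length b = n" using ts0 gen_length lts by (metis in_set_conv_nth)
  have few: "card {j. j < N \<and> \<not> gen A (ts ! j)} \<le> d" if "finite A" "rk P A \<le> d" for A
  proof -
    have "card {j. j < N \<and> \<not> gen A (ts ! j)} + rk (P \<union> (\<Union>j<N. set (ts ! j))) A \<le> rk P A"
      by (rule few_nongeneric[where N = N]) (use ts that in auto)
    then show ?thesis using that(2) by linarith
  qed
  have many: "d < card {j. j < N \<and> gen A (ts ! j)}" if "finite A" "rk P A \<le> d" for A
  proof -
    have "{..<N} = {j. j < N \<and> gen A (ts ! j)} \<union> {j. j < N \<and> \<not> gen A (ts ! j)}" by auto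
    then have "N \<le> card {j. j < N \<and> gen A (ts ! j)} + card {j. j < N \<and> \<not> gen A (ts ! j)}"
      by (metis card_Un_le card_lessThan)
    then show ?thesis using few[OF that] N_def by linarith
  qed
  have inj: "i = j" if ij: "i < N" "j < N" "ts ! i = ts ! j" for i j
  proof -
    have st: False if h: "i < j" "j < N" "ts ! i = ts ! j" for i j
    proof -
      have "rk (P \<union> (\<Union>k<j. set (ts ! k))) (set (ts ! j)) = 0"
      proof (rule F.rk_eq_0)
        have "set (ts ! j) \<subseteq> P \<union> (\<Union>k<j. set (ts ! k))" using h(1) unfolding h(3)[symmetric] by blast
        then show "set (ts ! j) \<subseteq> cl (P \<union> (\<Union>k<j. set (ts ! k)))" using F.cl_ext by (rule subset_trans)
      qed simp
      then have "d = 0" using ts[OF h(2)] unfolding gen_def by simp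
      then show False using h N_def by simp
    qed
    show ?thesis using st[of i j] st[of j i] ij by (metis linorder_neqE_nat)
  qed
  obtain QS where QS: "QS \<in> L (n * 4)" "\<And>s a s' b. gen {} s \<Longrightarrow> gen {} s' \<Longrightarrow> nice a \<Longrightarrow> nice b \<Longrightarrow> s @ a @ s' @ b \<in> QS \<longleftrightarrow> mul s (gv a) = mul s' (gv b)"
    using eq_set by blast
  obtain MS where MS: "MS \<in> L (n * 6)" "\<And>s1 a1 s2 a2 s3 a3. gen {} s1 \<Longrightarrow> gen {} s2 \<Longrightarrow> gen {} s3 \<Longrightarrow> nice a1 \<Longrightarrow> nice a2 \<Longrightarrow> nice a3 \<Longrightarrow>
     s1 @ a1 @ s2 @ a2 @ s3 @ a3 \<in> MS \<longleftrightarrow> mul (mul s1 (gv a1)) (mul s2 (gv a2)) = mul s3 (gv a3)"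
    using mul_set by blast
  \<comment> \<open>\<open>a\<close> is the only code of its element. The factor \<open>E 0\<close>
    on both sides is there because the set \<open>QS\<close> compares products; it cancels.\<close>
  define y3 where "y3 E a \<longleftrightarrow> a \<in> {a. nice a} \<and> (\<forall>b. length b = n \<longrightarrow> (b \<in> {a. nice a} \<longrightarrow> E 0 @ a @ E 0 @ b \<in> QS \<longrightarrow> b = a))" for E :: "nat \<Rightarrow> 'b list" and a
  \<comment> \<open>The pairs of a test point and an admissible code, with the least index that can
    represent the product; this makes the representing pair unique.\<close>
  define hh where "hh E s a \<longleftrightarrow> (\<exists>i\<in>{..<N}. s = E i \<and> y3 E a \<and> (\<forall>j\<in>{..<i}. \<not> (\<exists>b. length b = n \<and> (y3 E b \<and> E i @ a @ E j @ b \<in> QS))))" for E :: "nat \<Rightarrow> 'b list" and s a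
  \<comment> \<open>The graph relation between \<open>g\<close> and the pair of \<open>s\<close> and
    \<open>a\<close>. The value \<open>gv a\<close> is recovered as the \<open>h\<close> whose
    products with more than \<open>d\<close> test points agree with the action of \<open>a\<close>:
    one of these points is generic over \<open>a\<close>, and agreement there forces
    equality.\<close>
  define ff where "ff E g s a \<longleftrightarrow> hh E s a \<and> (\<exists>h. length h = n \<and> (s @ h @ g \<in> Gr \<and>
     (\<exists>J\<in>{J. J \<subseteq> {..<N} \<and> d < card J}. \<forall>j\<in>J. \<exists>w. length w = n \<and> (h @ E j @ w \<in> Gr \<and> a @ E j @ w \<in> \<Gamma>))))" for E :: "nat \<Rightarrow> 'b list" and g s a
  have y3_fresh: "y3 (E(v := c)) a = y3 E a" if "N \<le> v" for E v c a using that unfolding y3_def N_def by simp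
  \<comment> \<open>Variables 0 to \<open>N - 1\<close> hold the test points, the next ones the
    group elements and pairs, and those from \<open>N + 10\<close> on are used for
    quantifiers.\<close>
  have d_y3: "bdfn L n (\<lambda>E. y3 E (E p))" if "p < N + 10" for p
  proof -
    have 1: "bdfn L n (\<lambda>E. E 0 @ E p @ E 0 @ E (N + 11) \<in> QS)" using L.bdfn_atom[of QS n "[0, p, 0, N + 11]"] QS(1) by (simp add: numeral_eq_Suc)
    show ?thesis unfolding y3_def
      by (rule L.bdfn_conj[OF L.bdfn_atom1[OF nice_L]], rule L.bdfn_all[where v = "N + 11"], intro L.bdfn_imp L.bdfn_atom1[OF nice_L] L.bdfn_eq 1) (use that in auto)
  qed
  have d_y3': "bdfn L n (\<lambda>E. y3 E (E (N + 10)))"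
  proof -
    have 1: "bdfn L n (\<lambda>E. E 0 @ E (N + 10) @ E 0 @ E (N + 11) \<in> QS)" using L.bdfn_atom[of QS n "[0, N + 10, 0, N + 11]"] QS(1) by (simp add: numeral_eq_Suc)
    show ?thesis unfolding y3_def
      by (rule L.bdfn_conj[OF L.bdfn_atom1[OF nice_L]], rule L.bdfn_all[where v = "N + 11"], intro L.bdfn_imp L.bdfn_atom1[OF nice_L] L.bdfn_eq 1) auto
  qed
  have d_hh: "bdfn L n (\<lambda>E. hh E (E p) (E q))" if pq: "p < N + 10" "q < N + 10" for p q
    unfolding hh_def
  proof (intro L.bdfn_Bex L.bdfn_conj L.bdfn_eq d_y3[OF pq(2)] L.bdfn_Ball L.bdfn_not)
    fix i j assume ij: "i \<in> {..<N}" "j \<in> {..<i}"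
    have 1: "bdfn L n (\<lambda>E. E i @ E q @ E j @ E (N + 10) \<in> QS)" using L.bdfn_atom[of QS n "[i, q, j, N + 10]"] QS(1) by (simp add: numeral_eq_Suc)
    show "bdfn L n (\<lambda>E. \<exists>b. length b = n \<and> (y3 E b \<and> E i @ E q @ E j @ b \<in> QS))"
      by (rule L.bdfn_ex[where v = "N + 10"], intro L.bdfn_conj d_y3' 1) (use ij pq y3_fresh in auto)
  qed auto
  have LK: "bdfn L n \<phi> \<Longrightarrow> bdfn K n \<phi>" for \<phi> unfolding bdfn_def dfn_def using L_K by blast
  have d_Gr: "bdfn K n (\<lambda>E. E a @ E b @ E c \<in> Gr)" for a b c using K.bdfn_atom3[of Gr n a b c] Gr_K by (simp add: mult.commute)
  have d_\<Gamma>: "bdfn K n (\<lambda>E. E a @ E b @ E c \<in> \<Gamma>)" for a b c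
    using LK[OF L.bdfn_atom3[of \<Gamma> n a b c]] \<Gamma>_L by (simp add: mult.commute)
  have d_ff: "bdfn K n (\<lambda>E. ff E (E N) (E (N + 1)) (E (N + 2)))"
    unfolding ff_def
  proof (rule K.bdfn_conj[OF LK[OF d_hh]])
    show "bdfn K n (\<lambda>E. \<exists>h. length h = n \<and> (E (N + 1) @ h @ E N \<in> Gr \<and>
     (\<exists>J\<in>{J. J \<subseteq> {..<N} \<and> d < card J}. \<forall>j\<in>J. \<exists>w. length w = n \<and> (h @ E j @ w \<in> Gr \<and> E (N + 2) @ E j @ w \<in> \<Gamma>))))"
    proof (rule K.bdfn_ex[where v = "N + 12"], rule K.bdfn_conj[OF d_Gr])
      show "bdfn K n (\<lambda>E. \<exists>J\<in>{J. J \<subseteq> {..<N} \<and> d < card J}. \<forall>j\<in>J. \<exists>w. length w = n \<and> (E (N + 12) @ E j @ w \<in> Gr \<and> E (N + 2) @ E j @ w \<in> \<Gamma>))"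
      proof (intro K.bdfn_Bex K.bdfn_Ball)
        show "finite {J. J \<subseteq> {..<N} \<and> d < card J}" by (rule finite_subset[of _ "Pow {..<N}"]) auto
        fix J j assume J: "J \<in> {J. J \<subseteq> {..<N} \<and> d < card J}"
        show "finite J" using J finite_subset[of J "{..<N}"] by auto
        assume "j \<in> J"
        then have "j < N" using J by auto
        then show "bdfn K n (\<lambda>E. \<exists>w. length w = n \<and> (E (N + 12) @ E j @ w \<in> Gr \<and> E (N + 2) @ E j @ w \<in> \<Gamma>))"
          by (intro K.bdfn_ex[where v = "N + 13"] K.bdfn_conj d_Gr d_\<Gamma>) auto
      qed
      fix E :: "nat \<Rightarrow> 'b list" and b c
      have JE: "(\<forall>j\<in>J. \<exists>w. length w = n \<and> (b @ (E(N + 12 := c)) j @ w \<in> Gr \<and> E (N + 2) @ (E(N + 12 := c)) j @ w \<in> \<Gamma>)) =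
          (\<forall>j\<in>J. \<exists>w. length w = n \<and> (b @ E j @ w \<in> Gr \<and> E (N + 2) @ E j @ w \<in> \<Gamma>))" if JN: "J \<subseteq> {..<N}" for J
      proof (rule ball_cong[OF refl])
        fix j assume "j \<in> J"
        then have "(E(N + 12 := c)) j = E j" using JN by auto
        then show "(\<exists>w. length w = n \<and> (b @ (E(N + 12 := c)) j @ w \<in> Gr \<and> E (N + 2) @ (E(N + 12 := c)) j @ w \<in> \<Gamma>)) =
          (\<exists>w. length w = n \<and> (b @ E j @ w \<in> Gr \<and> E (N + 2) @ E j @ w \<in> \<Gamma>))" by (simp only:)
      qed
      have e: "(E(N + 12 := c)) (N + 1) = E (N + 1)" "(E(N + 12 := c)) N = E N" "(E(N + 12 := c)) (N + 2) = E (N + 2)" by auto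
      show "((E(N + 12 := c)) (N + 1) @ b @ (E(N + 12 := c)) N \<in> Gr \<and>
        (\<exists>J\<in>{J. J \<subseteq> {..<N} \<and> d < card J}. \<forall>j\<in>J. \<exists>w. length w = n \<and> (b @ (E(N + 12 := c)) j @ w \<in> Gr \<and> (E(N + 12 := c)) (N + 2) @ (E(N + 12 := c)) j @ w \<in> \<Gamma>))) =
       (E (N + 1) @ b @ E N \<in> Gr \<and>
        (\<exists>J\<in>{J. J \<subseteq> {..<N} \<and> d < card J}. \<forall>j\<in>J. \<exists>w. length w = n \<and> (b @ E j @ w \<in> Gr \<and> E (N + 2) @ E j @ w \<in> \<Gamma>)))"
        unfolding e by (intro arg_cong2[where f = "(\<and>)"] bex_cong refl JE) blast
    qed
  qed auto
  have y3_dep: "y3 E a = y3 E' a" if "\<forall>v<N. E v = E' v" for E E' a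
    using that unfolding y3_def N_def by simp
  have hh_dep: "hh E s a = hh E' s a" if v: "\<forall>v<N. E v = E' v" for E E' s a
  proof -
    have y: "y3 E = y3 E'" using y3_dep[OF v] by blast
    show ?thesis unfolding hh_def y
    proof (rule bex_cong[OF refl])
      fix i assume "i \<in> {..<N}"
      then have i: "E i = E' i" "\<And>j. j \<in> {..<i} \<Longrightarrow> E j = E' j" using v by auto
      have "(\<forall>j\<in>{..<i}. \<not> (\<exists>b. length b = n \<and> (y3 E' b \<and> E' i @ a @ E j @ b \<in> QS))) = (\<forall>j\<in>{..<i}. \<not> (\<exists>b. length b = n \<and> (y3 E' b \<and> E' i @ a @ E' j @ b \<in> QS)))"
      proof (rule ball_cong[OF refl])
        fix j assume "j \<in> {..<i}"
        then show "(\<not> (\<exists>b. length b = n \<and> (y3 E' b \<and> E' i @ a @ E j @ b \<in> QS))) = (\<not> (\<exists>b. length b = n \<and> (y3 E' b \<and> E' i @ a @ E' j @ b \<in> QS)))"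
          using i(2)[of j] by (simp only:)
      qed
      then show "(s = E i \<and> y3 E' a \<and> (\<forall>j\<in>{..<i}. \<not> (\<exists>b. length b = n \<and> (y3 E' b \<and> E i @ a @ E j @ b \<in> QS)))) =
        (s = E' i \<and> y3 E' a \<and> (\<forall>j\<in>{..<i}. \<not> (\<exists>b. length b = n \<and> (y3 E' b \<and> E' i @ a @ E' j @ b \<in> QS))))"
        unfolding i(1) by (simp only:)
    qed
  qed
  have ff_dep: "ff E g s a = ff E' g s a" if v: "\<forall>v<N. E v = E' v" for E E' g s a
  proof -
    have "(\<forall>j\<in>J. \<exists>w. length w = n \<and> (h @ E j @ w \<in> Gr \<and> a @ E j @ w \<in> \<Gamma>)) = (\<forall>j\<in>J. \<exists>w. length w = n \<and> (h @ E' j @ w \<in> Gr \<and> a @ E' j @ w \<in> \<Gamma>))"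
      if JN: "J \<subseteq> {..<N}" for J h
    proof (rule ball_cong[OF refl])
      fix j assume "j \<in> J"
      then have "E j = E' j" using JN v by auto
      then show "(\<exists>w. length w = n \<and> (h @ E j @ w \<in> Gr \<and> a @ E j @ w \<in> \<Gamma>)) = (\<exists>w. length w = n \<and> (h @ E' j @ w \<in> Gr \<and> a @ E' j @ w \<in> \<Gamma>))" by (simp only:)
    qed
    then have "(\<exists>J\<in>{J. J \<subseteq> {..<N} \<and> d < card J}. \<forall>j\<in>J. \<exists>w. length w = n \<and> (h @ E j @ w \<in> Gr \<and> a @ E j @ w \<in> \<Gamma>)) =
       (\<exists>J\<in>{J. J \<subseteq> {..<N} \<and> d < card J}. \<forall>j\<in>J. \<exists>w. length w = n \<and> (h @ E' j @ w \<in> Gr \<and> a @ E' j @ w \<in> \<Gamma>))" for h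
      by (intro bex_cong refl) blast
    then show ?thesis unfolding ff_def using hh_dep[OF v] by (simp only:)
  qed
  define Hs where "Hs = bset n (N + 2) (\<lambda>E. hh E (E N) (E (N + 1)))"
  define Ms where "Ms = bset n (N + 6) (\<lambda>E. hh E (E N) (E (N + 1)) \<and> hh E (E (N + 2)) (E (N + 3)) \<and> hh E (E (N + 4)) (E (N + 5)) \<and>
     E N @ E (N + 1) @ E (N + 2) @ E (N + 3) @ E (N + 4) @ E (N + 5) \<in> MS)"
  define Fs where "Fs = bset n (N + 3) (\<lambda>E. ff E (E N) (E (N + 1)) (E (N + 2)))"
  have Hs: "Hs \<in> L (n * (N + 2))" unfolding Hs_def
  proof (rule L.bset_mem[OF d_hh])
    fix E E' :: "nat \<Rightarrow> 'b list" assume "\<forall>v<N + 2. E v = E' v"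
    then show "hh E (E N) (E (N + 1)) = hh E' (E' N) (E' (N + 1))" using hh_dep[of E E'] by simp
  qed auto
  have Fs: "Fs \<in> K (n * (N + 3))" unfolding Fs_def
  proof (rule K.bset_mem[OF d_ff])
    fix E E' :: "nat \<Rightarrow> 'b list" assume "\<forall>v<N + 3. E v = E' v"
    then show "ff E (E N) (E (N + 1)) (E (N + 2)) = ff E' (E' N) (E' (N + 1)) (E' (N + 2))" using ff_dep[of E E'] by simp
  qed
  have Ms: "Ms \<in> L (n * (N + 6))" unfolding Ms_def
  proof (rule L.bset_mem)
    have "bdfn L n (\<lambda>E. E N @ E (N + 1) @ E (N + 2) @ E (N + 3) @ E (N + 4) @ E (N + 5) \<in> MS)"
      using L.bdfn_atom[of MS n "[N, N + 1, N + 2, N + 3, N + 4, N + 5]"] MS(1) by (simp add: numeral_eq_Suc)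
    then show "bdfn L n (\<lambda>E. hh E (E N) (E (N + 1)) \<and> hh E (E (N + 2)) (E (N + 3)) \<and> hh E (E (N + 4)) (E (N + 5)) \<and>
       E N @ E (N + 1) @ E (N + 2) @ E (N + 3) @ E (N + 4) @ E (N + 5) \<in> MS)"
      by (intro L.bdfn_conj d_hh) auto
    fix E E' :: "nat \<Rightarrow> 'b list" assume "\<forall>v<N + 6. E v = E' v"
    then show "(hh E (E N) (E (N + 1)) \<and> hh E (E (N + 2)) (E (N + 3)) \<and> hh E (E (N + 4)) (E (N + 5)) \<and>
       E N @ E (N + 1) @ E (N + 2) @ E (N + 3) @ E (N + 4) @ E (N + 5) \<in> MS) =
       (hh E' (E' N) (E' (N + 1)) \<and> hh E' (E' (N + 2)) (E' (N + 3)) \<and> hh E' (E' (N + 4)) (E' (N + 5)) \<and>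
       E' N @ E' (N + 1) @ E' (N + 2) @ E' (N + 3) @ E' (N + 4) @ E' (N + 5) \<in> MS)"
      using hh_dep[of E E'] by simp
  qed
  let ?E = "(!) ts"
  have y3: "y3 ?E a \<longleftrightarrow> nice a \<and> (\<forall>b. nice b \<longrightarrow> gv b = gv a \<longrightarrow> b = a)" for a
  proof (cases "nice a")
    case True
    have t0: "gen {} (ts ! 0)" using ts0 N_def by simp
    have "ts ! 0 @ a @ ts ! 0 @ b \<in> QS \<longleftrightarrow> gv b = gv a" if "nice b" for b
      using QS(2)[OF t0 t0 True that] mul_left_cancel[of "ts ! 0" "gv a" "gv b"] gen_G[OF t0] gv(1)[OF True] gv(1)[OF that] by auto
    then show ?thesis unfolding y3_def using True Y_length nice_Y by auto
  qed (simp add: y3_def)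
  have y3_gen: "y3 ?E a" "gv a = a" if "gen {} a" for a
    using gen_nice[OF that] gen_of_gv[OF that] unfolding y3 by auto
  have y3n: "nice a" if "y3 ?E a" for a using that unfolding y3 by blast
  have hh: "hh ?E s a \<longleftrightarrow> (\<exists>i<N. s = ts ! i \<and> y3 ?E a \<and> (\<forall>j<i. \<forall>b. y3 ?E b \<longrightarrow> mul (ts ! i) (gv a) \<noteq> mul (ts ! j) (gv b)))" for s a
  proof -
    have *: "length b = n \<and> (y3 ?E b \<and> ts ! i @ a @ ts ! j @ b \<in> QS) \<longleftrightarrow> y3 ?E b \<and> mul (ts ! i) (gv a) = mul (ts ! j) (gv b)"
      if "i < N" "j < i" "y3 ?E a" for i j b
      using QS(2)[OF ts0 ts0 y3n[OF that(3)] y3n, of i j b] that Y_length nice_Y y3n by (meson less_trans)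
    show ?thesis unfolding hh_def bex_simps Bex_def Ball_def lessThan_iff using * by (metis (no_types, lifting))
  qed
  have hhD: "nice a \<and> gen {} s" if "hh ?E s a" for s a using that ts0 y3n unfolding hh by blast
  have mulG: "mul s (gv a) \<in> G" if "hh ?E s a" for s a using hhD[OF that] gv(1) gen_G mul_closed by blast
  have hinj: "s = s' \<and> a = a'" if h: "hh ?E s a" "hh ?E s' a'" "mul s (gv a) = mul s' (gv a')" for s a s' a'
  proof -
    obtain i where i: "i < N" "s = ts ! i" "y3 ?E a" "\<forall>j<i. \<forall>b. y3 ?E b \<longrightarrow> mul (ts ! i) (gv a) \<noteq> mul (ts ! j) (gv b)" using h(1) unfolding hh by blast
    obtain j where j: "j < N" "s' = ts ! j" "y3 ?E a'" "\<forall>k<j. \<forall>b. y3 ?E b \<longrightarrow> mul (ts ! j) (gv a') \<noteq> mul (ts ! k) (gv b)" using h(2) unfolding hh by blast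
    have "i = j" using i j h(3) by (metis linorder_neqE_nat)
    then have s: "s = s'" using i j by simp
    then have "gv a = gv a'" using h(3) mul_left_cancel[of s "gv a" "gv a'"] hhD[OF h(1)] hhD[OF h(2)] gv(1) gen_G by blast
    then have "a' = a" using i(3) y3n[OF j(3)] unfolding y3 by auto
    then show ?thesis using s by simp
  qed
  have hsurj: "\<exists>s a. hh ?E s a \<and> g = mul s (gv a)" if g: "g \<in> G" for g
  proof -
    have ex: "\<exists>i. i < N \<and> (\<exists>a. y3 ?E a \<and> g = mul (ts ! i) (gv a))"
    proof -
      have "d < card {j. j < N \<and> gen (set g) (ts ! j)}" using many[of "set g"] rk_le_d[OF g] by simp
      then have "{j. j < N \<and> gen (set g) (ts ! j)} \<noteq> {}" by (metis card.empty not_less0)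
      then obtain i where i: "i < N" "gen (set g) (ts ! i)" by blast
      \<comment> \<open>The list member is generic over \<open>g\<close>, so the quotient is generic
        over \<open>g\<close> too, and a generic is the sole code of itself.\<close>
      let ?y = "mul (iv (ts ! i)) g"
      have tG: "ts ! i \<in> G" using i(2) gen_G by blast
      have y: "?y \<in> G" using tG g mul_closed iv_closed by blast
      have "g = mul (ts ! i) ?y" using mul_iv_cancel(1)[OF tG g] by simp
      then have "set (ts ! i) \<subseteq> cl (P \<union> (set ?y \<union> set g))" using mul_cl_P(3)[OF tG y _ order_refl] by blast
      then have "set (ts ! i) \<subseteq> cl (P \<union> set g \<union> set ?y)" by (simp add: Un_ac)
      then have "rk (P \<union> set g) (set (ts ! i)) \<le> rk (P \<union> set g) (set ?y)" by (intro F.rk_le_cl) auto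
      then have "gen (set g) ?y" using i(2) y by (intro genI) (auto simp: gen_def)
      then have "gen {} ?y" using gen_mono by blast
      then show ?thesis using y3_gen[of ?y] i(1) \<open>g = mul (ts ! i) ?y\<close> by metis
    qed
    define i where "i = (LEAST i. i < N \<and> (\<exists>a. y3 ?E a \<and> g = mul (ts ! i) (gv a)))"
    obtain a where a: "i < N" "y3 ?E a" "g = mul (ts ! i) (gv a)" using LeastI_ex[OF ex] unfolding i_def by blast
    have "\<forall>j<i. \<forall>b. y3 ?E b \<longrightarrow> g \<noteq> mul (ts ! j) (gv b)"
      using not_less_Least[of _ "\<lambda>i. i < N \<and> (\<exists>a. y3 ?E a \<and> g = mul (ts ! i) (gv a))"] a(1) unfolding i_def[symmetric] by (metis less_trans)
    then have "hh ?E (ts ! i) a" unfolding hh using a by blast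
    then show ?thesis using a(3) by blast
  qed
  have ff: "ff ?E g s a \<longleftrightarrow> hh ?E s a \<and> g = mul s (gv a)" if lg: "length g = n" for g s a
  proof (cases "hh ?E s a")
    case True
    have na: "nice a" and sG: "gen {} s" using hhD[OF True] by auto
    have sG': "s \<in> G" using gen_G[OF sG] .
    have ga: "gv a \<in> G" by (rule gv(1)[OF na])
    have la: "length a = n" using Y_length nice_Y na by blast
    have ra: "rk P (set a) \<le> d" using F.rk_antimono[of "set a" "{}" P] Y_rk[OF nice_Y[OF na]] by simp
    have gamE: "gam a (ts ! j) w \<longleftrightarrow> a @ ts ! j @ w \<in> \<Gamma>" if "j < N" "length w = n" for j w
      unfolding gam_def using that la gen_length[OF ts0] by simp
    have grE: "h @ ts ! j @ w \<in> Gr \<longleftrightarrow> h \<in> G \<and> w = mul h (ts ! j)" if "j < N" "length h = n" for h j w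
      using in_Gr[of h "ts ! j" w] that gen_length[OF ts0[OF that(1)]] gen_G[OF ts0[OF that(1)]] by blast
    have key: "(\<exists>J\<in>{J. J \<subseteq> {..<N} \<and> d < card J}. \<forall>j\<in>J. \<exists>w. length w = n \<and> (h @ ts ! j @ w \<in> Gr \<and> a @ ts ! j @ w \<in> \<Gamma>)) \<longleftrightarrow> h = gv a"
      if h: "h \<in> G" for h
    proof
      assume "\<exists>J\<in>{J. J \<subseteq> {..<N} \<and> d < card J}. \<forall>j\<in>J. \<exists>w. length w = n \<and> (h @ ts ! j @ w \<in> Gr \<and> a @ ts ! j @ w \<in> \<Gamma>)"
      then obtain J where J: "J \<subseteq> {..<N}" "d < card J" "\<forall>j\<in>J. \<exists>w. length w = n \<and> (h @ ts ! j @ w \<in> Gr \<and> a @ ts ! j @ w \<in> \<Gamma>)" by blast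
      have "\<not> J \<subseteq> {j. j < N \<and> \<not> gen (set a) (ts ! j)}"
      proof
        assume "J \<subseteq> {j. j < N \<and> \<not> gen (set a) (ts ! j)}"
        then have "card J \<le> card {j. j < N \<and> \<not> gen (set a) (ts ! j)}" by (intro card_mono) auto
        then show False using few[of "set a"] ra J(2) by simp
      qed
      then obtain j where j: "j \<in> J" "j < N" "gen (set a) (ts ! j)" using J(1) by blast
      obtain w where w: "length w = n" "h @ ts ! j @ w \<in> Gr" "a @ ts ! j @ w \<in> \<Gamma>" using J(3) j(1) by blast
      have "w = mul h (ts ! j)" using grE[OF j(2) G_length[OF h]] w(2) by blast
      moreover have "gam a (ts ! j) w" using gamE[OF j(2) w(1)] w(3) by blast
      ultimately show "h = gv a" using gv_unique[OF na h j(3)] by simp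
    next
      assume hv: "h = gv a"
      let ?J = "{j. j < N \<and> gen (set a) (ts ! j)}"
      have "\<exists>w. length w = n \<and> (h @ ts ! j @ w \<in> Gr \<and> a @ ts ! j @ w \<in> \<Gamma>)" if "j \<in> ?J" for j
      proof -
        have j: "j < N" "gen (set a) (ts ! j)" using that by auto
        have "gam a (ts ! j) (mul h (ts ! j))" using gv(2)[OF na j(2)] hv by blast
        moreover have "length (mul h (ts ! j)) = n" using gamD(9)[OF calculation] .
        ultimately show ?thesis using gamE[OF j(1)] grE[OF j(1) G_length[OF h]] h by blast
      qed
      moreover have "?J \<in> {J. J \<subseteq> {..<N} \<and> d < card J}" using many[of "set a"] ra by auto
      ultimately show "\<exists>J\<in>{J. J \<subseteq> {..<N} \<and> d < card J}. \<forall>j\<in>J. \<exists>w. length w = n \<and> (h @ ts ! j @ w \<in> Gr \<and> a @ ts ! j @ w \<in> \<Gamma>)" by (intro bexI[of _ ?J] ballI)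
    qed
    have sh: "s @ h @ g \<in> Gr \<longleftrightarrow> h \<in> G \<and> g = mul s h" if "length h = n" for h
      using in_Gr[of s h g] that G_length[OF sG'] sG' by blast
    have "ff ?E g s a \<longleftrightarrow> (\<exists>h. length h = n \<and> h \<in> G \<and> g = mul s h \<and> h = gv a)"
    proof -
      have "(length h = n \<and> (s @ h @ g \<in> Gr \<and> (\<exists>J\<in>{J. J \<subseteq> {..<N} \<and> d < card J}. \<forall>j\<in>J. \<exists>w. length w = n \<and> (h @ ts ! j @ w \<in> Gr \<and> a @ ts ! j @ w \<in> \<Gamma>)))) \<longleftrightarrow>
         (length h = n \<and> h \<in> G \<and> g = mul s h \<and> h = gv a)" for h
      proof (cases "length h = n \<and> h \<in> G")
        case True
        then show ?thesis using sh[of h] key[of h] by (simp only:) blast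
      next
        case False
        then show ?thesis using sh[of h] by blast
      qed
      then show ?thesis unfolding ff_def using True by (simp only: simp_thms)
    qed
    also have "\<dots> \<longleftrightarrow> g = mul s (gv a)" using ga G_length[OF ga] by auto
    finally show ?thesis using True by (simp only: simp_thms)
  qed (simp add: ff_def)
  let ?T = "concat ts"
  have split: "\<exists>s a. h = s @ a \<and> length s = n \<and> length a = n" if "length h = 2 * n" for h :: "'b list"
    using that by (intro exI[of _ "take n h"] exI[of _ "drop n h"]) auto
  have nth_ts: "(\<forall>v<N. (!) (ts @ bs) v = (!) ts v)" for bs using lts by (simp add: nth_append)
  have inF: "?T @ g @ s @ a \<in> Fs \<longleftrightarrow> hh ?E s a \<and> g = mul s (gv a)" if l: "length g = n" "length s = n" "length a = n" for g s a
  proof -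
    have "concat (ts @ [g, s, a]) \<in> Fs \<longleftrightarrow> ff ((!) (ts @ [g, s, a])) ((ts @ [g, s, a]) ! N) ((ts @ [g, s, a]) ! (N + 1)) ((ts @ [g, s, a]) ! (N + 2))"
      unfolding Fs_def by (rule in_bset) (use tsn lts l in auto)
    also have "\<dots> \<longleftrightarrow> ff ?E g s a"
    proof -
      have e: "(ts @ [g, s, a]) ! N = g" "(ts @ [g, s, a]) ! (N + 1) = s" "(ts @ [g, s, a]) ! (N + 2) = a" using lts by (simp_all add: nth_append)
      show ?thesis unfolding e by (rule ff_dep[OF nth_ts])
    qed
    finally show ?thesis using ff[OF l(1)] by simp
  qed
  have inH: "?T @ s @ a \<in> Hs \<longleftrightarrow> hh ?E s a" if l: "length s = n" "length a = n" for s a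
  proof -
    have "concat (ts @ [s, a]) \<in> Hs \<longleftrightarrow> hh ((!) (ts @ [s, a])) ((ts @ [s, a]) ! N) ((ts @ [s, a]) ! (N + 1))"
      unfolding Hs_def by (rule in_bset) (use tsn lts l in auto)
    also have "\<dots> \<longleftrightarrow> hh ?E s a"
    proof -
      have e: "(ts @ [s, a]) ! N = s" "(ts @ [s, a]) ! (N + 1) = a" using lts by (simp_all add: nth_append)
      show ?thesis unfolding e by (rule hh_dep[OF nth_ts])
    qed
    finally show ?thesis by simp
  qed
  have inM: "?T @ s1 @ a1 @ s2 @ a2 @ s3 @ a3 \<in> Ms \<longleftrightarrow> hh ?E s1 a1 \<and> hh ?E s2 a2 \<and> hh ?E s3 a3 \<and> mul (mul s1 (gv a1)) (mul s2 (gv a2)) = mul s3 (gv a3)"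
    if l: "length s1 = n" "length a1 = n" "length s2 = n" "length a2 = n" "length s3 = n" "length a3 = n" for s1 a1 s2 a2 s3 a3
  proof -
    let ?bs = "[s1, a1, s2, a2, s3, a3]"
    let ?e = "(!) (ts @ ?bs)"
    have e: "?e N = s1" "?e (N + 1) = a1" "?e (N + 2) = s2" "?e (N + 3) = a2" "?e (N + 4) = s3" "?e (N + 5) = a3"
      using lts by (simp_all add: nth_append)
    have "concat (ts @ ?bs) \<in> Ms \<longleftrightarrow> (hh ?e (?e N) (?e (N + 1)) \<and> hh ?e (?e (N + 2)) (?e (N + 3)) \<and> hh ?e (?e (N + 4)) (?e (N + 5)) \<and>
       ?e N @ ?e (N + 1) @ ?e (N + 2) @ ?e (N + 3) @ ?e (N + 4) @ ?e (N + 5) \<in> MS)"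
      unfolding Ms_def by (rule in_bset) (use tsn lts l in auto)
    also have "\<dots> \<longleftrightarrow> (hh ?E s1 a1 \<and> hh ?E s2 a2 \<and> hh ?E s3 a3 \<and> s1 @ a1 @ s2 @ a2 @ s3 @ a3 \<in> MS)"
      unfolding e hh_dep[OF nth_ts[of ?bs]] by (rule refl)
    also have "\<dots> \<longleftrightarrow> hh ?E s1 a1 \<and> hh ?E s2 a2 \<and> hh ?E s3 a3 \<and> mul (mul s1 (gv a1)) (mul s2 (gv a2)) = mul s3 (gv a3)"
      using MS(2) hhD by blast
    finally show ?thesis by simp
  qed
  have lh: "length s = n" "length a = n" if "hh ?E s a" for s a using hhD[OF that] gen_length nice_Y Y_length by blast+
  have "coded_iso n G Gr Hs Ms Fs ?T"
    unfolding coded_iso_def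
  proof (intro conjI allI impI)
    fix g assume g: "length g = n" "g \<in> G"
    obtain s a where sa: "hh ?E s a" "g = mul s (gv a)" using hsurj[OF g(2)] by blast
    then show "\<exists>h. length h = 2 * n \<and> ?T @ g @ h \<in> Fs" using inF[OF g(1) lh[OF sa(1)]] lh[OF sa(1)] by (intro exI[of _ "s @ a"]) simp
  next
    fix g h assume gh: "length g = n" "length h = 2 * n" "?T @ g @ h \<in> Fs"
    obtain s a where sa: "h = s @ a" "length s = n" "length a = n" using split[OF gh(2)] by blast
    show "g \<in> G" "?T @ h \<in> Hs" using gh inF[OF gh(1) sa(2,3)] inH[OF sa(2,3)] mulG unfolding sa(1) by auto
  next
    fix g h h' assume gh: "length g = n" "length h = 2 * n" "length h' = 2 * n" "?T @ g @ h \<in> Fs" "?T @ g @ h' \<in> Fs"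
    obtain s a where sa: "h = s @ a" "length s = n" "length a = n" using split[OF gh(2)] by blast
    obtain s' a' where sa': "h' = s' @ a'" "length s' = n" "length a' = n" using split[OF gh(3)] by blast
    show "h = h'" using gh(4,5) inF[OF gh(1) sa(2,3)] inF[OF gh(1) sa'(2,3)] hinj[of s a s' a'] unfolding sa(1) sa'(1) by auto
  next
    fix g g' h assume gh: "length g = n" "length g' = n" "length h = 2 * n" "?T @ g @ h \<in> Fs" "?T @ g' @ h \<in> Fs"
    obtain s a where sa: "h = s @ a" "length s = n" "length a = n" using split[OF gh(3)] by blast
    show "g = g'" using gh(4,5) inF[OF gh(1) sa(2,3)] inF[OF gh(2) sa(2,3)] unfolding sa(1) by auto
  next
    fix h assume h: "length h = 2 * n" "?T @ h \<in> Hs"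
    obtain s a where sa: "h = s @ a" "length s = n" "length a = n" using split[OF h(1)] by blast
    have hs: "hh ?E s a" using h(2) inH[OF sa(2,3)] unfolding sa(1) by simp
    have l: "length (mul s (gv a)) = n" using mulG[OF hs] G_length by blast
    show "\<exists>g. length g = n \<and> ?T @ g @ h \<in> Fs" using inF[OF l sa(2,3)] hs l unfolding sa(1) by blast
  next
    fix g1 g2 g3 h1 h2 h3 :: "'b list"
    assume l: "length g1 = n" "length g2 = n" "length g3 = n" "length h1 = 2 * n" "length h2 = 2 * n" "length h3 = 2 * n"
      and f: "?T @ g1 @ h1 \<in> Fs" "?T @ g2 @ h2 \<in> Fs" and gr: "g1 @ g2 @ g3 \<in> Gr"
    obtain s1 a1 where 1: "h1 = s1 @ a1" "length s1 = n" "length a1 = n" using split[OF l(4)] by blast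
    obtain s2 a2 where 2: "h2 = s2 @ a2" "length s2 = n" "length a2 = n" using split[OF l(5)] by blast
    obtain s3 a3 where 3: "h3 = s3 @ a3" "length s3 = n" "length a3 = n" using split[OF l(6)] by blast
    have g: "hh ?E s1 a1" "g1 = mul s1 (gv a1)" "hh ?E s2 a2" "g2 = mul s2 (gv a2)"
      using f inF[OF l(1) 1(2,3)] inF[OF l(2) 2(2,3)] unfolding 1(1) 2(1) by auto
    have g3: "g3 = mul g1 g2" using gr in_Gr[OF l(1,2)] by blast
    show "(?T @ h1 @ h2 @ h3 \<in> Ms) = (?T @ g3 @ h3 \<in> Fs)"
      using inM[OF 1(2,3) 2(2,3) 3(2,3)] inF[OF l(3) 3(2,3)] g unfolding 1(1) 2(1) 3(1) g3 by auto
  qed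
  moreover have "length ?T = n * N"
  proof -
    have "length ?T = n * length ts" using tsn by (induction ts) auto
    then show ?thesis using lts by simp
  qed
  ultimately show ?thesis using Hs Ms Fs by blast
qed

end

section \<open>Ultrapowers\<close>

text \<open>A maximal family all of whose finite intersections are infinite. Maximality decides
  every set, and the final segments \<open>{m..}\<close> belong to it because intersecting with them
  keeps an infinite set infinite.\<close>

lemma free_ultrafilter_exists:
  "\<exists>U::nat set set. (\<forall>A B. A \<in> U \<longrightarrow> A \<subseteq> B \<longrightarrow> B \<in> U) \<and> (\<forall>A B. A \<in> U \<longrightarrow> B \<in> U \<longrightarrow> A \<inter> B \<in> U) \<and>
     (\<forall>A. - A \<in> U \<longleftrightarrow> A \<notin> U) \<and> (\<forall>m. {m..} \<in> U)"
proof -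
  define \<A> where "\<A> = {C::nat set set. \<forall>V. finite V \<longrightarrow> V \<subseteq> C \<longrightarrow> infinite (\<Inter>V)}"
  have "\<exists>M\<in>\<A>. \<forall>X\<in>\<A>. M \<subseteq> X \<longrightarrow> X = M"
  proof (rule subset_Zorn')
    fix C assume C: "subset.chain \<A> C"
    show "\<Union>C \<in> \<A>"
    proof (cases "C = {}")
      case True then show ?thesis unfolding \<A>_def by simp
    next
      case False
      have "infinite (\<Inter>V)" if V: "finite V" "V \<subseteq> \<Union>C" for V
      proof -
        obtain D where "D \<in> C" "V \<subseteq> D" using finite_subset_Union_chain[OF V False C] by blast
        then show ?thesis using C V(1) unfolding subset.chain_def \<A>_def by blast
      qed
      then show ?thesis unfolding \<A>_def by blast
    qed
  qed
  then obtain M where M: "M \<in> \<A>" "\<And>X. X \<in> \<A> \<Longrightarrow> M \<subseteq> X \<Longrightarrow> X = M" by blast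
  have fip: "infinite (\<Inter>V)" if "finite V" "V \<subseteq> M" for V using M(1) that unfolding \<A>_def by blast
  have max: "A \<in> M" if h: "\<And>V. finite V \<Longrightarrow> V \<subseteq> M \<Longrightarrow> infinite (A \<inter> \<Inter>V)" for A
  proof -
    have "insert A M \<in> \<A>" unfolding \<A>_def
    proof (intro CollectI allI impI)
      fix V assume V: "finite V" "V \<subseteq> insert A M"
      have "infinite (A \<inter> \<Inter>(V - {A}))" by (rule h) (use V in auto)
      moreover have "A \<inter> \<Inter>(V - {A}) \<subseteq> \<Inter>V" by auto
      ultimately show "infinite (\<Inter>V)" using finite_subset by blast
    qed
    then show ?thesis using M(2)[of "insert A M"] by blast
  qed
  have up: "B \<in> M" if "A \<in> M" "A \<subseteq> B" for A B
  proof (rule max)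
    fix V assume V: "finite V" "V \<subseteq> M"
    have "infinite (\<Inter>(insert A V))" by (rule fip) (use V that in auto)
    moreover have "\<Inter>(insert A V) \<subseteq> B \<inter> \<Inter>V" using that by auto
    ultimately show "infinite (B \<inter> \<Inter>V)" using finite_subset by blast
  qed
  have int: "A \<inter> B \<in> M" if "A \<in> M" "B \<in> M" for A B
  proof (rule max)
    fix V assume V: "finite V" "V \<subseteq> M"
    have "infinite (\<Inter>(insert A (insert B V)))" by (rule fip) (use V that in auto)
    then show "infinite ((A \<inter> B) \<inter> \<Inter>V)" by (simp add: Int_assoc)
  qed
  have c1: "\<not> (A \<in> M \<and> - A \<in> M)" for A
  proof
    assume "A \<in> M \<and> - A \<in> M"
    then have "infinite (\<Inter>{A, - A})" by (intro fip) auto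
    then show False by simp
  qed
  have c2: "A \<in> M \<or> - A \<in> M" for A
  proof (rule ccontr)
    assume n: "\<not> (A \<in> M \<or> - A \<in> M)"
    obtain V where V: "finite V" "V \<subseteq> M" "finite (A \<inter> \<Inter>V)" using n max[of A] by blast
    obtain V' where V': "finite V'" "V' \<subseteq> M" "finite (- A \<inter> \<Inter>V')" using n max[of "- A"] by blast
    have "\<Inter>(V \<union> V') \<subseteq> (A \<inter> \<Inter>V) \<union> (- A \<inter> \<Inter>V')" by auto
    then have "finite (\<Inter>(V \<union> V'))" using V(3) V'(3) by (meson finite_UnI finite_subset)
    then show False using fip[of "V \<union> V'"] V V' by blast
  qed
  have co: "{m..} \<in> M" for m
  proof (rule max)
    fix V assume "finite V" "V \<subseteq> M"
    then have "infinite (\<Inter>V)" by (rule fip)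
    moreover have "\<Inter>V \<subseteq> ({m..} \<inter> \<Inter>V) \<union> {..<m}" by auto
    ultimately show "infinite ({m..} \<inter> \<Inter>V)" by (meson finite_UnI finite_lessThan finite_subset)
  qed
  show ?thesis using up int c1 c2 co by (intro exI[of _ M]) blast
qed

definition ultra :: "nat set set" where
  "ultra = (SOME U. (\<forall>A B. A \<in> U \<longrightarrow> A \<subseteq> B \<longrightarrow> B \<in> U) \<and> (\<forall>A B. A \<in> U \<longrightarrow> B \<in> U \<longrightarrow> A \<inter> B \<in> U) \<and>
     (\<forall>A. - A \<in> U \<longleftrightarrow> A \<notin> U) \<and> (\<forall>m. {m..} \<in> U))"

lemma ultra:
  shows ultra_mono: "\<And>A B. A \<in> ultra \<Longrightarrow> A \<subseteq> B \<Longrightarrow> B \<in> ultra" and ultra_Int: "\<And>A B. A \<in> ultra \<Longrightarrow> B \<in> ultra \<Longrightarrow> A \<inter> B \<in> ultra"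
    and ultra_compl: "\<And>A. - A \<in> ultra \<longleftrightarrow> A \<notin> ultra" and ultra_ge: "\<And>m. {m..} \<in> ultra"
proof -
  have "(\<forall>A B. A \<in> ultra \<longrightarrow> A \<subseteq> B \<longrightarrow> B \<in> ultra) \<and> (\<forall>A B. A \<in> ultra \<longrightarrow> B \<in> ultra \<longrightarrow> A \<inter> B \<in> ultra) \<and>
     (\<forall>A. - A \<in> ultra \<longleftrightarrow> A \<notin> ultra) \<and> (\<forall>m. {m..} \<in> ultra)"
    unfolding ultra_def by (rule someI_ex[OF free_ultrafilter_exists])
  then show "\<And>A B. A \<in> ultra \<Longrightarrow> A \<subseteq> B \<Longrightarrow> B \<in> ultra" "\<And>A B. A \<in> ultra \<Longrightarrow> B \<in> ultra \<Longrightarrow> A \<inter> B \<in> ultra"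
     "\<And>A. - A \<in> ultra \<longleftrightarrow> A \<notin> ultra" "\<And>m. {m..} \<in> ultra" by blast+
qed

definition ae :: "(nat \<Rightarrow> bool) \<Rightarrow> bool" where "ae \<phi> \<longleftrightarrow> {i. \<phi> i} \<in> ultra"

lemma ae_mono: "ae \<phi> \<Longrightarrow> (\<And>i. \<phi> i \<Longrightarrow> \<psi> i) \<Longrightarrow> ae \<psi>"
  unfolding ae_def by (rule ultra_mono) auto

lemma ae_conj: "ae (\<lambda>i. \<phi> i \<and> \<psi> i) \<longleftrightarrow> ae \<phi> \<and> ae \<psi>"
proof
  show "ae \<phi> \<and> ae \<psi> \<Longrightarrow> ae (\<lambda>i. \<phi> i \<and> \<psi> i)" unfolding ae_def using ultra_Int[of "{i. \<phi> i}" "{i. \<psi> i}"] by (simp add: Collect_conj_eq)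
qed (auto intro: ae_mono)

lemma ae_not: "ae (\<lambda>i. \<not> \<phi> i) \<longleftrightarrow> \<not> ae \<phi>"
  unfolding ae_def using ultra_compl[of "{i. \<phi> i}"] by (simp add: Collect_neg_eq)

lemma ae_disj: "ae (\<lambda>i. \<phi> i \<or> \<psi> i) \<longleftrightarrow> ae \<phi> \<or> ae \<psi>"
  using ae_conj[of "\<lambda>i. \<not> \<phi> i" "\<lambda>i. \<not> \<psi> i"] ae_not[of "\<lambda>i. \<phi> i \<or> \<psi> i"] unfolding de_Morgan_disj ae_not by blast

lemma ae_ge: "ae (\<lambda>i. m \<le> i)" unfolding ae_def using ultra_ge[of m] by (simp add: atLeast_def)

lemma ae_const: "ae (\<lambda>i. c) \<longleftrightarrow> c"
  using ae_ge[of 0] ae_not[of "\<lambda>_. True"] by (cases c) auto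

lemma ae_mono2: "ae \<phi> \<Longrightarrow> ae \<psi> \<Longrightarrow> (\<And>i. \<phi> i \<Longrightarrow> \<psi> i \<Longrightarrow> \<chi> i) \<Longrightarrow> ae \<chi>"
  using ae_conj[of \<phi> \<psi>] ae_mono[of "\<lambda>i. \<phi> i \<and> \<psi> i" \<chi>] by blast

lemma ae_Ball: "finite J \<Longrightarrow> (\<forall>j\<in>J. ae (\<phi> j)) \<Longrightarrow> ae (\<lambda>i. \<forall>j\<in>J. \<phi> j i)"
  by (induction J rule: finite_induct) (auto simp: ae_const ae_conj)

lemma ae_Bex: "finite J \<Longrightarrow> ae (\<lambda>i. \<exists>j\<in>J. \<phi> j i) \<Longrightarrow> \<exists>j\<in>J. ae (\<phi> j)"
  by (induction J rule: finite_induct) (auto simp: ae_const ae_disj)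

lemma ae_ex: "ae (\<lambda>i. \<exists>x. \<phi> i x) \<Longrightarrow> \<exists>f. ae (\<lambda>i. \<phi> i (f i))"
  by (rule exI[of _ "\<lambda>i. SOME x. \<phi> i x"]) (erule ae_mono, erule someI_ex)

section \<open>The ultrapower and its internal sets\<close>

definition ueq :: "(nat \<Rightarrow> 'a) \<Rightarrow> (nat \<Rightarrow> 'a) \<Rightarrow> bool" where "ueq f g \<longleftrightarrow> ae (\<lambda>i. f i = g i)"

quotient_type 'a upow = "nat \<Rightarrow> 'a" / ueq
proof (rule equivpI)
  show "reflp ueq" unfolding reflp_def ueq_def by (simp add: ae_const)
  show "symp ueq" unfolding symp_def ueq_def by (auto elim: ae_mono)
  show "transp ueq" unfolding transp_def ueq_def by (auto elim: ae_mono2)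
qed

text \<open>Coordinates of a chosen representative, hence meaningful only for almost all
  \<open>i\<close>; statements about elements are therefore made under \<open>ae\<close>.\<close>

definition val :: "nat \<Rightarrow> 'a upow \<Rightarrow> 'a" where "val i x = rep_upow x i"
definition mk :: "(nat \<Rightarrow> 'a) \<Rightarrow> 'a upow" where "mk f = abs_upow f"

lemma val_mk: "ae (\<lambda>i. val i (mk f) = f i)"
proof -
  have "ueq f f" unfolding ueq_def by (simp add: ae_const)
  then have "ueq (rep_upow (abs_upow f)) f" using Quotient3_rep_abs[OF Quotient3_upow] by blast
  then show ?thesis unfolding ueq_def val_def mk_def .
qed

lemma upow_eq_iff: "x = y \<longleftrightarrow> ae (\<lambda>i. val i x = val i y)"
  using Quotient3_rel_rep[OF Quotient3_upow, of x y] unfolding ueq_def val_def by simp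

definition at :: "nat \<Rightarrow> 'a upow list \<Rightarrow> 'a list" where "at i xs = map (val i) xs"

lemma at_simps [simp]: "length (at i xs) = length xs" "at i [] = []" "at i (x # xs) = val i x # at i xs" "at i (xs @ ys) = at i xs @ at i ys"
  unfolding at_def by simp_all

lemma at_nth: "j < length xs \<Longrightarrow> at i xs ! j = val i (xs ! j)" unfolding at_def by simp

lemma at_eq_iff: "length xs = length ys \<Longrightarrow> xs = ys \<longleftrightarrow> ae (\<lambda>i. at i xs = at i ys)"
proof
  assume l: "length xs = length ys" and a: "ae (\<lambda>i. at i xs = at i ys)"
  have "xs ! j = ys ! j" if "j < length xs" for j
  proof -
    have "ae (\<lambda>i. val i (xs ! j) = val i (ys ! j))" using a by (rule ae_mono) (use that l at_nth in metis)
    then show ?thesis using upow_eq_iff by blast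
  qed
  then show "xs = ys" using l by (simp add: list_eq_iff_nth_eq)
qed (simp add: ae_const)

text \<open>Turns a sequence of lists into a tuple of the ultrapower. At indices where the list does
  not have length \<open>k\<close> the entries may be junk; \<open>at_lift\<close> asks for the
  right length almost everywhere.\<close>

definition lift :: "nat \<Rightarrow> (nat \<Rightarrow> 'a list) \<Rightarrow> 'a upow list" where
  "lift k s = map (\<lambda>j. mk (\<lambda>i. s i ! j)) [0..<k]"

lemma lift_length [simp]: "length (lift k s) = k" unfolding lift_def by simp

lemma at_lift: assumes "ae (\<lambda>i. length (s i) = k)" shows "ae (\<lambda>i. at i (lift k s) = s i)"
proof -
  have "ae (\<lambda>i. \<forall>j\<in>{..<k}. val i (mk (\<lambda>i. s i ! j)) = s i ! j)" by (rule ae_Ball) (auto intro: val_mk)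
  then show ?thesis using assms by (rule ae_mono2) (auto simp: lift_def at_def intro!: nth_equalityI)
qed

definition star :: "'a list set \<Rightarrow> 'a upow list set" where "star X = {xs. ae (\<lambda>i. at i xs \<in> X)}"

lemma in_star: "xs \<in> star X \<longleftrightarrow> ae (\<lambda>i. at i xs \<in> X)" unfolding star_def by simp

lemma star_length: "X \<subseteq> tuples n \<Longrightarrow> xs \<in> star X \<Longrightarrow> length xs = n"
proof -
  assume X: "X \<subseteq> tuples n" and "xs \<in> star X"
  then have "ae (\<lambda>i. length xs = n)" unfolding in_star by (elim ae_mono) auto
  then show ?thesis by (simp add: ae_const)
qed

lemma star_empty: "star {} = {}" unfolding star_def by (simp add: ae_const)
lemma star_Un: "star (A \<union> B) = star A \<union> star B" unfolding star_def by (auto simp: ae_disj)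
lemma star_compl: "star (tuples n - A) = tuples n - star A"
  unfolding star_def by (auto simp: ae_conj ae_not ae_const)

lemma star_ex:
  assumes "length xs = n"
  shows "ae (\<lambda>i. \<exists>y. at i xs @ [y] \<in> A) \<longleftrightarrow> (\<exists>y. xs @ [y] \<in> star A)"
proof
  assume "ae (\<lambda>i. \<exists>y. at i xs @ [y] \<in> A)"
  then obtain f where f: "ae (\<lambda>i. at i xs @ [f i] \<in> A)" using ae_ex[of "\<lambda>i y. at i xs @ [y] \<in> A"] by blast
  have "ae (\<lambda>i. at i (xs @ [mk f]) \<in> A)" using f val_mk[of f] by (rule ae_mono2) simp
  then show "\<exists>y. xs @ [y] \<in> star A" unfolding in_star by blast
qed (auto simp: in_star elim!: ae_mono)

lemma star_cons: "star {x # xs | x xs. xs \<in> A} = {x # xs | x xs. xs \<in> star A}"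
  proof (rule Set.set_eqI)
    fix z show "z \<in> star {x # xs | x xs. xs \<in> A} \<longleftrightarrow> z \<in> {x # xs | x xs. xs \<in> star A}"
      by (cases z) (auto simp: in_star ae_const)
  qed

lemma star_snoc: "star {xs @ [x] | x xs. xs \<in> A} = {xs @ [x] | x xs. xs \<in> star A}"
  proof (rule Set.set_eqI)
    fix z show "z \<in> star {xs @ [x] | x xs. xs \<in> A} \<longleftrightarrow> z \<in> {xs @ [x] | x xs. xs \<in> star A}"
      by (cases z rule: rev_cases) (auto simp: in_star ae_const)
  qed

lemma star_diag: assumes n: "n \<ge> 1" shows "star {xs \<in> tuples n. xs ! 0 = xs ! (n - 1)} = {xs \<in> tuples n. xs ! 0 = xs ! (n - 1)}"
  proof (rule Set.set_eqI)
    fix z :: "'a upow list"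
    show "z \<in> star {xs \<in> tuples n. xs ! 0 = xs ! (n - 1)} \<longleftrightarrow> z \<in> {xs \<in> tuples n. xs ! 0 = xs ! (n - 1)}"
    proof (cases "length z = n")
      case True
      then have "at i z ! 0 = val i (z ! 0)" "at i z ! (n - 1) = val i (z ! (n - 1))" for i using n by (auto simp: at_nth)
      then show ?thesis using True by (simp add: in_star upow_eq_iff)
    qed (simp add: in_star ae_const)
  qed

lemma star_proj: assumes A': "A \<subseteq> tuples (Suc n)" shows "star (butlast ` A) = butlast ` star A"
  proof (rule Set.set_eqI)
    have bl: "w \<in> butlast ` B \<longleftrightarrow> (\<exists>u. w @ [u] \<in> B)" if B: "\<And>z. z \<in> B \<Longrightarrow> length z = Suc n" for w :: "'c list" and B
    proof
      assume "w \<in> butlast ` B"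
      then obtain z where z: "z \<in> B" "w = butlast z" by blast
      then have "w @ [last z] = z" using B[OF z(1)] by (metis append_butlast_last_id length_0_conv nat.distinct(1))
      then show "\<exists>u. w @ [u] \<in> B" using z(1) by metis
    next
      assume "\<exists>u. w @ [u] \<in> B"
      then obtain u where "w @ [u] \<in> B" by blast
      then show "w \<in> butlast ` B" by (rule image_eqI[rotated]) simp
    qed
    have A: "length z = Suc n" if "z \<in> A" for z using A' that by auto
    fix z
    have "z \<in> star (butlast ` A) \<longleftrightarrow> ae (\<lambda>i. \<exists>u. at i z @ [u] \<in> A)" unfolding in_star using bl[of A] A by simp
    also have "\<dots> \<longleftrightarrow> (\<exists>u. z @ [u] \<in> star A)" by (rule star_ex[OF refl])
    also have "\<dots> \<longleftrightarrow> z \<in> butlast ` star A" using bl[of "star A"] star_length[OF A'] by simp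
    finally show "z \<in> star (butlast ` A) \<longleftrightarrow> z \<in> butlast ` star A" .
  qed

text \<open>The theorem of Los in the language of structures: \<open>star\<close> commutes with the
  Boolean operations, products, diagonals and projections. Choosing witnesses coordinatewise handles
  projections.\<close>

lemma is_structure_star:
  assumes "is_structure S" shows "is_structure (\<lambda>n. star ` S n)"
proof -
  interpret S: struct S by unfold_locales fact
  show ?thesis
    unfolding is_structure_def
  proof (intro conjI allI impI)
    fix n show "star ` S n \<subseteq> Pow (tuples n)"
    proof
      fix Z assume "Z \<in> star ` S n"
      then obtain B where B: "B \<in> S n" "Z = star B" by blast
      have "B \<subseteq> tuples n" using S.length_mem[OF B(1)] by auto
      then show "Z \<in> Pow (tuples n)" using star_length[of B n] B(2) by auto
    qed
    show "{} \<in> star ` S n" using S.empty_mem star_empty by (metis imageI)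
  next
    fix n :: nat assume n: "n \<ge> 1"
    show "{xs \<in> tuples n. xs ! 0 = xs ! (n - 1)} \<in> star ` S n" 
      using imageI[OF S.diag_mem[OF n], of star] unfolding star_diag[OF n] .
  next
    fix n A B assume "A \<in> star ` S n" "B \<in> star ` S n"
    then obtain A' B' where "A' \<in> S n" "A = star A'" "B' \<in> S n" "B = star B'" by blast
    then show "A \<union> B \<in> star ` S n" using imageI[OF S.Un_mem[of A' n B'], of star] star_Un[of A' B'] by simp
  next
    fix n A assume "A \<in> star ` S n"
    then obtain B where B: "B \<in> S n" "A = star B" by blast
    show "tuples n - A \<in> star ` S n" using imageI[OF S.compl_mem[OF B(1)], of star] unfolding star_compl B(2) .
    show "{x # xs |x xs. xs \<in> A} \<in> star ` S (Suc n)" unfolding B(2) star_cons[symmetric] using S.cons_mem[OF B(1)] by (rule imageI)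
    show "{xs @ [x] |x xs. xs \<in> A} \<in> star ` S (Suc n)" unfolding B(2) star_snoc[symmetric] using S.snoc_mem[OF B(1)] by (rule imageI)
  next
    fix n A assume "A \<in> star ` S (Suc n)"
    then obtain B where B: "B \<in> S (Suc n)" "A = star B" by blast
    have l: "B \<subseteq> tuples (Suc n)" using S.length_mem[OF B(1)] by auto
    show "butlast ` A \<in> star ` S n" unfolding B(2) star_proj[OF l, symmetric] using S.proj_mem[OF B(1)] by (rule imageI)
  qed
qed

text \<open>That \<open>K\<close> is generated by \<open>L\<close> and the predicate is not a
  first-order property; it survives because the generated sets whose \<open>star\<close> is again
  generated form a structure.\<close>

lemma star_gen:
  assumes G: "\<And>n. G n \<subseteq> Pow (tuples n)" and X: "X \<in> gen_structure G n"
  shows "star X \<in> gen_structure (\<lambda>n. star ` G n) n"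
proof -
  have G': "star ` G n \<subseteq> Pow (tuples n)" for n
  proof
    fix Z assume "Z \<in> star ` G n"
    then obtain Y where "Y \<in> G n" "Z = star Y" by blast
    then show "Z \<in> Pow (tuples n)" using star_length[of Y n] G[of n] by auto
  qed
  interpret H: struct "gen_structure (\<lambda>n. star ` G n)" by (rule struct_gen) (rule G')
  interpret S: struct "gen_structure G" by (rule struct_gen) (rule G)
  define T where "T n = {X \<in> gen_structure G n. star X \<in> gen_structure (\<lambda>n. star ` G n) n}" for n
  have "is_structure T"
    unfolding is_structure_def
  proof (intro conjI allI impI)
    fix n show "T n \<subseteq> Pow (tuples n)" unfolding T_def using S.length_mem by auto
    show "{} \<in> T n" unfolding T_def using S.empty_mem H.empty_mem by (simp add: star_empty)
  next
    fix n :: nat assume n: "n \<ge> 1"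
    show "{xs \<in> tuples n. xs ! 0 = xs ! (n - 1)} \<in> T n"
      unfolding T_def mem_Collect_eq star_diag[OF n] using S.diag_mem[OF n] H.diag_mem[OF n] by (rule conjI)
  next
    fix n A B assume "A \<in> T n" "B \<in> T n"
    then show "A \<union> B \<in> T n" unfolding T_def using S.Un_mem H.Un_mem by (simp add: star_Un)
  next
    fix n A assume "A \<in> T n"
    then have A: "A \<in> gen_structure G n" "star A \<in> gen_structure (\<lambda>n. star ` G n) n" unfolding T_def by auto
    show "tuples n - A \<in> T n" unfolding T_def using S.compl_mem[OF A(1)] H.compl_mem[OF A(2)] by (simp add: star_compl)
    show "{x # xs |x xs. xs \<in> A} \<in> T (Suc n)" unfolding T_def mem_Collect_eq star_cons using S.cons_mem[OF A(1)] H.cons_mem[OF A(2)] by (rule conjI)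
    show "{xs @ [x] |x xs. xs \<in> A} \<in> T (Suc n)" unfolding T_def mem_Collect_eq star_snoc using S.snoc_mem[OF A(1)] H.snoc_mem[OF A(2)] by (rule conjI)
  next
    fix n A assume "A \<in> T (Suc n)"
    then have A: "A \<in> gen_structure G (Suc n)" "star A \<in> gen_structure (\<lambda>n. star ` G n) (Suc n)" unfolding T_def by auto
    have l: "A \<subseteq> tuples (Suc n)" using S.length_mem[OF A(1)] by auto
    show "butlast ` A \<in> T n" unfolding T_def mem_Collect_eq star_proj[OF l] using S.proj_mem[OF A(1)] H.proj_mem[OF A(2)] by (rule conjI)
  qed
  moreover have "G m \<subseteq> T m" for m
    unfolding T_def using gen_structure_incl[of G m] gen_structure_incl[of "\<lambda>n. star ` G n" m] by blast
  ultimately have "gen_structure G n \<subseteq> T n" by (rule gen_structure_least)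
  then show ?thesis using X unfolding T_def by blast
qed

section \<open>Independence over finitely many parameters\<close>

context pregeometry begin

text \<open>If the new point \<open>u\<close> makes some \<open>p\<close> outside \<open>Q\<close>
  dependent, exchange puts \<open>u\<close> in the closure of a finite set \<open>B\<close>. Once
  the points of \<open>B\<close> in \<open>P\<close> have joined the exceptions, \<open>u\<close>
  lies in the closure of \<open>X\<close> and \<open>P\<close> without \<open>p'\<close> for every
  remaining \<open>p'\<close>, so adding it changes nothing.\<close>

lemma indep_over_finite:
  assumes ind: "\<And>p. p \<in> P \<Longrightarrow> p \<notin> cl (P - {p})" and X: "finite X"
  shows "\<exists>Q. finite Q \<and> Q \<subseteq> P \<and> (\<forall>p\<in>P - Q. p \<notin> cl (X \<union> (P - {p})))"
  using X
proof (induction X rule: finite_induct)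
  case empty then show ?case using ind by (intro exI[of _ "{}"]) simp
next
  case (insert u X)
  then obtain Q where Q: "finite Q" "Q \<subseteq> P" "\<forall>p\<in>P - Q. p \<notin> cl (X \<union> (P - {p}))" by blast
  show ?case
  proof (cases "\<forall>p\<in>P - Q. p \<notin> cl (insert u X \<union> (P - {p}))")
    case True then show ?thesis using Q by blast
  next
    case False
    then obtain p where p: "p \<in> P - Q" "p \<in> cl (insert u (X \<union> (P - {p})))" by auto
    then have "u \<in> cl (insert p (X \<union> (P - {p})))" using cl_exchange Q(3) by blast
    then obtain B where B: "finite B" "B \<subseteq> insert p (X \<union> (P - {p}))" "u \<in> cl B" using cl_finitary by blast
    let ?Q = "Q \<union> (B \<inter> P)"
    have "p' \<notin> cl (insert u X \<union> (P - {p'}))" if p': "p' \<in> P - ?Q" for p'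
    proof -
      have "B \<subseteq> X \<union> (P - {p'})" using B(2) p' p(1) by auto
      then have "u \<in> cl (X \<union> (P - {p'}))" using B(3) cl_mono by blast
      then have "cl (insert u (X \<union> (P - {p'}))) = cl (X \<union> (P - {p'}))" by (rule cl_insert_absorb)
      then show ?thesis using Q(3) p' by simp
    qed
    then show ?thesis using Q B(1) by (intro exI[of _ ?Q]) auto
  qed
qed

end

lemma dense_set_infinite:
  fixes P :: "'a::linorder set"
  assumes d: "\<And>a b. a < b \<Longrightarrow> \<exists>p\<in>P. a < p \<and> p < b" and ab: "a < b"
  shows "infinite {p \<in> P. a < p \<and> p < b}"
proof
  assume f: "finite {p \<in> P. a < p \<and> p < b}" (is "finite ?S")
  have "?S \<noteq> {}" using d[OF ab] by blast
  then have m: "Min ?S \<in> ?S" using Min_in[OF f] by blast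
  then obtain p where p: "p \<in> P" "a < p" "p < Min ?S" using d[of a "Min ?S"] by auto
  then have "p \<in> ?S" using m by auto
  then have "Min ?S \<le> p" using Min_le[OF f] by blast
  then show False using p(3) by simp
qed

section \<open>The pair over a countable reduct and its ultrapower\<close>

locale mpair = omin_reduct D L for D :: "nat \<Rightarrow> ('a::linordered_ab_group_add) list set set" and L +
  fixes P :: "'a set"
  assumes L_countable: "countable (L n)"
    and P_dense: "a < b \<Longrightarrow> \<exists>p\<in>P. a < p \<and> p < b"
    and P_indep: "p \<in> P \<Longrightarrow> p \<notin> FL.cl (P - {p})"
begin

lemma infinite_P_interval: "a < b \<Longrightarrow> infinite {p \<in> P. a < p \<and> p < b}"
  by (rule dense_set_infinite[OF P_dense])

lemma fibre_interval:
  assumes "X \<in> L (Suc n)" "infinite {y. as @ [y] \<in> X}"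
  shows "\<exists>a b. a < b \<and> (\<forall>x. a < x \<and> x < b \<longrightarrow> as @ [x] \<in> X)"
proof -
  obtain y where "as @ [y] \<in> X" using assms(2) by (metis (mono_tags, lifting) Collect_empty_eq finite.emptyI)
  then have "length as = n" using L.length_mem[OF assms(1)] by fastforce
  then have "{[x] | x. as @ [x] \<in> X} \<in> D 1" using dset_fiber L_sub assms(1) by blast
  then show ?thesis using infinite_contains_interval[of "{y. as @ [y] \<in> X}"] assms(2) by simp
qed

lemma P_dense_fibre:
  assumes X: "X \<in> L (Suc n)" "infinite {y. as @ [y] \<in> X}" and Z: "Z \<in> FL m"
  shows "\<exists>p\<in>P. as @ [p] \<in> X \<and> as @ bs @ [p] \<notin> Z"
proof -
  obtain a b where ab: "a < b" "\<forall>x. a < x \<and> x < b \<longrightarrow> as @ [x] \<in> X" using fibre_interval[OF X] by blast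
  have f: "finite {y. (as @ bs) @ [y] \<in> Z}" using Z unfolding FL_def by blast
  have "infinite ({p \<in> P. a < p \<and> p < b} - {y. (as @ bs) @ [y] \<in> Z})" by (rule Diff_infinite_finite[OF f infinite_P_interval[OF ab(1)]])
  then obtain p where "p \<in> {p \<in> P. a < p \<and> p < b} - {y. (as @ bs) @ [y] \<in> Z}" by (metis finite.emptyI equals0I)
  then show ?thesis using ab(2) by auto
qed

lemma FL_diff_sum: "finite I \<Longrightarrow> x \<in> FL.cl A \<Longrightarrow> (\<And>i. i \<in> I \<Longrightarrow> i \<in> FL.cl A) \<Longrightarrow> x - \<Sum>I \<in> FL.cl A"
proof (induction I rule: finite_induct)
  case (insert i I)
  have eq: "x - \<Sum>(insert i I) = (x - \<Sum>I) - i" using insert.hyps by (simp add: algebra_simps)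
  show ?case unfolding eq by (rule FL_minus) (use insert in auto)
qed simp

text \<open>The point \<open>u\<close> is a sum of \<open>k + 1\<close> points of \<open>P\<close>,
  where \<open>k\<close> bounds the number of points of \<open>P\<close> that any of the given sets
  may use. A list \<open>q\<close> of at most \<open>k\<close> points misses a summand
  \<open>p\<close>; if \<open>u\<close> depended on \<open>as\<close>, \<open>bs\<close> and
  \<open>q\<close>, subtracting the other summands would make \<open>p\<close> depend on
  \<open>as\<close>, \<open>bs\<close> and the rest of \<open>P\<close>.\<close>

lemma P_codense_fibre:
  assumes X: "X \<in> L (Suc n)" "infinite {y. as @ [y] \<in> X}"
    and Z: "finite \<Z>" "\<forall>(k, Z)\<in>\<Z>. Z \<in> FL (length (as @ bs) + k)"
  shows "\<exists>u. as @ [u] \<in> X \<and> (\<forall>(k, Z)\<in>\<Z>. \<forall>q. set q \<subseteq> P \<longrightarrow> length q = k \<longrightarrow> as @ bs @ q @ [u] \<notin> Z)"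
proof -
  obtain a b where ab: "a < b" "\<forall>x. a < x \<and> x < b \<longrightarrow> as @ [x] \<in> X" using fibre_interval[OF X] by blast
  \<comment> \<open>The summands must avoid the finitely many points of \<open>P\<close> that may
    fail to be free over \<open>as\<close> and \<open>bs\<close>.\<close>
  obtain P0 where P0: "finite P0" "P0 \<subseteq> P" "\<forall>p\<in>P - P0. p \<notin> FL.cl (set (as @ bs) \<union> (P - {p}))"
    using FL.indep_over_finite[of P "set (as @ bs)"] P_indep by auto
  define k where "k = Max (insert 0 (fst ` \<Z>))"
  have kk: "j \<le> k" if "(j, Z) \<in> \<Z>" for j Z unfolding k_def using Z(1) that by (intro Max_ge) force+
  have "infinite ({p \<in> P. a < p \<and> p < b} - P0)" by (rule Diff_infinite_finite[OF P0(1) infinite_P_interval[OF ab(1)]])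
  then obtain T where T: "finite T" "card T = k" "T \<subseteq> {p \<in> P. a < p \<and> p < b} - P0" using infinite_arbitrarily_large by blast
  \<comment> \<open>\<open>k\<close> summands have been chosen; the last one is taken from the
    translated interval so that the sum lands between \<open>a\<close> and \<open>b\<close>.\<close>
  have "a - \<Sum>T < b - \<Sum>T" using ab(1) by simp
  then have "infinite ({p \<in> P. a - \<Sum>T < p \<and> p < b - \<Sum>T} - (P0 \<union> T))"
    using P0(1) T(1) by (intro Diff_infinite_finite infinite_P_interval) auto
  then obtain p0 where p0: "p0 \<in> {p \<in> P. a - \<Sum>T < p \<and> p < b - \<Sum>T} - (P0 \<union> T)" by (metis finite.emptyI equals0I)
  define S where "S = insert p0 T"
  define u where "u = \<Sum>S"
  have S: "finite S" "card S = Suc k" "S \<subseteq> P - P0" unfolding S_def using T p0 by auto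
  have "u = p0 + \<Sum>T" unfolding u_def S_def using T(1) p0 by simp
  then have "a < u" "u < b" using p0 by (auto simp: algebra_simps)
  then have uX: "as @ [u] \<in> X" using ab(2) by blast
  have "as @ bs @ q @ [u] \<notin> W" if jW: "(j, W) \<in> \<Z>" and q: "set q \<subseteq> P" "length q = j" for j W q
  proof
    assume w: "as @ bs @ q @ [u] \<in> W"
    have "card (set q) < card S" using card_length[of q] q(2) kk[OF jW] S(2) by simp
    then have "\<not> S \<subseteq> set q" using card_mono[of "set q" S] by auto
    then obtain p where p: "p \<in> S" "p \<notin> set q" by blast
    have "W \<in> FL (length (as @ bs @ q))" using bspec[OF Z(2) jW] q(2) by (simp add: add.assoc)
    then have "u \<in> FL.cl (set (as @ bs @ q))" using FL.cl_set_iff[of u "as @ bs @ q"] w by auto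
    moreover have "set (as @ bs @ q) \<subseteq> set (as @ bs) \<union> (P - {p})" using q(1) p(2) by auto
    ultimately have uc: "u \<in> FL.cl (set (as @ bs) \<union> (P - {p}))" using FL.cl_mono by blast
    have "u - \<Sum>(S - {p}) \<in> FL.cl (set (as @ bs) \<union> (P - {p}))"
    proof (rule FL_diff_sum[OF _ uc])
      fix i assume "i \<in> S - {p}"
      then have "i \<in> set (as @ bs) \<union> (P - {p})" using S(3) by blast
      then show "i \<in> FL.cl (set (as @ bs) \<union> (P - {p}))" by (rule subsetD[OF FL.cl_ext])
    qed (use S(1) in simp)
    moreover have "u - \<Sum>(S - {p}) = p" unfolding u_def using sum.remove[OF S(1) p(1), of "\<lambda>x. x"] by simp
    ultimately show False using P0(3) p(1) S(3) by auto
  qed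
  then show ?thesis using uX by (intro exI[of _ u]) auto
qed

abbreviation "Pset \<equiv> {[p] | p. p \<in> P}"

definition KM :: "nat \<Rightarrow> 'a list set set" where
  "KM = gen_structure (\<lambda>n. L n \<union> (if n = 1 then {Pset} else {}))"

lemma KM_gens: "L n \<union> (if n = 1 then {Pset} else {}) \<subseteq> Pow (tuples n)"
  using L.length_mem by (auto split: if_splits)

lemma KM_struct: "is_structure KM" unfolding KM_def by (rule is_structure_gen[OF KM_gens])

definition starP :: "'a upow set" where "starP = {p. ae (\<lambda>i. val i p \<in> P)}"

lemma set_starP: "set q \<subseteq> starP \<longleftrightarrow> ae (\<lambda>i. set (at i q) \<subseteq> P)"
proof
  assume "set q \<subseteq> starP"
  then have "ae (\<lambda>i. \<forall>x\<in>set q. val i x \<in> P)" unfolding starP_def by (intro ae_Ball) auto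
  then show "ae (\<lambda>i. set (at i q) \<subseteq> P)" by (rule ae_mono) (auto simp: at_def)
next
  assume a: "ae (\<lambda>i. set (at i q) \<subseteq> P)"
  show "set q \<subseteq> starP"
  proof
    fix x assume "x \<in> set q"
    then have "ae (\<lambda>i. val i x \<in> P)" using a by (elim ae_mono) (auto simp: at_def)
    then show "x \<in> starP" unfolding starP_def by simp
  qed
qed

lemma star_Pset: "star Pset = {[p] | p. p \<in> starP}"
proof (rule Set.set_eqI)
  fix z show "z \<in> star Pset \<longleftrightarrow> z \<in> {[p] | p. p \<in> starP}"
  proof (cases "\<exists>p. z = [p]")
    case True then show ?thesis by (auto simp: in_star starP_def)
  next
    case False
    have "ae (\<lambda>i. length z = 1)" if "z \<in> star Pset" using that unfolding in_star
    proof (rule ae_mono)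
      fix i assume "at i z \<in> Pset"
      then obtain p where "at i z = [p]" by blast
      then have "length (at i z) = 1" by simp
      then show "length z = 1" by simp
    qed
    then show ?thesis using False by (auto simp: ae_const length_Suc_conv)
  qed
qed

lemma star_finfam: "finfam (\<lambda>n. star ` FL n)"
proof
  fix X n xs assume "X \<in> star ` FL n" "xs \<in> X"
  then obtain Y where Y: "Y \<in> FL n" "xs \<in> star Y" by blast
  have "Y \<subseteq> tuples (Suc n)" using FL.F_len[OF Y(1)] by auto
  then show "length xs = Suc n" using star_length Y(2) by blast
next
  have "star {xs \<in> tuples 2. xs ! 0 = (xs ! (2 - 1) :: 'a)} = {xs \<in> tuples 2. xs ! 0 = xs ! (2 - 1)}" by (rule star_diag) simp
  moreover have "star {xs \<in> tuples 2. xs ! 0 = xs ! 1} \<in> star ` FL 1" using FL.F_id by (rule imageI)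
  ultimately show "{xs \<in> tuples 2. xs ! 0 = xs ! 1} \<in> star ` FL 1" by simp
next
  fix X Y n assume "X \<in> star ` FL n" "Y \<in> star ` FL n"
  then obtain A B where "A \<in> FL n" "B \<in> FL n" "X = star A" "Y = star B" by blast
  then show "X \<union> Y \<in> star ` FL n" using FL.F_Un[of A n B] star_Un[of A B] by (metis imageI)
next
  fix X n m and js :: "nat list" assume X: "X \<in> star ` FL n" and js: "length js = n" "\<forall>j\<in>set js. j < m"
  then obtain A where A: "A \<in> FL n" "X = star A" by blast
  have "star {as @ [u] |as u. length as = m \<and> map ((!) as) js @ [u] \<in> A} = {as @ [u] |as u. length as = m \<and> map ((!) as) js @ [u] \<in> X}"
  proof (rule Set.set_eqI)
    fix z
    show "z \<in> star {as @ [u] |as u. length as = m \<and> map ((!) as) js @ [u] \<in> A} \<longleftrightarrow> z \<in> {as @ [u] |as u. length as = m \<and> map ((!) as) js @ [u] \<in> X}"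
    proof (cases z rule: rev_cases)
      case Nil then show ?thesis by (simp add: in_star ae_const)
    next
      case (snoc as u)
      have "map ((!) (at i as)) js = at i (map ((!) as) js)" if "length as = m" for i
        using js(2) that by (auto simp: at_def)
      then show ?thesis unfolding snoc A(2) in_star by (cases "length as = m") (auto simp: in_star ae_const)
    qed
  qed
  then show "{as @ [u] |as u. length as = m \<and> map ((!) as) js @ [u] \<in> X} \<in> star ` FL m"
    using imageI[OF FL.F_reindex[OF A(1) js], of star] by simp
next
  fix X n Y assume "X \<in> star ` FL (Suc n)" "Y \<in> star ` FL n"
  then obtain A B where A: "A \<in> FL (Suc n)" "X = star A" and B: "B \<in> FL n" "Y = star B" by blast
  have "star {as @ [u] |as u. \<exists>b. as @ [b] \<in> B \<and> as @ [b, u] \<in> A} = {as @ [u] |as u. \<exists>b. as @ [b] \<in> Y \<and> as @ [b, u] \<in> X}"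
  proof (rule Set.set_eqI)
    fix z
    show "z \<in> star {as @ [u] |as u. \<exists>b. as @ [b] \<in> B \<and> as @ [b, u] \<in> A} \<longleftrightarrow> z \<in> {as @ [u] |as u. \<exists>b. as @ [b] \<in> Y \<and> as @ [b, u] \<in> X}"
    proof (cases z rule: rev_cases)
      case Nil then show ?thesis by (simp add: in_star ae_const)
    next
      case (snoc as u)
      have "ae (\<lambda>i. \<exists>b. at i as @ [b] \<in> B \<and> at i as @ [b, val i u] \<in> A) \<longleftrightarrow> (\<exists>b. as @ [b] \<in> star B \<and> as @ [b, u] \<in> star A)"
      proof
        assume "ae (\<lambda>i. \<exists>b. at i as @ [b] \<in> B \<and> at i as @ [b, val i u] \<in> A)"
        then obtain f where f: "ae (\<lambda>i. at i as @ [f i] \<in> B \<and> at i as @ [f i, val i u] \<in> A)"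
          using ae_ex[of "\<lambda>i b. at i as @ [b] \<in> B \<and> at i as @ [b, val i u] \<in> A"] by blast
        have "ae (\<lambda>i. at i (as @ [mk f]) \<in> B)" "ae (\<lambda>i. at i (as @ [mk f, u]) \<in> A)" using f val_mk[of f] by (rule ae_mono2; simp)+
        then show "\<exists>b. as @ [b] \<in> star B \<and> as @ [b, u] \<in> star A" unfolding in_star by blast
      next
        assume "\<exists>b. as @ [b] \<in> star B \<and> as @ [b, u] \<in> star A"
        then obtain b where b: "ae (\<lambda>i. at i (as @ [b]) \<in> B)" "ae (\<lambda>i. at i (as @ [b, u]) \<in> A)" unfolding in_star by blast
        then show "ae (\<lambda>i. \<exists>b. at i as @ [b] \<in> B \<and> at i as @ [b, val i u] \<in> A)" by (rule ae_mono2) auto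
      qed
      then show ?thesis unfolding snoc A(2) B(2) in_star[of "as @ [u]"] by simp
    qed
  qed
  then show "{as @ [u] |as u. \<exists>b. as @ [b] \<in> Y \<and> as @ [b, u] \<in> X} \<in> star ` FL n"
    using imageI[OF FL.F_comp[OF A(1) B(1)], of star] by simp
next
  fix X n assume "X \<in> star ` FL (Suc n)"
  then obtain A where A: "A \<in> FL (Suc n)" "X = star A" by blast
  obtain B C where BC: "B \<in> FL n" "C \<in> FL (Suc n)" "\<forall>as b u. as @ [b, u] \<in> A \<longrightarrow> as @ [u] \<in> B \<or> as @ [u, b] \<in> C" using FL.F_exch[OF A(1)] by blast
  have "as @ [u] \<in> star B \<or> as @ [u, b] \<in> star C" if "as @ [b, u] \<in> X" for as b u
  proof -
    have "ae (\<lambda>i. at i (as @ [b, u]) \<in> A)" using that A(2) in_star by blast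
    then have "ae (\<lambda>i. at i (as @ [u]) \<in> B \<or> at i (as @ [u, b]) \<in> C)" by (rule ae_mono) (use BC(3) in simp)
    then show ?thesis unfolding ae_disj in_star .
  qed
  then show "\<exists>Y\<in>star ` FL n. \<exists>Z\<in>star ` FL (Suc n). \<forall>as b u. as @ [b, u] \<in> X \<longrightarrow> as @ [u] \<in> Y \<or> as @ [u, b] \<in> Z"
    using BC(1,2) by blast
qed

text \<open>The usual diagonal argument: \<open>M i\<close> is the largest number, up to
  \<open>i\<close>, of initial conditions that are solvable together at index \<open>i\<close>, and
  \<open>s i\<close> solves them. For fixed \<open>j\<close> the first \<open>j + 1\<close>
  conditions are solvable almost everywhere, so \<open>M i\<close> exceeds \<open>j\<close> almost
  everywhere.\<close>

lemma star_saturated: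
  assumes X: "\<And>j::nat. X j \<in> star ` KM (m + k)"
    and fin: "\<And>J. \<exists>x. length x = k \<and> (\<forall>j<J. a @ x \<in> X j)"
  shows "\<exists>x. length x = k \<and> (\<forall>j. a @ x \<in> X j)"
proof -
  have "\<forall>j. \<exists>Y. X j = star Y" using X by blast
  then obtain Y where Y: "\<And>j. X j = star (Y j)" by metis
  define \<Phi> where "\<Phi> J i s \<longleftrightarrow> length s = k \<and> (\<forall>j<J. at i a @ s \<in> Y j)" for J i s
  have ex: "ae (\<lambda>i. \<exists>s. \<Phi> J i s)" for J
  proof -
    obtain x where x: "length x = k" "\<forall>j<J. a @ x \<in> star (Y j)" using fin[of J] Y by auto
    have "ae (\<lambda>i. \<forall>j\<in>{..<J}. at i (a @ x) \<in> Y j)" by (rule ae_Ball) (use x(2) in \<open>auto simp: in_star\<close>)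
    then show ?thesis by (rule ae_mono) (auto simp: \<Phi>_def x(1) intro!: exI[of _ "at _ x"])
  qed
  define M where "M i = (GREATEST J. J \<le> i \<and> (\<exists>s. \<Phi> J i s))" for i
  have "\<exists>s. \<Phi> 0 i s" for i unfolding \<Phi>_def by (intro exI[of _ "replicate k undefined"]) simp
  then have M: "\<exists>s. \<Phi> (M i) i s" "J \<le> i \<Longrightarrow> \<exists>s. \<Phi> J i s \<Longrightarrow> J \<le> M i" for i J
  proof -
    show "\<exists>s. \<Phi> (M i) i s" unfolding M_def
      using GreatestI_nat[of "\<lambda>J. J \<le> i \<and> (\<exists>s. \<Phi> J i s)" 0 i] \<open>\<And>i. \<exists>s. \<Phi> 0 i s\<close> by blast
    show "J \<le> i \<Longrightarrow> \<exists>s. \<Phi> J i s \<Longrightarrow> J \<le> M i" unfolding M_def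
      by (rule Greatest_le_nat[of "\<lambda>J. J \<le> i \<and> (\<exists>s. \<Phi> J i s)" J i]) auto
  qed
  then obtain s where s: "\<And>i. \<Phi> (M i) i (s i)" by metis
  have lift: "ae (\<lambda>i. at i (lift k s) = s i)" by (rule at_lift) (use s in \<open>auto simp: \<Phi>_def ae_const\<close>)
  have "a @ lift k s \<in> star (Y j)" for j
  proof -
    have "ae (\<lambda>i. at i a @ s i \<in> Y j)" using ae_ge[of "Suc j"] ex[of "Suc j"]
    proof (rule ae_mono2)
      fix i assume "Suc j \<le> i" "\<exists>s. \<Phi> (Suc j) i s"
      then have "Suc j \<le> M i" by (rule M(2))
      then show "at i a @ s i \<in> Y j" using s[of i] unfolding \<Phi>_def by simp
    qed
    then show ?thesis unfolding in_star using lift by (rule ae_mono2) simp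
  qed
  then show ?thesis using Y by (intro exI[of _ "lift k s"]) auto
qed

text \<open>\<open>E0\<close> is the set of base tuples with infinite fibres, definable by
  \<open>finite_fibre_mem\<close>. Over its complement the fibres are finite; over \<open>E0\<close>
  the density and codensity statements hold at almost every index, and their witnesses are glued to
  an element of the ultrapower.\<close>

lemma star_split:
  assumes "X \<in> star ` L (Suc n)"
  shows "\<exists>E\<in>star ` L n. {as @ [u] | as u. as @ [u] \<in> X \<and> as \<notin> E} \<in> star ` FL n \<and>
        (\<forall>as\<in>E. (\<forall>bs. \<forall>Z\<in>star ` FL (n + length bs). \<exists>p\<in>starP. as @ [p] \<in> X \<and> as @ bs @ [p] \<notin> Z) \<and>
          (\<forall>bs \<Z>. finite \<Z> \<longrightarrow> (\<forall>(k, Z)\<in>\<Z>. Z \<in> star ` FL (n + length bs + k)) \<longrightarrow>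
             (\<exists>u. as @ [u] \<in> X \<and> (\<forall>(k, Z)\<in>\<Z>. \<forall>q. set q \<subseteq> starP \<longrightarrow> length q = k \<longrightarrow> as @ bs @ q @ [u] \<notin> Z))))"
proof -
  obtain A where A: "A \<in> L (Suc n)" "X = star A" using assms by blast
  define E0 where "E0 = tuples n - {as \<in> tuples n. finite {y. as @ [y] \<in> A}}"
  have E0: "E0 \<in> L n" unfolding E0_def using L.compl_mem finite_fibre_mem[OF A(1)] by blast
  have E0i: "infinite {y. as @ [y] \<in> A}" if "as \<in> E0" for as using that unfolding E0_def by auto
  have E0l: "length as = n" if "as \<in> star E0" for as using star_length[of E0 n] that unfolding E0_def by blast
  have "A - {as @ [x] | x as. as \<in> E0} \<in> L (Suc n)" using L.Diff_mem[OF A(1) L.snoc_mem[OF E0]] .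
  moreover have "finite {y. as @ [y] \<in> A - {as @ [x] | x as. as \<in> E0}}" for as
  proof (cases "length as = n \<and> as \<notin> E0")
    case True
    then have "finite {y. as @ [y] \<in> A}" unfolding E0_def by auto
    then show ?thesis by (rule finite_subset[rotated]) auto
  next
    case False
    then have "{y. as @ [y] \<in> A - {as @ [x] | x as. as \<in> E0}} = {}" using L.length_mem[OF A(1)] by fastforce
    then show ?thesis by (simp only: finite.emptyI)
  qed
  ultimately have FA: "A - {as @ [x] | x as. as \<in> E0} \<in> FL n" unfolding FL_def by blast
  have "star (A - {as @ [x] | x as. as \<in> E0}) = {as @ [u] | as u. as @ [u] \<in> X \<and> as \<notin> star E0}"
  proof (rule Set.set_eqI)
    fix z
    show "z \<in> star (A - {as @ [x] | x as. as \<in> E0}) \<longleftrightarrow> z \<in> {as @ [u] | as u. as @ [u] \<in> X \<and> as \<notin> star E0}"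
    proof (cases z rule: rev_cases)
      case Nil
      have "ae (\<lambda>i. False)" if "z \<in> star (A - {as @ [x] | x as. as \<in> E0})"
        using that unfolding in_star by (rule ae_mono) (use L.length_mem[OF A(1)] Nil in fastforce)
      then show ?thesis using Nil by (auto simp: ae_const)
    next
      case (snoc as u)
      then show ?thesis unfolding A(2) by (simp add: in_star ae_conj ae_not)
    qed
  qed
  then have 1: "{as @ [u] | as u. as @ [u] \<in> X \<and> as \<notin> star E0} \<in> star ` FL n" using imageI[OF FA, of star] by simp
  have 2: "\<exists>p\<in>starP. as @ [p] \<in> X \<and> as @ bs @ [p] \<notin> Z" if as: "as \<in> star E0" and Z: "Z \<in> star ` FL (n + length bs)" for as bs Z
  proof -
    obtain B where B: "B \<in> FL (n + length bs)" "Z = star B" using Z by blast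
    have "ae (\<lambda>i. \<exists>p. p \<in> P \<and> at i as @ [p] \<in> A \<and> at i as @ at i bs @ [p] \<notin> B)"
      using as unfolding in_star
    proof (rule ae_mono)
      fix i assume "at i as \<in> E0"
      then show "\<exists>p. p \<in> P \<and> at i as @ [p] \<in> A \<and> at i as @ at i bs @ [p] \<notin> B"
        using P_dense_fibre[OF A(1) E0i B(1)] by blast
    qed
    then obtain f where f: "ae (\<lambda>i. f i \<in> P \<and> at i as @ [f i] \<in> A \<and> at i as @ at i bs @ [f i] \<notin> B)"
      using ae_ex[of "\<lambda>i p. p \<in> P \<and> at i as @ [p] \<in> A \<and> at i as @ at i bs @ [p] \<notin> B"] by blast
    have "ae (\<lambda>i. val i (mk f) \<in> P \<and> at i (as @ [mk f]) \<in> A \<and> at i (as @ bs @ [mk f]) \<notin> B)" using f val_mk[of f] by (rule ae_mono2) simp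
    then have "mk f \<in> starP" "as @ [mk f] \<in> X" "as @ bs @ [mk f] \<notin> Z" unfolding ae_conj ae_not starP_def A(2) B(2) in_star by auto
    then show ?thesis by blast
  qed
  have 3: "\<exists>u. as @ [u] \<in> X \<and> (\<forall>(k, Z)\<in>\<Z>. \<forall>q. set q \<subseteq> starP \<longrightarrow> length q = k \<longrightarrow> as @ bs @ q @ [u] \<notin> Z)"
    if as: "as \<in> star E0" and Z: "finite \<Z>" "\<forall>(k, Z)\<in>\<Z>. Z \<in> star ` FL (n + length bs + k)" for as bs \<Z>
  proof -
    have "\<forall>z\<in>\<Z>. \<exists>B. B \<in> FL (n + length bs + fst z) \<and> snd z = star B" using Z(2) by fastforce
    then obtain B where B: "\<And>z. z \<in> \<Z> \<Longrightarrow> B z \<in> FL (n + length bs + fst z) \<and> snd z = star (B z)" by metis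
    define \<W> where "\<W> = (\<lambda>z. (fst z, B z)) ` \<Z>"
    have W: "finite \<W>" unfolding \<W>_def using Z(1) by simp
    have "ae (\<lambda>i. \<exists>u. at i as @ [u] \<in> A \<and> (\<forall>(k, Z)\<in>\<W>. \<forall>q. set q \<subseteq> P \<longrightarrow> length q = k \<longrightarrow> at i as @ at i bs @ q @ [u] \<notin> Z))"
      using as unfolding in_star
    proof (rule ae_mono)
      fix i assume i: "at i as \<in> E0"
      have "\<forall>(k, Z)\<in>\<W>. Z \<in> FL (length (at i as @ at i bs) + k)" unfolding \<W>_def using B E0l[OF as] by auto
      then show "\<exists>u. at i as @ [u] \<in> A \<and> (\<forall>(k, Z)\<in>\<W>. \<forall>q. set q \<subseteq> P \<longrightarrow> length q = k \<longrightarrow> at i as @ at i bs @ q @ [u] \<notin> Z)"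
        by (rule P_codense_fibre[OF A(1) E0i[OF i] W])
    qed
    then obtain f where f: "ae (\<lambda>i. at i as @ [f i] \<in> A \<and> (\<forall>(k, Z)\<in>\<W>. \<forall>q. set q \<subseteq> P \<longrightarrow> length q = k \<longrightarrow> at i as @ at i bs @ q @ [f i] \<notin> Z))"
      using ae_ex[of "\<lambda>i u. at i as @ [u] \<in> A \<and> (\<forall>(k, Z)\<in>\<W>. \<forall>q. set q \<subseteq> P \<longrightarrow> length q = k \<longrightarrow> at i as @ at i bs @ q @ [u] \<notin> Z)"] by blast
    have g: "ae (\<lambda>i. at i (as @ [mk f]) \<in> A \<and> (\<forall>(k, Z)\<in>\<W>. \<forall>q. set q \<subseteq> P \<longrightarrow> length q = k \<longrightarrow> at i as @ at i bs @ q @ [val i (mk f)] \<notin> Z))"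
      using f val_mk[of f] by (rule ae_mono2) simp
    then have "as @ [mk f] \<in> X" unfolding A(2) in_star ae_conj by blast
    moreover have "as @ bs @ q @ [mk f] \<notin> Z" if kZ: "(k, Z) \<in> \<Z>" and q: "set q \<subseteq> starP" "length q = k" for k Z q
    proof
      assume "as @ bs @ q @ [mk f] \<in> Z"
      moreover have "Z = star (B (k, Z))" using B[OF kZ] by simp
      ultimately have "as @ bs @ q @ [mk f] \<in> star (B (k, Z))" by (metis (no_types))
      then have "ae (\<lambda>i. at i (as @ bs @ q @ [mk f]) \<in> B (k, Z))" unfolding in_star .
      moreover have "ae (\<lambda>i. set (at i q) \<subseteq> P)" using q(1) set_starP by blast
      ultimately have "ae (\<lambda>i. at i (as @ bs @ q @ [mk f]) \<in> B (k, Z) \<and> set (at i q) \<subseteq> P)" by (simp only: ae_conj simp_thms)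
      then have "ae (\<lambda>i. False)" using g
      proof (rule ae_mono2)
        fix i assume h: "at i (as @ bs @ q @ [mk f]) \<in> B (k, Z) \<and> set (at i q) \<subseteq> P"
          "at i (as @ [mk f]) \<in> A \<and> (\<forall>(k, Z)\<in>\<W>. \<forall>q. set q \<subseteq> P \<longrightarrow> length q = k \<longrightarrow> at i as @ at i bs @ q @ [val i (mk f)] \<notin> Z)"
        have "(k, B (k, Z)) \<in> \<W>" unfolding \<W>_def using kZ by force
        then have "at i as @ at i bs @ at i q @ [val i (mk f)] \<notin> B (k, Z)" using h q(2) by fastforce
        then show False using h(1) by simp
      qed
      then show False by (simp add: ae_const)
    qed
    ultimately show ?thesis by (intro exI[of _ "mk f"]) auto
  qed
  show ?thesis
    by (rule bexI[of _ "star E0"], intro conjI ballI allI impI)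
      (rule 1, erule 2, assumption, erule 3, assumption, assumption, rule imageI, rule E0)
qed

lemma star_sat: "sat (\<lambda>n. star ` L n) (\<lambda>n. star ` KM n) (\<lambda>n. star ` FL n) starP"
proof -
  have LK: "L n \<subseteq> KM n" for n unfolding KM_def using gen_structure_incl[of "\<lambda>n. L n \<union> (if n = 1 then {Pset} else {})" n] by blast
  have PK: "Pset \<in> KM 1" unfolding KM_def using gen_structure_incl[of "\<lambda>n. L n \<union> (if n = 1 then {Pset} else {})" 1] by auto
  interpret finfam "\<lambda>n. star ` FL n" by (rule star_finfam)
  show ?thesis
  proof (unfold_locales)
    show "is_structure (\<lambda>n. star ` L n)" by (rule is_structure_star[OF L.is_structure])
    show "is_structure (\<lambda>n. star ` KM n)" by (rule is_structure_star[OF KM_struct])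
    fix n
    show "star ` L n \<subseteq> star ` KM n" using LK by blast
    show "countable (star ` L n)" using L_countable by simp
    show "{[p] |p. p \<in> starP} \<in> star ` KM 1" unfolding star_Pset[symmetric] using PK by (rule imageI)
    show "star ` KM n \<subseteq> gen_structure (\<lambda>n. star ` L n \<union> (if n = 1 then {{[p] |p. p \<in> starP}} else {})) n"
    proof
      fix Z assume "Z \<in> star ` KM n"
      then obtain X where X: "X \<in> KM n" "Z = star X" by blast
      have "star X \<in> gen_structure (\<lambda>n. star ` (L n \<union> (if n = 1 then {Pset} else {}))) n"
        by (rule star_gen[OF KM_gens]) (use X(1) in \<open>simp add: KM_def\<close>)
      moreover have "(\<lambda>n. star ` (L n \<union> (if n = 1 then {Pset} else {}))) = (\<lambda>n. star ` L n \<union> (if n = 1 then {{[p] |p. p \<in> starP}} else {}))"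
        by (auto simp: fun_eq_iff star_Pset image_Un)
      ultimately show "Z \<in> gen_structure (\<lambda>n. star ` L n \<union> (if n = 1 then {{[p] |p. p \<in> starP}} else {})) n" using X(2) by simp
    qed
    show "star ` FL n \<subseteq> star ` L (Suc n)" unfolding FL_def by blast
    have "{} \<in> FL n" unfolding FL_def using L.empty_mem by simp
    then show "{} \<in> star ` FL n" using star_empty by (metis imageI)
  next
    fix XX :: "nat \<Rightarrow> 'a upow list set" and m k a
    assume "\<And>j. XX j \<in> star ` KM (m + k)" "\<And>J. \<exists>x. length x = k \<and> (\<forall>j<J. a @ x \<in> XX j)"
    then show "\<exists>x. length x = k \<and> (\<forall>j. a @ x \<in> XX j)" by (rule star_saturated)
  next
    fix X n assume "X \<in> star ` L (Suc n)"
    then show "\<exists>E\<in>star ` L n. {as @ [u] | as u. as @ [u] \<in> X \<and> as \<notin> E} \<in> star ` FL n \<and>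
        (\<forall>as\<in>E. (\<forall>bs. \<forall>Z\<in>star ` FL (n + length bs). \<exists>p\<in>starP. as @ [p] \<in> X \<and> as @ bs @ [p] \<notin> Z) \<and>
          (\<forall>bs \<Z>. finite \<Z> \<longrightarrow> (\<forall>(k, Z)\<in>\<Z>. Z \<in> star ` FL (n + length bs + k)) \<longrightarrow>
             (\<exists>u. as @ [u] \<in> X \<and> (\<forall>(k, Z)\<in>\<Z>. \<forall>q. set q \<subseteq> starP \<longrightarrow> length q = k \<longrightarrow> as @ bs @ q @ [u] \<notin> Z))))"
      by (rule star_split)
  next
    fix Z n ps and p :: "'a upow" assume Z: "Z \<in> star ` FL n" and ps: "length ps = n" "set ps \<subseteq> starP" "p \<in> starP" "ps @ [p] \<in> Z"
    obtain B where B: "B \<in> FL n" "Z = star B" using Z by blast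
    have "ae (\<lambda>i. set (at i ps) \<subseteq> P \<and> val i p \<in> P)" using ps(2,3) set_starP unfolding starP_def ae_conj by auto
    moreover have "ae (\<lambda>i. at i (ps @ [p]) \<in> B)" using ps(4) unfolding B(2) in_star .
    \<comment> \<open>At almost every index \<open>p\<close> equals one of the entries of
      \<open>ps\<close>; there are only \<open>n\<close> candidates, so one of them works almost
      everywhere.\<close>
    ultimately have "ae (\<lambda>i. \<exists>j\<in>{..<n}. val i p = val i (ps ! j))"
    proof (rule ae_mono2)
      fix i assume h: "set (at i ps) \<subseteq> P \<and> val i p \<in> P" "at i (ps @ [p]) \<in> B"
      have "val i p \<in> set (at i ps)"
      proof (rule ccontr)
        assume "val i p \<notin> set (at i ps)"
        then have "set (at i ps) \<subseteq> P - {val i p}" using h(1) by auto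
        moreover have "B \<in> FL (length (at i ps))" using B(1) ps(1) by simp
        then have "val i p \<in> FL.cl (set (at i ps))" using h(2) FL.cl_set_iff[of "val i p" "at i ps"] by auto
        ultimately have "val i p \<in> FL.cl (P - {val i p})" using FL.cl_mono by blast
        then show False using P_indep h(1) by blast
      qed
      then show "\<exists>j\<in>{..<n}. val i p = val i (ps ! j)" using ps(1) unfolding at_def by (auto simp: in_set_conv_nth)
    qed
    then obtain j where "j < n" "ae (\<lambda>i. val i p = val i (ps ! j))" using ae_Bex[of "{..<n}" "\<lambda>j i. val i p = val i (ps ! j)"] by auto
    then show "p \<in> set ps" using upow_eq_iff[of p "ps ! j"] ps(1) by simp
  qed
qed

end

section \<open>Transfer back to the original structure\<close>

lemma ae_all:
  fixes \<phi> :: "nat \<Rightarrow> 'a list \<Rightarrow> bool"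
  assumes "\<And>x. length x = k \<Longrightarrow> ae (\<lambda>i. \<phi> i (at i x))" shows "ae (\<lambda>i. \<forall>x. length x = k \<longrightarrow> \<phi> i x)"
proof (rule ccontr)
  assume "\<not> ?thesis"
  then have "ae (\<lambda>i. \<exists>x. length x = k \<and> \<not> \<phi> i x)" unfolding ae_not[symmetric] by (rule ae_mono) blast
  then obtain f where f: "ae (\<lambda>i. length (f i) = k \<and> \<not> \<phi> i (f i))" using ae_ex[of "\<lambda>i x. length x = k \<and> \<not> \<phi> i x"] by blast
  then have "ae (\<lambda>i. length (f i) = k)" by (rule ae_mono) simp
  then have l: "ae (\<lambda>i. at i (lift k f) = f i)" by (rule at_lift)
  have "ae (\<lambda>i. \<phi> i (at i (lift k f)))" by (rule assms) simp
  then have "ae (\<lambda>i. \<phi> i (f i))" using l by (rule ae_mono2) simp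
  then have "ae (\<lambda>i. False)" using f by (rule ae_mono2) blast
  then show False by (simp add: ae_const)
qed

lemma ae_imp: "(ae \<phi> \<Longrightarrow> ae \<psi>) \<Longrightarrow> ae (\<lambda>i. \<phi> i \<longrightarrow> \<psi> i)"
  using ae_disj[of "\<lambda>i. \<not> \<phi> i" \<psi>] unfolding ae_not imp_conv_disj by blast

lemma ae_iff: assumes "ae \<phi> \<longleftrightarrow> ae \<psi>" shows "ae (\<lambda>i. \<phi> i \<longleftrightarrow> \<psi> i)"
  using ae_imp[of \<phi> \<psi>] ae_imp[of \<psi> \<phi>] assms unfolding iff_conv_conj_imp ae_conj by blast

lemma ae_exI: "length x = k \<Longrightarrow> ae (\<lambda>i. \<phi> i (at i x)) \<Longrightarrow> ae (\<lambda>i. \<exists>x. length x = k \<and> \<phi> i x)"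
  by (erule ae_mono) (rule exI[of _ "at _ x"], simp)

text \<open>The property is first-order in its ingredients, so it holds at almost every index; any
  one such index supplies parameters in the original structure.\<close>

lemma coded_iso_transfer:
  assumes c: "coded_iso n (star G) (star Gr) (star Hs) (star Ms) (star Fs) t"
  shows "\<exists>i. coded_iso n G Gr Hs Ms Fs (at i t)"
proof -
  have st: "ae (\<lambda>i. at i t @ at i g @ at i h \<in> Fs) \<longleftrightarrow> t @ g @ h \<in> star Fs" for g h unfolding in_star by simp
  have st2: "ae (\<lambda>i. at i t @ at i h \<in> Hs) \<longleftrightarrow> t @ h \<in> star Hs" for h unfolding in_star by simp
  have st3: "ae (\<lambda>i. at i t @ at i h1 @ at i h2 @ at i h3 \<in> Ms) \<longleftrightarrow> t @ h1 @ h2 @ h3 \<in> star Ms" for h1 h2 h3 unfolding in_star by simp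
  have st4: "ae (\<lambda>i. at i h1 @ at i h2 @ at i h3 \<in> Gr) \<longleftrightarrow> h1 @ h2 @ h3 \<in> star Gr" for h1 h2 h3 unfolding in_star by simp
  note cc = c[unfolded coded_iso_def]
  have 1: "ae (\<lambda>i. \<forall>g. length g = n \<longrightarrow> g \<in> G \<longrightarrow> (\<exists>h. length h = 2 * n \<and> at i t @ g @ h \<in> Fs))"
  proof (rule ae_all, rule ae_imp)
    fix g :: "'a upow list" assume g: "length g = n" "ae (\<lambda>i. at i g \<in> G)"
    then obtain h where "length h = 2 * n" "t @ g @ h \<in> star Fs" using conjunct1[OF cc] in_star by blast
    then show "ae (\<lambda>i. \<exists>h. length h = 2 * n \<and> at i t @ at i g @ h \<in> Fs)" using st by (intro ae_exI) auto
  qed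
  have 2: "ae (\<lambda>i. \<forall>g. length g = n \<longrightarrow> (\<forall>h. length h = 2 * n \<longrightarrow> at i t @ g @ h \<in> Fs \<longrightarrow> g \<in> G \<and> at i t @ h \<in> Hs))"
  proof (rule ae_all, rule ae_all, rule ae_imp)
    fix g h :: "'a upow list" assume "length g = n" "length h = 2 * n" "ae (\<lambda>i. at i t @ at i g @ at i h \<in> Fs)"
    then have "g \<in> star G \<and> t @ h \<in> star Hs" using cc unfolding st by blast
    then show "ae (\<lambda>i. at i g \<in> G \<and> at i t @ at i h \<in> Hs)" unfolding ae_conj st2 in_star[symmetric] .
  qed
  have 3: "ae (\<lambda>i. \<forall>g. length g = n \<longrightarrow> (\<forall>h. length h = 2 * n \<longrightarrow> (\<forall>h'. length h' = 2 * n \<longrightarrow> at i t @ g @ h \<in> Fs \<longrightarrow> at i t @ g @ h' \<in> Fs \<longrightarrow> h = h')))"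
  proof (rule ae_all, rule ae_all, rule ae_all, rule ae_imp, rule ae_imp)
    fix g h h' :: "'a upow list" assume l: "length g = n" "length h = 2 * n" "length h' = 2 * n"
      and "ae (\<lambda>i. at i t @ at i g @ at i h \<in> Fs)" "ae (\<lambda>i. at i t @ at i g @ at i h' \<in> Fs)"
    then have "h = h'" using cc unfolding st by blast
    then show "ae (\<lambda>i. at i h = at i h')" by (simp add: ae_const)
  qed
  have 4: "ae (\<lambda>i. \<forall>g. length g = n \<longrightarrow> (\<forall>g'. length g' = n \<longrightarrow> (\<forall>h. length h = 2 * n \<longrightarrow> at i t @ g @ h \<in> Fs \<longrightarrow> at i t @ g' @ h \<in> Fs \<longrightarrow> g = g')))"
  proof (rule ae_all, rule ae_all, rule ae_all, rule ae_imp, rule ae_imp)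
    fix g g' h :: "'a upow list" assume l: "length g = n" "length g' = n" "length h = 2 * n"
      and "ae (\<lambda>i. at i t @ at i g @ at i h \<in> Fs)" "ae (\<lambda>i. at i t @ at i g' @ at i h \<in> Fs)"
    then have "g = g'" using cc unfolding st by blast
    then show "ae (\<lambda>i. at i g = at i g')" by (simp add: ae_const)
  qed
  have 5: "ae (\<lambda>i. \<forall>h. length h = 2 * n \<longrightarrow> at i t @ h \<in> Hs \<longrightarrow> (\<exists>g. length g = n \<and> at i t @ g @ h \<in> Fs))"
  proof (rule ae_all, rule ae_imp)
    fix h :: "'a upow list" assume h: "length h = 2 * n" "ae (\<lambda>i. at i t @ at i h \<in> Hs)"
    then obtain g where g: "length g = n" "t @ g @ h \<in> star Fs" using cc unfolding st2 by blast
    have "ae (\<lambda>i. at i t @ at i g @ at i h \<in> Fs)" using g(2) st by blast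
    then show "ae (\<lambda>i. \<exists>g. length g = n \<and> at i t @ g @ at i h \<in> Fs)" by (rule ae_exI[OF g(1)])
  qed
  have 6: "ae (\<lambda>i. \<forall>g1. length g1 = n \<longrightarrow> (\<forall>g2. length g2 = n \<longrightarrow> (\<forall>g3. length g3 = n \<longrightarrow> (\<forall>h1. length h1 = 2 * n \<longrightarrow>
     (\<forall>h2. length h2 = 2 * n \<longrightarrow> (\<forall>h3. length h3 = 2 * n \<longrightarrow> at i t @ g1 @ h1 \<in> Fs \<longrightarrow> at i t @ g2 @ h2 \<in> Fs \<longrightarrow> g1 @ g2 @ g3 \<in> Gr \<longrightarrow>
       (at i t @ h1 @ h2 @ h3 \<in> Ms \<longleftrightarrow> at i t @ g3 @ h3 \<in> Fs)))))))"
  proof (rule ae_all, rule ae_all, rule ae_all, rule ae_all, rule ae_all, rule ae_all, rule ae_imp, rule ae_imp, rule ae_imp, rule ae_iff)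
    fix g1 g2 g3 h1 h2 h3 :: "'a upow list"
    assume "length g1 = n" "length g2 = n" "length g3 = n" "length h1 = 2 * n" "length h2 = 2 * n" "length h3 = 2 * n"
      "ae (\<lambda>i. at i t @ at i g1 @ at i h1 \<in> Fs)" "ae (\<lambda>i. at i t @ at i g2 @ at i h2 \<in> Fs)" "ae (\<lambda>i. at i g1 @ at i g2 @ at i g3 \<in> Gr)"
    then show "ae (\<lambda>i. at i t @ at i h1 @ at i h2 @ at i h3 \<in> Ms) = ae (\<lambda>i. at i t @ at i g3 @ at i h3 \<in> Fs)"
      using cc unfolding st st3 st4 by blast
  qed
  have "ae (\<lambda>i. coded_iso n G Gr Hs Ms Fs (at i t))"
    unfolding coded_iso_def ae_conj
    by (intro conjI) (rule 1, rule ae_mono[OF 2], blast, rule ae_mono[OF 3], blast, rule ae_mono[OF 4], blast, rule 5, rule ae_mono[OF 6], blast)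
  then show ?thesis using ae_const[of False] ae_mono[of _ "\<lambda>_. False"] by blast
qed

text \<open>The group laws hold at almost every index. Multiplication is chosen coordinatewise by
  \<open>lift\<close>, and its graph, being internal, is the image under \<open>star\<close> of the
  original graph.\<close>

lemma star_group:
  fixes G :: "'a list set"
  assumes G: "G \<subseteq> tuples n" and gr: "group (grp G m e)"
  shows "\<exists>mul one'. group (grp (star G) mul one') \<and>
     star {x @ y @ m x y | x y. x \<in> G \<and> y \<in> G} = {x @ y @ mul x y | x y. x \<in> star G \<and> y \<in> star G}"
proof -
  interpret group "grp G m e" by (rule gr)
  have s: "carrier (grp G m e) = G" "\<And>x y. x \<otimes>\<^bsub>grp G m e\<^esub> y = m x y" "\<one>\<^bsub>grp G m e\<^esub> = e" by (simp_all add: grp_def)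
  have closed: "x \<in> G \<Longrightarrow> y \<in> G \<Longrightarrow> m x y \<in> G" for x y using m_closed unfolding s by blast
  have assoc: "x \<in> G \<Longrightarrow> y \<in> G \<Longrightarrow> z \<in> G \<Longrightarrow> m (m x y) z = m x (m y z)" for x y z using m_assoc unfolding s by blast
  have oneG: "e \<in> G" and l1: "x \<in> G \<Longrightarrow> m e x = x" for x using one_closed l_one unfolding s by auto
  have linv: "x \<in> G \<Longrightarrow> \<exists>y\<in>G. m y x = e" for x using l_inv_ex unfolding s by blast
  have lG: "x \<in> G \<Longrightarrow> length x = n" for x using G by auto
  define mul where "mul x y = lift n (\<lambda>i. m (at i x) (at i y))" for x y
  have mul_at: "ae (\<lambda>i. at i (mul x y) = m (at i x) (at i y))" if "x \<in> star G" "y \<in> star G" for x y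
    unfolding mul_def
  proof (rule at_lift)
    show "ae (\<lambda>i. length (m (at i x) (at i y)) = n)" using that unfolding in_star by (rule ae_mono2) (use closed lG in blast)
  qed
  have mul_len: "length (mul x y) = n" for x y unfolding mul_def by simp
  have mul_closed: "mul x y \<in> star G" if xy: "x \<in> star G" "y \<in> star G" for x y
  proof -
    have "ae (\<lambda>i. at i x \<in> G \<and> at i y \<in> G)" using xy unfolding in_star ae_conj by blast
    then show ?thesis unfolding in_star using mul_at[OF xy] by (rule ae_mono2) (use closed in auto)
  qed
  have len: "x \<in> star G \<Longrightarrow> length x = n" for x by (rule star_length[OF G])
  define one' where "one' = lift n (\<lambda>i. e)"
  have one_at: "ae (\<lambda>i. at i one' = e)" unfolding one'_def by (rule at_lift) (simp add: ae_const lG oneG)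
  have one_star: "one' \<in> star G" unfolding in_star using one_at by (rule ae_mono) (simp add: oneG)
  have "group (grp (star G) mul one')"
  proof (rule groupI)
    fix x y assume "x \<in> carrier (grp (star G) mul one')" "y \<in> carrier (grp (star G) mul one')"
    then show "x \<otimes>\<^bsub>grp (star G) mul one'\<^esub> y \<in> carrier (grp (star G) mul one')" using mul_closed by (simp add: grp_def)
  next
    show "\<one>\<^bsub>grp (star G) mul one'\<^esub> \<in> carrier (grp (star G) mul one')" using one_star by (simp add: grp_def)
  next
    fix x y z assume "x \<in> carrier (grp (star G) mul one')" "y \<in> carrier (grp (star G) mul one')" "z \<in> carrier (grp (star G) mul one')"
    then have xyz: "x \<in> star G" "y \<in> star G" "z \<in> star G" by (simp_all add: grp_def)
    note c1 = mul_closed[OF xyz(1,2)] note c2 = mul_closed[OF xyz(2,3)]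
    have a: "ae (\<lambda>i. at i (mul x y) = m (at i x) (at i y) \<and> at i (mul y z) = m (at i y) (at i z) \<and>
       at i (mul (mul x y) z) = m (at i (mul x y)) (at i z) \<and> at i (mul x (mul y z)) = m (at i x) (at i (mul y z)))"
      using mul_at[OF xyz(1,2)] mul_at[OF xyz(2,3)] mul_at[OF c1 xyz(3)] mul_at[OF xyz(1) c2] unfolding ae_conj by blast
    have b: "ae (\<lambda>i. at i x \<in> G \<and> at i y \<in> G \<and> at i z \<in> G)" using xyz unfolding in_star ae_conj by blast
    have "ae (\<lambda>i. at i (mul (mul x y) z) = at i (mul x (mul y z)))" using a b by (rule ae_mono2) (simp add: assoc)
    then have "mul (mul x y) z = mul x (mul y z)" using at_eq_iff[of "mul (mul x y) z" "mul x (mul y z)"] mul_len by simp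
    then show "x \<otimes>\<^bsub>grp (star G) mul one'\<^esub> y \<otimes>\<^bsub>grp (star G) mul one'\<^esub> z = x \<otimes>\<^bsub>grp (star G) mul one'\<^esub> (y \<otimes>\<^bsub>grp (star G) mul one'\<^esub> z)"
      by (simp add: grp_def)
  next
    fix x assume "x \<in> carrier (grp (star G) mul one')"
    then have x: "x \<in> star G" by (simp add: grp_def)
    have "ae (\<lambda>i. at i x \<in> G \<and> at i one' = e)" using x one_at unfolding in_star ae_conj by blast
    then have "ae (\<lambda>i. at i (mul one' x) = at i x)" using mul_at[OF one_star x] by (rule ae_mono2) (simp add: l1)
    then have "mul one' x = x" using at_eq_iff[of "mul one' x" x] mul_len len[OF x] by simp
    then show "\<one>\<^bsub>grp (star G) mul one'\<^esub> \<otimes>\<^bsub>grp (star G) mul one'\<^esub> x = x" by (simp add: grp_def)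
    have "ae (\<lambda>i. \<exists>y. y \<in> G \<and> m y (at i x) = e)" using x unfolding in_star by (rule ae_mono) (use linv in blast)
    then obtain f where f: "ae (\<lambda>i. f i \<in> G \<and> m (f i) (at i x) = e)" using ae_ex[of "\<lambda>i y. y \<in> G \<and> m y (at i x) = e"] by blast
    let ?y = "lift n f"
    have fl: "ae (\<lambda>i. at i ?y = f i)" by (rule at_lift) (use f in \<open>rule ae_mono, simp add: lG\<close>)
    have y: "?y \<in> star G" unfolding in_star using f fl by (rule ae_mono2) simp
    have "ae (\<lambda>i. at i ?y = f i \<and> at i one' = e \<and> at i (mul ?y x) = m (at i ?y) (at i x))" using fl one_at mul_at[OF y x] unfolding ae_conj by blast
    then have "ae (\<lambda>i. at i (mul ?y x) = at i one')" using f by (rule ae_mono2) simp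
    then have "mul ?y x = one'" using at_eq_iff[of "mul ?y x" one'] mul_len by (simp add: one'_def)
    then show "\<exists>y\<in>carrier (grp (star G) mul one'). y \<otimes>\<^bsub>grp (star G) mul one'\<^esub> x = \<one>\<^bsub>grp (star G) mul one'\<^esub>"
      using y by (auto simp: grp_def)
  qed
  moreover have "star {x @ y @ m x y | x y. x \<in> G \<and> y \<in> G} = {x @ y @ mul x y | x y. x \<in> star G \<and> y \<in> star G}"
  proof (rule Set.set_eqI)
    fix z
    let ?Gr = "{x @ y @ m x y | x y. x \<in> G \<and> y \<in> G}"
    have inGr: "x @ y @ w \<in> ?Gr \<longleftrightarrow> x \<in> G \<and> y \<in> G \<and> w = m x y" if l: "length x = n" "length y = n" for x y w
    proof
      assume "x @ y @ w \<in> ?Gr"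
      then obtain x' y' where xy: "x @ y @ w = x' @ y' @ m x' y'" "x' \<in> G" "y' \<in> G" by blast
      then have "x = x' \<and> y = y' \<and> w = m x' y'" using l lG[OF xy(2)] lG[OF xy(3)] by (metis append_eq_append_conv)
      then show "x \<in> G \<and> y \<in> G \<and> w = m x y" using xy by blast
    qed blast
    have key: "x @ y @ w \<in> star ?Gr \<longleftrightarrow> x \<in> star G \<and> y \<in> star G \<and> w = mul x y" if l: "length x = n" "length y = n" "length w = n" for x y w
    proof -
      have "x @ y @ w \<in> star ?Gr \<longleftrightarrow> ae (\<lambda>i. at i x \<in> G \<and> at i y \<in> G \<and> at i w = m (at i x) (at i y))"
        unfolding in_star at_simps using inGr l by simp
      also have "\<dots> \<longleftrightarrow> x \<in> star G \<and> y \<in> star G \<and> ae (\<lambda>i. at i w = m (at i x) (at i y))" unfolding ae_conj in_star by blast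
      also have "\<dots> \<longleftrightarrow> x \<in> star G \<and> y \<in> star G \<and> w = mul x y"
      proof -
        have "ae (\<lambda>i. at i w = m (at i x) (at i y)) \<longleftrightarrow> w = mul x y" if xy: "x \<in> star G" "y \<in> star G"
        proof -
          have "w = mul x y \<longleftrightarrow> ae (\<lambda>i. at i w = at i (mul x y))" by (rule at_eq_iff) (simp add: l mul_len)
          also have "\<dots> \<longleftrightarrow> ae (\<lambda>i. at i w = m (at i x) (at i y))"
          proof
            assume "ae (\<lambda>i. at i w = at i (mul x y))"
            then show "ae (\<lambda>i. at i w = m (at i x) (at i y))" using mul_at[OF xy] by (rule ae_mono2) simp
          next
            assume "ae (\<lambda>i. at i w = m (at i x) (at i y))"
            then show "ae (\<lambda>i. at i w = at i (mul x y))" using mul_at[OF xy] by (rule ae_mono2) simp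
          qed
          finally show ?thesis by blast
        qed
        then show ?thesis by blast
      qed
      finally show ?thesis .
    qed
    show "z \<in> star ?Gr \<longleftrightarrow> z \<in> {x @ y @ mul x y | x y. x \<in> star G \<and> y \<in> star G}"
    proof (cases "length z = 3 * n")
      case True
      define x y w where "x = take n z" and "y = take n (drop n z)" and "w = drop (2 * n) z"
      have l: "length x = n" "length y = n" "length w = n" unfolding x_def y_def w_def using True by auto
      have z: "z = x @ y @ w" unfolding x_def y_def w_def by (metis append_take_drop_id drop_drop mult_2)
      show ?thesis
      proof
        assume "z \<in> star ?Gr"
        then show "z \<in> {x @ y @ mul x y | x y. x \<in> star G \<and> y \<in> star G}" unfolding z using key[OF l] by blast
      next
        assume "z \<in> {x @ y @ mul x y | x y. x \<in> star G \<and> y \<in> star G}"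
        then obtain x' y' where xy: "z = x' @ y' @ mul x' y'" "x' \<in> star G" "y' \<in> star G" by blast
        then show "z \<in> star ?Gr" using key[OF len len mul_len] by blast
      qed
    next
      case False
      have "?Gr \<subseteq> tuples (3 * n)" using lG closed by auto
      then have "z \<notin> star ?Gr" using star_length False by blast
      moreover have "z \<notin> {x @ y @ mul x y | x y. x \<in> star G \<and> y \<in> star G}" using False len mul_len by auto
      ultimately show ?thesis by blast
    qed
  qed
  ultimately show ?thesis by blast
qed

context mpair begin

theorem KM_group_coded:
  assumes "G \<in> KM n" "{x @ y @ m x y | x y. x \<in> G \<and> y \<in> G} \<in> KM (3 * n)" "group (grp G m e)"
  shows "\<exists>N t Hs Ms Fs. length t = n * N \<and> Hs \<in> L (n * (N + 2)) \<and> Ms \<in> L (n * (N + 6)) \<and> Fs \<in> KM (n * (N + 3)) \<and>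
     coded_iso n G {x @ y @ m x y | x y. x \<in> G \<and> y \<in> G} Hs Ms Fs t"
proof -
  interpret KS: struct KM by unfold_locales (rule KM_struct)
  have Gt: "G \<subseteq> tuples n" using KS.length_mem[OF assms(1)] by auto
  obtain mul one' where g: "group (grp (star G) mul one')"
    and gr: "star {x @ y @ m x y | x y. x \<in> G \<and> y \<in> G} = {x @ y @ mul x y | x y. x \<in> star G \<and> y \<in> star G}"
    using star_group[OF Gt assms(3)] by blast
  interpret SG: sat_group "\<lambda>n. star ` L n" "\<lambda>n. star ` KM n" "\<lambda>n. star ` FL n" starP n "star G" mul one'
  proof (rule sat_group.intro[OF star_sat], rule sat_group_axioms.intro)
    show "star G \<in> star ` KM n" using assms(1) by (rule imageI)
    show "{x @ y @ mul x y |x y. x \<in> star G \<and> y \<in> star G} \<in> star ` KM (3 * n)" unfolding gr[symmetric] using assms(2) by (rule imageI)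
    show "group (grp (star G) mul one')" by (rule g)
  qed
  obtain Y \<Gamma> where "SG.chunk Y \<Gamma>" using SG.chunk_exists by blast
  then interpret SC: sat_chunk "\<lambda>n. star ` L n" "\<lambda>n. star ` KM n" "\<lambda>n. star ` FL n" starP n "star G" mul one' Y \<Gamma>
    by unfold_locales
  obtain N T Hs' Ms' Fs' where T: "length T = n * N" "Hs' \<in> star ` L (n * (N + 2))" "Ms' \<in> star ` L (n * (N + 6))" "Fs' \<in> star ` KM (n * (N + 3))"
     "coded_iso n (star G) {x @ y @ mul x y | x y. x \<in> star G \<and> y \<in> star G} Hs' Ms' Fs' T" using SC.coded_iso_exists by blast
  obtain Hs Ms Fs where H: "Hs \<in> L (n * (N + 2))" "Hs' = star Hs" "Ms \<in> L (n * (N + 6))" "Ms' = star Ms" "Fs \<in> KM (n * (N + 3))" "Fs' = star Fs"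
    using T(2-4) by blast
  obtain i where "coded_iso n G {x @ y @ m x y | x y. x \<in> G \<and> y \<in> G} Hs Ms Fs (at i T)"
    using coded_iso_transfer[of n G _ Hs Ms Fs T] T(5) unfolding H gr[symmetric] by blast
  then show ?thesis using T(1) H by (intro exI[of _ N] exI[of _ "at i T"] exI[of _ Hs] exI[of _ Ms] exI[of _ Fs]) simp
qed

end

section \<open>Parameters as fibres\<close>

lemma (in pstruct) fibre_mem:
  assumes X: "X \<in> S (l + k)" and t: "length t = l"
  shows "{x \<in> tuples k. t @ x \<in> X} \<in> S k"
proof -
  have "X \<in> S (length ([k..<k+l] @ [0..<k]))" using X by simp
  then have "dfn S (\<lambda>e. map e ([k..<k+l] @ [0..<k]) \<in> X)" by (rule dfn_atom)
  from dfn_inst_but[OF this, of "{..<k}" "\<lambda>i. t ! (i - k)"]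
  have d: "dfn S (\<lambda>e. map (\<lambda>i. if i \<in> {..<k} then e i else t ! (i - k)) ([k..<k+l] @ [0..<k]) \<in> X)" .
  have "map (\<lambda>i. if i \<in> {..<k} then e i else t ! (i - k)) ([k..<k+l] @ [0..<k]) = t @ map e [0..<k]" for e
    by (rule nth_equalityI) (auto simp: t nth_append)
  then have "dfn S (\<lambda>e. t @ map e [0..<k] \<in> X)" using d by (simp only:)
  moreover have "(t @ map e [0..<k] \<in> X) = (t @ map e' [0..<k] \<in> X)" if "\<forall>i<k. e i = e' i" for e e'
  proof -
    have "map e [0..<k] = map e' [0..<k]" using that by simp
    then show ?thesis by (simp only:)
  qed
  ultimately have "{xs \<in> tuples k. t @ map ((!) xs) [0..<k] \<in> X} \<in> S k" by (rule dfn_mem)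
  moreover have "{xs \<in> tuples k. t @ map ((!) xs) [0..<k] \<in> X} = {x \<in> tuples k. t @ x \<in> X}"
  proof (intro Collect_cong conj_cong refl)
    fix x :: "'a list" assume "x \<in> tuples k"
    then have "map ((!) x) [0..<k] = x" using map_nth[of x] by simp
    then show "t @ map ((!) x) [0..<k] \<in> X \<longleftrightarrow> t @ x \<in> X" by (simp only:)
  qed
  ultimately show ?thesis by simp
qed

text \<open>Used to remove constants from a definition at the price of extra coordinates: what the
  entries of \<open>c\<close> generate over \<open>S\<close> stays among the fibres over
  \<open>c\<close>.\<close>

lemma (in struct) is_structure_params:
  fixes c :: "'a list"
  shows "is_structure (\<lambda>k. {{x \<in> tuples k. c @ x \<in> X} | X. X \<in> S (length c + k)})"
proof -
  let ?T = "\<lambda>k. {{x \<in> tuples k. c @ x \<in> X} | X. X \<in> S (length c + k)}"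
  have I: "A \<in> ?T k" if "X \<in> S (length c + k)" "A = {x \<in> tuples k. c @ x \<in> X}" for A X k using that by blast
  show ?thesis
    unfolding is_structure_def
  proof (intro conjI allI impI)
    fix n show "?T n \<subseteq> Pow (tuples n)" by auto
    show "{} \<in> ?T n" by (rule I[OF empty_mem]) simp
  next
    fix n A B assume "A \<in> ?T n" "B \<in> ?T n"
    then obtain X Y where XY: "X \<in> S (length c + n)" "Y \<in> S (length c + n)" "A = {x \<in> tuples n. c @ x \<in> X}" "B = {x \<in> tuples n. c @ x \<in> Y}" by blast
    show "A \<union> B \<in> ?T n" by (rule I[OF Un_mem[OF XY(1,2)]]) (auto simp: XY(3,4))
  next
    fix n A assume "A \<in> ?T n"
    then obtain X where X: "X \<in> S (length c + n)" "A = {x \<in> tuples n. c @ x \<in> X}" by blast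
    show "tuples n - A \<in> ?T n" by (rule I[OF compl_mem[OF X(1)]]) (auto simp: X(2))
    let ?js = "[0..<length c] @ [Suc (length c)..<Suc (length c) + n]"
    have m: "{z \<in> tuples (length c + Suc n). map ((!) z) ?js \<in> X} \<in> S (length c + Suc n)"
      by (rule reindex_mem[OF X(1)]) auto
    have e: "map ((!) (c @ x # xs)) ?js = c @ xs" if "length xs = n" for x xs
    proof -
      have "map ((!) (c @ x # xs)) [0..<length c] = c" by (rule nth_equalityI) (auto simp: nth_append)
      moreover have "map ((!) (c @ x # xs)) [Suc (length c)..<Suc (length c) + n] = xs"
        by (rule nth_equalityI) (auto simp: that nth_append simp del: upt_Suc)
      ultimately show ?thesis by simp
    qed
    have "{x # xs | x xs. xs \<in> A} = {x \<in> tuples (Suc n). c @ x \<in> {z \<in> tuples (length c + Suc n). map ((!) z) ?js \<in> X}}"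
    proof (rule Set.set_eqI)
      fix z show "z \<in> {x # xs | x xs. xs \<in> A} \<longleftrightarrow> z \<in> {x \<in> tuples (Suc n). c @ x \<in> {z \<in> tuples (length c + Suc n). map ((!) z) ?js \<in> X}}"
      proof (cases z)
        case Nil then show ?thesis by simp
      next
        case (Cons x xs)
        show ?thesis
        proof (cases "length xs = n")
          case True then show ?thesis using e[OF True, of x] unfolding Cons X(2) by simp
        next
          case False then show ?thesis unfolding Cons X(2) by simp
        qed
      qed
    qed
    then show "{x # xs | x xs. xs \<in> A} \<in> ?T (Suc n)" by (rule I[OF m])
    have m': "{xs @ [x] | x xs. xs \<in> X} \<in> S (length c + Suc n)" using snoc_mem[OF X(1)] by simp
    have "{xs @ [x] | x xs. xs \<in> A} = {x \<in> tuples (Suc n). c @ x \<in> {xs @ [x] | x xs. xs \<in> X}}"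
    proof (rule Set.set_eqI)
      fix z show "z \<in> {xs @ [x] | x xs. xs \<in> A} \<longleftrightarrow> z \<in> {x \<in> tuples (Suc n). c @ x \<in> {xs @ [x] | x xs. xs \<in> X}}"
      proof (cases z rule: rev_cases)
        case Nil then show ?thesis by simp
      next
        case (snoc xs x) then show ?thesis unfolding X(2) by (auto simp flip: append_assoc)
      qed
    qed
    then show "{xs @ [x] | x xs. xs \<in> A} \<in> ?T (Suc n)" by (rule I[OF m'])
  next
    fix n :: nat assume n: "1 \<le> n"
    have m: "{xs \<in> tuples (length c + n). xs ! length c = xs ! (length c + n - 1)} \<in> S (length c + n)"
      by (rule eq_mem) (use n in auto)
    show "{xs \<in> tuples n. xs ! 0 = xs ! (n - 1)} \<in> ?T n" by (rule I[OF m]) (use n in \<open>auto simp: nth_append\<close>)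
  next
    fix n A assume "A \<in> ?T (Suc n)"
    then obtain X where X: "X \<in> S (length c + Suc n)" "A = {x \<in> tuples (Suc n). c @ x \<in> X}" by blast
    have m: "butlast ` X \<in> S (length c + n)" using proj_mem[of X "length c + n"] X(1) by simp
    have "butlast ` A = {x \<in> tuples n. c @ x \<in> butlast ` X}"
    proof (intro equalityI subsetI)
      fix z assume "z \<in> butlast ` A"
      then obtain x where x: "length x = Suc n" "c @ x \<in> X" "z = butlast x" unfolding X(2) by auto
      then have "c @ z = butlast (c @ x)" by (auto simp: butlast_append)
      then show "z \<in> {x \<in> tuples n. c @ x \<in> butlast ` X}" using x by auto
    next
      fix z assume "z \<in> {x \<in> tuples n. c @ x \<in> butlast ` X}"
      then obtain w where w: "length z = n" "w \<in> X" "c @ z = butlast w" by auto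
      have "w \<noteq> []" using length_mem[OF X(1) w(2)] by auto
      then have "w = c @ z @ [last w]" using append_butlast_last_id[of w] unfolding w(3)[symmetric] by simp
      then have "z @ [last w] \<in> A" unfolding X(2) using w by simp
      then show "z \<in> butlast ` A" by force
    qed
    then show "butlast ` A \<in> ?T n" by (rule I[OF m])
  qed
qed

lemma (in struct) gen_structure_params:
  assumes A: "finite A" and X: "X \<in> gen_structure (\<lambda>m. S m \<union> (if m = 1 then {{[a]} | a. a \<in> A} else {})) k"
  shows "\<exists>c Y. set c = A \<and> Y \<in> S (length c + k) \<and> X = {x \<in> tuples k. c @ x \<in> Y}"
proof -
  obtain c where c: "set c = A" using A finite_list by blast
  let ?T = "\<lambda>k. {{x \<in> tuples k. c @ x \<in> X} | X. X \<in> S (length c + k)}"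
  have "gen_structure (\<lambda>m. S m \<union> (if m = 1 then {{[a]} | a. a \<in> A} else {})) k \<subseteq> ?T k"
  proof (rule gen_structure_least[OF is_structure_params])
    fix m
    show "S m \<union> (if m = 1 then {{[a]} | a. a \<in> A} else {}) \<subseteq> ?T m"
    proof
      fix Z assume "Z \<in> S m \<union> (if m = 1 then {{[a]} | a. a \<in> A} else {})"
      then consider "Z \<in> S m" | a where "m = 1" "a \<in> A" "Z = {[a]}" by (auto split: if_splits)
      then show "Z \<in> ?T m"
      proof cases
        case 1
        have "c @ x \<in> {ys @ xs | ys xs. length ys = length c \<and> xs \<in> Z} \<longleftrightarrow> x \<in> Z" for x
        proof
          assume "c @ x \<in> {ys @ xs | ys xs. length ys = length c \<and> xs \<in> Z}"
          then obtain ys xs where "c @ x = ys @ xs" "length ys = length c" "xs \<in> Z" by blast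
          then show "x \<in> Z" by simp
        qed blast
        then have "Z = {x \<in> tuples m. c @ x \<in> {ys @ xs | ys xs. length ys = length c \<and> xs \<in> Z}}"
          using length_mem[OF 1] by (simp only:) auto
        then show ?thesis using padL_mem[OF 1, of "length c"]
          by (intro CollectI exI[of _ "{ys @ xs | ys xs. length ys = length c \<and> xs \<in> Z}"] conjI)
      next
        case 2
        then obtain j where j: "j < length c" "c ! j = a" using c by (metis in_set_conv_nth)
        have "Z = {x \<in> tuples m. c @ x \<in> {xs \<in> tuples (length c + 1). xs ! j = xs ! length c}}"
        proof (rule Set.set_eqI)
          fix z
          show "z \<in> Z \<longleftrightarrow> z \<in> {x \<in> tuples m. c @ x \<in> {xs \<in> tuples (length c + 1). xs ! j = xs ! length c}}"
          proof (cases "length z = 1")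
            case True
            then obtain b where "z = [b]" by (auto simp: length_Suc_conv)
            then show ?thesis unfolding 2(1,3) using j by (auto simp: nth_append)
          qed (use 2 in auto)
        qed
        moreover have "{xs \<in> tuples (length c + 1). xs ! j = xs ! length c} \<in> S (length c + m)" unfolding 2(1) by (rule eq_mem) (use j in auto)
        ultimately show ?thesis by (intro CollectI exI[of _ "{xs \<in> tuples (length c + 1). xs ! j = xs ! length c}"] conjI)
      qed
    qed
  qed
  then have "X \<in> ?T k" using X by (rule subsetD)
  then show ?thesis using c by blast
qed

text \<open>Fixing the tuple \<open>t\<close> turns the coded sets into an actual group and
  isomorphism. The group laws are transported along \<open>f\<close> from the given group.\<close>

lemma coded_iso_definable:
  fixes G :: "'a list set"
  assumes D: "pstruct D" and E: "pstruct E" and t: "length t = n * N"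
    and Hs: "Hs \<in> D (n * (N + 2))" and Ms: "Ms \<in> D (n * (N + 6))" and Fs: "Fs \<in> E (n * (N + 3))"
    and G: "G \<subseteq> tuples n" and gr: "group (grp G m e)"
    and co: "coded_iso n G {x @ y @ m x y | x y. x \<in> G \<and> y \<in> G} Hs Ms Fs t"
  shows "\<exists>H m' e' f. definable_group D (2 * n) H m' e' \<and> f \<in> iso (grp G m e) (grp H m' e') \<and> {x @ f x | x. x \<in> G} \<in> E (n + 2 * n)"
proof -
  interpret D: pstruct D by (rule D)
  interpret E: pstruct E by (rule E)
  interpret Gp: group "grp G m e" by (rule gr)
  note c = co[unfolded coded_iso_def]
  have c1: "\<exists>h. length h = 2 * n \<and> t @ g @ h \<in> Fs" if "length g = n" "g \<in> G" for g using conjunct1[OF c] that by simp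
  have c2: "g \<in> G" "t @ h \<in> Hs" if "length g = n" "length h = 2 * n" "t @ g @ h \<in> Fs" for g h
    using conjunct1[OF conjunct2[OF c]] that by simp_all
  have c3: "h = h'" if "length g = n" "length h = 2 * n" "length h' = 2 * n" "t @ g @ h \<in> Fs" "t @ g @ h' \<in> Fs" for g h h'
    using conjunct1[OF conjunct2[OF conjunct2[OF c]]] that by simp
  have c4: "g = g'" if "length g = n" "length g' = n" "length h = 2 * n" "t @ g @ h \<in> Fs" "t @ g' @ h \<in> Fs" for g g' h
    using conjunct1[OF conjunct2[OF conjunct2[OF conjunct2[OF c]]]] that by simp
  have c5: "\<exists>g. length g = n \<and> t @ g @ h \<in> Fs" if "length h = 2 * n" "t @ h \<in> Hs" for h
    using conjunct1[OF conjunct2[OF conjunct2[OF conjunct2[OF conjunct2[OF c]]]]] that by simp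
  note c6 = conjunct2[OF conjunct2[OF conjunct2[OF conjunct2[OF conjunct2[OF c]]]]]
  have lG: "g \<in> G \<Longrightarrow> length g = n" for g using G by auto
  have mG: "x \<in> G \<Longrightarrow> y \<in> G \<Longrightarrow> m x y \<in> G" for x y using Gp.m_closed[of x y] by (simp add: grp_def)
  define f where "f g = (THE h. length h = 2 * n \<and> t @ g @ h \<in> Fs)" for g
  have fiff: "length h = 2 * n \<and> t @ g @ h \<in> Fs \<longleftrightarrow> h = f g" if g: "g \<in> G" for g h
  proof -
    obtain h0 where h0: "length h0 = 2 * n" "t @ g @ h0 \<in> Fs" using c1[OF lG[OF g] g] by blast
    have u: "h = h0" if "length h = 2 * n \<and> t @ g @ h \<in> Fs" for h using c3[OF lG[OF g]] that h0 by blast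
    have "f g = h0" unfolding f_def using h0 u by blast
    then show ?thesis using h0 u by blast
  qed
  define H where "H = {h \<in> tuples (2 * n). t @ h \<in> Hs}"
  have lH: "h \<in> H \<Longrightarrow> length h = 2 * n" for h unfolding H_def by simp
  have fH: "f g \<in> H" if g: "g \<in> G" for g
  proof -
    have "length (f g) = 2 * n" "t @ g @ f g \<in> Fs" using fiff[OF g] by blast+
    then have "t @ f g \<in> Hs" using c2(2)[OF lG[OF g]] by blast
    then show ?thesis unfolding H_def using \<open>length (f g) = 2 * n\<close> by simp
  qed
  have inj: "inj_on f G"
  proof (rule inj_onI)
    fix x y assume xy: "x \<in> G" "y \<in> G" "f x = f y"
    have "length (f x) = 2 * n" "t @ x @ f x \<in> Fs" "t @ y @ f x \<in> Fs" using fiff[OF xy(1), of "f x"] fiff[OF xy(2), of "f x"] xy(3) by blast+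
    then show "x = y" by (rule c4[OF lG[OF xy(1)] lG[OF xy(2)]])
  qed
  have surj: "\<exists>g\<in>G. h = f g" if "h \<in> H" for h
  proof -
    have h: "length h = 2 * n" "t @ h \<in> Hs" using that unfolding H_def by auto
    obtain g where g: "length g = n" "t @ g @ h \<in> Fs" using c5[OF h] by blast
    then have "g \<in> G" using c2(1) h(1) by blast
    then show ?thesis using fiff[of g h] h(1) g(2) by blast
  qed
  define m' where "m' h1 h2 = f (m (inv_into G f h1) (inv_into G f h2))" for h1 h2
  have m': "m' (f x) (f y) = f (m x y)" if "x \<in> G" "y \<in> G" for x y unfolding m'_def using that by (simp add: inv_into_f_f[OF inj])
  have iso: "f \<in> iso (grp G m e) (grp H m' (f e))"
  proof (rule isoI)
    show "f \<in> hom (grp G m e) (grp H m' (f e))" unfolding hom_def grp_def using fH m' by auto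
    have "f ` G = H" using fH surj by blast
    then show "bij_betw f (carrier (grp G m e)) (carrier (grp H m' (f e)))" using inj unfolding bij_betw_def grp_def by simp
  qed
  have "group (grp H m' (f e))" using Gp.iso_imp_img_group[OF iso] by (simp add: grp_def)
  moreover have HD: "H \<in> D (2 * n)" unfolding H_def
  proof (rule D.fibre_mem[OF _ t])
    have "n * (N + 2) = n * N + 2 * n" by algebra
    then show "Hs \<in> D (n * N + 2 * n)" using Hs by (simp only:)
  qed
  moreover have "{x @ y @ m' x y | x y. x \<in> H \<and> y \<in> H} \<in> D (3 * (2 * n))"
  proof -
    \<comment> \<open>\<open>coded_iso\<close> controls the fibre of \<open>Ms\<close> only over
      pairs from \<open>H\<close>, so the graph of \<open>m'\<close> is cut out by requiring the
      first two blocks to lie in \<open>H\<close>.\<close>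
    define M1 where "M1 = {z \<in> tuples (3 * (2 * n)). t @ z \<in> Ms}"
    define M2 where "M2 = {xs @ ys | xs ys. length ys = 4 * n \<and> xs \<in> H}"
    define M4 where "M4 = {xs @ ys | xs ys. length ys = 2 * n \<and> xs \<in> H}"
    define M3 where "M3 = {ys @ xs | ys xs. length ys = 2 * n \<and> xs \<in> M4}"
    have "M1 \<in> D (3 * (2 * n))" unfolding M1_def
    proof (rule D.fibre_mem[OF _ t])
      have "n * (N + 6) = n * N + 3 * (2 * n)" by algebra
      then show "Ms \<in> D (n * N + 3 * (2 * n))" using Ms by (simp only:)
    qed
    moreover have "M2 \<in> D (3 * (2 * n))" using D.padR_mem[OF HD, of "4 * n"] unfolding M2_def by simp
    moreover have "M4 \<in> D (2 * n + 2 * n)" unfolding M4_def by (rule D.padR_mem[OF HD])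
    then have "M3 \<in> D (3 * (2 * n))" using D.padL_mem[of M4 "2 * n + 2 * n" "2 * n"] unfolding M3_def by simp
    ultimately have "M1 \<inter> (M2 \<inter> M3) \<in> D (3 * (2 * n))" by (intro D.Int_mem)
    moreover have "{x @ y @ m' x y | x y. x \<in> H \<and> y \<in> H} = M1 \<inter> (M2 \<inter> M3)"
    proof -
      have key: "t @ f x @ f y @ h \<in> Ms \<longleftrightarrow> h = m' (f x) (f y)" if xy: "x \<in> G" "y \<in> G" and h: "length h = 2 * n" for x y h
      proof -
        have "length (f x) = 2 * n" "t @ x @ f x \<in> Fs" "length (f y) = 2 * n" "t @ y @ f y \<in> Fs" using fiff[OF xy(1)] fiff[OF xy(2)] by blast+
        moreover have "x @ y @ m x y \<in> {x @ y @ m x y | x y. x \<in> G \<and> y \<in> G}" using xy by blast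
        ultimately have "t @ f x @ f y @ h \<in> Ms \<longleftrightarrow> t @ m x y @ h \<in> Fs" using c6 lG[OF xy(1)] lG[OF xy(2)] lG[OF mG[OF xy]] h by simp
        then show ?thesis using fiff[OF mG[OF xy], of h] h m'[OF xy] by simp
      qed
      have lm: "length (m' x y) = 2 * n" if xy: "x \<in> H" "y \<in> H" for x y
      proof -
        obtain a b where "a \<in> G" "b \<in> G" "x = f a" "y = f b" using surj xy by meson
        then show ?thesis using m' fH mG lH by metis
      qed
      have ms: "t @ x @ y @ h \<in> Ms \<longleftrightarrow> h = m' x y" if xy: "x \<in> H" "y \<in> H" and h: "length h = 2 * n" for x y h
      proof -
        obtain a b where "a \<in> G" "b \<in> G" "x = f a" "y = f b" using surj xy by meson
        then show ?thesis using key[of a b h] h by simp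
      qed
      show ?thesis
      proof (intro equalityI subsetI)
        fix z assume "z \<in> {x @ y @ m' x y | x y. x \<in> H \<and> y \<in> H}"
        then obtain x y where z: "z = x @ y @ m' x y" "x \<in> H" "y \<in> H" by blast
        have l: "length x = 2 * n" "length y = 2 * n" "length (m' x y) = 2 * n" using lH lm z by auto
        have "z \<in> M1" unfolding M1_def z(1) using l ms[OF z(2,3) l(3)] by simp
        moreover have "length (y @ m' x y) = 4 * n" using l by simp
        then have "z \<in> M2" unfolding M2_def z(1) using z(2) by blast
        moreover have "y @ m' x y \<in> M4" unfolding M4_def using z(3) l(3) by blast
        then have "z \<in> M3" unfolding M3_def z(1) using l(1) by blast
        ultimately show "z \<in> M1 \<inter> (M2 \<inter> M3)" by blast
      next
        fix z assume z: "z \<in> M1 \<inter> (M2 \<inter> M3)"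
        then obtain x w where x: "z = x @ w" "x \<in> H" unfolding M2_def by blast
        obtain x' y h where y: "z = x' @ y @ h" "length x' = 2 * n" "y \<in> H" "length h = 2 * n" using z unfolding M3_def M4_def by auto
        have "x' = x" using x(1) y(1,2) lH[OF x(2)] by (simp add: append_eq_append_conv)
        then have "t @ x @ y @ h \<in> Ms" using z y(1) unfolding M1_def by simp
        then have "h = m' x y" using ms[OF x(2) y(3,4)] by blast
        then show "z \<in> {x @ y @ m' x y | x y. x \<in> H \<and> y \<in> H}" using y(1,3) x(2) \<open>x' = x\<close> by blast
      qed
    qed
    ultimately show ?thesis by simp
  qed
  moreover have "{x @ f x | x. x \<in> G} \<in> E (n + 2 * n)"
  proof -
    have "{z \<in> tuples (n + 2 * n). t @ z \<in> Fs} \<in> E (n + 2 * n)"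
    proof (rule E.fibre_mem[OF _ t])
      have "n * (N + 3) = n * N + (n + 2 * n)" by algebra
      then show "Fs \<in> E (n * N + (n + 2 * n))" using Fs by (simp only:)
    qed
    moreover have "{z \<in> tuples (n + 2 * n). t @ z \<in> Fs} = {x @ f x | x. x \<in> G}"
    proof (intro equalityI subsetI)
      fix z assume z: "z \<in> {z \<in> tuples (n + 2 * n). t @ z \<in> Fs}"
      define x h where "x = take n z" and "h = drop n z"
      have zl: "z = x @ h" "length x = n" "length h = 2 * n" unfolding x_def h_def using z by auto
      have F: "t @ x @ h \<in> Fs" using z zl(1) by simp
      then have "x \<in> G" by (rule c2(1)[OF zl(2,3)])
      then show "z \<in> {x @ f x | x. x \<in> G}" using fiff[of x h] F zl by blast
    next
      fix z assume "z \<in> {x @ f x | x. x \<in> G}"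
      then obtain x where x: "x \<in> G" "z = x @ f x" by blast
      then show "z \<in> {z \<in> tuples (n + 2 * n). t @ z \<in> Fs}" using fiff[OF x(1), of "f x"] lG[OF x(1)] by simp
    qed
    ultimately show ?thesis by simp
  qed
  ultimately show ?thesis using iso unfolding definable_group_def by blast
qed

section \<open>Reduction to countable structures\<close>

text \<open>The structure is generated in two stages, by parameters and then by the predicate;
  merging the generators into one family lets \<open>gen_structure_finite\<close> extract the
  finitely many sets and constants in use.\<close>

lemma expand_definable_finite:
  assumes S: "is_structure S0" and X: "X \<in> expand_pred (definable_sets S0) P n"
  shows "\<exists>F A. finite F \<and> finite A \<and> (\<forall>(m, Y)\<in>F. Y \<in> S0 m) \<and>
    X \<in> gen_structure (\<lambda>m. {Y. (m, Y) \<in> F} \<union> (if m = 1 then insert {[p] | p. p \<in> P} {{[a]} | a. a \<in> A} else {})) n"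
proof -
  interpret struct S0 by unfold_locales (rule S)
  let ?Ps = "{[p] | p. p \<in> P}"
  define \<G> where "\<G> m = S0 m \<union> (if m = 1 then insert ?Ps {{[a]} | a. True} else {})" for m
  have GP: "\<G> m \<subseteq> Pow (tuples m)" for m
  proof -
    have "S0 m \<subseteq> Pow (tuples m)" using length_mem by auto
    then show ?thesis unfolding \<G>_def by auto
  qed
  have "expand_pred (definable_sets S0) P n \<subseteq> gen_structure \<G> n"
    unfolding expand_pred_def
  proof (rule gen_structure_least[OF is_structure_gen[OF GP]])
    fix m
    have "definable_sets S0 m \<subseteq> gen_structure \<G> m" unfolding definable_sets_def
      by (rule gen_structure_mono) (auto simp: \<G>_def)
    moreover have "(if m = 1 then {?Ps} else {}) \<subseteq> \<G> m" unfolding \<G>_def by auto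
    then have "(if m = 1 then {?Ps} else {}) \<subseteq> gen_structure \<G> m" using gen_structure_incl[of \<G> m] by (rule subset_trans)
    ultimately show "definable_sets S0 m \<union> (if m = 1 then {?Ps} else {}) \<subseteq> gen_structure \<G> m" by (rule Un_least)
  qed
  then have "X \<in> gen_structure \<G> n" using X by (rule subsetD)
  then obtain F where F: "finite F" "\<forall>(m, Y)\<in>F. Y \<in> \<G> m" "X \<in> gen_structure (\<lambda>m. {Y. (m, Y) \<in> F}) n"
    using gen_structure_finite[OF GP] by blast
  define A where "A = (\<lambda>a. (1::nat, {[a]})) -` F"
  have "finite A" unfolding A_def by (rule finite_vimageI[OF F(1)]) (auto simp: inj_on_def)
  moreover define F' where "F' = {(m, Y) \<in> F. Y \<in> S0 m}"
  have "finite F'" unfolding F'_def by (rule finite_subset[OF _ F(1)]) auto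
  moreover have "X \<in> gen_structure (\<lambda>m. {Y. (m, Y) \<in> F'} \<union> (if m = 1 then insert ?Ps {{[a]} | a. a \<in> A} else {})) n"
  proof (rule subsetD[OF gen_structure_mono F(3)])
    fix m show "{Y. (m, Y) \<in> F} \<subseteq> {Y. (m, Y) \<in> F'} \<union> (if m = 1 then insert ?Ps {{[a]} | a. a \<in> A} else {})"
    proof
      fix Y assume Y: "Y \<in> {Y. (m, Y) \<in> F}"
      then have "Y \<in> \<G> m" using F(2) by auto
      then consider "Y \<in> S0 m" | "m = 1" "Y = ?Ps" | a where "m = 1" "Y = {[a]}" unfolding \<G>_def by (auto split: if_splits)
      then show "Y \<in> {Y. (m, Y) \<in> F'} \<union> (if m = 1 then insert ?Ps {{[a]} | a. a \<in> A} else {})"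
      proof cases
        case 1 then show ?thesis using Y unfolding F'_def by simp
      next
        case 2 then show ?thesis by simp
      next
        case 3
        then have "a \<in> A" using Y unfolding A_def by simp
        then show ?thesis using 3 by auto
      qed
    qed
  qed
  moreover have "\<forall>(m, Y)\<in>F'. Y \<in> S0 m" unfolding F'_def by auto
  ultimately show ?thesis by blast
qed

lemma (in struct) finite_points_mem:
  assumes "finite A" "\<And>a. a \<in> A \<Longrightarrow> {[a]} \<in> S 1" shows "{[a] | a. a \<in> A} \<in> S 1"
proof -
  have "\<Union>{{[a]} | a. a \<in> A} \<in> S 1" by (rule finite_UN_mem) (use assms in auto)
  moreover have "\<Union>{{[a]} | a. a \<in> A} = {[a] | a. a \<in> A}" by auto
  ultimately show ?thesis by simp
qed

text \<open>Members of \<open>FL\<close> have finite fibres over every base tuple. Restricting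
  \<open>X\<close> to the base tuples with finite fibre, a condition definable in \<open>L\<close>,
  achieves this.\<close>

lemma (in omin_reduct) finite_fibre_cl:
  assumes X: "X \<in> L (Suc (length as))" and f: "finite {y. as @ [y] \<in> X}" and p: "as @ [p] \<in> X"
  shows "p \<in> FL.cl (set as)"
proof -
  define Z where "Z = {bs \<in> tuples (length as). finite {y. bs @ [y] \<in> X}}"
  have Z: "Z \<in> L (length as)" unfolding Z_def by (rule finite_fibre_mem[OF X])
  define Y where "Y = X \<inter> {xs @ [x] | x xs. xs \<in> Z}"
  have "Y \<in> L (Suc (length as))" unfolding Y_def by (rule L.Int_mem[OF X L.snoc_mem[OF Z]])
  moreover have "finite {y. bs @ [y] \<in> Y}" for bs
  proof (cases "bs \<in> Z")
    case True
    then have "finite {y. bs @ [y] \<in> X}" unfolding Z_def by simp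
    then show ?thesis by (rule rev_finite_subset) (auto simp: Y_def)
  next
    case False then have "{y. bs @ [y] \<in> Y} = {}" unfolding Y_def by auto
    then show ?thesis by simp
  qed
  ultimately have "Y \<in> FL (length as)" unfolding FL_def by blast
  moreover have "as \<in> Z" unfolding Z_def using f by simp
  then have "as @ [p] \<in> Y" unfolding Y_def using p by blast
  ultimately show ?thesis using FL.cl_set_iff[of p as] by blast
qed

theorem theorem1p2:
  fixes S0 :: "nat \<Rightarrow> ('a::linordered_ab_group_add) list set set"
    and P :: "'a set"
  assumes S0_structure: "is_structure S0"
    and less_def: "{[x, y] | x y. x < y} \<in> S0 2"
    and plus_def: "{[x, y, z] | x y z. x + y = z} \<in> S0 3"
    and omin: "o_minimal S0"
    and P_dense: "\<forall>a b. a < b \<longrightarrow> (\<exists>p \<in> P. a < p \<and> p < b)"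
    and P_indep: "dcl_independent S0 P"
  shows "\<forall>n G m e. definable_group (expand_pred (definable_sets S0) P) n G m e \<longrightarrow>
           (\<exists>k H m' e' f. definable_group (definable_sets S0) k H m' e' \<and>
              f \<in> iso (grp G m e) (grp H m' e') \<and>
              {xs @ f xs | xs. xs \<in> G} \<in> expand_pred (definable_sets S0) P (n + k))"
proof (intro allI impI)
  fix n G m e
  let ?D = "definable_sets S0" and ?Ps = "{[p] | p. p \<in> P}"
  let ?E = "expand_pred ?D P"
  assume "definable_group ?E n G m e"
  then have GE: "G \<in> ?E n" and GrE: "{x @ y @ m x y | x y. x \<in> G \<and> y \<in> G} \<in> ?E (3 * n)" and gr: "group (grp G m e)"
    unfolding definable_group_def by auto
  interpret S0: struct S0 by unfold_locales (rule S0_structure)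
  have S0P: "S0 m \<subseteq> Pow (tuples m)" for m using S0.length_mem by auto
  have Dg: "S0 m \<union> (if m = 1 then {{[a]} | a. True} else {}) \<subseteq> ?D m" for m
    unfolding definable_sets_def by (rule gen_structure_incl)
  have Ds: "is_structure ?D" unfolding definable_sets_def by (rule is_structure_gen) (use S0P in auto)
  have S0D: "S0 m \<subseteq> ?D m" for m using Dg[of m] by blast
  have Dpt: "{[a]} \<in> ?D 1" for a using Dg[of 1] by auto
  interpret D: pstruct ?D by (unfold_locales) (rule Ds, rule Dpt)
  interpret R: omin_reduct ?D S0
  proof
    show "\<exists>F. finite F \<and> (\<forall>I\<in>F. interval_or_point I) \<and> X = {[x] |x. x \<in> \<Union> F}" if "X \<in> ?D 1" for X
      using omin that unfolding o_minimal_def by blast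
    show "\<exists>c. a < c \<and> c < b" if "a < b" for a b :: 'a using P_dense that by blast
    show "{[x, y] | x y. x < y} \<in> ?D 2" using S0D less_def by blast
    show "{[x, y, z] | x y z. x + y = z} \<in> ?D 3" using S0D plus_def by blast
  qed (rule S0D less_def plus_def)+
  \<comment> \<open>Independence is assumed for definable closure; \<open>finite_fibre_dcl\<close>
    carries it over to closure by finite fibres.\<close>
  have P0: "p \<notin> R.FL.cl (P - {p})" if "p \<in> P" for p
  proof
    assume "p \<in> R.FL.cl (P - {p})"
    then obtain as where as: "set as \<subseteq> P - {p}" "p \<in> R.FL.cl (set as)" using R.FL.cl_finite_list by blast
    then obtain X where X: "X \<in> R.FL (length as)" "as @ [p] \<in> X" using R.FL.cl_set_iff[of p as] by blast
    have "p \<in> dcl S0 (P - {p})"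
      by (rule R.finite_fibre_dcl[OF _ refl _ X(2) as(1)]) (use X(1) R.FL_def in auto)
    then show False using P_indep that unfolding dcl_independent_def by blast
  qed
  have Eg: "?D m \<union> (if m = 1 then {?Ps} else {}) \<subseteq> ?E m" for m unfolding expand_pred_def by (rule gen_structure_incl)
  have Es: "is_structure ?E" unfolding expand_pred_def by (rule is_structure_gen) (use D.length_mem in auto)
  have DE: "?D m \<subseteq> ?E m" for m using Eg[of m] by blast
  have EP: "?Ps \<in> ?E 1" using Eg[of 1] by auto
  interpret E: pstruct ?E by (unfold_locales) (rule Es, rule subsetD[OF DE Dpt])
  obtain F1 A1 where F1: "finite F1" "finite A1" "\<forall>(m, Y)\<in>F1. Y \<in> S0 m"
    "G \<in> gen_structure (\<lambda>m. {Y. (m, Y) \<in> F1} \<union> (if m = 1 then insert ?Ps {{[a]} | a. a \<in> A1} else {})) n"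
    using expand_definable_finite[OF S0_structure GE] by blast
  obtain F2 A2 where F2: "finite F2" "finite A2" "\<forall>(m, Y)\<in>F2. Y \<in> S0 m"
    "{x @ y @ m x y | x y. x \<in> G \<and> y \<in> G} \<in> gen_structure (\<lambda>m. {Y. (m, Y) \<in> F2} \<union> (if m = 1 then insert ?Ps {{[a]} | a. a \<in> A2} else {})) (3 * n)"
    using expand_definable_finite[OF S0_structure GrE] by blast
  define A where "A = A1 \<union> A2"
  have "finite A" unfolding A_def using F1(2) F2(2) by simp
  \<comment> \<open>The constants in \<open>A\<close> may create dependences in \<open>P\<close>;
    outside the finite set \<open>Q\<close> each point stays independent of \<open>A\<close> and the
    rest of \<open>P\<close>.\<close>
  from R.FL.indep_over_finite[OF P0 this]
  obtain Q where Q: "finite Q" "Q \<subseteq> P" "\<forall>p\<in>P - Q. p \<notin> R.FL.cl (A \<union> (P - {p}))" by blast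
  \<comment> \<open>Order and addition are included, since the reduct must still express intervals
    and sums.\<close>
  define F where "F = F1 \<union> F2 \<union> {(2, {[x, y] | x y. x < y}), (3, {[x, y, z] | x y z. x + y = z})}"
  have F: "finite F" "\<And>m Y. (m, Y) \<in> F \<Longrightarrow> Y \<in> S0 m" unfolding F_def using F1(1,3) F2(1,3) less_def plus_def by auto
  define B where "B = A \<union> Q"
  have B: "finite B" unfolding B_def using \<open>finite A\<close> Q(1) by simp
  define Lg where "Lg m = {Y. (m, Y) \<in> F} \<union> (if m = 1 then {{[a]} | a. a \<in> B} else {})" for m
  define L where "L = gen_structure Lg"
  have LgP: "Lg k \<subseteq> Pow (tuples k)" for k
  proof -
    have "{Y. (k, Y) \<in> F} \<subseteq> Pow (tuples k)" using F(2) S0P by blast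
    then show ?thesis unfolding Lg_def by auto
  qed
  have Lc: "countable (L k)" for k unfolding L_def
  proof (rule gen_structure_countable[OF LgP])
    fix k
    have "{Y. (k, Y) \<in> F} \<subseteq> snd ` F" by force
    then have "finite {Y. (k, Y) \<in> F}" using F(1) by (meson finite_imageI finite_subset)
    then have "finite (Lg k)" unfolding Lg_def using B by simp
    then show "countable (Lg k)" by (rule countable_finite)
  qed
  have L1: "L k \<subseteq> gen_structure (\<lambda>m. S0 m \<union> (if m = 1 then {{[a]} | a. a \<in> B} else {})) k" for k
    unfolding L_def by (rule gen_structure_mono) (auto simp: Lg_def F(2))
  have LD: "L k \<subseteq> ?D k" for k
    unfolding L_def
  proof (rule gen_structure_least[OF Ds])
    fix m have "Lg m \<subseteq> S0 m \<union> (if m = 1 then {{[a]} | a. True} else {})" unfolding Lg_def using F(2) by auto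
    then show "Lg m \<subseteq> ?D m" using Dg by (rule subset_trans)
  qed
  have LgL: "Lg k \<subseteq> L k" for k unfolding L_def by (rule gen_structure_incl)
  have Lpt: "{[a]} \<in> L 1" if "a \<in> B" for a
  proof -
    have "{[a]} \<in> Lg 1" unfolding Lg_def using that by auto
    then show ?thesis using LgL by blast
  qed
  interpret RL: omin_reduct ?D L
  proof
    show "is_structure L" unfolding L_def by (rule is_structure_gen[OF LgP])
    have "{[x::'a, y] | x y. x < y} \<in> Lg 2" "{[x::'a, y, z] | x y z. x + y = z} \<in> Lg 3" unfolding Lg_def F_def by simp_all
    then show "{[x::'a, y] | x y. x < y} \<in> L 2" "{[x::'a, y, z] | x y z. x + y = z} \<in> L 3" using LgL by blast+
  qed (rule LD)
  \<comment> \<open>Removing finitely many points keeps \<open>P\<close> dense. Independence over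
    the constants \<open>B\<close> is pulled back to \<open>S0\<close> by treating the constants as
    extra coordinates.\<close>
  interpret M: mpair ?D L "P - Q"
  proof
    show "countable (L k)" for k by (rule Lc)
    show "\<exists>p\<in>P - Q. a < p \<and> p < b" if ab: "a < b" for a b
    proof -
      have "infinite ({p \<in> P. a < p \<and> p < b} - Q)"
        by (rule Diff_infinite_finite[OF Q(1) dense_set_infinite[OF _ ab]]) (use P_dense in blast)
      then obtain p where "p \<in> {p \<in> P. a < p \<and> p < b} - Q" by (metis finite.emptyI equals0I)
      then show ?thesis by blast
    qed
    show "p \<notin> RL.FL.cl (P - Q - {p})" if p: "p \<in> P - Q" for p
    proof
      assume "p \<in> RL.FL.cl (P - Q - {p})"
      then obtain as where as: "set as \<subseteq> P - Q - {p}" "p \<in> RL.FL.cl (set as)" using RL.FL.cl_finite_list by blast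
      then obtain X where X: "X \<in> RL.FL (length as)" "as @ [p] \<in> X" using RL.FL.cl_set_iff[of p as] by blast
      have XL: "X \<in> L (Suc (length as))" and Xf: "finite {y. as @ [y] \<in> X}" using X(1) unfolding RL.FL_def by blast+
      obtain c Y where cY: "set c = B" "Y \<in> S0 (length c + Suc (length as))" "X = {x \<in> tuples (Suc (length as)). c @ x \<in> Y}"
        using S0.gen_structure_params[OF B subsetD[OF L1 XL]] by blast
      have e: "as @ [y] \<in> X \<longleftrightarrow> (c @ as) @ [y] \<in> Y" for y unfolding cY(3) by simp
      have "p \<in> R.FL.cl (set (c @ as))"
      proof (rule R.finite_fibre_cl)
        show "Y \<in> S0 (Suc (length (c @ as)))" using cY(2) by simp
        show "finite {y. (c @ as) @ [y] \<in> Y}" using Xf unfolding e .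
        show "(c @ as) @ [p] \<in> Y" using X(2) unfolding e .
      qed
      moreover have "set (c @ as) \<subseteq> A \<union> (P - {p})" using cY(1) as(1) Q(2) p unfolding B_def by auto
      ultimately have "p \<in> R.FL.cl (A \<union> (P - {p}))" using R.FL.cl_mono by blast
      then show False using Q(3) p by blast
    qed
  qed
  interpret K: struct M.KM by unfold_locales (rule M.KM_struct)
  have Kg: "L k \<union> (if k = 1 then {{[p] | p. p \<in> P - Q}} else {}) \<subseteq> M.KM k" for k
    unfolding M.KM_def by (rule gen_structure_incl)
  have LK: "L k \<subseteq> M.KM k" for k using Kg[of k] by blast
  \<comment> \<open>The removed points are constants of the reduct, so the full predicate is
    recovered from the smaller one.\<close>
  have "{[p] | p. p \<in> P - Q} \<in> M.KM 1" using Kg[of 1] by auto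
  moreover have "{[p] | p. p \<in> Q} \<in> M.KM 1"
    by (rule K.finite_points_mem[OF Q(1)]) (rule subsetD[OF LK Lpt], simp add: B_def)
  ultimately have "{[p] | p. p \<in> P - Q} \<union> {[p] | p. p \<in> Q} \<in> M.KM 1" by (rule K.Un_mem)
  moreover have "{[p] | p. p \<in> P - Q} \<union> {[p] | p. p \<in> Q} = ?Ps" using Q(2) by auto
  ultimately have PK: "?Ps \<in> M.KM 1" by simp
  have sub: "gen_structure (\<lambda>m. {Y. (m, Y) \<in> F'} \<union> (if m = 1 then insert ?Ps {{[a]} | a. a \<in> A'} else {})) k \<subseteq> M.KM k"
    if FA: "F' \<subseteq> F" "A' \<subseteq> B" for F' A' k
  proof (rule gen_structure_least[OF M.KM_struct])
    fix m
    have "{Y. (m, Y) \<in> F'} \<union> (if m = 1 then {{[a]} | a. a \<in> A'} else {}) \<subseteq> Lg m" unfolding Lg_def using FA by auto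
    then have "{Y. (m, Y) \<in> F'} \<union> (if m = 1 then {{[a]} | a. a \<in> A'} else {}) \<subseteq> M.KM m" using LgL LK by (meson subset_trans)
    then show "{Y. (m, Y) \<in> F'} \<union> (if m = 1 then insert ?Ps {{[a]} | a. a \<in> A'} else {}) \<subseteq> M.KM m" using PK by (auto split: if_splits)
  qed
  have GK: "G \<in> M.KM n" by (rule subsetD[OF sub F1(4)]) (auto simp: F_def B_def A_def)
  have GrK: "{x @ y @ m x y | x y. x \<in> G \<and> y \<in> G} \<in> M.KM (3 * n)" by (rule subsetD[OF sub F2(4)]) (auto simp: F_def B_def A_def)
  \<comment> \<open>Conversely, what is definable in the reduced pair is definable in the original
    one; this applies to the graph of the isomorphism.\<close>
  have KE: "M.KM k \<subseteq> ?E k" for k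
    unfolding M.KM_def
  proof (rule gen_structure_least[OF Es])
    fix k
    have "{[p] | p. p \<in> Q} \<in> ?E 1" by (rule E.finite_points_mem[OF Q(1) E.point_mem])
    with EP have "?Ps - {[p] | p. p \<in> Q} \<in> ?E 1" by (rule E.Diff_mem)
    moreover have "?Ps - {[p] | p. p \<in> Q} = {[p] | p. p \<in> P - Q}" by auto
    ultimately have "{[p] | p. p \<in> P - Q} \<in> ?E 1" by simp
    then show "L k \<union> (if k = 1 then {{[p] | p. p \<in> P - Q}} else {}) \<subseteq> ?E k" using LD[of k] DE[of k] by auto
  qed
  obtain N t Hs Ms Fs where t: "length t = n * N" and HMF: "Hs \<in> L (n * (N + 2))" "Ms \<in> L (n * (N + 6))" "Fs \<in> M.KM (n * (N + 3))"
    and co: "coded_iso n G {x @ y @ m x y | x y. x \<in> G \<and> y \<in> G} Hs Ms Fs t"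
    using M.KM_group_coded[OF GK GrK gr] by blast
  have Gt: "G \<subseteq> tuples n" using E.length_mem[OF GE] by auto
  from coded_iso_definable[OF D.pstruct_axioms E.pstruct_axioms t subsetD[OF LD HMF(1)] subsetD[OF LD HMF(2)] subsetD[OF KE HMF(3)] Gt gr co]
  show "\<exists>k H m' e' f. definable_group ?D k H m' e' \<and> f \<in> iso (grp G m e) (grp H m' e') \<and> {xs @ f xs | xs. xs \<in> G} \<in> ?E (n + k)"
    by blast
qed

end
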